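(* Let $K$ be a number field and $DG_K=\widehat{Q}_K\ltimes_{\widehat{I}_K}G_K$ the free deformation of $G_K$. There exists an injective homomorphism $\psi:\mathcal{V}_K^*\hookrightarrow DG_K$ from the discrete monoid $\mathcal{V}_K^*$ of finite words over $\mathcal{V}_K$ with dense image.
   Context: $\bar K$ is an algebraic closure of $K$, $G_K=\mathrm{Gal}(\bar K/K)$, $P_K$ the set of non-zero maximal ideals of $O_K$; $\mathbb{N}\ni0$. $\mathcal{V}_K$ is the set of finite primes $v$ of $\bar K$; $\mathfrak{p}_v\in P_K$ is the restriction of $v$ to $K$. $G_v\le G_K$ is the decomposition group of $v$, identified with the absolute Galois group of $K_{\mathfrak{p}_v}$; $I_v\le G_v$ is the inertia subgroup, $q_v:G_v\to G_v/I_v$ the quotient, $\mathrm{Frob}_v\in G_v/I_v$ the Frobenius. $W_v^+:=q_v^{-1}(\{\mathrm{Frob}_v^n:n\in\mathbb{N}\})\subseteq G_v$, with the Weil group topology ($I_v$ open with its profinite topology). $Q_v:=W_v^+\cup\{0_v\}$ is its one-point compactification, a profinite monoid with zero element $0_v$. The free product of profinite monoids $\{D_i\}_i$ is the profinite monoid $D$ with continuous homomorphisms $\iota_i:D_i\to D$ universal for arbitrary families of continuous homomorphisms from the $D_i$ to a profinite monoid. For finite $S\subseteq P_K$, $Q_S$ is the free product of the $Q_v$ with $\mathfrak p_v\in S$; for $S\subseteq S'$ let $Q_{S'}\to Q_S$ be the identity on $Q_v$ with $\mathfrak p_v\in S$ and trivial on $Q_v$ with $\mathfrak{p}_v\in S'\setminus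 S$. $\widehat{Q}_K:=\varprojlim_S Q_S$, over finite subsets $S\subseteq P_K$. $\widehat{I}_K$ is the free product of the profinite groups $I_v$, $v\in\mathcal{V}_K$. $G_K$ acts on $\mathcal{V}_K$ ($G_{\sigma v}=\sigma G_v\sigma^{-1}$) and on $\widehat{Q}_K$ via $Q_v\to Q_{\sigma v}$, $\rho\mapsto{}^\sigma\rho=\sigma\rho\sigma^{-1}$ on $W_v^+$, $0_v\mapsto0_{\sigma v}$. $\widehat{Q}_K\ltimes G_K$ is the semidirect product, $(\rho,\sigma)(\rho',\sigma')=(\rho\cdot{}^\sigma\rho',\sigma\sigma')$, and $DG_K=\widehat{Q}_K\ltimes_{\widehat{I}_K}G_K$ is its quotient by the minimal profinite congruence containing $(\rho,\sigma)\sim(\rho u_v,u_v^{-1}\sigma)$ for all $\rho\in\widehat{Q}_K$, $\sigma\in G_K$, $v\in\mathcal{V}_K$, $u_v\in I_v$. *)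

theory Defs
  imports
    "HOL-Analysis.Analysis"
    "HOL-Algebra.Algebra"
    "HOL-Algebra.Algebraic_Closure"
begin

section \<open>Profinite monoids\<close>

record 'a top_monoid = "'a monoid" +
  topo :: "'a topology"

text \<open>In contrast to \<^const>\<open>hom\<close>, homomorphisms of monoids have to preserve the unit.\<close>

definition top_hom :: "'a top_monoid \<Rightarrow> 'b top_monoid \<Rightarrow> ('a \<Rightarrow> 'b) set" where
  "top_hom M N =
     {f \<in> hom M N. f \<one>\<^bsub>M\<^esub> = \<one>\<^bsub>N\<^esub> \<and> continuous_map (topo M) (topo N) f}"

definition topological_monoid :: "'a top_monoid \<Rightarrow> bool" where
  "topological_monoid M \<longleftrightarrow>
     monoid M \<and> topspace (topo M) = carrier M \<and>
     continuous_map (prod_topology (topo M) (topo M)) (topo M) (\<lambda>(x, y). x \<otimes>\<^bsub>M\<^esub> y)"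

definition finite_discrete_monoid :: "'a top_monoid \<Rightarrow> bool" where
  "finite_discrete_monoid F \<longleftrightarrow>
     monoid F \<and> finite (carrier F) \<and> topo F = discrete_topology (carrier F)"

text \<open>
  A profinite monoid is a compact topological monoid that is residually finite, i.e. a closed
  submonoid of a product (equivalently, an inverse limit) of finite discrete monoids.  Up to
  isomorphism every finite monoid has its carrier in \<^typ>\<open>nat\<close>.
\<close>

definition profinite_monoid :: "'a top_monoid \<Rightarrow> bool" where
  "profinite_monoid M \<longleftrightarrow>
     topological_monoid M \<and> compact_space (topo M) \<and>
     (\<forall>x\<in>carrier M. \<forall>y\<in>carrier M. x \<noteq> y \<longrightarrow>
        (\<exists>(F :: nat top_monoid) e.
           finite_discrete_monoid F \<and> e \<in> top_hom M F \<and> e x \<noteq> e y))"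

definition restr :: "'a top_monoid \<Rightarrow> 'a set \<Rightarrow> 'a top_monoid" where
  "restr M C = M\<lparr>carrier := C, topo := subtopology (topo M) C\<rparr>"

definition prod_monoid :: "'j set \<Rightarrow> ('j \<Rightarrow> 'a top_monoid) \<Rightarrow> ('j \<Rightarrow> 'a) top_monoid" where
  "prod_monoid J M =
     monoid.extend (product_group J M) \<lparr>topo = product_topology (\<lambda>j. topo (M j)) J\<rparr>"

definition inv_limit ::
  "'j set \<Rightarrow> ('j \<Rightarrow> 'j \<Rightarrow> bool) \<Rightarrow> ('j \<Rightarrow> 'a top_monoid) \<Rightarrow>
     ('j \<Rightarrow> 'j \<Rightarrow> 'a \<Rightarrow> 'a) \<Rightarrow> ('j \<Rightarrow> 'a) top_monoid" where
  "inv_limit J r M \<pi> = restr (prod_monoid J M)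
     {x \<in> carrier (prod_monoid J M). \<forall>j\<in>J. \<forall>k\<in>J. r j k \<longrightarrow> \<pi> j k (x k) = x j}"


subsection \<open>Free products\<close>

text \<open>
  The free product of \<open>(D\<^sub>i)\<^sub>i\<close> is constructed as in the adjoint functor theorem: a test is a finite
  discrete monoid \<open>F\<close> together with continuous homomorphisms \<open>D\<^sub>i \<rightarrow> F\<close>, and the free product is the
  smallest closed submonoid of the product of all these \<open>F\<close> that contains the images of the \<open>D\<^sub>i\<close>.
  Its universal property with respect to profinite monoids of arbitrary type is
  \<open>free_product_universal\<close> below.  The index set carries no topology.
\<close>

type_synonym ('i, 'd) test = "nat top_monoid \<times> ('i \<Rightarrow> 'd \<Rightarrow> nat)"

definition tests :: "'i set \<Rightarrow> ('i \<Rightarrow> 'd top_monoid) \<Rightarrow> ('i, 'd) test set" where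
  "tests I D = {(F, f). finite_discrete_monoid F \<and> (\<forall>i\<in>I. f i \<in> top_hom (D i) F)}"

definition free_incl ::
  "'i set \<Rightarrow> ('i \<Rightarrow> 'd top_monoid) \<Rightarrow> 'i \<Rightarrow> 'd \<Rightarrow> ('i, 'd) test \<Rightarrow> nat" where
  "free_incl I D i x = (\<lambda>(F, f)\<in>tests I D. f i x)"

definition free_product ::
  "'i set \<Rightarrow> ('i \<Rightarrow> 'd top_monoid) \<Rightarrow> (('i, 'd) test \<Rightarrow> nat) top_monoid" where
  "free_product I D =
     (let P = prod_monoid (tests I D) fst
      in restr P (\<Inter>{C. submonoid C P \<and> closedin (topo P) C \<and>
                        (\<Union>i\<in>I. free_incl I D i ` carrier (D i)) \<subseteq> C}))"

definition free_lift ::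
  "'i set \<Rightarrow> ('i \<Rightarrow> 'd top_monoid) \<Rightarrow> 'e top_monoid \<Rightarrow> ('i \<Rightarrow> 'd \<Rightarrow> 'e) \<Rightarrow>
     (('i, 'd) test \<Rightarrow> nat) \<Rightarrow> 'e" where
  "free_lift I D E h =
     (THE f. f \<in> extensional (carrier (free_product I D)) \<and>
             f \<in> top_hom (free_product I D) E \<and>
             (\<forall>i\<in>I. \<forall>x\<in>carrier (D i). f (free_incl I D i x) = h i x))"

lemma restr_simps [simp]:
  "carrier (restr M C) = C" "x \<otimes>\<^bsub>restr M C\<^esub> y = x \<otimes>\<^bsub>M\<^esub> y" "\<one>\<^bsub>restr M C\<^esub> = \<one>\<^bsub>M\<^esub>"
  "topo (restr M C) = subtopology (topo M) C"
  by (simp_all add: restr_def)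

lemma prod_monoid_simps [simp]:
  "carrier (prod_monoid J M) = (\<Pi>\<^sub>E j\<in>J. carrier (M j))"
  "x \<otimes>\<^bsub>prod_monoid J M\<^esub> y = (\<lambda>j\<in>J. x j \<otimes>\<^bsub>M j\<^esub> y j)"
  "\<one>\<^bsub>prod_monoid J M\<^esub> = (\<lambda>j\<in>J. \<one>\<^bsub>M j\<^esub>)"
  "topo (prod_monoid J M) = product_topology (\<lambda>j. topo (M j)) J"
  by (simp_all add: prod_monoid_def product_group_def monoid.extend_def)

lemma profinite_separates:
  assumes "profinite_monoid M" "x \<in> carrier M" "y \<in> carrier M" "x \<noteq> y"
  obtains F :: "nat top_monoid" and e
  where "finite_discrete_monoid F" "e \<in> top_hom M F" "e x \<noteq> e y"
proof -
  have "\<exists>(F :: nat top_monoid) e. finite_discrete_monoid F \<and> e \<in> top_hom M F \<and> e x \<noteq> e y"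
    using assms by (simp add: profinite_monoid_def)
  with that show thesis by blast
qed

lemma top_hom_carrier: "f \<in> top_hom M N \<Longrightarrow> x \<in> carrier M \<Longrightarrow> f x \<in> carrier N"
  by (auto simp: top_hom_def hom_def)

lemma profinite_Hausdorff:
  assumes "profinite_monoid M"
  shows "Hausdorff_space (topo M)"
  unfolding Hausdorff_space_def
proof (intro allI impI)
  fix x y assume xy: "x \<in> topspace (topo M) \<and> y \<in> topspace (topo M) \<and> x \<noteq> y"
  then obtain F :: "nat top_monoid" and e where
    F: "finite_discrete_monoid F" and e: "e \<in> top_hom M F" "e x \<noteq> e y"
    using assms profinite_separates[of M x y]
    by (auto simp: profinite_monoid_def topological_monoid_def)
  have c: "continuous_map (topo M) (discrete_topology (carrier F)) e"
    using F e by (simp add: top_hom_def finite_discrete_monoid_def)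
  have im: "e x \<in> carrier F" "e y \<in> carrier F"
    using c xy by (auto simp: continuous_map_def)
  let ?U = "\<lambda>z. {w \<in> topspace (topo M). e w \<in> {e z}}"
  have "openin (topo M) (?U z)" if "z = x \<or> z = y" for z
    using that im openin_continuous_map_preimage[OF c, of "{e z}"] by auto
  moreover have "disjnt (?U x) (?U y)" using e by (auto simp: disjnt_def)
  ultimately show "\<exists>U V. openin (topo M) U \<and> openin (topo M) V \<and> x \<in> U \<and> y \<in> V \<and> disjnt U V"
    using xy by (intro exI[of _ "?U x"] exI[of _ "?U y"]) auto
qed

lemma finite_discrete_topological:
  assumes "finite_discrete_monoid F"
  shows "topological_monoid F"
proof -
  interpret monoid F using assms by (simp add: finite_discrete_monoid_def)
  show ?thesis
    using assms by (auto simp: topological_monoid_def finite_discrete_monoid_def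
        prod_topology_discrete_topology [symmetric] continuous_map_def intro: monoid.m_closed)
qed

lemma topological_monoid_prod:
  assumes "\<And>j. j \<in> J \<Longrightarrow> topological_monoid (M j)"
  shows "topological_monoid (prod_monoid J M)"
proof -
  have mon: "monoid (M j)" and top: "topspace (topo (M j)) = carrier (M j)"
    and cont: "continuous_map (prod_topology (topo (M j)) (topo (M j))) (topo (M j))
                 (\<lambda>(x, y). x \<otimes>\<^bsub>M j\<^esub> y)" if "j \<in> J" for j
    using assms[OF that] by (auto simp: topological_monoid_def)
  have "monoid (prod_monoid J M)"
  proof (rule monoidI, goal_cases)
    case (1 x y)
    then show ?case by (auto intro!: monoid.m_closed mon)
  next
    case 2
    then show ?case by (auto intro!: monoid.one_closed mon)
  next
    case (3 x y z)
    then show ?case by (auto intro!: restrict_ext monoid.m_assoc mon)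
  next
    case (4 x)
    then show ?case
      by (auto simp: fun_eq_iff PiE_iff extensional_def intro!: monoid.l_one mon)
  next
    case (5 x)
    then show ?case
      by (auto simp: fun_eq_iff PiE_iff extensional_def intro!: monoid.r_one mon)
  qed
  moreover have "topspace (topo (prod_monoid J M)) = carrier (prod_monoid J M)"
    using top by (auto simp: PiE_iff)
  moreover have "continuous_map (prod_topology (topo (prod_monoid J M)) (topo (prod_monoid J M)))
      (topo (prod_monoid J M)) (\<lambda>(x, y). x \<otimes>\<^bsub>prod_monoid J M\<^esub> y)"
  proof -
    have "continuous_map (prod_topology (topo (prod_monoid J M)) (topo (prod_monoid J M)))
        (topo (M j)) (\<lambda>p. fst p j \<otimes>\<^bsub>M j\<^esub> snd p j)" if j: "j \<in> J" for j
    proof -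
      have pr: "continuous_map (topo (prod_monoid J M)) (topo (M j)) (\<lambda>x. x j)"
        using continuous_map_product_projection[OF j, of "\<lambda>j. topo (M j)"] by simp
      have "continuous_map (prod_topology (topo (prod_monoid J M)) (topo (prod_monoid J M)))
         (prod_topology (topo (M j)) (topo (M j))) (\<lambda>p. (fst p j, snd p j))"
        using continuous_map_compose[OF continuous_map_fst pr, of "topo (prod_monoid J M)"]
          continuous_map_compose[OF continuous_map_snd pr, of "topo (prod_monoid J M)"]
        unfolding continuous_map_paired o_def by blast
      from continuous_map_compose[OF this cont[OF j]] show ?thesis
        by (simp add: o_def case_prod_unfold)
    qed
    then show ?thesis
      by (auto simp: continuous_map_componentwise case_prod_unfold)
  qed
  ultimately show ?thesis by (simp add: topological_monoid_def)
qed

lemma prod_finite_discrete_profinite: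
  fixes M :: "'j \<Rightarrow> nat top_monoid"
  assumes "\<And>j. j \<in> J \<Longrightarrow> finite_discrete_monoid (M j)"
  shows "profinite_monoid (prod_monoid J M)"
  unfolding profinite_monoid_def
proof (intro conjI ballI impI)
  show "topological_monoid (prod_monoid J M)"
    by (intro topological_monoid_prod finite_discrete_topological assms)
  show "compact_space (topo (prod_monoid J M))"
    using assms by (auto simp: compact_space_product_topology finite_discrete_monoid_def
        compact_space_discrete_topology)
  fix x y assume xy: "x \<in> carrier (prod_monoid J M)" "y \<in> carrier (prod_monoid J M)" "x \<noteq> y"
  then obtain j where j: "j \<in> J" "x j \<noteq> y j"
    using PiE_ext[of x J "\<lambda>j. carrier (M j)" y] by auto
  have "(\<lambda>x. x j) \<in> top_hom (prod_monoid J M) (M j)"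
    using j continuous_map_product_projection[OF j(1), of "\<lambda>j. topo (M j)"]
    by (auto simp: top_hom_def hom_def)
  with j show "\<exists>(F :: nat top_monoid) e.
      finite_discrete_monoid F \<and> e \<in> top_hom (prod_monoid J M) F \<and> e x \<noteq> e y"
    using assms by blast
qed

lemma profinite_restr:
  assumes M: "profinite_monoid M" and C: "submonoid C M" "closedin (topo M) C"
  shows "profinite_monoid (restr M C)"
  unfolding profinite_monoid_def
proof (intro conjI ballI impI)
  interpret monoid M using M by (simp add: profinite_monoid_def topological_monoid_def)
  interpret submonoid C M by fact
  have sub: "C \<subseteq> topspace (topo M)" using C closedin_subset by blast
  have "monoid (restr M C)"
    by (rule monoidI) (auto simp: m_assoc)
  moreover have "continuous_map (subtopology (prod_topology (topo M) (topo M)) (C \<times> C))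
       (subtopology (topo M) C) (\<lambda>(x, y). x \<otimes>\<^bsub>M\<^esub> y)"
    using M by (auto simp: continuous_map_in_subtopology profinite_monoid_def
        topological_monoid_def intro: continuous_map_from_subtopology)
  ultimately show "topological_monoid (restr M C)"
    using sub by (auto simp: topological_monoid_def prod_topology_subtopology subtopology_subtopology Times_Int_Times Int_absorb1 Int_absorb2)
  show "compact_space (topo (restr M C))"
    using M C by (simp add: profinite_monoid_def closedin_compact_space compact_space_subtopology)
  fix x y assume xy: "x \<in> carrier (restr M C)" "y \<in> carrier (restr M C)" "x \<noteq> y"
  then obtain F :: "nat top_monoid" and e where
    e: "finite_discrete_monoid F" "e \<in> top_hom M F" "e x \<noteq> e y"
    using profinite_separates[OF M, of x y] subset by auto
  then have "e \<in> top_hom (restr M C) F"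
    using subset by (auto simp: top_hom_def hom_def Pi_iff intro: continuous_map_from_subtopology)
  with e show "\<exists>(F :: nat top_monoid) e.
      finite_discrete_monoid F \<and> e \<in> top_hom (restr M C) F \<and> e x \<noteq> e y"
    by blast
qed

context
  fixes I :: "'i set" and D :: "'i \<Rightarrow> 'd top_monoid"
begin

private abbreviation "P \<equiv> prod_monoid (tests I D) fst"

private abbreviation "closed_submonoids \<equiv>
  {C. submonoid C P \<and> closedin (topo P) C \<and> (\<Union>i\<in>I. free_incl I D i ` carrier (D i)) \<subseteq> C}"

private lemma carrier_free: "carrier (free_product I D) = \<Inter>closed_submonoids"
  by (simp add: free_product_def Let_def)

private lemma profinite_P: "profinite_monoid P"
  by (rule prod_finite_discrete_profinite) (auto simp: tests_def)

private lemma P_in: "carrier P \<in> closed_submonoids"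
proof -
  interpret monoid P using profinite_P by (simp add: profinite_monoid_def topological_monoid_def)
  have t: "topspace (topo P) = carrier P"
    using profinite_P by (simp add: profinite_monoid_def topological_monoid_def del: prod_monoid_simps)
  have "submonoid (carrier P) P"
    by (rule submonoid.intro) (auto simp del: prod_monoid_simps)
  moreover have "closedin (topo P) (carrier P)"
    using t closedin_topspace by metis
  moreover have "free_incl I D i x \<in> carrier P" if "i \<in> I" "x \<in> carrier (D i)" for i x
  proof -
    have "f i x \<in> carrier F" if "(F, f) \<in> tests I D" for F f
      using that \<open>i \<in> I\<close> \<open>x \<in> carrier (D i)\<close> top_hom_carrier[of "f i" "D i" F x]
      by (simp add: tests_def)
    then show ?thesis by (auto simp: free_incl_def)
  qed
  ultimately show ?thesis by blast
qed

private lemma carrier_free_in: "carrier (free_product I D) \<in> closed_submonoids"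
proof -
  have "submonoid (\<Inter>closed_submonoids) P"
  proof
    show "\<Inter>closed_submonoids \<subseteq> carrier P" using P_in by blast
  next
    fix x y assume "x \<in> \<Inter>closed_submonoids" "y \<in> \<Inter>closed_submonoids"
    then show "x \<otimes>\<^bsub>P\<^esub> y \<in> \<Inter>closed_submonoids"
      by (blast intro: submonoid.m_closed)
  next
    show "\<one>\<^bsub>P\<^esub> \<in> \<Inter>closed_submonoids" by (blast intro: submonoid.one_closed)
  qed
  moreover have "closedin (topo P) (\<Inter>closed_submonoids)"
    using P_in by (intro closedin_Inter) blast+
  ultimately show ?thesis unfolding carrier_free by blast
qed

private lemma free_product_eq: "free_product I D = restr P (carrier (free_product I D))"
  by (simp add: free_product_def Let_def)

private lemma mult_free: "x \<otimes>\<^bsub>free_product I D\<^esub> y = x \<otimes>\<^bsub>P\<^esub> y"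
  and one_free: "\<one>\<^bsub>free_product I D\<^esub> = \<one>\<^bsub>P\<^esub>"
  and topo_free: "topo (free_product I D) = subtopology (topo P) (carrier (free_product I D))"
  by (simp_all add: free_product_def Let_def)

lemma free_product_profinite: "profinite_monoid (free_product I D)"
proof -
  have "profinite_monoid (restr P (carrier (free_product I D)))"
    using carrier_free_in by (intro profinite_restr[OF profinite_P]) simp_all
  then show ?thesis using free_product_eq by metis
qed

lemma free_incl_top_hom:
  assumes i: "i \<in> I" and D: "topological_monoid (D i)"
  shows "free_incl I D i \<in> top_hom (D i) (free_product I D)"
proof -
  interpret monoid "D i" using D by (simp add: topological_monoid_def)
  have t: "topspace (topo (D i)) = carrier (D i)" using D by (simp add: topological_monoid_def)
  have c: "free_incl I D i x \<in> carrier (free_product I D)" if "x \<in> carrier (D i)" for x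
    using carrier_free_in i that by blast
  have "continuous_map (topo (D i)) (topo (free_product I D)) (free_incl I D i)"
    unfolding topo_free
    using c i
    by (auto simp: continuous_map_in_subtopology t continuous_map_componentwise free_incl_def
        tests_def top_hom_def split_def)
  moreover have "free_incl I D i \<in> hom (D i) (free_product I D)"
    apply (rule homI)
     apply (erule c)
    using i by (auto simp: mult_free free_incl_def fun_eq_iff tests_def top_hom_def hom_mult)
  moreover have "free_incl I D i \<one>\<^bsub>D i\<^esub> = \<one>\<^bsub>free_product I D\<^esub>"
    using i by (auto simp: one_free free_incl_def fun_eq_iff tests_def top_hom_def)
  ultimately show ?thesis by (simp add: top_hom_def)
qed

theorem free_product_universal:
  fixes E :: "'e top_monoid"
  assumes E: "profinite_monoid E"
    and h: "\<And>i. i \<in> I \<Longrightarrow> h i \<in> top_hom (D i) E"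
  shows "\<exists>!f. f \<in> extensional (carrier (free_product I D)) \<and>
              f \<in> top_hom (free_product I D) E \<and>
              (\<forall>i\<in>I. \<forall>x\<in>carrier (D i). f (free_incl I D i x) = h i x)"
proof -
  interpret E: monoid E using E by (simp add: profinite_monoid_def topological_monoid_def)
  let ?A = "carrier (free_product I D)"
  have tE: "topspace (topo E) = carrier E" and tP: "topspace (topo P) = carrier P"
    and compE: "compact_space (topo E)"
    and contE: "continuous_map (prod_topology (topo E) (topo E)) (topo E) (\<lambda>(x, y). x \<otimes>\<^bsub>E\<^esub> y)"
    using E profinite_P by (auto simp: profinite_monoid_def topological_monoid_def
        simp del: prod_monoid_simps)
  have subA: "submonoid ?A P" and clA: "closedin (topo P) ?A"
    and genA: "\<And>i x. i \<in> I \<Longrightarrow> x \<in> carrier (D i) \<Longrightarrow> free_incl I D i x \<in> ?A"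
    using carrier_free_in by blast+
  have AP: "?A \<subseteq> carrier P" using subA submonoid.subset by blast
  have least: "?A \<subseteq> C" if "submonoid C P" "closedin (topo P) C"
     "\<And>i x. i \<in> I \<Longrightarrow> x \<in> carrier (D i) \<Longrightarrow> free_incl I D i x \<in> C" for C
    using that unfolding carrier_free by blast
  have mA: "x \<otimes>\<^bsub>free_product I D\<^esub> y = x \<otimes>\<^bsub>P\<^esub> y" "\<one>\<^bsub>free_product I D\<^esub> = \<one>\<^bsub>P\<^esub>"
    "topo (free_product I D) = subtopology (topo P) ?A" for x y
    by (simp_all only: mult_free one_free topo_free)
  define t :: "nat top_monoid \<Rightarrow> ('e \<Rightarrow> nat) \<Rightarrow> ('i, 'd) test"
    where "t = (\<lambda>F e. (F, \<lambda>i x. e (h i x)))"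
  define Q where "Q = {(F :: nat top_monoid, e). finite_discrete_monoid F \<and> e \<in> top_hom E F}"
  have tin: "t F e \<in> tests I D" if "(F, e) \<in> Q" for F e
    using that h by (auto simp: t_def Q_def tests_def top_hom_def hom_def Pi_iff
        intro: continuous_map_compose[unfolded o_def])
  define G where "G = {p \<in> carrier P \<times> carrier E. \<forall>(F, e)\<in>Q. fst p (t F e) = e (snd p)}"
  have sep: "x = y" if "(d, x) \<in> G" "(d, y) \<in> G" for d x y
  proof (rule ccontr)
    assume "x \<noteq> y"
    moreover have "x \<in> carrier E" "y \<in> carrier E" using that by (auto simp: G_def)
    ultimately obtain F :: "nat top_monoid" and e where
      e: "finite_discrete_monoid F" "e \<in> top_hom E F" "e x \<noteq> e y"
      using profinite_separates[OF E, of x y] \<open>x \<noteq> y\<close> by auto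
    then have "(F, e) \<in> Q" by (simp add: Q_def)
    with that e show False by (fastforce simp: G_def)
  qed
  have closG: "closedin (prod_topology (topo P) (topo E)) G"
  proof -
    have "closedin (prod_topology (topo P) (topo E))
      {p \<in> topspace (prod_topology (topo P) (topo E)). fst p (t F e) = e (snd p)}"
      if "(F, e) \<in> Q" for F e
    proof (rule closedin_continuous_maps_eq[where Y = "topo F"])
      show "Hausdorff_space (topo F)"
        using that by (simp add: Q_def finite_discrete_monoid_def Hausdorff_space_discrete_topology)
      have "continuous_map (topo P) (topo F) (\<lambda>d. d (t F e))"
        using continuous_map_product_projection[OF tin[OF that], of "\<lambda>j. topo (fst j)"]
        by (simp add: t_def)
      from continuous_map_compose[OF continuous_map_fst this]
      show "continuous_map (prod_topology (topo P) (topo E)) (topo F) (\<lambda>p. fst p (t F e))"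
        by (simp add: o_def)
      have "continuous_map (topo E) (topo F) e" using that by (simp add: Q_def top_hom_def)
      from continuous_map_compose[OF continuous_map_snd this]
      show "continuous_map (prod_topology (topo P) (topo E)) (topo F) (\<lambda>p. e (snd p))"
        by (simp add: o_def)
    qed
    then have "closedin (prod_topology (topo P) (topo E)) C"
      if "C \<in> insert (topspace (prod_topology (topo P) (topo E)))
       ((\<lambda>(F, e). {p \<in> topspace (prod_topology (topo P) (topo E)). fst p (t F e) = e (snd p)}) ` Q)"
      for C using that closedin_topspace by (auto simp del: prod_monoid_simps topspace_prod_topology)
    then have "closedin (prod_topology (topo P) (topo E)) (\<Inter>(insert (topspace (prod_topology (topo P) (topo E)))
       ((\<lambda>(F, e). {p \<in> topspace (prod_topology (topo P) (topo E)). fst p (t F e) = e (snd p)}) ` Q)))"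
      by (intro closedin_Inter) auto
    moreover have "G = \<Inter>(insert (topspace (prod_topology (topo P) (topo E)))
       ((\<lambda>(F, e). {p \<in> topspace (prod_topology (topo P) (topo E)). fst p (t F e) = e (snd p)}) ` Q))"
      using tP tE by (auto simp: G_def simp del: prod_monoid_simps)
    ultimately show ?thesis by simp
  qed
  have one_G: "(\<one>\<^bsub>P\<^esub>, \<one>\<^bsub>E\<^esub>) \<in> G"
  proof -
    have "\<one>\<^bsub>P\<^esub> \<in> carrier P" using subA AP submonoid.one_closed by blast
    moreover have "\<one>\<^bsub>P\<^esub> (t F e) = e \<one>\<^bsub>E\<^esub>" if "(F, e) \<in> Q" for F e
      using tin[OF that] that by (simp add: Q_def top_hom_def t_def)
    ultimately show ?thesis by (auto simp: G_def simp del: prod_monoid_simps)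
  qed
  have mult_G: "(d \<otimes>\<^bsub>P\<^esub> d', x \<otimes>\<^bsub>E\<^esub> x') \<in> G" if "(d, x) \<in> G" "(d', x') \<in> G" for d d' x x'
  proof -
    have "monoid P" using profinite_P by (simp add: profinite_monoid_def topological_monoid_def)
    moreover have "d \<in> carrier P" "d' \<in> carrier P"
      using that by (auto simp: G_def simp del: prod_monoid_simps)
    ultimately have "d \<otimes>\<^bsub>P\<^esub> d' \<in> carrier P" by (rule monoid.m_closed)
    moreover have "(d \<otimes>\<^bsub>P\<^esub> d') (t F e) = e (x \<otimes>\<^bsub>E\<^esub> x')" if Fe: "(F, e) \<in> Q" for F e
    proof -
      have "d (t F e) = e x" "d' (t F e) = e x'"
        using Fe \<open>(d, x) \<in> G\<close> \<open>(d', x') \<in> G\<close> by (auto simp: G_def)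
      moreover have "e (x \<otimes>\<^bsub>E\<^esub> x') = e x \<otimes>\<^bsub>F\<^esub> e x'"
        using Fe \<open>(d, x) \<in> G\<close> \<open>(d', x') \<in> G\<close> by (auto simp: G_def Q_def top_hom_def hom_def)
      ultimately show ?thesis using tin[OF Fe] by (simp add: t_def)
    qed
    ultimately show ?thesis
      using that by (auto simp: G_def simp del: prod_monoid_simps)
  qed
  have gen_G: "(free_incl I D i x, h i x) \<in> G" if "i \<in> I" "x \<in> carrier (D i)" for i x
  proof -
    have "h i x \<in> carrier E" using h that by (auto simp: top_hom_def hom_def)
    moreover have "free_incl I D i x \<in> carrier P" using genA AP that by blast
    moreover have "free_incl I D i x (t F e) = e (h i x)" if "(F, e) \<in> Q" for F e
      using tin[OF that] by (simp add: free_incl_def t_def)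
    ultimately show ?thesis by (auto simp: G_def simp del: prod_monoid_simps)
  qed
  have "?A \<subseteq> fst ` G"
  proof (rule least)
    show "submonoid (fst ` G) P"
    proof
      show "fst ` G \<subseteq> carrier P" by (auto simp: G_def simp del: prod_monoid_simps)
      show "\<one>\<^bsub>P\<^esub> \<in> fst ` G" using one_G by force
    next
      fix x y assume "x \<in> fst ` G" "y \<in> fst ` G"
      then show "x \<otimes>\<^bsub>P\<^esub> y \<in> fst ` G"
        using mult_G by (auto simp del: prod_monoid_simps) (metis fst_conv image_eqI)
    qed
    show "closedin (topo P) (fst ` G)"
      using closed_map_fst[OF compE, of "topo P"] closG unfolding closed_map_def by blast
  next
    fix i x assume "i \<in> I" "x \<in> carrier (D i)"
    then show "free_incl I D i x \<in> fst ` G" using gen_G by force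
  qed
  then have ex: "\<exists>x. (d, x) \<in> G" if "d \<in> ?A" for d using that by force
  define f where "f = (\<lambda>d\<in>?A. THE x. (d, x) \<in> G)"
  have fG: "(d, f d) \<in> G" if "d \<in> ?A" for d
    using ex[OF that] sep that unfolding f_def by (auto intro: theI2)
  have f_eq: "f d = x" if "d \<in> ?A" "(d, x) \<in> G" for d x
    using fG sep that by blast
  have fE: "f d \<in> carrier E" if "d \<in> ?A" for d using fG[OF that] by (simp add: G_def)
  have f_cont: "continuous_map (topo (free_product I D)) (topo E) f"
    unfolding mA continuous_map_closedin
  proof (intro conjI allI impI ballI)
    show "f \<in> topspace (subtopology (topo P) ?A) \<rightarrow> topspace (topo E)" using fE tE by auto
  next
    fix C assume C: "closedin (topo E) C"
    have "closedin (topo P) (carrier P)" using tP closedin_topspace by metis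
    then have "closedin (prod_topology (topo P) (topo E)) (G \<inter> (carrier P \<times> C))"
      using C by (intro closedin_Int closG) (simp add: closedin_prod_Times_iff del: prod_monoid_simps)
    then have "closedin (topo P) (fst ` (G \<inter> (carrier P \<times> C)))"
      using closed_map_fst[OF compE, of "topo P"] unfolding closed_map_def by blast
    then have "closedin (subtopology (topo P) ?A) (?A \<inter> fst ` (G \<inter> (carrier P \<times> C)))"
      by (auto simp: closedin_subtopology)
    moreover have "{d \<in> topspace (subtopology (topo P) ?A). f d \<in> C} = ?A \<inter> fst ` (G \<inter> (carrier P \<times> C))"
    proof -
      have "topspace (subtopology (topo P) ?A) = ?A"
        using clA closedin_subset by fastforce
      moreover have "d \<in> fst ` (G \<inter> (carrier P \<times> C))" if "d \<in> ?A" "f d \<in> C" for d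
        using fG[OF that(1)] that AP by force
      ultimately show ?thesis using f_eq by force
    qed
    ultimately show "closedin (subtopology (topo P) ?A) {d \<in> topspace (subtopology (topo P) ?A). f d \<in> C}"
      by simp
  qed
  have f_hom: "f \<in> top_hom (free_product I D) E"
  proof -
    have "f \<in> hom (free_product I D) E"
    proof (rule homI)
      fix x y assume xy: "x \<in> ?A" "y \<in> ?A"
      then have "x \<otimes>\<^bsub>P\<^esub> y \<in> ?A" by (rule submonoid.m_closed[OF subA])
      then show "f (x \<otimes>\<^bsub>free_product I D\<^esub> y) = f x \<otimes>\<^bsub>E\<^esub> f y"
        unfolding mA by (rule f_eq) (intro mult_G fG xy)
    qed (rule fE)
    moreover have "f \<one>\<^bsub>free_product I D\<^esub> = \<one>\<^bsub>E\<^esub>"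
      unfolding mA by (rule f_eq[OF submonoid.one_closed[OF subA] one_G])
    ultimately show ?thesis using f_cont by (simp add: top_hom_def)
  qed
  show ?thesis
  proof (rule ex1I[of _ f], intro conjI ballI)
    show "f \<in> extensional ?A" by (simp add: f_def)
    show "f \<in> top_hom (free_product I D) E" by (fact f_hom)
    show "f (free_incl I D i x) = h i x" if "i \<in> I" "x \<in> carrier (D i)" for i x
      using f_eq[OF genA gen_G] that by blast
  next
    fix g assume g: "g \<in> extensional ?A \<and> g \<in> top_hom (free_product I D) E \<and>
        (\<forall>i\<in>I. \<forall>x\<in>carrier (D i). g (free_incl I D i x) = h i x)"
    let ?C = "{d \<in> topspace (subtopology (topo P) ?A). f d = g d}"
    have tA: "topspace (subtopology (topo P) ?A) = ?A"
      using clA closedin_subset by fastforce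
    have "?A \<subseteq> ?C"
    proof (rule least)
      have "closedin (subtopology (topo P) ?A) ?C"
        using f_cont g profinite_Hausdorff[OF E] unfolding mA
        by (intro closedin_continuous_maps_eq) (auto simp: top_hom_def mA)
      then show "closedin (topo P) ?C"
        by (rule closedin_trans_full[OF _ clA])
      show "submonoid ?C P"
        unfolding tA
      proof
        show "{d \<in> ?A. f d = g d} \<subseteq> carrier P" using AP by auto
        show "\<one>\<^bsub>P\<^esub> \<in> {d \<in> ?A. f d = g d}"
          using f_hom g submonoid.one_closed[OF subA]
          by (auto simp: top_hom_def mA simp del: prod_monoid_simps)
      next
        fix x y assume xy: "x \<in> {d \<in> ?A. f d = g d}" "y \<in> {d \<in> ?A. f d = g d}"
        have k: "k (x \<otimes>\<^bsub>P\<^esub> y) = k x \<otimes>\<^bsub>E\<^esub> k y" if "k \<in> top_hom (free_product I D) E" for k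
          using that xy by (auto simp: top_hom_def hom_def mA simp del: prod_monoid_simps)
        have "f (x \<otimes>\<^bsub>P\<^esub> y) = g (x \<otimes>\<^bsub>P\<^esub> y)"
          using k[OF f_hom] k[of g] g xy by (simp del: prod_monoid_simps)
        moreover have "x \<otimes>\<^bsub>P\<^esub> y \<in> ?A" using submonoid.m_closed[OF subA, of x y] xy by blast
        ultimately show "x \<otimes>\<^bsub>P\<^esub> y \<in> {d \<in> ?A. f d = g d}" by blast
      qed
    next
      fix i x assume "i \<in> I" "x \<in> carrier (D i)"
      then show "free_incl I D i x \<in> ?C"
        unfolding tA using g genA f_eq[OF genA gen_G] by (auto simp del: prod_monoid_simps)
    qed
    then have "g d = f d" if "d \<in> ?A" for d using that by fastforce
    then show "g = f"
      using g by (intro extensionalityI[of _ ?A]) (auto simp: f_def)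
  qed
qed

end

lemma free_lift:
  assumes "profinite_monoid E" "\<And>i. i \<in> I \<Longrightarrow> h i \<in> top_hom (D i) E"
  shows "free_lift I D E h \<in> top_hom (free_product I D) E"
    and "i \<in> I \<Longrightarrow> x \<in> carrier (D i) \<Longrightarrow> free_lift I D E h (free_incl I D i x) = h i x"
  using theI'[OF free_product_universal[where h = h, OF assms]] unfolding free_lift_def by blast+


subsection \<open>Profinite congruences and semidirect products\<close>

definition congruence :: "'a top_monoid \<Rightarrow> ('a \<times> 'a) set \<Rightarrow> bool" where
  "congruence M R \<longleftrightarrow>
     equiv (carrier M) R \<and>
     (\<forall>(a, b)\<in>R. \<forall>(c, d)\<in>R. (a \<otimes>\<^bsub>M\<^esub> c, b \<otimes>\<^bsub>M\<^esub> d) \<in> R)"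

definition quotient_topology :: "'a topology \<Rightarrow> ('a \<times> 'a) set \<Rightarrow> 'a set topology" where
  "quotient_topology T R =
     topology (\<lambda>U. U \<subseteq> topspace T // R \<and> openin T {x \<in> topspace T. R `` {x} \<in> U})"

lemma openin_quotient_topology:
  "openin (quotient_topology T R) U \<longleftrightarrow>
     U \<subseteq> topspace T // R \<and> openin T {x \<in> topspace T. R `` {x} \<in> U}"
proof -
  have "istopology (\<lambda>U. U \<subseteq> topspace T // R \<and> openin T {x \<in> topspace T. R `` {x} \<in> U})"
    unfolding istopology_def
  proof (intro conjI allI impI)
    fix U V assume "U \<subseteq> topspace T // R \<and> openin T {x \<in> topspace T. R `` {x} \<in> U}"
      "V \<subseteq> topspace T // R \<and> openin T {x \<in> topspace T. R `` {x} \<in> V}"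
    moreover have "{x \<in> topspace T. R `` {x} \<in> U \<inter> V} =
        {x \<in> topspace T. R `` {x} \<in> U} \<inter> {x \<in> topspace T. R `` {x} \<in> V}" by auto
    ultimately show "U \<inter> V \<subseteq> topspace T // R" "openin T {x \<in> topspace T. R `` {x} \<in> U \<inter> V}"
      by auto
  next
    fix \<K> assume "\<forall>U\<in>\<K>. U \<subseteq> topspace T // R \<and> openin T {x \<in> topspace T. R `` {x} \<in> U}"
    moreover have "{x \<in> topspace T. R `` {x} \<in> \<Union>\<K>} = (\<Union>U\<in>\<K>. {x \<in> topspace T. R `` {x} \<in> U})"
      by auto
    ultimately show "\<Union>\<K> \<subseteq> topspace T // R" "openin T {x \<in> topspace T. R `` {x} \<in> \<Union>\<K>}"
      by auto
  qed
  then show ?thesis by (simp add: quotient_topology_def)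
qed

definition quotient_monoid :: "'a top_monoid \<Rightarrow> ('a \<times> 'a) set \<Rightarrow> 'a set top_monoid" where
  "quotient_monoid M R =
     \<lparr>carrier = carrier M // R,
      monoid.mult = (\<lambda>A B. \<Union>a\<in>A. \<Union>b\<in>B. R `` {a \<otimes>\<^bsub>M\<^esub> b}),
      one = R `` {\<one>\<^bsub>M\<^esub>},
      topo = quotient_topology (topo M) R\<rparr>"

definition profinite_congruence :: "'a top_monoid \<Rightarrow> ('a \<times> 'a) set \<Rightarrow> bool" where
  "profinite_congruence M R \<longleftrightarrow> congruence M R \<and> profinite_monoid (quotient_monoid M R)"

definition min_profinite_congruence ::
  "'a top_monoid \<Rightarrow> ('a \<times> 'a) set \<Rightarrow> ('a \<times> 'a) set" where
  "min_profinite_congruence M r = \<Inter>{R. profinite_congruence M R \<and> r \<subseteq> R}"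

text \<open>
  On a monoid with a compact topology (multiplication need not be continuous), this intersection is
  itself a profinite congruence; hence it is the least one containing \<open>r\<close>.
\<close>

lemma profinite_monoidI:
  fixes Q :: "'a top_monoid"
  assumes mon: "monoid Q" and top: "topspace (topo Q) = carrier Q" and comp: "compact_space (topo Q)"
    and sep: "\<And>x y. x \<in> carrier Q \<Longrightarrow> y \<in> carrier Q \<Longrightarrow> x \<noteq> y \<Longrightarrow>
      \<exists>(F :: nat top_monoid) e. finite_discrete_monoid F \<and> e \<in> top_hom Q F \<and> e x \<noteq> e y"
  shows "profinite_monoid Q"
proof -
  interpret monoid Q by fact
  define J where "J = {(F :: nat top_monoid, e). finite_discrete_monoid F \<and> e \<in> top_hom Q F}"
  define Y where "Y = product_topology (\<lambda>j. topo (fst j)) J"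
  define f where "f = (\<lambda>x. \<lambda>j\<in>J. snd j x)"
  have cf: "continuous_map (topo Q) Y f"
    by (auto simp: Y_def f_def continuous_map_componentwise J_def top_hom_def)
  have hY: "Hausdorff_space Y"
    by (auto simp: Y_def J_def Hausdorff_space_product_topology finite_discrete_monoid_def
        Hausdorff_space_discrete_topology)
  have inj: "inj_on f (topspace (topo Q))"
  proof (rule inj_onI, rule ccontr)
    fix x y assume xy: "x \<in> topspace (topo Q)" "y \<in> topspace (topo Q)" "f x = f y" "x \<noteq> y"
    then obtain F :: "nat top_monoid" and e
      where e: "(F, e) \<in> J" "e x \<noteq> e y" using sep[of x y] top by (auto simp: J_def)
    have "f x (F, e) = f y (F, e)" using xy by simp
    with e show False by (simp add: f_def)
  qed
  obtain g where g: "homeomorphic_maps (topo Q) (subtopology Y (f ` topspace (topo Q))) f g"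
    using continuous_imp_embedding_map[OF cf comp hY inj]
    unfolding embedding_map_def homeomorphic_map_maps by blast
  have "continuous_map (prod_topology (topo Q) (topo Q)) (topo (fst j))
     (\<lambda>p. snd j (fst p \<otimes>\<^bsub>Q\<^esub> snd p))" if j: "j \<in> J" for j
  proof -
    have fd: "finite_discrete_monoid (fst j)" and h: "snd j \<in> top_hom Q (fst j)"
      using j by (auto simp: J_def)
    have ce: "continuous_map (topo Q) (topo (fst j)) (snd j)" using h by (simp add: top_hom_def)
    have "continuous_map (prod_topology (topo Q) (topo Q))
        (prod_topology (topo (fst j)) (topo (fst j))) (\<lambda>p. (snd j (fst p), snd j (snd p)))"
      unfolding continuous_map_paired
      using continuous_map_compose[OF continuous_map_fst ce, of "topo Q"]
        continuous_map_compose[OF continuous_map_snd ce, of "topo Q"] by (simp add: o_def)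
    moreover have "continuous_map (prod_topology (topo (fst j)) (topo (fst j))) (topo (fst j))
       (\<lambda>(x, y). x \<otimes>\<^bsub>fst j\<^esub> y)"
      using finite_discrete_topological[OF fd] by (simp add: topological_monoid_def)
    ultimately have "continuous_map (prod_topology (topo Q) (topo Q)) (topo (fst j))
        (\<lambda>p. snd j (fst p) \<otimes>\<^bsub>fst j\<^esub> snd j (snd p))"
      using continuous_map_compose by (fastforce simp: o_def)
    then show ?thesis
      by (rule continuous_map_eq) (use h top in \<open>auto simp: top_hom_def hom_def\<close>)
  qed
  then have "continuous_map (prod_topology (topo Q) (topo Q)) Y (\<lambda>p. f (fst p \<otimes>\<^bsub>Q\<^esub> snd p))"
    by (auto simp: Y_def f_def continuous_map_componentwise)
  then have "continuous_map (prod_topology (topo Q) (topo Q)) (subtopology Y (f ` topspace (topo Q)))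
      (\<lambda>p. f (fst p \<otimes>\<^bsub>Q\<^esub> snd p))"
    by (auto simp: continuous_map_in_subtopology top)
  moreover have "continuous_map (subtopology Y (f ` topspace (topo Q))) (topo Q) g"
    using g by (simp add: homeomorphic_maps_def)
  ultimately have "continuous_map (prod_topology (topo Q) (topo Q)) (topo Q)
      (\<lambda>p. g (f (fst p \<otimes>\<^bsub>Q\<^esub> snd p)))"
    using continuous_map_compose by (fastforce simp: o_def)
  then have "continuous_map (prod_topology (topo Q) (topo Q)) (topo Q) (\<lambda>(x, y). x \<otimes>\<^bsub>Q\<^esub> y)"
    by (rule continuous_map_eq) (use g top in \<open>auto simp: homeomorphic_maps_def\<close>)
  then show ?thesis
    using assms by (simp add: profinite_monoid_def topological_monoid_def)
qed

lemma quotient_monoid_simps: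
  "carrier (quotient_monoid M R) = carrier M // R"
  "\<one>\<^bsub>quotient_monoid M R\<^esub> = R `` {\<one>\<^bsub>M\<^esub>}"
  "topo (quotient_monoid M R) = quotient_topology (topo M) R"
  by (simp_all add: quotient_monoid_def)

lemma quotient_mult:
  assumes R: "congruence M R" and "a \<in> carrier M" "b \<in> carrier M"
  shows "R `` {a} \<otimes>\<^bsub>quotient_monoid M R\<^esub> R `` {b} = R `` {a \<otimes>\<^bsub>M\<^esub> b}"
proof -
  have e: "equiv (carrier M) R" using R by (simp add: congruence_def)
  have "R `` {a' \<otimes>\<^bsub>M\<^esub> b'} = R `` {a \<otimes>\<^bsub>M\<^esub> b}" if "(a, a') \<in> R" "(b, b') \<in> R" for a' b'
    using R that equiv_class_eq[OF e] unfolding congruence_def by fastforce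
  moreover have "(a, a) \<in> R" "(b, b) \<in> R"
    using assms equiv_class_self[OF e] by auto
  ultimately have "(\<Union>a'\<in>R `` {a}. \<Union>b'\<in>R `` {b}. R `` {a' \<otimes>\<^bsub>M\<^esub> b'}) = R `` {a \<otimes>\<^bsub>M\<^esub> b}"
    by blast
  then show ?thesis by (simp add: quotient_monoid_def)
qed

lemma topspace_quotient_topology: "topspace (quotient_topology T R) = topspace T // R"
proof
  show "topspace (quotient_topology T R) \<subseteq> topspace T // R"
    using openin_topspace[of "quotient_topology T R"] unfolding openin_quotient_topology by blast
  have "{x \<in> topspace T. R `` {x} \<in> topspace T // R} = topspace T"
    by (auto intro: quotientI)
  then have "openin (quotient_topology T R) (topspace T // R)"
    unfolding openin_quotient_topology by simp
  then show "topspace T // R \<subseteq> topspace (quotient_topology T R)" by (rule openin_subset)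
qed

lemma continuous_quotient:
  "continuous_map T (quotient_topology T R) (\<lambda>x. R `` {x})"
  by (auto simp: continuous_map_def topspace_quotient_topology openin_quotient_topology
      intro: quotientI)

lemma monoid_quotient:
  assumes M: "monoid M" and R: "congruence M R"
  shows "monoid (quotient_monoid M R)"
proof -
  interpret monoid M by fact
  show ?thesis
    by (rule monoidI) (auto simp: quotient_monoid_simps quotient_mult[OF R] m_assoc
        intro!: quotientI elim!: quotientE)
qed

theorem profinite_min_congruence:
  fixes M :: "'a top_monoid"
  assumes M: "monoid M" and top: "topspace (topo M) = carrier M" and comp: "compact_space (topo M)"
    and r: "r \<subseteq> carrier M \<times> carrier M"
  shows "profinite_congruence M (min_profinite_congruence M r)"
proof -
  interpret monoid M by fact
  define RR where "RR = {R. profinite_congruence M R \<and> r \<subseteq> R}"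
  define R where "R = \<Inter>RR"
  have comp_q: "compact_space (topo (quotient_monoid M S))" for S
  proof -
    have "compactin (quotient_topology (topo M) S) ((\<lambda>x. S `` {x}) ` topspace (topo M))"
      by (rule image_compactin[OF _ continuous_quotient]) (use comp in \<open>simp add: compact_space_def\<close>)
    moreover have "(\<lambda>x. S `` {x}) ` topspace (topo M) = topspace (quotient_topology (topo M) S)"
      by (auto simp: topspace_quotient_topology quotient_def)
    ultimately show ?thesis by (simp add: quotient_monoid_simps compact_space_def)
  qed
  have top_q: "topspace (topo (quotient_monoid M S)) = carrier (quotient_monoid M S)" for S
    by (simp add: quotient_monoid_simps topspace_quotient_topology top)
  have "carrier M \<times> carrier M \<in> RR"
  proof -
    have "equiv (carrier M) (carrier M \<times> carrier M)"
      by (auto simp: equiv_def refl_on_def sym_def trans_def)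
    then have c: "congruence M (carrier M \<times> carrier M)"
      by (auto simp: congruence_def)
    have "profinite_monoid (quotient_monoid M (carrier M \<times> carrier M))"
      by (rule profinite_monoidI[OF monoid_quotient[OF M c] top_q comp_q])
        (auto simp: quotient_monoid_simps elim!: quotientE)
    with c r show ?thesis by (simp add: RR_def profinite_congruence_def)
  qed
  then have ne: "RR \<noteq> {}" by blast
  have RRc: "congruence M S" "profinite_monoid (quotient_monoid M S)" if "S \<in> RR" for S
    using that by (auto simp: RR_def profinite_congruence_def)
  have eq: "equiv (carrier M) S" if "S \<in> RR" for S
    using RRc[OF that] by (simp add: congruence_def)
  have "equiv (carrier M) R"
  proof (rule equivI)
    obtain S0 where "S0 \<in> RR" using ne by blast
    with eq[OF this] show "R \<subseteq> carrier M \<times> carrier M" by (auto simp: R_def equiv_def)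
    show "refl_on (carrier M) R"
      using eq by (simp add: R_def equiv_def refl_on_def)
    show "sym R"
    proof (rule symI)
      fix a b assume "(a, b) \<in> R"
      then show "(b, a) \<in> R" using eq by (auto simp: R_def equiv_def dest: symD)
    qed
    show "trans R"
    proof (rule transI)
      fix a b c assume *: "(a, b) \<in> R" "(b, c) \<in> R"
      have "(a, c) \<in> S" if "S \<in> RR" for S
      proof (rule transD)
        show "trans S" using eq[OF that] by (simp add: equiv_def)
        show "(a, b) \<in> S" "(b, c) \<in> S" using * that by (auto simp: R_def)
      qed
      then show "(a, c) \<in> R" by (simp add: R_def)
    qed
  qed
  then have cR: "congruence M R"
  proof -
    have "(a \<otimes>\<^bsub>M\<^esub> c, b \<otimes>\<^bsub>M\<^esub> d) \<in> R" if "(a, b) \<in> R" "(c, d) \<in> R" for a b c d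
      unfolding R_def
    proof
      fix S assume "S \<in> RR"
      moreover from this have "(a, b) \<in> S" "(c, d) \<in> S" using that by (auto simp: R_def)
      ultimately show "(a \<otimes>\<^bsub>M\<^esub> c, b \<otimes>\<^bsub>M\<^esub> d) \<in> S"
        using RRc(1)[of S] by (auto simp: congruence_def)
    qed
    with \<open>equiv (carrier M) R\<close> show ?thesis by (auto simp: congruence_def)
  qed
  have "profinite_monoid (quotient_monoid M R)"
  proof (rule profinite_monoidI[OF monoid_quotient[OF M cR] top_q comp_q])
    fix A B assume AB: "A \<in> carrier (quotient_monoid M R)" "B \<in> carrier (quotient_monoid M R)" "A \<noteq> B"
    then obtain a b where a: "a \<in> carrier M" "A = R `` {a}" and b: "b \<in> carrier M" "B = R `` {b}"
      by (auto simp: quotient_monoid_simps elim!: quotientE)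
    then have "(a, b) \<notin> R" using AB equiv_class_eq[OF \<open>equiv (carrier M) R\<close>] by blast
    then obtain S where S: "S \<in> RR" "(a, b) \<notin> S" by (auto simp: R_def)
    have "S `` {a} \<noteq> S `` {b}" using S eq_equiv_class[OF _ eq] b by blast
    moreover have "S `` {x} \<in> carrier (quotient_monoid M S)" if "x \<in> carrier M" for x
      using that by (simp add: quotient_monoid_simps quotientI)
    ultimately obtain F :: "nat top_monoid" and e where e: "finite_discrete_monoid F"
      "e \<in> top_hom (quotient_monoid M S) F" "e (S `` {a}) \<noteq> e (S `` {b})"
      using profinite_separates[OF RRc(2)[OF S(1)]] a b by metis
    have SR: "S `` (R `` {x}) = S `` {x}" if "x \<in> carrier M" for x
    proof -
      have "R \<subseteq> S" using S by (auto simp: R_def)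
      moreover have "(x, x) \<in> R"
        using that \<open>equiv (carrier M) R\<close> by (auto simp: equiv_def refl_on_def)
      moreover have "trans S" using eq[OF S(1)] by (simp add: equiv_def)
      ultimately show ?thesis by (auto dest: transD)
    qed
    have "(\<lambda>A. e (S `` A)) \<in> top_hom (quotient_monoid M R) F"
    proof -
      have "(\<lambda>A. e (S `` A)) \<in> hom (quotient_monoid M R) F"
      proof (rule homI)
        fix A assume "A \<in> carrier (quotient_monoid M R)"
        then obtain x where "x \<in> carrier M" "A = R `` {x}"
          by (auto simp: quotient_monoid_simps elim!: quotientE)
        then show "e (S `` A) \<in> carrier F"
          using SR e top_hom_carrier by (fastforce simp: quotient_monoid_simps intro: quotientI)
      next
        fix A B assume "A \<in> carrier (quotient_monoid M R)" "B \<in> carrier (quotient_monoid M R)"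
        then obtain x y where xy: "x \<in> carrier M" "A = R `` {x}" "y \<in> carrier M" "B = R `` {y}"
          by (auto simp: quotient_monoid_simps elim!: quotientE)
        have "e (S `` {x} \<otimes>\<^bsub>quotient_monoid M S\<^esub> S `` {y}) = e (S `` {x}) \<otimes>\<^bsub>F\<^esub> e (S `` {y})"
          using e xy by (auto simp: top_hom_def hom_def quotient_monoid_simps quotientI)
        with xy show "e (S `` (A \<otimes>\<^bsub>quotient_monoid M R\<^esub> B)) = e (S `` A) \<otimes>\<^bsub>F\<^esub> e (S `` B)"
          by (simp add: quotient_mult[OF cR] quotient_mult[OF RRc(1)[OF S(1)]] SR)
      qed
      moreover have "e (S `` \<one>\<^bsub>quotient_monoid M R\<^esub>) = \<one>\<^bsub>F\<^esub>"
        using e by (simp add: quotient_monoid_simps SR top_hom_def)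
      moreover have "continuous_map (topo (quotient_monoid M R)) (topo F) (\<lambda>A. e (S `` A))"
      proof -
        have "continuous_map (quotient_topology (topo M) S) (topo F) e"
          using e by (simp add: top_hom_def quotient_monoid_simps)
        from continuous_map_compose[OF continuous_quotient this]
        have c: "continuous_map (topo M) (topo F) (\<lambda>x. e (S `` {x}))" by (simp add: o_def)
        have "openin (topo M) {x \<in> topspace (topo M). R `` {x} \<in>
            {A \<in> topspace (topo M) // R. e (S `` A) \<in> U}}" if U: "openin (topo F) U" for U
        proof -
          have "{x \<in> topspace (topo M). R `` {x} \<in> {A \<in> topspace (topo M) // R. e (S `` A) \<in> U}} =
              {x \<in> topspace (topo M). e (S `` {x}) \<in> U}"
            using SR top by (auto intro: quotientI)
          then show ?thesis using c U by (simp add: continuous_map_def)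
        qed
        moreover have "e (S `` A) \<in> topspace (topo F)" if "A \<in> topspace (topo M) // R" for A
          using that c SR top by (auto simp: continuous_map_def elim!: quotientE)
        ultimately show ?thesis
          unfolding continuous_map_def quotient_monoid_simps openin_quotient_topology
            topspace_quotient_topology by blast
      qed
      ultimately show ?thesis by (simp add: top_hom_def)
    qed
    moreover have "e (S `` A) \<noteq> e (S `` B)" using e a b SR by simp
    ultimately show "\<exists>(F :: nat top_monoid) e. finite_discrete_monoid F \<and>
        e \<in> top_hom (quotient_monoid M R) F \<and> e A \<noteq> e B"
      using e(1) by (intro exI[of _ F] exI[of _ "\<lambda>A. e (S `` A)"]) auto
  qed
  with cR show ?thesis
    by (simp add: profinite_congruence_def min_profinite_congruence_def R_def RR_def)
qed

definition semidirect ::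
  "'a top_monoid \<Rightarrow> 'b top_monoid \<Rightarrow> ('b \<Rightarrow> 'a \<Rightarrow> 'a) \<Rightarrow> ('a \<times> 'b) top_monoid" where
  "semidirect Q G act =
     \<lparr>carrier = carrier Q \<times> carrier G,
      monoid.mult = (\<lambda>(\<rho>, \<sigma>) (\<rho>', \<sigma>'). (\<rho> \<otimes>\<^bsub>Q\<^esub> act \<sigma> \<rho>', \<sigma> \<otimes>\<^bsub>G\<^esub> \<sigma>')),
      one = (\<one>\<^bsub>Q\<^esub>, \<one>\<^bsub>G\<^esub>),
      topo = prod_topology (topo Q) (topo G)\<rparr>"

definition words :: "'a set \<Rightarrow> 'a list top_monoid" where
  "words A = \<lparr>carrier = lists A, monoid.mult = (@), one = [],
              topo = discrete_topology (lists A)\<rparr>"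


section \<open>Number fields, their finite primes and Galois groups\<close>

text \<open>
  Throughout, \<open>K\<close> is a subfield of a field \<^typ>\<open>'a\<close> of characteristic \<open>0\<close>, and the whole type
  \<^typ>\<open>'a\<close> plays the role of the algebraic closure of \<open>K\<close>.
\<close>

definition ring_on :: "'a::comm_ring_1 set \<Rightarrow> 'a ring" where
  "ring_on A = \<lparr>carrier = A, monoid.mult = (*), one = 1, ring.zero = 0, add = (+)\<rparr>"

definition number_field :: "'a::field_char_0 set \<Rightarrow> bool" where
  "number_field K \<longleftrightarrow>
     subfield K (ring_on UNIV) \<and> ring.finite_dimension (ring_on UNIV) \<rat> K"

definition integers :: "'a::field_char_0 set \<Rightarrow> 'a set" where
  "integers A = {x \<in> A. algebraic_int x}"

text \<open>
  For \<open>A = K\<close> this is the set of primes of \<open>K\<close>; for \<open>A = UNIV\<close> it is the set of finite primes of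
  the algebraic closure.
\<close>

definition finite_primes :: "'a::field_char_0 set \<Rightarrow> 'a set set" where
  "finite_primes A = {v. maximalideal v (ring_on (integers A)) \<and> v \<noteq> {0}}"

abbreviation closure_primes :: "'a::field_char_0 set set" ("\<V>") where
  "\<V> \<equiv> finite_primes UNIV"

definition below :: "'a::field_char_0 set \<Rightarrow> 'a set \<Rightarrow> 'a set" where
  "below K v = v \<inter> integers K"

definition gal :: "'a::field_char_0 set \<Rightarrow> ('a \<Rightarrow> 'a) top_monoid" where
  "gal K = restr
     \<lparr>carrier = UNIV, monoid.mult = (\<circ>), one = id,
      topo = product_topology (\<lambda>_. discrete_topology UNIV) UNIV\<rparr>
     {\<sigma> \<in> ring_iso (ring_on UNIV) (ring_on UNIV). \<forall>x\<in>K. \<sigma> x = x}"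

definition decomposition_group ::
  "'a::field_char_0 set \<Rightarrow> 'a set \<Rightarrow> ('a \<Rightarrow> 'a) top_monoid" where
  "decomposition_group K v = restr (gal K) {\<sigma> \<in> carrier (gal K). \<sigma> ` v = v}"

definition inertia :: "'a::field_char_0 set \<Rightarrow> 'a set \<Rightarrow> ('a \<Rightarrow> 'a) set" where
  "inertia K v =
     {\<sigma> \<in> carrier (decomposition_group K v). \<forall>x\<in>integers UNIV. \<sigma> x - x \<in> v}"

text \<open>
  The arithmetic Frobenius.  The set of all its lifts to the decomposition group is a coset of the
  inertia group, i.e. an element of the quotient by the inertia group.
\<close>

definition frob :: "'a::field_char_0 set \<Rightarrow> 'a set \<Rightarrow> ('a \<Rightarrow> 'a) set" where
  "frob K v =
     {\<sigma> \<in> carrier (decomposition_group K v). \<forall>x\<in>integers UNIV.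
        \<sigma> x - x ^ card (carrier (ring_on (integers K) Quot below K v)) \<in> v}"

definition weil_monoid :: "'a::field_char_0 set \<Rightarrow> 'a set \<Rightarrow> ('a \<Rightarrow> 'a) set" where
  "weil_monoid K v =
     (let G = decomposition_group K v; H = inertia K v
      in {\<sigma> \<in> carrier G. \<exists>n::nat. H #>\<^bsub>G\<^esub> \<sigma> = frob K v [^]\<^bsub>G Mod H\<^esub> n})"

text \<open>The topology for which all translates of the (profinite) inertia group are open.\<close>

definition weil_topology :: "'a::field_char_0 set \<Rightarrow> 'a set \<Rightarrow> ('a \<Rightarrow> 'a) topology" where
  "weil_topology K v = topology (\<lambda>U. U \<subseteq> weil_monoid K v \<and>
     (\<forall>\<sigma>\<in>weil_monoid K v.
        openin (subtopology (topo (gal K)) (inertia K v)) {\<tau> \<in> inertia K v. \<sigma> \<circ> \<tau> \<in> U}))"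

lemma openin_weil_topology:
  "openin (weil_topology K v) U \<longleftrightarrow> U \<subseteq> weil_monoid K v \<and>
     (\<forall>\<sigma>\<in>weil_monoid K v.
        openin (subtopology (topo (gal K)) (inertia K v)) {\<tau> \<in> inertia K v. \<sigma> \<circ> \<tau> \<in> U})"
proof -
  let ?S = "\<lambda>\<sigma> U. {\<tau> \<in> inertia K v. \<sigma> \<circ> \<tau> \<in> U}"
  let ?T = "subtopology (topo (gal K)) (inertia K v)"
  have "istopology (\<lambda>U. U \<subseteq> weil_monoid K v \<and> (\<forall>\<sigma>\<in>weil_monoid K v. openin ?T (?S \<sigma> U)))"
    unfolding istopology_def
  proof (intro conjI allI impI ballI)
    fix U V \<sigma> assume *: "U \<subseteq> weil_monoid K v \<and> (\<forall>\<sigma>\<in>weil_monoid K v. openin ?T (?S \<sigma> U))"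
      "V \<subseteq> weil_monoid K v \<and> (\<forall>\<sigma>\<in>weil_monoid K v. openin ?T (?S \<sigma> V))"
    then show "U \<inter> V \<subseteq> weil_monoid K v" by auto
    assume "\<sigma> \<in> weil_monoid K v"
    moreover have "?S \<sigma> (U \<inter> V) = ?S \<sigma> U \<inter> ?S \<sigma> V" by auto
    ultimately show "openin ?T (?S \<sigma> (U \<inter> V))" using * by (simp add: openin_Int)
  next
    fix \<K> \<sigma>
    assume *: "\<forall>U\<in>\<K>. U \<subseteq> weil_monoid K v \<and> (\<forall>\<sigma>\<in>weil_monoid K v. openin ?T (?S \<sigma> U))"
    then show "\<Union>\<K> \<subseteq> weil_monoid K v" by auto
    assume "\<sigma> \<in> weil_monoid K v"
    moreover have "?S \<sigma> (\<Union>\<K>) = (\<Union>U\<in>\<K>. ?S \<sigma> U)" by auto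
    ultimately show "openin ?T (?S \<sigma> (\<Union>\<K>))"
      using * by (simp only:) (rule openin_Union, blast)
  qed
  then show ?thesis by (simp add: weil_topology_def)
qed

text \<open>In \<open>Q\<^sub>v\<close> the zero element \<open>0\<^sub>v\<close> is \<^const>\<open>None\<close>.\<close>

definition Q_loc :: "'a::field_char_0 set \<Rightarrow> 'a set \<Rightarrow> ('a \<Rightarrow> 'a) option top_monoid" where
  "Q_loc K v =
     \<lparr>carrier = insert None (Some ` weil_monoid K v),
      monoid.mult = (\<lambda>x y. case (x, y) of (Some \<sigma>, Some \<tau>) \<Rightarrow> Some (\<sigma> \<circ> \<tau>) | _ \<Rightarrow> None),
      one = Some id,
      topo = Alexandroff_compactification (weil_topology K v)\<rparr>"

definition primes_over :: "'a::field_char_0 set \<Rightarrow> 'a set set \<Rightarrow> 'a set set" where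
  "primes_over K S = {v \<in> \<V>. below K v \<in> S}"

type_synonym 'a Q_elem = "('a set, ('a \<Rightarrow> 'a) option) test \<Rightarrow> nat"

definition Q_fin :: "'a::field_char_0 set \<Rightarrow> 'a set set \<Rightarrow> 'a Q_elem top_monoid" where
  "Q_fin K S = free_product (primes_over K S) (Q_loc K)"

definition Q_incl ::
  "'a::field_char_0 set \<Rightarrow> 'a set set \<Rightarrow> 'a set \<Rightarrow> ('a \<Rightarrow> 'a) option \<Rightarrow> 'a Q_elem" where
  "Q_incl K S v x =
     (if v \<in> primes_over K S then free_incl (primes_over K S) (Q_loc K) v x else \<one>\<^bsub>Q_fin K S\<^esub>)"

definition Q_proj ::
  "'a::field_char_0 set \<Rightarrow> 'a set set \<Rightarrow> 'a set set \<Rightarrow> 'a Q_elem \<Rightarrow> 'a Q_elem" where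
  "Q_proj K S S' = free_lift (primes_over K S') (Q_loc K) (Q_fin K S) (Q_incl K S)"

definition finite_sets :: "'a::field_char_0 set \<Rightarrow> 'a set set set" where
  "finite_sets K = {S. finite S \<and> S \<subseteq> finite_primes K}"

definition Q_hat :: "'a::field_char_0 set \<Rightarrow> ('a set set \<Rightarrow> 'a Q_elem) top_monoid" where
  "Q_hat K = inv_limit (finite_sets K) (\<subseteq>) (Q_fin K) (Q_proj K)"

definition Q_hat_incl ::
  "'a::field_char_0 set \<Rightarrow> 'a set \<Rightarrow> ('a \<Rightarrow> 'a) option \<Rightarrow> 'a set set \<Rightarrow> 'a Q_elem" where
  "Q_hat_incl K v x = (\<lambda>S\<in>finite_sets K. Q_incl K S v x)"

definition conj_loc ::
  "'a::field_char_0 set \<Rightarrow> ('a \<Rightarrow> 'a) \<Rightarrow> ('a \<Rightarrow> 'a) option \<Rightarrow> ('a \<Rightarrow> 'a) option" where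
  "conj_loc K \<sigma> = map_option (\<lambda>\<rho>. \<sigma> \<circ> \<rho> \<circ> inv\<^bsub>gal K\<^esub> \<sigma>)"

definition Q_fin_act ::
  "'a::field_char_0 set \<Rightarrow> 'a set set \<Rightarrow> ('a \<Rightarrow> 'a) \<Rightarrow> 'a Q_elem \<Rightarrow> 'a Q_elem" where
  "Q_fin_act K S \<sigma> =
     free_lift (primes_over K S) (Q_loc K) (Q_fin K S) (\<lambda>v x. Q_incl K S (\<sigma> ` v) (conj_loc K \<sigma> x))"

definition Q_hat_act ::
  "'a::field_char_0 set \<Rightarrow> ('a \<Rightarrow> 'a) \<Rightarrow> ('a set set \<Rightarrow> 'a Q_elem) \<Rightarrow> 'a set set \<Rightarrow> 'a Q_elem"
  where
  "Q_hat_act K \<sigma> \<rho> = (\<lambda>S\<in>finite_sets K. Q_fin_act K S \<sigma> (\<rho> S))"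


section \<open>The free deformation of the absolute Galois group\<close>

type_synonym 'a Q_hat_gal = "('a set set \<Rightarrow> 'a Q_elem) \<times> ('a \<Rightarrow> 'a)"

definition Q_hat_semidirect :: "'a::field_char_0 set \<Rightarrow> 'a Q_hat_gal top_monoid" where
  "Q_hat_semidirect K = semidirect (Q_hat K) (gal K) (Q_hat_act K)"

definition inertia_rel :: "'a::field_char_0 set \<Rightarrow> ('a Q_hat_gal \<times> 'a Q_hat_gal) set" where
  "inertia_rel K =
     {((\<rho>, \<sigma>), (\<rho> \<otimes>\<^bsub>Q_hat K\<^esub> Q_hat_incl K v (Some u), inv\<^bsub>gal K\<^esub> u \<otimes>\<^bsub>gal K\<^esub> \<sigma>)) | \<rho> \<sigma> v u.
        \<rho> \<in> carrier (Q_hat K) \<and> \<sigma> \<in> carrier (gal K) \<and> v \<in> \<V> \<and> u \<in> inertia K v}"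

definition DG :: "'a::field_char_0 set \<Rightarrow> 'a Q_hat_gal set top_monoid" where
  "DG K = quotient_monoid (Q_hat_semidirect K)
            (min_profinite_congruence (Q_hat_semidirect K) (inertia_rel K))"

end

theory Submission
  imports Defs "Jordan_Normal_Form.Char_Poly"
begin

text \<open>
  A place \<open>v\<close> is sent to the class of \<open>(\<phi> v, s v)\<close>, where \<open>\<phi> v \<in> Q\<^sub>v\<close> is a lift of the Frobenius and \<open>s v\<close>
  is a Galois element such that every \<open>\<sigma>\<close> is approximated by the \<open>s v\<close> with \<open>v\<close> above primes outside any
  given finite set.

  Density. The closure of the image is a closed submonoid. A neighbourhood in \<open>Q\<close> sees only finitely many
  primes of \<open>K\<close>, hence the closure contains all \<open>(1, \<sigma>)\<close>: approximate \<open>\<sigma>\<close> by \<open>s v\<close> for a place \<open>v\<close> whose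
  component \<open>\<phi> v\<close> is invisible. Multiplying by \<open>(1, (s v)\<^sup>-\<^sup>1)\<close> it contains the classes of all \<open>\<phi> v\<close>. The
  inertia groups enter through the second factor, since \<open>(u, 1)\<close> and \<open>(1, u)\<close> are identified, and
  \<open>0\<^sub>v\<close> is the limit of \<open>\<phi> v ^ n\<close>; so it contains every \<open>Q\<^sub>v\<close> and therefore everything.

  Injectivity. Given two words, let \<open>B\<close> be a finite Galois-stable set of algebraic integers that separates
  their letters. Only finitely many primes have an inertia group that moves an element of \<open>B\<close>. The free
  monoid over the traces \<open>v \<inter> B\<close>, truncated at a large length and extended by the action of the Galois group
  on \<open>B\<close>, is a finite quotient of the free deformation: an element of \<open>W\<^sub>v\<close> of degree \<open>n\<close> is sent to \<open>(v \<inter> B)\<^sup>n\<close>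
  together with its restriction to \<open>B\<close>. A word is sent to its letters, each moved by an automorphism that is
  determined by the letters before it, so the word can be recovered from its image.
\<close>

text \<open>Existence of \<open>\<phi> v\<close> is the arithmetic core. One automorphism has to
  match the Frobenius on finitely many integers at once, so these become the coefficients of one
  polynomial; the Frobenius sends it to a root, modulo \<open>v\<close>, of the product over its
  Galois conjugates, hence to a conjugate. Compactness of the Galois group passes to all integers.
  The truncation of the words is forced by \<open>0_v\<close>: powers of a Frobenius lift converge
  to it, so in every finite quotient all large degrees collapse to its image. The bound is the
  length of the longer word, which keeps both words alive. The inertia relations decide which primes
  a finite quotient has to see. At a prime that it ignores, \<open>Q_v\<close> goes to
  \<open>1\<close>, so \<open>(1, \<sigma>)\<close> is identified with
  \<open>(1, u\<^sup>-\<^sup>1 \<sigma>)\<close> and inertia has to fix \<open>B\<close> pointwise.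
  Where it does not, the prime must be seen; it then divides a difference of distinct elements of
  \<open>B\<close>, so there are finitely many. Limits of products are taken in the free
  deformation, whose multiplication is continuous; in the semidirect product only the closed
  preimage of the closure is used.\<close>

hide_const (open) Polynomials.degree Polynomials.lead_coeff up_ring.monom up_ring.coeff
hide_const (open) Module.smult Divisibility.prime

section \<open>Rings of algebraic integers\<close>

text \<open>For infinite \<open>B\<close> the sum defaults to \<open>0\<close> and the span is
  trivial, which is why membership of the generators asks for finiteness.\<close>

definition int_span :: "'a::ring_1 set \<Rightarrow> 'a set" where
  "int_span B = range (\<lambda>c. \<Sum>b\<in>B. of_int (c b) * b)"

lemma int_span_add: "x \<in> int_span B \<Longrightarrow> y \<in> int_span B \<Longrightarrow> x + y \<in> int_span B"
proof -
  assume "x \<in> int_span B" "y \<in> int_span B"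
  then obtain c d where "x = (\<Sum>b\<in>B. of_int (c b) * b)" "y = (\<Sum>b\<in>B. of_int (d b) * b)"
    by (auto simp: int_span_def)
  then have "x + y = (\<Sum>b\<in>B. of_int (c b + d b) * b)"
    by (simp add: sum.distrib algebra_simps)
  then show ?thesis unfolding int_span_def by (rule range_eqI[where x = "\<lambda>b. c b + d b"])
qed

lemma int_span_scale: "x \<in> int_span B \<Longrightarrow> of_int k * x \<in> int_span B"
proof -
  assume "x \<in> int_span B"
  then obtain c where "x = (\<Sum>b\<in>B. of_int (c b) * b)"
    by (auto simp: int_span_def)
  then have "of_int k * x = (\<Sum>b\<in>B. of_int (k * c b) * b)"
    by (simp add: sum_distrib_left mult.assoc)
  then show ?thesis unfolding int_span_def by (rule range_eqI[where x = "\<lambda>b. k * c b"])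
qed

lemma int_span_zero: "0 \<in> int_span B"
  unfolding int_span_def by (rule range_eqI[where x = "\<lambda>_. 0"]) simp

lemma int_span_sum: "(\<And>i. i \<in> A \<Longrightarrow> f i \<in> int_span B) \<Longrightarrow> sum f A \<in> int_span B"
  by (induction A rule: infinite_finite_induct) (auto intro: int_span_zero int_span_add)

lemma int_span_base: "finite B \<Longrightarrow> b \<in> B \<Longrightarrow> b \<in> int_span B"
proof -
  assume "finite B" "b \<in> B"
  moreover have "(\<Sum>a\<in>B. of_int (if a = b then 1 else 0) * a) = (\<Sum>a\<in>B. if a = b then a else 0)"
    by (intro sum.cong) auto
  ultimately have "b = (\<Sum>a\<in>B. of_int (if a = b then 1 else 0) * a)" by simp
  then show ?thesis unfolding int_span_def by (rule range_eqI[where x = "\<lambda>a. if a = b then 1 else 0"])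
qed

lemma int_span_stable:
  fixes z :: "'a::comm_ring_1"
  assumes "\<And>b. b \<in> B \<Longrightarrow> z * b \<in> int_span B" "x \<in> int_span B"
  shows "z * x \<in> int_span B"
proof -
  obtain c where "x = (\<Sum>b\<in>B. of_int (c b) * b)" using assms by (auto simp: int_span_def)
  then have "z * x = (\<Sum>b\<in>B. of_int (c b) * (z * b))" by (simp add: sum_distrib_left algebra_simps)
  also have "\<dots> \<in> int_span B" by (intro int_span_sum int_span_scale assms)
  finally show ?thesis .
qed

text \<open>An eigenvalue of an integer matrix is a root of its characteristic polynomial.\<close>

lemma algebraic_int_if_stable:
  fixes z :: "'a::field_char_0"
  assumes B: "finite B" "1 \<in> B" "\<And>b. b \<in> B \<Longrightarrow> z * b \<in> int_span B"
  shows "algebraic_int z"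
proof -
  define n where "n = card B"
  obtain e where e: "bij_betw e {..<n} B"
    using ex_bij_betw_nat_finite[OF B(1)] by (auto simp: n_def atLeast0LessThan)
  have "\<forall>b\<in>B. \<exists>c. z * b = (\<Sum>a\<in>B. of_int (c a :: int) * a)"
    using B(3) by (auto simp: int_span_def)
  then obtain c :: "'a \<Rightarrow> 'a \<Rightarrow> int" where c: "\<And>b. b \<in> B \<Longrightarrow> z * b = (\<Sum>a\<in>B. of_int (c b a) * a)"
    by metis
  define A where "A = Matrix.mat n n (\<lambda>(i, j). c (e i) (e j))"
  define v where "v = Matrix.vec n e"
  have A: "A \<in> carrier_mat n n" by (simp add: A_def)
  let ?A = "map_mat of_int A :: 'a mat"
  have A': "?A \<in> carrier_mat n n" using A by simp
  have "eigenvector ?A v z"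
    unfolding eigenvector_def
  proof (intro conjI)
    show "v \<in> carrier_vec (dim_row ?A)" using A by (simp add: v_def)
    \<comment> \<open>The vector lists \<open>B\<close> itself; its entry \<open>1\<close> keeps it
      from being zero.\<close>
    obtain i where i: "i < n" "e i = 1"
      using e B(2) unfolding bij_betw_def by (metis imageE lessThan_iff)
    then have "vec_index v i \<noteq> vec_index (0\<^sub>v n) i" by (simp add: v_def)
    moreover have "dim_row ?A = n" using A by simp
    ultimately show "v \<noteq> 0\<^sub>v (dim_row ?A)" by metis
    show "?A *\<^sub>v v = z \<cdot>\<^sub>v v"
    proof (rule eq_vecI)
      fix i assume "i < dim_vec (z \<cdot>\<^sub>v v)"
      then have i: "i < n" by (simp add: v_def)
      then have "e i \<in> B" using e by (auto simp: bij_betw_def)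
      then have "z * e i = (\<Sum>j<n. of_int (c (e i) (e j)) * e j)"
        using c sum.reindex_bij_betw[OF e, of "\<lambda>a. of_int (c (e i) a) * a"] by simp
      then show "vec_index (?A *\<^sub>v v) i = vec_index (z \<cdot>\<^sub>v v) i"
        using i by (simp add: v_def A_def scalar_prod_def atLeast0LessThan)
    qed (use A in \<open>simp add: v_def\<close>)
  qed
  then have "poly (char_poly ?A) z = 0"
    using eigenvalue_root_char_poly[OF A'] eigenvalue_def by blast
  moreover have "char_poly ?A = map_poly of_int (char_poly A)"
    by (rule of_int_hom.char_poly_hom[OF A])
  ultimately show ?thesis
    using degree_monic_char_poly[OF A] by (auto simp: algebraic_int_altdef_ipoly)
qed

text \<open>A monic integer polynomial is solved for its leading power; degree \<open>0\<close>
  would say \<open>1 = 0\<close>.\<close>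

lemma int_power_reduction:
  fixes x :: "'a::field_char_0"
  assumes "algebraic_int x"
  obtains m c where "m > 0" "x ^ m = (\<Sum>i<m. of_int (c i) * x ^ i)"
proof -
  obtain p where p: "poly (map_poly of_int p) x = 0" "Polynomial.lead_coeff p = 1"
    using assms by (auto simp: algebraic_int_altdef_ipoly)
  define m where "m = Polynomial.degree p"
  have "0 = (\<Sum>i\<le>m. of_int (Polynomial.coeff p i) * x ^ i)"
    using p by (simp add: poly_altdef m_def)
  also have "\<dots> = (\<Sum>i<m. of_int (Polynomial.coeff p i) * x ^ i) + x ^ m"
    using p by (simp add: lessThan_Suc_atMost[symmetric] m_def)
  finally have *: "x ^ m = (\<Sum>i<m. of_int (- Polynomial.coeff p i) * x ^ i)"
    by (simp add: sum_negf eq_neg_iff_add_eq_0 add.commute)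
  have "m > 0"
  proof (rule ccontr)
    assume "\<not> m > 0"
    with * show False by simp
  qed
  show thesis by (rule that[OF \<open>m > 0\<close> *])
qed

text \<open>The products \<open>x ^ i * y ^ j\<close> with both exponents below the respective
  degrees span a module that contains \<open>1\<close> and is mapped into itself by \<open>x\<close>
  and \<open>y\<close>, hence also by \<open>x + y\<close> and \<open>x * y\<close>.\<close>

lemma algebraic_int_add_mult:
  fixes x y :: "'a::field_char_0"
  assumes "algebraic_int x" "algebraic_int y"
  shows "algebraic_int (x + y)" "algebraic_int (x * y)"
proof -
  obtain m c where m: "m > 0" "x ^ m = (\<Sum>i<m. of_int (c i) * x ^ i)"
    using int_power_reduction[OF assms(1)] by metis
  obtain n d where n: "n > 0" "y ^ n = (\<Sum>i<n. of_int (d i) * y ^ i)"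
    using int_power_reduction[OF assms(2)] by metis
  define B where "B = (\<lambda>(i, j). x ^ i * y ^ j) ` ({..<m} \<times> {..<n})"
  have B: "finite B" "1 \<in> B"
    unfolding B_def using m n by (auto intro!: image_eqI[of _ _ "(0, 0)"])
  have base: "x ^ i * y ^ j \<in> int_span B" if "i < m" "j < n" for i j
    using that by (intro int_span_base[OF B(1)]) (auto simp: B_def)
  have x: "x * b \<in> int_span B" if "b \<in> B" for b
  proof -
    obtain i j where ij: "i < m" "j < n" "b = x ^ i * y ^ j"
      using \<open>b \<in> B\<close> unfolding B_def by force
    show ?thesis
    proof (cases "Suc i < m")
      case True
      then show ?thesis using base[of "Suc i" j] ij by (simp add: mult.assoc)
    next
      case False
      then have mi: "m = Suc i" using ij by simp
      have "x * b = x ^ m * y ^ j" using ij mi by (simp add: mult.assoc)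
      also have "\<dots> = (\<Sum>k<m. of_int (c k) * (x ^ k * y ^ j))"
        unfolding m(2) by (simp add: sum_distrib_right mult.assoc)
      also have "\<dots> \<in> int_span B" by (intro int_span_sum int_span_scale base) (use ij in auto)
      finally show ?thesis .
    qed
  qed
  have y: "y * b \<in> int_span B" if "b \<in> B" for b
  proof -
    obtain i j where ij: "i < m" "j < n" "b = x ^ i * y ^ j"
      using \<open>b \<in> B\<close> unfolding B_def by force
    show ?thesis
    proof (cases "Suc j < n")
      case True
      then show ?thesis using base[of i "Suc j"] ij by (simp add: mult.left_commute)
    next
      case False
      then have nj: "n = Suc j" using ij by simp
      have "y * b = x ^ i * y ^ n" using ij nj by simp
      also have "\<dots> = (\<Sum>k<n. of_int (d k) * (x ^ i * y ^ k))"
        unfolding n(2) by (simp add: sum_distrib_left mult.left_commute)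
      also have "\<dots> \<in> int_span B" by (intro int_span_sum int_span_scale base) (use ij in auto)
      finally show ?thesis .
    qed
  qed
  show "algebraic_int (x + y)"
  proof (rule algebraic_int_if_stable[OF B])
    fix b assume "b \<in> B"
    then show "(x + y) * b \<in> int_span B"
      using int_span_add[OF x y] by (simp add: distrib_right)
  qed
  show "algebraic_int (x * y)"
  proof (rule algebraic_int_if_stable[OF B])
    fix b assume "b \<in> B"
    then show "(x * y) * b \<in> int_span B"
      using int_span_stable[OF x y] by (simp add: mult.assoc)
  qed
qed

section \<open>Subrings of a ring type and their ideals\<close>

definition is_subring :: "'a::comm_ring_1 set \<Rightarrow> bool" where
  "is_subring R \<longleftrightarrow> 1 \<in> R \<and> (\<forall>x\<in>R. - x \<in> R \<and> (\<forall>y\<in>R. x + y \<in> R \<and> x * y \<in> R))"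

lemma is_subringD:
  assumes "is_subring R"
  shows "1 \<in> R" "0 \<in> R" "x \<in> R \<Longrightarrow> - x \<in> R" "x \<in> R \<Longrightarrow> y \<in> R \<Longrightarrow> x + y \<in> R"
    "x \<in> R \<Longrightarrow> y \<in> R \<Longrightarrow> x * y \<in> R" "x \<in> R \<Longrightarrow> y \<in> R \<Longrightarrow> x - y \<in> R"
    "x \<in> R \<Longrightarrow> x ^ n \<in> R" "of_nat n \<in> R" "of_int k \<in> R"
proof -
  show one: "1 \<in> R" and uminus: "x \<in> R \<Longrightarrow> - x \<in> R" for x
    using assms by (auto simp: is_subring_def)
  show plus: "x \<in> R \<Longrightarrow> y \<in> R \<Longrightarrow> x + y \<in> R" for x y using assms by (auto simp: is_subring_def)
  show times: "x \<in> R \<Longrightarrow> y \<in> R \<Longrightarrow> x * y \<in> R" for x y using assms by (auto simp: is_subring_def)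
  show "x \<in> R \<Longrightarrow> y \<in> R \<Longrightarrow> x - y \<in> R" using plus[of x "- y"] uminus by simp
  show zero: "0 \<in> R" using plus[OF one uminus[OF one]] by simp
  show "x \<in> R \<Longrightarrow> x ^ n \<in> R" by (induction n) (auto intro: one times)
  show nat: "of_nat n \<in> R" for n by (induction n) (auto intro: one zero plus)
  show "of_int k \<in> R" by (cases k rule: int_cases2) (auto intro: nat uminus)
qed

lemma is_subring_sum: "is_subring R \<Longrightarrow> (\<And>i. i \<in> A \<Longrightarrow> f i \<in> R) \<Longrightarrow> sum f A \<in> R"
  by (induction A rule: infinite_finite_induct) (auto intro: is_subringD)

lemma is_subring_prod: "is_subring R \<Longrightarrow> (\<And>i. i \<in> A \<Longrightarrow> f i \<in> R) \<Longrightarrow> prod f A \<in> R"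
  by (induction A rule: infinite_finite_induct) (auto intro: is_subringD)

lemma ring_on_simps [simp]:
  "carrier (ring_on A) = A" "x \<otimes>\<^bsub>ring_on A\<^esub> y = x * y" "x \<oplus>\<^bsub>ring_on A\<^esub> y = x + y"
  "\<one>\<^bsub>ring_on A\<^esub> = 1" "\<zero>\<^bsub>ring_on A\<^esub> = 0"
  by (simp_all add: ring_on_def)

lemma cring_ring_on:
  assumes "is_subring R"
  shows "cring (ring_on R)"
proof (rule cringI)
  show "abelian_group (ring_on R)"
  proof (rule abelian_groupI)
    fix x assume "x \<in> carrier (ring_on R)"
    then show "\<exists>y\<in>carrier (ring_on R). y \<oplus>\<^bsub>ring_on R\<^esub> x = \<zero>\<^bsub>ring_on R\<^esub>"
      using is_subringD(3)[OF assms] by (intro bexI[of _ "- x"]) auto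
  qed (auto simp: is_subringD[OF assms] algebra_simps)
  show "Group.comm_monoid (ring_on R)"
    by (rule comm_monoidI) (auto simp: is_subringD[OF assms] algebra_simps)
qed (auto simp: algebra_simps)

lemma is_subring_UNIV: "is_subring UNIV" by (simp add: is_subring_def)

lemma is_subring_integers: "is_subring A \<Longrightarrow> is_subring (integers A)"
  by (auto simp: is_subring_def integers_def intro: algebraic_int_add_mult int_imp_algebraic_int)

lemma ideal_ring_on:
  assumes "is_subring R"
  shows "ideal v (ring_on R) \<longleftrightarrow> v \<subseteq> R \<and> 0 \<in> v \<and> (\<forall>x\<in>v. \<forall>y\<in>v. x + y \<in> v) \<and> (\<forall>a\<in>R. \<forall>x\<in>v. a * x \<in> v)"
    (is "?L \<longleftrightarrow> ?R")
proof
  assume ?L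
  then interpret ideal v "ring_on R" .
  have "v \<subseteq> R" using a_subset by simp
  moreover have "0 \<in> v" using additive_subgroup.zero_closed[OF is_additive_subgroup] by simp
  moreover have "x + y \<in> v" if "x \<in> v" "y \<in> v" for x y
    using additive_subgroup.a_closed[OF is_additive_subgroup that] by simp
  moreover have "a * x \<in> v" if "a \<in> R" "x \<in> v" for a x using I_l_closed[of x a] that by simp
  ultimately show ?R by blast
next
  assume R: ?R
  interpret cring "ring_on R" by (rule cring_ring_on[OF assms])
  have minus: "- x \<in> v" if "x \<in> v" for x
  proof -
    have "(- 1) * x \<in> v" using R that is_subringD(1,3)[OF assms] by blast
    then show ?thesis by simp
  qed
  have "subgroup v (add_monoid (ring_on R))"
  proof (rule group.subgroupI)
    show "Group.group (add_monoid (ring_on R))" by (rule add.is_group)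
    fix a assume a: "a \<in> v"
    then have "\<ominus>\<^bsub>ring_on R\<^esub> a = - a"
      using R is_subringD(3)[OF assms] by (intro minus_equality) auto
    then show "inv\<^bsub>add_monoid (ring_on R)\<^esub> a \<in> v" using minus a by (simp add: a_inv_def)
  qed (use R in auto)
  moreover have "x * a \<in> v" "a * x \<in> v" if "a \<in> v" "x \<in> R" for a x
    using R that by (auto simp: mult.commute[of a x])
  ultimately show ?L by (intro idealI ring_axioms) auto
qed

text \<open>Adjoining an outside element \<open>a\<close> to a maximal ideal yields the unit ideal,
  and an expression of \<open>1\<close> is an inverse of \<open>a\<close> modulo the ideal. Such
  inverses are easy to find in subrings and to move by automorphisms, which is how maximality is
  checked from now on.\<close>

lemma maximalideal_ring_on:
  assumes "is_subring R"
  shows "maximalideal v (ring_on R) \<longleftrightarrow> ideal v (ring_on R) \<and> 1 \<notin> v \<and> (\<forall>a\<in>R - v. \<exists>b\<in>R. a * b - 1 \<in> v)"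
    (is "?L \<longleftrightarrow> ?R")
proof
  assume ?L
  then interpret maximalideal v "ring_on R" .
  have v: "v \<subseteq> R" "0 \<in> v" "\<And>x y. x \<in> v \<Longrightarrow> y \<in> v \<Longrightarrow> x + y \<in> v" "\<And>a x. a \<in> R \<Longrightarrow> x \<in> v \<Longrightarrow> a * x \<in> v"
    using is_ideal unfolding ideal_ring_on[OF assms] by auto
  have "1 \<notin> v"
  proof
    assume "1 \<in> v"
    then have "R \<subseteq> v" using v(4)[of _ 1] by auto
    then show False using I_notcarr v(1) by auto
  qed
  moreover have "\<exists>b\<in>R. a * b - 1 \<in> v" if a: "a \<in> R - v" for a
  proof -
    \<comment> \<open>The ideal generated by \<open>v\<close> and \<open>a\<close>.\<close>
    define J where "J = {x + b * a | x b. x \<in> v \<and> b \<in> R}"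
    have "ideal J (ring_on R)"
      unfolding ideal_ring_on[OF assms]
    proof (intro conjI ballI)
      show "J \<subseteq> R" using v a by (auto simp: J_def intro!: is_subringD[OF assms])
      show "0 \<in> J" using v is_subringD(2)[OF assms] by (force simp: J_def)
    next
      fix x y assume "x \<in> J" "y \<in> J"
      then obtain u b w c where "x = u + b * a" "y = w + c * a" "u \<in> v" "w \<in> v" "b \<in> R" "c \<in> R"
        by (auto simp: J_def)
      then have "x + y = (u + w) + (b + c) * a" "u + w \<in> v" "b + c \<in> R"
        using v is_subringD(4)[OF assms] by (auto simp: algebra_simps)
      then show "x + y \<in> J" unfolding J_def by blast
    next
      fix d x assume "d \<in> R" "x \<in> J"
      then obtain u b where "x = u + b * a" "u \<in> v" "b \<in> R" by (auto simp: J_def)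
      then have "d * x = d * u + (d * b) * a" "d * u \<in> v" "d * b \<in> R"
        using v is_subringD(5)[OF assms] \<open>d \<in> R\<close> by (auto simp: algebra_simps)
      then show "d * x \<in> J" unfolding J_def by blast
    qed
    moreover have "v \<subseteq> J" using is_subringD(2)[OF assms] by (force simp: J_def)
    moreover have "J \<subseteq> R" using v a by (auto simp: J_def intro!: is_subringD[OF assms])
    moreover have "a \<in> J" using v(2) is_subringD(1)[OF assms] unfolding J_def by force
    ultimately have "J = R" using I_maximal[of J] a by auto
    then have "1 \<in> J" using is_subringD(1)[OF assms] by simp
    then obtain u b where "1 = u + b * a" "u \<in> v" "b \<in> R" by (auto simp: J_def)
    moreover have "- 1 * u \<in> v" using v(4)[of "- 1" u] \<open>u \<in> v\<close> is_subringD(1,3)[OF assms] by blast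
    moreover have "a * b - 1 = - 1 * u" using \<open>1 = u + b * a\<close> by (simp add: algebra_simps)
    ultimately show ?thesis by metis
  qed
  ultimately show ?R using is_ideal by blast
next
  assume R: ?R
  then have v: "v \<subseteq> R" "0 \<in> v" "\<And>x y. x \<in> v \<Longrightarrow> y \<in> v \<Longrightarrow> x + y \<in> v" "\<And>a x. a \<in> R \<Longrightarrow> x \<in> v \<Longrightarrow> a * x \<in> v"
    unfolding ideal_ring_on[OF assms] by auto
  show ?L
  proof (rule maximalidealI)
    show "ideal v (ring_on R)" using R by blast
    show "carrier (ring_on R) \<noteq> v" using R is_subringD(1)[OF assms] by auto
    fix J assume J: "ideal J (ring_on R)" "v \<subseteq> J" "J \<subseteq> carrier (ring_on R)"
    show "J = v \<or> J = carrier (ring_on R)"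
    proof (rule disjCI)
      assume "J \<noteq> carrier (ring_on R)"
      then have "1 \<notin> J"
        using J unfolding ideal_ring_on[OF assms] by (metis ring_on_simps(1) mult.right_neutral subsetI subset_antisym)
      have "a \<in> v" if a: "a \<in> J" for a
      proof (rule ccontr)
        assume "a \<notin> v"
        moreover have "a \<in> R" using a J by auto
        ultimately obtain b where b: "b \<in> R" "a * b - 1 \<in> v" using R by blast
        then have "b * a \<in> J" "- 1 * (a * b - 1) \<in> J"
          using J a is_subringD(1,3)[OF assms] unfolding ideal_ring_on[OF assms] by blast+
        then have "b * a + - 1 * (a * b - 1) \<in> J"
          using J unfolding ideal_ring_on[OF assms] by blast
        then show False using \<open>1 \<notin> J\<close> by (simp add: algebra_simps)
      qed
      with J show "J = v" by blast
    qed
  qed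
qed

section \<open>Maximal ideals of rings of integers\<close>

lemma int_poly_value:
  assumes "is_subring A" "x \<in> integers A"
  shows "poly (map_poly of_int g) x \<in> integers A"
  using assms(2)
  by (induction g) (auto simp: map_poly_pCons intro!: is_subringD[OF is_subring_integers[OF assms(1)]])

text \<open>Factors \<open>x\<close> are cancelled until the constant term is nonzero; its negative
  is then the multiple of \<open>x\<close> in question.\<close>

lemma int_poly_multiple:
  fixes f :: "int poly" and x :: "'a::field_char_0"
  shows "poly (map_poly of_int f) x = 0 \<Longrightarrow> f \<noteq> 0 \<Longrightarrow> x \<noteq> 0 \<Longrightarrow>
    \<exists>c g. c \<noteq> 0 \<and> of_int c = x * poly (map_poly of_int g) x"
proof (induction f)
  case (pCons a g)
  show ?case
  proof (cases "a = 0")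
    case False
    then show ?thesis
      using pCons.prems
      by (intro exI[of _ "- a"] exI[of _ g]) (auto simp: map_poly_pCons add_eq_0_iff)
  next
    case True
    then show ?thesis using pCons by (auto simp: map_poly_pCons)
  qed
qed auto

lemma integer_multiple:
  assumes A: "is_subring A" and x: "x \<in> integers A" "x \<noteq> (0::'a::field_char_0)"
  shows "\<exists>k y. k \<noteq> 0 \<and> y \<in> integers A \<and> of_int k = x * y"
proof -
  obtain f where "poly (map_poly of_int f) x = 0" "Polynomial.lead_coeff f = 1"
    using x(1) by (auto simp: integers_def algebraic_int_altdef_ipoly)
  then obtain c g where "c \<noteq> 0" "of_int c = x * poly (map_poly of_int g) x"
    using int_poly_multiple[of f x] x by force
  then show ?thesis using int_poly_value[OF A x(1)] by blast
qed

context
  fixes A :: "'a::field_char_0 set" and v :: "'a set"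
  assumes A: "is_subring A" and v: "v \<in> finite_primes A"
begin

private lemma O: "is_subring (integers A)" by (rule is_subring_integers[OF A])

private lemma v_maximal: "ideal v (ring_on (integers A))" "1 \<notin> v"
  "a \<in> integers A \<Longrightarrow> a \<notin> v \<Longrightarrow> \<exists>b\<in>integers A. a * b - 1 \<in> v" "v \<noteq> {0}"
  using v unfolding finite_primes_def mem_Collect_eq maximalideal_ring_on[OF O] by auto

lemma finite_primesD:
  shows "v \<subseteq> integers A" "0 \<in> v" "x \<in> v \<Longrightarrow> y \<in> v \<Longrightarrow> x + y \<in> v" "x \<in> v \<Longrightarrow> - x \<in> v"
    "x \<in> v \<Longrightarrow> y \<in> v \<Longrightarrow> x - y \<in> v" "a \<in> integers A \<Longrightarrow> x \<in> v \<Longrightarrow> a * x \<in> v"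
    "a \<in> integers A \<Longrightarrow> x \<in> v \<Longrightarrow> x * a \<in> v"
    "1 \<notin> v" "a \<in> integers A \<Longrightarrow> a \<notin> v \<Longrightarrow> \<exists>b\<in>integers A. a * b - 1 \<in> v"
proof -
  show "v \<subseteq> integers A" "0 \<in> v"
    using v_maximal(1) unfolding ideal_ring_on[OF O] by auto
  show plus: "x \<in> v \<Longrightarrow> y \<in> v \<Longrightarrow> x + y \<in> v" for x y
    using v_maximal(1) unfolding ideal_ring_on[OF O] by auto
  show times: "a \<in> integers A \<Longrightarrow> x \<in> v \<Longrightarrow> a * x \<in> v" for a x
    using v_maximal(1) unfolding ideal_ring_on[OF O] by auto
  then show "a \<in> integers A \<Longrightarrow> x \<in> v \<Longrightarrow> x * a \<in> v" by (simp add: mult.commute)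
  show minus: "x \<in> v \<Longrightarrow> - x \<in> v" for x
    using times[of "- 1" x] is_subringD(1,3)[OF O] by simp
  show "x \<in> v \<Longrightarrow> y \<in> v \<Longrightarrow> x - y \<in> v" using plus[of x "- y"] minus by simp
qed (use v_maximal in auto)

lemma finite_primes_sum: "(\<And>i. i \<in> S \<Longrightarrow> f i \<in> v) \<Longrightarrow> sum f S \<in> v"
  by (induction S rule: infinite_finite_induct) (auto intro: finite_primesD)

lemma finite_primes_prime:
  assumes "a \<in> integers A" "b \<in> integers A" "a * b \<in> v"
  shows "a \<in> v \<or> b \<in> v"
proof (rule disjCI)
  assume "b \<notin> v"
  then obtain c where c: "c \<in> integers A" "b * c - 1 \<in> v" using finite_primesD(9) assms by blast
  have "c * (a * b) - a * (b * c - 1) \<in> v"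
    by (intro finite_primesD(5,6) c assms)
  then show "a \<in> v" by (simp add: algebra_simps)
qed

lemma finite_primes_power: "a \<in> integers A \<Longrightarrow> a ^ n \<in> v \<Longrightarrow> a \<in> v"
  by (induction n) (use finite_primesD(8) finite_primes_prime is_subringD(7)[OF O] in auto)

lemma finite_primes_prod:
  "finite S \<Longrightarrow> (\<And>i. i \<in> S \<Longrightarrow> f i \<in> integers A) \<Longrightarrow> prod f S \<in> v \<Longrightarrow> \<exists>i\<in>S. f i \<in> v"
proof (induction S rule: finite_induct)
  case (insert i S)
  then have "f i \<in> integers A" "prod f S \<in> integers A" "f i * prod f S \<in> v"
    by (auto intro: is_subring_prod[OF O])
  from finite_primes_prime[OF this] show ?case using insert by auto
qed (use finite_primesD(8) in auto)

lemma finite_primes_of_int: "of_int k \<in> integers A"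
  by (rule is_subringD(9)[OF O])

lemma finite_primes_ex_int: "\<exists>c. c \<noteq> 0 \<and> of_int c \<in> v"
proof -
  obtain x where x: "x \<in> v" "x \<noteq> 0" using finite_primesD(2) v_maximal(4) by auto
  have "x \<in> integers A" using x(1) finite_primesD(1) by (rule rev_subsetD)
  from integer_multiple[OF A this x(2)] obtain k y where k: "k \<noteq> 0" "y \<in> integers A" "of_int k = x * y"
    by (elim exE conjE)
  have "of_int k \<in> v" unfolding k(3) by (rule finite_primesD(7)[OF k(2) x(1)])
  then show ?thesis using k(1) by (intro exI conjI)
qed

text \<open>Descent on a positive integer in \<open>v\<close>: it is not \<open>1\<close>, and since
  \<open>v\<close> is prime, either a prime factor or the smaller cofactor lies in
  \<open>v\<close>.\<close>

lemma finite_primes_ex_prime: "\<exists>p::nat. prime p \<and> of_nat p \<in> v"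
proof -
  have "\<exists>p::nat. prime p \<and> of_nat p \<in> v" if "n > 0" "of_nat n \<in> v" for n
    using that
  proof (induction n rule: less_induct)
    case (less n)
    have "n \<noteq> 1" using less.prems finite_primesD(8) by auto
    then obtain p where p: "prime p" "p dvd n" using prime_factor_nat by blast
    then obtain m where m: "n = p * m" by blast
    have "of_nat p * of_nat m \<in> v" using less.prems m by simp
    then consider "of_nat p \<in> v" | "of_nat m \<in> v"
      using finite_primes_prime is_subringD(8)[OF O] by blast
    then show ?case
    proof cases
      case 2
      have "m < n" "m > 0" using m p less.prems prime_gt_1_nat[of p] by auto
      then show ?thesis using less.IH 2 by blast
    qed (use p in auto)
  qed
  moreover obtain c where c: "c \<noteq> 0" "of_int c \<in> v" using finite_primes_ex_int by blast
  have "of_int \<bar>c\<bar> \<in> v" using c finite_primesD(4)[of "of_int c"] by (simp add: abs_if)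
  then have "of_nat (nat \<bar>c\<bar>) \<in> v" by (simp add: of_nat_nat)
  ultimately show ?thesis using c(1) by (metis zero_less_nat_eq zero_less_abs_iff)
qed

text \<open>By Bezout, an integer in \<open>v\<close> that is prime to \<open>p\<close> would put
  \<open>1\<close> into \<open>v\<close>.\<close>

lemma finite_primes_int_iff:
  assumes p: "prime p" "of_nat p \<in> v"
  shows "of_int k \<in> v \<longleftrightarrow> int p dvd k"
proof
  assume "int p dvd k"
  then obtain m where "k = int p * m" by blast
  then have "of_int k = of_int m * (of_nat p :: 'a)" by simp
  then show "of_int k \<in> v" using finite_primesD(6)[OF finite_primes_of_int p(2)] by metis
next
  assume k: "of_int k \<in> v"
  show "int p dvd k"
  proof (rule ccontr)
    assume "\<not> int p dvd k"
    then have "Rings.coprime (int p) k" using p(1) by (simp add: prime_imp_coprime)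
    then obtain a b where "a * int p + b * k = 1" by (metis bezout_int coprime_imp_gcd_eq_1)
    then have "of_int a * of_nat p + of_int b * of_int k = (1::'a)"
      by (metis of_int_1 of_int_add of_int_mult of_int_of_nat_eq)
    moreover have "of_int a * of_nat p + of_int b * of_int k \<in> v"
      by (intro finite_primesD(3,6) finite_primes_of_int k p)
    ultimately show False using finite_primesD(8) by simp
  qed
qed

lemma finite_primes_prime_unique:
  assumes "prime p" "of_nat p \<in> v" "prime q" "of_nat q \<in> v"
  shows "p = q"
proof -
  have "int p dvd int q" using finite_primes_int_iff[OF assms(1,2), of "int q"] assms(4) by simp
  then show ?thesis using assms by (simp add: primes_dvd_imp_eq)
qed

text \<open>Modulo \<open>v\<close> the coefficients matter only modulo \<open>p\<close>, so those
  in \<open>{0..<p}\<close> already give all residues.\<close>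

lemma int_span_finite_residues:
  assumes B: "finite B" "B \<subseteq> integers A"
  shows "\<exists>T. finite T \<and> T \<subseteq> int_span B \<and> (\<forall>y\<in>int_span B. \<exists>t\<in>T. y - t \<in> v)"
proof -
  obtain p :: nat where p: "prime p" "of_nat p \<in> v" using finite_primes_ex_prime by blast
  define T where "T = (\<lambda>c. \<Sum>b\<in>B. of_int (c b) * b) ` (B \<rightarrow>\<^sub>E {0..<int p})"
  have "\<exists>t\<in>T. y - t \<in> v" if "y \<in> int_span B" for y
  proof -
    obtain c where c: "y = (\<Sum>b\<in>B. of_int (c b) * b)" using \<open>y \<in> int_span B\<close> by (auto simp: int_span_def)
    define d where "d = (\<lambda>b\<in>B. c b mod int p)"
    have "d \<in> B \<rightarrow>\<^sub>E {0..<int p}" using p(1) by (auto simp: d_def prime_gt_0_nat)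
    moreover have "y - (\<Sum>b\<in>B. of_int (d b) * b) = (\<Sum>b\<in>B. b * of_int (c b - d b))"
      by (simp add: c sum_subtractf algebra_simps)
    moreover have "\<dots> \<in> v"
    proof (intro finite_primes_sum finite_primesD(6))
      fix b assume "b \<in> B"
      then show "b \<in> integers A" "of_int (c b - d b) \<in> v"
        using B(2) by (auto simp: finite_primes_int_iff[OF p] d_def simp del: of_int_diff)
    qed
    ultimately show ?thesis unfolding T_def by (intro bexI[OF _ imageI]) simp_all
  qed
  moreover have "finite T" unfolding T_def using B by (intro finite_imageI finite_PiE) auto
  moreover have "T \<subseteq> int_span B" by (auto simp: T_def int_span_def)
  ultimately show ?thesis by blast
qed

text \<open>All powers of \<open>x\<close> lie in one finitely generated module, which has finitely
  many residues modulo \<open>v\<close>; two powers agree there and the smaller one is cancelled.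
  For the closure the whole residue field is infinite, but each of its nonzero elements still has
  finite order.\<close>

lemma finite_primes_torsion:
  assumes x: "x \<in> integers A" "x \<notin> v"
  shows "\<exists>n>0. x ^ n - 1 \<in> v"
proof -
  obtain m c where m: "m > 0" "x ^ m = (\<Sum>i<m. of_int (c i) * x ^ i)"
    using int_power_reduction x by (auto simp: integers_def)
  define B where "B = (\<lambda>i. x ^ i) ` {..<m}"
  have B: "finite B" "B \<subseteq> integers A" using x by (auto simp: B_def intro: is_subringD(7)[OF O])
  have xB: "x * b \<in> int_span B" if "b \<in> B" for b
  proof -
    obtain i where i: "i < m" "b = x ^ i" using \<open>b \<in> B\<close> by (auto simp: B_def)
    have base: "x ^ i \<in> int_span B" if "i < m" for i
      using that by (intro int_span_base[OF B(1)]) (auto simp: B_def)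
    show ?thesis
    proof (cases "Suc i < m")
      case True
      then show ?thesis using base[of "Suc i"] i by simp
    next
      case False
      then have "x * b = x ^ m" using i by (metis Suc_lessI power_Suc)
      then show ?thesis unfolding m(2) by (auto intro!: int_span_sum int_span_scale base)
    qed
  qed
  have pow: "x ^ n \<in> int_span B" for n
  proof (induction n)
    case 0
    have "x ^ 0 \<in> B" using m unfolding B_def by blast
    then show ?case using int_span_base[OF B(1)] by simp
  next
    case (Suc n)
    then show ?case using int_span_stable[OF xB, of "x ^ n"] by simp
  qed
  obtain T where T: "finite T" "\<And>y. y \<in> int_span B \<Longrightarrow> \<exists>t\<in>T. y - t \<in> v"
    using int_span_finite_residues[OF B] by blast
  have "\<forall>n. \<exists>t. t \<in> T \<and> x ^ n - t \<in> v" using T(2)[OF pow] by blast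
  then obtain t where t: "\<And>n. t n \<in> T \<and> x ^ n - t n \<in> v" by metis
  \<comment> \<open>Pigeonhole: infinitely many exponents, finitely many residues.\<close>
  have "\<not> inj t" using T(1) t by (meson finite_imageD finite_subset image_subsetI infinite_UNIV_nat)
  then obtain i j where "t i = t j" "i < j" unfolding inj_on_def by (metis linorder_neqE_nat)
  then have "(x ^ j - t j) - (x ^ i - t i) \<in> v" using t finite_primesD(5) by blast
  then have "x ^ j - x ^ i \<in> v" using \<open>t i = t j\<close> by simp
  moreover have "x ^ j - x ^ i = x ^ i * (x ^ (j - i) - 1)"
    using \<open>i < j\<close> by (simp add: algebra_simps power_add[symmetric])
  ultimately have "x ^ i \<in> v \<or> x ^ (j - i) - 1 \<in> v"
    using x by (intro finite_primes_prime) (auto intro!: is_subringD[OF O])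
  then show ?thesis using finite_primes_power x \<open>i < j\<close> by (metis zero_less_diff)
qed

end

text \<open>Zorn's lemma for the ideals that contain \<open>a\<close> but not \<open>1\<close>; the
  multiples of \<open>a\<close> form one of them.\<close>

lemma ideal_proper_maximal:
  assumes R: "is_subring (R :: 'a::comm_ring_1 set)" and a: "a \<in> R" "\<And>b. b \<in> R \<Longrightarrow> b * a \<noteq> 1"
  shows "\<exists>v. maximalideal v (ring_on R) \<and> a \<in> v"
proof -
  define \<C> where "\<C> = {J. ideal J (ring_on R) \<and> a \<in> J \<and> 1 \<notin> J}"
  have "(\<lambda>b. b * a) ` R \<in> \<C>"
    unfolding \<C>_def mem_Collect_eq ideal_ring_on[OF R]
  proof (intro conjI ballI)
    show "0 \<in> (\<lambda>b. b * a) ` R" using is_subringD(2)[OF R] by force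
    show "a \<in> (\<lambda>b. b * a) ` R" using is_subringD(1)[OF R] by force
    show "1 \<notin> (\<lambda>b. b * a) ` R" using a by force
    show "x + y \<in> (\<lambda>b. b * a) ` R" if "x \<in> (\<lambda>b. b * a) ` R" "y \<in> (\<lambda>b. b * a) ` R" for x y
      using that is_subringD(4)[OF R] by (auto simp: distrib_right[symmetric])
    show "c * x \<in> (\<lambda>b. b * a) ` R" if "c \<in> R" "x \<in> (\<lambda>b. b * a) ` R" for c x
      using that is_subringD(5)[OF R] by (auto simp: mult.assoc[symmetric])
  qed (use is_subringD(5)[OF R] a in auto)
  moreover have "\<Union>\<D> \<in> \<C>" if \<D>: "\<D> \<noteq> {}" "subset.chain \<C> \<D>" for \<D>
    unfolding \<C>_def mem_Collect_eq ideal_ring_on[OF R]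
  proof (intro conjI ballI)
    have sub: "\<And>J. J \<in> \<D> \<Longrightarrow> J \<in> \<C>" using \<D> by (auto simp: subset.chain_def)
    then have J: "J \<subseteq> R" "0 \<in> J" "a \<in> J" "1 \<notin> J" "\<And>x y. x \<in> J \<Longrightarrow> y \<in> J \<Longrightarrow> x + y \<in> J"
      "\<And>x c. x \<in> J \<Longrightarrow> c \<in> R \<Longrightarrow> c * x \<in> J" if "J \<in> \<D>" for J
      using that unfolding \<C>_def mem_Collect_eq ideal_ring_on[OF R] by auto
    show "\<Union>\<D> \<subseteq> R" "0 \<in> \<Union>\<D>" "a \<in> \<Union>\<D>" "1 \<notin> \<Union>\<D>" using J \<D>(1) by blast+
    show "c * x \<in> \<Union>\<D>" if "c \<in> R" "x \<in> \<Union>\<D>" for c x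
      using J(6) that by (metis UnionE UnionI)
    show "x + y \<in> \<Union>\<D>" if xy: "x \<in> \<Union>\<D>" "y \<in> \<Union>\<D>" for x y
    proof -
      obtain J L where JL: "J \<in> \<D>" "x \<in> J" "L \<in> \<D>" "y \<in> L" using xy by blast
      then have "J \<subseteq> L \<or> L \<subseteq> J" using \<D>(2) by (auto simp: subset.chain_def)
      then show ?thesis using J(5)[of J x y] J(5)[of L x y] JL by (meson UnionI subsetD)
    qed
  qed
  ultimately obtain M where M: "M \<in> \<C>" "\<And>J. J \<in> \<C> \<Longrightarrow> M \<subseteq> J \<Longrightarrow> J = M"
    using subset_Zorn_nonempty[of \<C>] by blast
  have "maximalideal M (ring_on R)"
  proof (rule maximalidealI)
    show "ideal M (ring_on R)" using M by (simp add: \<C>_def)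
    show "carrier (ring_on R) \<noteq> M" using M is_subringD(1)[OF R] by (auto simp: \<C>_def)
    fix J assume J: "ideal J (ring_on R)" "M \<subseteq> J" "J \<subseteq> carrier (ring_on R)"
    show "J = M \<or> J = carrier (ring_on R)"
    proof (cases "1 \<in> J")
      case True
      then have "R \<subseteq> J" using J(1) unfolding ideal_ring_on[OF R] by (metis mult.right_neutral subsetI)
      then show ?thesis using J by auto
    next
      case False
      then have "J \<in> \<C>" using J M by (auto simp: \<C>_def)
      then show ?thesis using M J by blast
    qed
  qed
  then show ?thesis using M by (auto simp: \<C>_def)
qed

text \<open>An inverse of \<open>p\<close> among the algebraic integers would be rational, hence an
  ordinary integer, which is absurd; so \<open>p\<close> lies in a maximal ideal.\<close>

lemma ex_finite_prime_above:
  assumes A: "is_subring (A :: 'a::field_char_0 set)" and p: "prime (p::nat)"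
  shows "\<exists>v\<in>finite_primes A. of_nat p \<in> v"
proof -
  have "b * of_nat p \<noteq> 1" if "b \<in> integers A" for b
  proof
    assume b: "b * of_nat p = 1"
    then have "b = 1 / of_nat p" using p by (auto simp: field_simps)
    moreover have "algebraic_int b" using that by (simp add: integers_def)
    ultimately have "b \<in> \<int>" by (intro rational_algebraic_int_is_int) auto
    then obtain k where "b = of_int k" by (auto elim: Ints_cases)
    then have "of_int (k * int p) = (of_int 1 :: 'a)" using b by simp
    then have "k * int p = 1" by (simp only: of_int_eq_iff)
    then have "int p dvd 1" by (metis dvd_triv_right)
    then show False using p by auto
  qed
  then obtain v where v: "maximalideal v (ring_on (integers A))" "of_nat p \<in> v"
    using ideal_proper_maximal[OF is_subring_integers[OF A] is_subringD(8)[OF is_subring_integers[OF A]]]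
    by metis
  moreover have "(of_nat p :: 'a) \<noteq> 0" using p by auto
  ultimately show ?thesis by (auto simp: finite_primes_def)
qed

text \<open>By torsion, the inverse of \<open>a\<close> modulo \<open>v\<close> can be chosen as a
  power of \<open>a\<close>, so it does not leave \<open>A\<close>. A rational prime in
  \<open>v\<close> shows that the restriction is nonzero.\<close>

lemma below_finite_primes:
  assumes A: "is_subring A" and v: "v \<in> finite_primes UNIV"
  shows "below A v \<in> finite_primes A"
proof -
  note O = is_subring_integers[OF A] and U = is_subring_UNIV
  note vD = finite_primesD[OF U v]
  have sub: "integers A \<subseteq> integers UNIV" by (auto simp: integers_def)
  have "maximalideal (below A v) (ring_on (integers A))"
    unfolding maximalideal_ring_on[OF O] ideal_ring_on[OF O] below_def
  proof (intro conjI ballI)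
    fix a assume a: "a \<in> integers A - v \<inter> integers A"
    then obtain n where n: "n > 0" "a ^ n - 1 \<in> v"
      using finite_primes_torsion[OF U v, of a] sub by auto
    then have "a * a ^ (n - 1) - 1 \<in> v" by (simp add: power_eq_if)
    moreover have "a ^ (n - 1) \<in> integers A" "a * a ^ (n - 1) - 1 \<in> integers A"
      using a by (auto intro!: is_subringD[OF O])
    ultimately show "\<exists>b\<in>integers A. a * b - 1 \<in> v \<inter> integers A" by blast
  qed (use vD sub in \<open>auto intro: is_subringD[OF O]\<close>)
  moreover obtain p :: nat where p: "prime p" "of_nat p \<in> v" using finite_primes_ex_prime[OF U v] by blast
  then have "of_nat p \<in> below A v" "(of_nat p :: 'a) \<noteq> 0"
    using is_subringD(8)[OF O] by (auto simp: below_def)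
  then have "below A v \<noteq> {0}" by blast
  ultimately show ?thesis by (simp add: finite_primes_def)
qed

section \<open>Number fields\<close>

lemma field_ring_on_UNIV: "Ring.field (ring_on (UNIV :: 'a::Fields.field set))"
proof -
  interpret cring "ring_on (UNIV :: 'a set)" by (rule cring_ring_on[OF is_subring_UNIV])
  show ?thesis
  proof (rule cring_fieldI2)
    fix a :: 'a assume "a \<noteq> \<zero>\<^bsub>ring_on UNIV\<^esub>"
    then show "\<exists>b\<in>carrier (ring_on UNIV). a \<otimes>\<^bsub>ring_on UNIV\<^esub> b = \<one>\<^bsub>ring_on UNIV\<^esub>"
      by (intro bexI[of _ "inverse a"]) auto
  qed auto
qed

lemma subfield_ring_on:
  fixes K :: "'a::Fields.field set"
  assumes "subfield K (ring_on UNIV)"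
  shows "is_subring K" "x \<in> K \<Longrightarrow> inverse x \<in> K"
proof -
  interpret R: Ring.field "ring_on (UNIV :: 'a set)" by (rule field_ring_on_UNIV)
  have sr: "subring K (ring_on UNIV)" using assms by (rule subfieldE)
  have one: "1 \<in> K" and plus: "x \<in> K \<Longrightarrow> y \<in> K \<Longrightarrow> x + y \<in> K"
    and times: "x \<in> K \<Longrightarrow> y \<in> K \<Longrightarrow> x * y \<in> K" for x y
    using subringE(3,6,7)[OF sr] by auto
  have "\<ominus>\<^bsub>ring_on UNIV\<^esub> x = - x" for x :: 'a
    by (rule R.minus_equality) auto
  then have minus: "x \<in> K \<Longrightarrow> - x \<in> K" for x
    using subringE(5)[OF sr] by metis
  show "is_subring K" using one plus times minus by (simp add: is_subring_def)
  show "inverse x \<in> K" if x: "x \<in> K"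
  proof (cases "x = 0")
    case False
    have "inv\<^bsub>ring_on UNIV\<^esub> x = inverse x"
      using False by (intro R.comm_inv_char) auto
    then show ?thesis using R.subfield_m_inv(1)[OF assms, of x] False x by auto
  qed (use x in simp)
qed

lemma subfield_Rats: "subfield \<rat> (ring_on (UNIV :: 'a::field_char_0 set))"
proof -
  interpret R: Ring.field "ring_on (UNIV :: 'a set)" by (rule field_ring_on_UNIV)
  have minus: "\<ominus>\<^bsub>ring_on UNIV\<^esub> x = - x" for x :: 'a
    by (rule R.minus_equality) auto
  show ?thesis
  proof (rule R.subfieldI')
    show "subring \<rat> (ring_on (UNIV :: 'a set))"
      by (rule R.subringI) (auto simp: minus)
    fix k :: 'a assume "k \<in> \<rat> - {\<zero>\<^bsub>ring_on UNIV\<^esub>}"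
    moreover from this have "inv\<^bsub>ring_on UNIV\<^esub> k = inverse k"
      by (intro R.comm_inv_char) auto
    ultimately show "inv\<^bsub>ring_on UNIV\<^esub> k \<in> \<rat>" by auto
  qed
qed

lemma combine_ring_on:
  fixes Ks :: "'a::comm_ring_1 list"
  shows "ring.combine (ring_on UNIV) Ks Us = (\<Sum>i<min (length Ks) (length Us). Ks ! i * Us ! i)"
proof -
  interpret R: cring "ring_on (UNIV :: 'a set)" by (rule cring_ring_on[OF is_subring_UNIV])
  show ?thesis
    by (induction Ks Us rule: R.combine.induct) (auto simp: sum.lessThan_Suc_shift simp del: sum.lessThan_Suc)
qed

lemma ex_common_denominator:
  assumes "finite S" "S \<subseteq> \<rat>"
  shows "\<exists>d::int. d > 0 \<and> (\<forall>r\<in>S. of_int d * (r::'a::field_char_0) \<in> \<int>)"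
  using assms
proof (induction S rule: finite_induct)
  case (insert r S)
  then obtain d :: int where d: "d > 0" "\<And>s. s \<in> S \<Longrightarrow> of_int d * s \<in> \<int>" by auto
  obtain a b :: int where ab: "b > 0" "r = of_int a / of_int b"
    using insert.prems by (auto elim: Rats_cases')
  have "of_int (d * b) * s \<in> \<int>" if "s \<in> insert r S" for s
  proof (cases "s = r")
    case True
    then have "of_int (d * b) * s = of_int (d * a)" using ab by simp
    then show ?thesis by (metis Ints_of_int)
  next
    case False
    then have "of_int d * s \<in> \<int>" using that d(2) by blast
    then have "of_int b * (of_int d * s) \<in> \<int>" by (rule Ints_mult[OF Ints_of_int])
    then show ?thesis by (simp add: mult.commute mult.left_commute)
  qed
  then show ?case using d(1) ab(1) by (intro exI[of _ "d * b"]) auto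
qed (auto intro: exI[of _ 1])

text \<open>Here \<open>n\<close> is the degree of \<open>K\<close> over the rationals; a rational
  relation is multiplied by a common denominator.\<close>

lemma number_field_dependent:
  fixes K :: "'a::field_char_0 set"
  assumes "number_field K"
  shows "\<exists>n. \<forall>e::nat \<Rightarrow> 'a. (\<forall>i\<le>n. e i \<in> K) \<longrightarrow>
           (\<exists>c::nat \<Rightarrow> int. (\<Sum>i\<le>n. of_int (c i) * e i) = 0 \<and> (\<exists>i\<le>n. c i \<noteq> 0))"
proof -
  interpret R: Ring.field "ring_on (UNIV :: 'a set)" by (rule field_ring_on_UNIV)
  obtain n where n: "R.dimension n \<rat> K"
    using assms by (auto simp: number_field_def R.finite_dimension_def)
  have "\<exists>c::nat \<Rightarrow> int. (\<Sum>i\<le>n. of_int (c i) * e i) = 0 \<and> (\<exists>i\<le>n. c i \<noteq> 0)"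
    if e: "\<forall>i\<le>n. e i \<in> K" for e :: "nat \<Rightarrow> 'a"
  proof -
    define Us where "Us = map e [0..<Suc n]"
    have "set Us \<subseteq> K" using e by (auto simp: Us_def simp del: upt_Suc)
    then have "\<not> R.independent \<rat> Us"
      using R.independent_length_le_dimension[OF subfield_Rats n, of Us] by (auto simp: Us_def)
    then obtain Ks where Ks: "set Ks \<subseteq> \<rat>" "R.combine Ks Us = 0"
      "\<not> set (take (length Us) Ks) \<subseteq> {0}"
      using R.trivial_combine_imp_independent[OF subfield_Rats, of Us] by auto
    \<comment> \<open>\<open>R.combine\<close> stops at the shorter of its two lists; the
      coefficients are padded by \<open>0\<close> so that the sum runs over all indices up to
      \<open>n\<close>.\<close>
    define r where "r = (\<lambda>i. if i < length Ks then Ks ! i else 0)"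
    have "(\<Sum>i\<le>n. r i * e i) = (\<Sum>i<min (length Ks) (Suc n). Ks ! i * e i)"
      by (rule sum.mono_neutral_cong_right) (auto simp: r_def)
    also have "\<dots> = (\<Sum>i<min (length Ks) (length Us). Ks ! i * Us ! i)"
      by (intro sum.cong) (auto simp: Us_def simp del: upt_Suc)
    also have "\<dots> = 0" using Ks(2) by (simp add: combine_ring_on)
    finally have sum0: "(\<Sum>i\<le>n. r i * e i) = 0" .
    obtain k where k: "k \<in> set (take (Suc n) Ks)" "k \<noteq> 0" using Ks(3) by (auto simp: Us_def)
    then obtain i where i: "i < Suc n" "i < length Ks" "Ks ! i = k"
      by (auto simp: in_set_conv_nth)
    have "r ` {..n} \<subseteq> \<rat>" using Ks(1) by (auto simp: r_def)
    then obtain d :: int where d: "d > 0" "\<And>i. i \<le> n \<Longrightarrow> of_int d * r i \<in> \<int>"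
      using ex_common_denominator[of "r ` {..n}"] by auto
    have "\<exists>c::nat \<Rightarrow> int. \<forall>i\<le>n. of_int d * r i = of_int (c i)"
      using d(2) by (auto simp: Ints_def image_iff intro!: choice)
    then obtain c :: "nat \<Rightarrow> int" where c: "\<And>i. i \<le> n \<Longrightarrow> of_int d * r i = of_int (c i)" by auto
    have "(\<Sum>i\<le>n. of_int (c i) * e i) = of_int d * (\<Sum>i\<le>n. r i * e i)"
      unfolding sum_distrib_left using c by (intro sum.cong) (auto simp: mult.assoc[symmetric])
    moreover have "c i \<noteq> 0"
      using c[of i] i k d(1) by (auto simp: r_def)
    ultimately show ?thesis using sum0 i by (intro exI[of _ c]) auto
  qed
  then show ?thesis by blast
qed

text \<open>Division by the gcd of the coefficients makes an integer relation nontrivial modulo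
  every prime. The resulting \<open>n\<close> bounds both the residue degrees and the number of
  primes of \<open>K\<close> over \<open>p\<close>.\<close>

lemma number_field_dependent_mod:
  fixes K :: "'a::field_char_0 set"
  assumes "number_field K"
  shows "\<exists>n. \<forall>(e::nat \<Rightarrow> 'a) (p::nat). prime p \<longrightarrow> (\<forall>i\<le>n. e i \<in> K) \<longrightarrow>
           (\<exists>c::nat \<Rightarrow> int. (\<Sum>i\<le>n. of_int (c i) * e i) = 0 \<and> (\<exists>i\<le>n. \<not> int p dvd c i))"
proof -
  obtain n where n: "\<And>e::nat \<Rightarrow> 'a. (\<forall>i\<le>n. e i \<in> K) \<Longrightarrow>
           (\<exists>c::nat \<Rightarrow> int. (\<Sum>i\<le>n. of_int (c i) * e i) = 0 \<and> (\<exists>i\<le>n. c i \<noteq> 0))"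
    using number_field_dependent[OF assms] by blast
  have "\<exists>c::nat \<Rightarrow> int. (\<Sum>i\<le>n. of_int (c i) * e i) = 0 \<and> (\<exists>i\<le>n. \<not> int p dvd c i)"
    if e: "\<forall>i\<le>n. e i \<in> K" and p: "prime p" for e :: "nat \<Rightarrow> 'a" and p :: nat
  proof -
    obtain c :: "nat \<Rightarrow> int" where c: "(\<Sum>i\<le>n. of_int (c i) * e i) = 0" "\<exists>i\<le>n. c i \<noteq> 0"
      using n e by blast
    define g where "g = Gcd (c ` {..n})"
    have g0: "g \<noteq> 0" using c(2) by (auto simp: g_def)
    have gd: "g dvd c i" if "i \<le> n" for i using that by (auto simp: g_def)
    have "0 = (\<Sum>i\<le>n. of_int g * (of_int (c i div g) * e i))"
      unfolding c(1)[symmetric]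
    proof (rule sum.cong)
      fix i assume "i \<in> {..n}"
      then have "c i = g * (c i div g)" using gd by simp
      then show "of_int (c i) * e i = of_int g * (of_int (c i div g) * e i)"
        by (metis mult.assoc of_int_mult)
    qed simp
    also have "\<dots> = of_int g * (\<Sum>i\<le>n. of_int (c i div g) * e i)"
      by (simp add: sum_distrib_left)
    finally have "(\<Sum>i\<le>n. of_int (c i div g) * e i) = 0" using g0 by simp
    moreover have "\<exists>i\<le>n. \<not> int p dvd c i div g"
    proof (rule ccontr)
      assume "\<not> (\<exists>i\<le>n. \<not> int p dvd c i div g)"
      then have "g * int p dvd c i" if "i \<le> n" for i
        using that gd[OF that] g0 by (metis dvd_div_iff_mult mult.commute)
      then have "g * int p dvd g" unfolding g_def by (intro Gcd_greatest) auto
      then have "int p dvd 1" using dvd_times_left_cancel_iff[OF g0, of "int p" 1] by simp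
      then show False using p by simp
    qed
    ultimately show ?thesis by (intro exI[of _ "\<lambda>i. c i div g"]) auto
  qed
  then show ?thesis by (intro exI[of _ n]) blast
qed

text \<open>This makes the closure countable, on which the enumeration of finite pieces of
  automorphisms relies.\<close>

lemma countable_number_field:
  fixes K :: "'a::field_char_0 set"
  assumes "number_field K"
  shows "countable K"
proof -
  interpret R: Ring.field "ring_on (UNIV :: 'a set)" by (rule field_ring_on_UNIV)
  obtain n where n: "R.dimension n \<rat> K"
    using assms by (auto simp: number_field_def R.finite_dimension_def)
  obtain Vs where "set Vs \<subseteq> carrier (ring_on (UNIV :: 'a set))" "R.Span \<rat> Vs = K"
    using R.exists_base[OF subfield_Rats n] by blast
  then have "K = (\<lambda>Ks. R.combine Ks Vs) ` lists \<rat>"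
    using R.Span_eq_combine_set[OF subfield_Rats, of Vs] by auto
  moreover have "countable (lists (\<rat> :: 'a set))"
    by (intro countable_lists) (simp add: Rats_def)
  ultimately show ?thesis by simp
qed

section \<open>Residue fields\<close>

context
  fixes K :: "'a::field_char_0 set" and v :: "'a set" and p :: nat
  assumes nf: "number_field K" and v: "v \<in> finite_primes K" and p: "prime p" "of_nat p \<in> v"
begin

private lemma K_subring: "is_subring K"
  using nf subfield_ring_on by (auto simp: number_field_def)

private lemmas O_K = is_subring_integers[OF K_subring]
private lemmas primeD = finite_primesD[OF K_subring v]
private lemmas v_int = finite_primes_int_iff[OF K_subring v p]

text \<open>Linear independence of the residues of \<open>B\<close> over the field with
  \<open>p\<close> elements, expressed by integer lifts of the coefficients.\<close>

private definition indep where
  "indep B \<longleftrightarrow> (\<forall>c. (\<Sum>b\<in>B. of_int (c b) * b) \<in> v \<longrightarrow> (\<forall>b\<in>B. int p dvd c b))"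

private lemma indep_card:
  "\<exists>n. \<forall>B. finite B \<longrightarrow> B \<subseteq> integers K \<longrightarrow> indep B \<longrightarrow> card B \<le> n"
proof -
  obtain n where n: "\<And>e::nat \<Rightarrow> 'a. (\<forall>i\<le>n. e i \<in> K) \<Longrightarrow>
           (\<exists>c::nat \<Rightarrow> int. (\<Sum>i\<le>n. of_int (c i) * e i) = 0 \<and> (\<exists>i\<le>n. \<not> int p dvd c i))"
    using number_field_dependent_mod[OF nf] p(1) by blast
  have "card B \<le> n" if B: "finite B" "B \<subseteq> integers K" "indep B" for B
  proof (rule ccontr)
    assume "\<not> card B \<le> n"
    then obtain B' where B': "B' \<subseteq> B" "card B' = Suc n" "finite B'"
      using obtain_subset_with_card_n[of "Suc n" B] by auto
    obtain e where e: "bij_betw e {..n} B'"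
      using ex_bij_betw_nat_finite[OF B'(3)] B'(2) by (auto simp: atLeast0LessThan lessThan_Suc_atMost)
    have "\<forall>i\<le>n. e i \<in> K" using e B' B by (auto simp: bij_betw_def integers_def)
    then obtain c :: "nat \<Rightarrow> int" where c: "(\<Sum>i\<le>n. of_int (c i) * e i) = 0" "\<exists>i\<le>n. \<not> int p dvd c i"
      using n by blast
    define d where "d = (\<lambda>b. if b \<in> B' then c (the_inv_into {..n} e b) else 0)"
    have de: "d (e i) = c i" if "i \<le> n" for i
      using e that by (auto simp: d_def bij_betw_def the_inv_into_f_f)
    have "(\<Sum>b\<in>B. of_int (d b) * b) = (\<Sum>b\<in>B'. of_int (d b) * b)"
      by (rule sum.mono_neutral_right) (use B B' in \<open>auto simp: d_def\<close>)
    also have "\<dots> = (\<Sum>i\<le>n. of_int (d (e i)) * e i)"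
      by (rule sum.reindex_bij_betw[OF e, symmetric])
    also have "\<dots> = 0" unfolding c(1)[symmetric] by (intro sum.cong) (auto simp: de)
    finally have "\<forall>b\<in>B. int p dvd d b" using B(3) primeD(2) unfolding indep_def by metis
    moreover have "e i \<in> B" if "i \<le> n" for i using e B' that by (auto simp: bij_betw_def)
    ultimately show False using c(2) de by metis
  qed
  then show ?thesis by blast
qed

text \<open>An independent set of largest cardinality spans. A relation with one more element
  \<open>x\<close> has a coefficient of \<open>x\<close> prime to \<open>p\<close>, since otherwise
  it would reduce to a relation within \<open>B\<close>; by Bezout it can be solved for
  \<open>x\<close> modulo \<open>v\<close>.\<close>

lemma residue_basis:
  obtains B where "finite B" "B \<subseteq> integers K"
    "\<And>c. (\<Sum>b\<in>B. of_int (c b) * b) \<in> v \<Longrightarrow> \<forall>b\<in>B. int p dvd c b"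
    "\<And>x. x \<in> integers K \<Longrightarrow> \<exists>y\<in>int_span B. x - y \<in> v"
proof -
  let ?P = "\<lambda>B. finite B \<and> B \<subseteq> integers K \<and> indep B"
  obtain n where n: "\<And>B. ?P B \<Longrightarrow> card B \<le> n" using indep_card by blast
  have "?P {}" by (simp add: indep_def)
  then obtain B where B: "?P B" "\<And>B'. ?P B' \<Longrightarrow> card B' \<le> card B"
    using ex_has_greatest_nat[of ?P "{}" card "Suc n"] n by (metis le_imp_less_Suc)
  have "\<exists>y\<in>int_span B. x - y \<in> v" if x: "x \<in> integers K" for x
  proof (cases "x \<in> B")
    case True
    then show ?thesis using int_span_base B(1) primeD(2) by (intro bexI[of _ x]) auto
  next
    case False
    then have "\<not> indep (insert x B)" using B(1) B(2)[of "insert x B"] x by auto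
    then obtain c b where c: "(\<Sum>b\<in>insert x B. of_int (c b) * b) \<in> v" "b \<in> insert x B" "\<not> int p dvd c b"
      by (auto simp: indep_def)
    define s where "s = (\<Sum>b\<in>B. of_int (c b) * b)"
    have s: "of_int (c x) * x + s \<in> v" using c(1) False B(1) by (simp add: s_def)
    have "\<not> int p dvd c x"
    proof
      assume dv: "int p dvd c x"
      then have "of_int (c x) * x \<in> v" using primeD(7)[OF x] v_int by simp
      then have "s \<in> v" using primeD(5)[OF s, of "of_int (c x) * x"] by simp
      then have "\<forall>b\<in>B. int p dvd c b" using B(1) by (auto simp: indep_def s_def)
      then show False using c(2,3) dv by auto
    qed
    then have "Rings.coprime (c x) (int p)" using p(1) by (simp add: prime_imp_coprime coprime_commute)
    then obtain a k where "a * c x + k * int p = 1" by (metis bezout_int coprime_imp_gcd_eq_1)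
    then have "of_int a * of_int (c x) + of_int k * of_nat p = (1::'a)"
      by (metis of_int_1 of_int_add of_int_mult of_int_of_nat_eq)
    moreover have "x = (of_int a * of_int (c x) + of_int k * of_nat p) * x" using calculation by simp
    then have "x - of_int (- a) * s = of_int a * (of_int (c x) * x + s) + of_int k * (x * of_nat p)"
      by (simp add: algebra_simps)
    moreover have "\<dots> \<in> v"
      by (intro primeD(3) primeD(6) s p x is_subringD[OF O_K])
    moreover have "of_int (- a) * s \<in> int_span B"
      unfolding s_def by (intro int_span_scale) (auto simp: int_span_def)
    ultimately show ?thesis by (intro bexI[of _ "of_int (- a) * s"]) (simp_all only:)
  qed
  with B(1) that show thesis unfolding indep_def by blast
qed

private abbreviation "Q \<equiv> ring_on (integers K) Quot v"

private lemma coset_eq: 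
  "x \<in> integers K \<Longrightarrow> y \<in> integers K \<Longrightarrow> v +>\<^bsub>ring_on (integers K)\<^esub> x = v +>\<^bsub>ring_on (integers K)\<^esub> y \<longleftrightarrow> x - y \<in> v"
proof -
  have *: "v +>\<^bsub>ring_on (integers K)\<^esub> x = (\<lambda>h. h + x) ` v" for x
    by (auto simp: a_r_coset_def')
  show ?thesis
  proof
    assume "v +>\<^bsub>ring_on (integers K)\<^esub> x = v +>\<^bsub>ring_on (integers K)\<^esub> y"
    moreover have "x \<in> v +>\<^bsub>ring_on (integers K)\<^esub> x" using primeD(2) unfolding * by force
    ultimately show "x - y \<in> v" unfolding * by auto
  next
    assume xy: "x - y \<in> v"
    then have yx: "y - x \<in> v" using primeD(4)[OF xy] by simp
    have "h + x \<in> (\<lambda>h. h + y) ` v" if "h \<in> v" for h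
      by (rule image_eqI[OF _ primeD(3)[OF that xy]]) simp
    moreover have "h + y \<in> (\<lambda>h. h + x) ` v" if "h \<in> v" for h
      by (rule image_eqI[OF _ primeD(3)[OF that yx]]) simp
    ultimately show "v +>\<^bsub>ring_on (integers K)\<^esub> x = v +>\<^bsub>ring_on (integers K)\<^esub> y" unfolding * by blast
  qed
qed

private lemma carrier_Q: "carrier Q = (\<lambda>x. v +>\<^bsub>ring_on (integers K)\<^esub> x) ` integers K"
  by (auto simp: FactRing_def A_RCOSETS_def')

text \<open>The residues are the combinations of a residue basis with coefficients in
  \<open>{0..<p}\<close>. That the cardinality is a power of \<open>p\<close> makes raising to it
  additive modulo \<open>v\<close>; being nonzero, it also shows that the residue field is finite,
  because \<open>card\<close> of an infinite set is \<open>0\<close>.\<close>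

lemma card_residue_field: "\<exists>k. card (carrier (ring_on (integers K) Quot v)) = p ^ k"
proof -
  obtain B where B: "finite B" "B \<subseteq> integers K"
    "\<And>c. (\<Sum>b\<in>B. of_int (c b) * b) \<in> v \<Longrightarrow> \<forall>b\<in>B. int p dvd c b"
    "\<And>x. x \<in> integers K \<Longrightarrow> \<exists>y\<in>int_span B. x - y \<in> v"
    using residue_basis by blast
  define s where "s = (\<lambda>c. \<Sum>b\<in>B. of_int (c b) * b)"
  have sO: "s c \<in> integers K" for c
    unfolding s_def using B(2) by (intro is_subring_sum[OF O_K] is_subringD[OF O_K]) auto
  let ?C = "B \<rightarrow>\<^sub>E {0..<int p}"
  have "bij_betw (\<lambda>c. v +>\<^bsub>ring_on (integers K)\<^esub> s c) ?C (carrier Q)"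
    unfolding bij_betw_def
  proof
    show "inj_on (\<lambda>c. v +>\<^bsub>ring_on (integers K)\<^esub> s c) ?C"
    proof (rule inj_onI)
      fix c d assume cd: "c \<in> ?C" "d \<in> ?C"
        and "v +>\<^bsub>ring_on (integers K)\<^esub> s c = v +>\<^bsub>ring_on (integers K)\<^esub> s d"
      then have "s c - s d \<in> v" using coset_eq sO by simp
      then have "(\<Sum>b\<in>B. of_int (c b - d b) * b) \<in> v" by (simp add: s_def sum_subtractf left_diff_distrib)
      then have "\<forall>b\<in>B. int p dvd c b - d b" by (rule B(3))
      then have "c b = d b" if "b \<in> B" for b
        using that PiE_mem[OF cd(1) that] PiE_mem[OF cd(2) that]
        by (metis atLeastLessThan_iff mod_eq_dvd_iff mod_pos_pos_trivial)
      then show "c = d" using cd by (intro PiE_ext)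
    qed
    show "(\<lambda>c. v +>\<^bsub>ring_on (integers K)\<^esub> s c) ` ?C = carrier Q"
    proof
      show "(\<lambda>c. v +>\<^bsub>ring_on (integers K)\<^esub> s c) ` ?C \<subseteq> carrier Q"
        unfolding carrier_Q using sO by blast
      show "carrier Q \<subseteq> (\<lambda>c. v +>\<^bsub>ring_on (integers K)\<^esub> s c) ` ?C"
        unfolding carrier_Q
      proof
        fix z assume "z \<in> (\<lambda>x. v +>\<^bsub>ring_on (integers K)\<^esub> x) ` integers K"
        then obtain x where x: "x \<in> integers K" "z = v +>\<^bsub>ring_on (integers K)\<^esub> x" by blast
        then obtain c where c: "x - s c \<in> v" using B(4) by (auto simp: int_span_def s_def)
        define d where "d = (\<lambda>b\<in>B. c b mod int p)"
        have "s c - s d = (\<Sum>b\<in>B. b * of_int (c b - d b))"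
          by (simp add: s_def sum_subtractf algebra_simps)
        also have "\<dots> \<in> v"
          using B(2) by (intro finite_primes_sum[OF K_subring v] primeD(6)) (auto simp: v_int d_def simp del: of_int_diff)
        finally have "x - s d \<in> v" using primeD(3)[OF c] by fastforce
        moreover have "d \<in> ?C" using p(1) by (auto simp: d_def prime_gt_0_nat)
        ultimately show "z \<in> (\<lambda>c. v +>\<^bsub>ring_on (integers K)\<^esub> s c) ` ?C"
          using x coset_eq[OF x(1) sO] by blast
      qed
    qed
  qed
  then have "card (carrier Q) = card ?C" by (metis bij_betw_same_card)
  also have "\<dots> = p ^ card B" using B(1) by (simp add: card_PiE)
  finally show ?thesis by blast
qed

lemma card_residue_field_gt_1: "card (carrier (ring_on (integers K) Quot v)) > 1"
proof -
  have fin: "finite (carrier Q)"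
    using card_residue_field p(1) by (metis card.infinite not_prime_0 power_not_zero)
  have "{v +>\<^bsub>ring_on (integers K)\<^esub> 0, v +>\<^bsub>ring_on (integers K)\<^esub> 1} \<subseteq> carrier Q"
    unfolding carrier_Q using is_subringD(1,2)[OF O_K] by blast
  moreover have "v +>\<^bsub>ring_on (integers K)\<^esub> 1 \<noteq> v +>\<^bsub>ring_on (integers K)\<^esub> 0"
    using coset_eq[of 1 0] is_subringD(1,2)[OF O_K] primeD(8) by simp
  then have "card {v +>\<^bsub>ring_on (integers K)\<^esub> 0, v +>\<^bsub>ring_on (integers K)\<^esub> 1} = 2" by simp
  ultimately show ?thesis using card_mono[OF fin] by (metis Suc_1 Suc_le_lessD One_nat_def)
qed

text \<open>Lagrange's theorem in the unit group of the residue field, whose order is one less than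
  the cardinality of the field; elements of \<open>v\<close> are treated separately.\<close>

lemma residue_field_fermat:
  assumes x: "x \<in> integers K"
  shows "x ^ card (carrier (ring_on (integers K) Quot v)) - x \<in> v"
proof (cases "x \<in> v")
  case True
  let ?q = "card (carrier Q)"
  have "x ^ ?q = x ^ (?q - 1) * x" using card_residue_field_gt_1 by (simp add: power_eq_if)
  then have "x ^ ?q - x = (x ^ (?q - 1) - 1) * x" by (simp add: left_diff_distrib)
  then show ?thesis using primeD(6)[OF _ True, of "x ^ (?q - 1) - 1"] x is_subringD(1,6,7)[OF O_K] by metis
next
  case False
  interpret R: cring "ring_on (integers K)" by (rule cring_ring_on[OF O_K])
  interpret I: maximalideal v "ring_on (integers K)" using v by (simp add: finite_primes_def)
  interpret Q: Ring.field Q by (rule I.quotient_is_field[OF R.is_cring])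
  let ?q = "card (carrier Q)"
  let ?c = "\<lambda>x. v +>\<^bsub>ring_on (integers K)\<^esub> x"
  have fin: "finite (carrier Q)"
    using card_residue_field p(1) by (metis card.infinite not_prime_0 power_not_zero)
  have hom: "?c \<in> Ring.ring_hom (ring_on (integers K)) Q" by (rule I.rcos_ring_hom)
  have pow: "?c x [^]\<^bsub>Q\<^esub> n = ?c (x ^ n)" for n :: nat
  proof (induction n)
    case 0
    then show ?case using Ring.ring_hom_one[OF hom] by simp
  next
    case (Suc n)
    then show ?case using Ring.ring_hom_mult[OF hom, of "x ^ n" x] x is_subringD(7)[OF O_K] by (simp add: mult.commute)
  qed
  have "?c x \<noteq> \<zero>\<^bsub>Q\<^esub>"
    using Ring.ring_hom_zero[OF hom R.ring_axioms Q.ring_axioms] coset_eq[OF x is_subringD(2)[OF O_K]] False by simp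
  moreover have "?c x \<in> carrier Q" using x unfolding carrier_Q by blast
  ultimately have cU: "?c x \<in> Units Q" by (simp add: Q.field_Units)
  have ord: "order (units_of Q) = ?q - 1"
    using fin by (simp add: order_def units_of_carrier Q.field_Units card_Diff_singleton)
  have "?c x [^]\<^bsub>units_of Q\<^esub> order (units_of Q) = \<one>\<^bsub>units_of Q\<^esub>"
    using cU by (intro group.pow_order_eq_1 Q.units_group) (simp add: units_of_carrier)
  then have "?c x [^]\<^bsub>Q\<^esub> (?q - 1) = \<one>\<^bsub>Q\<^esub>"
    using Q.units_of_pow[OF cU] by (simp add: ord units_of_one)
  then have "?c (x ^ (?q - 1)) = ?c 1" using Ring.ring_hom_one[OF hom] by (simp add: pow)
  then have "x ^ (?q - 1) - 1 \<in> v"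
    using coset_eq[of "x ^ (?q - 1)" 1] x is_subringD(1,7)[OF O_K] by simp
  then have "x * (x ^ (?q - 1) - 1) \<in> v" by (rule primeD(6)[OF x])
  then show ?thesis using card_residue_field_gt_1 by (simp add: right_diff_distrib power_eq_if)
qed

end

text \<open>Given \<open>n + 1\<close> primes over \<open>p\<close>, choose for each
  \<open>i\<close> an element that lies in all of them except the \<open>i\<close>-th. An integer
  relation between these elements has a coefficient prime to \<open>p\<close>, and modulo the prime
  of that index only this one term survives, which is impossible.\<close>

lemma finite_primes_over_prime:
  assumes nf: "number_field K" and p: "prime (p::nat)"
  shows "finite {v \<in> finite_primes K. of_nat p \<in> v}"
proof (rule ccontr)
  have K: "is_subring K" using nf subfield_ring_on by (auto simp: number_field_def)
  note O = is_subring_integers[OF K]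
  assume inf: "infinite {v \<in> finite_primes K. of_nat p \<in> v}"
  obtain n where n: "\<And>e::nat \<Rightarrow> 'a. (\<forall>i\<le>n. e i \<in> K) \<Longrightarrow>
           (\<exists>c::nat \<Rightarrow> int. (\<Sum>i\<le>n. of_int (c i) * e i) = 0 \<and> (\<exists>i\<le>n. \<not> int p dvd c i))"
    using number_field_dependent_mod[OF nf] p by blast
  obtain P where P: "finite P" "card P = Suc n" "P \<subseteq> {v \<in> finite_primes K. of_nat p \<in> v}"
    using infinite_arbitrarily_large[OF inf] by blast
  obtain w where w: "bij_betw w {..n} P"
    using ex_bij_betw_nat_finite[OF P(1)] P(2) by (auto simp: atLeast0LessThan lessThan_Suc_atMost)
  have wP: "w i \<in> finite_primes K" "of_nat p \<in> w i" if "i \<le> n" for i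
    using w P(3) that by (auto simp: bij_betw_def)
  note wD = finite_primesD[OF K wP(1)]
  have "\<exists>x. x \<in> w j \<and> x \<notin> w i" if ij: "i \<le> n" "j \<le> n" "i \<noteq> j" for i j
  proof (rule ccontr)
    assume "\<not> (\<exists>x. x \<in> w j \<and> x \<notin> w i)"
    then have sub: "w j \<subseteq> w i" by blast
    have "w i \<subseteq> w j"
    proof
      fix x assume x: "x \<in> w i"
      show "x \<in> w j"
      proof (rule ccontr)
        assume "x \<notin> w j"
        then obtain b where b: "b \<in> integers K" "x * b - 1 \<in> w j"
          using wD(9)[OF ij(2), of x] wD(1)[OF ij(1)] x by blast
        then have "x * b \<in> w i" "x * b - 1 \<in> w i" using sub wD(7)[OF ij(1) b(1) x] by auto
        then have "x * b - (x * b - 1) \<in> w i" by (rule wD(5)[OF ij(1)])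
        then show False using wD(8)[OF ij(1)] by simp
      qed
    qed
    then have "w i = w j" using sub by blast
    then show False using w ij by (auto simp: bij_betw_def inj_on_def)
  qed
  then obtain x where x: "\<And>i j. i \<le> n \<Longrightarrow> j \<le> n \<Longrightarrow> i \<noteq> j \<Longrightarrow> x i j \<in> w j \<and> x i j \<notin> w i"
    by metis
  \<comment> \<open>A member of every \<open>w j\<close> with \<open>j \<noteq> i\<close>, but not
    of \<open>w i\<close>, because \<open>w i\<close> is prime and contains no factor.\<close>
  define e where "e = (\<lambda>i. \<Prod>j\<in>{..n} - {i}. x i j)"
  have xO: "x i j \<in> integers K" if "i \<le> n" "j \<le> n" "i \<noteq> j" for i j
    using x[OF that] wD(1)[OF that(2)] by blast
  have eO: "e i \<in> integers K" if "i \<le> n" for i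
    unfolding e_def using that by (intro is_subring_prod[OF O] xO) auto
  have e_in: "e i \<in> w j" if "i \<le> n" "j \<le> n" "i \<noteq> j" for i j
  proof -
    have "e i = x i j * (\<Prod>j\<in>{..n} - {i} - {j}. x i j)"
      unfolding e_def using that by (intro prod.remove) auto
    moreover have "(\<Prod>j\<in>{..n} - {i} - {j}. x i j) \<in> integers K"
      using that by (intro is_subring_prod[OF O] xO) auto
    ultimately show ?thesis using wD(7)[OF that(2)] x[OF that] by simp
  qed
  have e_notin: "e i \<notin> w i" if "i \<le> n" for i
  proof
    assume "e i \<in> w i"
    then have "\<exists>j\<in>{..n} - {i}. x i j \<in> w i"
      unfolding e_def using that xO by (intro finite_primes_prod[OF K wP(1)[OF that]]) auto
    then show False using x that by auto
  qed
  have "\<forall>i\<le>n. e i \<in> K" using eO by (auto simp: integers_def)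
  then obtain c :: "nat \<Rightarrow> int" and i where c: "(\<Sum>i\<le>n. of_int (c i) * e i) = 0" "i \<le> n" "\<not> int p dvd c i"
    using n by blast
  have "(\<Sum>j\<in>{..n} - {i}. of_int (c j) * e j) \<in> w i"
    using c(2) by (intro finite_primes_sum[OF K wP(1)] wD(6) e_in is_subringD(9)[OF O]) auto
  moreover have "0 = of_int (c i) * e i + (\<Sum>j\<in>{..n} - {i}. of_int (c j) * e j)"
    unfolding c(1)[symmetric] using c(2) by (intro sum.remove) auto
  ultimately have "of_int (c i) * e i \<in> w i"
    using wD(4)[OF c(2)] by (metis add.right_inverse add_left_cancel add.commute minus_unique)
  then have "of_int (c i) \<in> w i \<or> e i \<in> w i"
    by (intro finite_primes_prime[OF K wP(1)] c eO is_subringD(9)[OF O])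
  then show False
    using e_notin c finite_primes_int_iff[OF K wP(1)[OF c(2)] p wP(2)[OF c(2)]] by blast
qed

text \<open>The inner binomial coefficients of exponent \<open>p\<close> are divisible by
  \<open>p\<close>; higher powers of \<open>p\<close> follow by iteration.\<close>

lemma freshmans_dream_mod:
  assumes A: "is_subring A" and w: "w \<in> finite_primes A" and p: "prime (p::nat)" "of_nat p \<in> w"
    and x: "x \<in> integers A" and y: "y \<in> integers A"
  shows "(x + y) ^ (p ^ k) - x ^ (p ^ k) - y ^ (p ^ k) \<in> w"
proof -
  note O = is_subring_integers[OF A] and wD = finite_primesD[OF A w]
  have one: "(x + y) ^ p - x ^ p - y ^ p \<in> w" if x: "x \<in> integers A" and y: "y \<in> integers A" for x y
  proof -
    have "{..p} = insert 0 (insert p {1..<p})" using prime_gt_0_nat[OF p(1)] by auto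
    then have "(x + y) ^ p = y ^ p + (x ^ p + (\<Sum>i\<in>{1..<p}. of_nat (p choose i) * x ^ i * y ^ (p - i)))"
      using prime_gt_0_nat[OF p(1)] by (simp add: binomial_ring)
    then have "(x + y) ^ p - x ^ p - y ^ p = (\<Sum>i\<in>{1..<p}. x ^ i * y ^ (p - i) * of_nat (p choose i))"
      by (simp add: mult.commute mult.left_commute)
    also have "\<dots> \<in> w"
    proof (intro finite_primes_sum[OF A w] wD(6))
      fix i assume "i \<in> {1..<p}"
      then have "int p dvd int (p choose i)" using p(1) by (auto intro!: dvd_choose_prime)
      then show "of_nat (p choose i) \<in> w" using finite_primes_int_iff[OF A w p, of "int (p choose i)"] by simp
      show "x ^ i * y ^ (p - i) \<in> integers A" using x y by (intro is_subringD[OF O])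
    qed
    finally show ?thesis .
  qed
  show ?thesis
  proof (induction k)
    case 0
    then show ?case using wD(2) by simp
  next
    case (Suc k)
    \<comment> \<open>\<open>t\<close> is the error of the previous exponent. It lies in
      \<open>w\<close>, and so does its \<open>p\<close>-th power.\<close>
    define X1 Y1 t where "X1 = x ^ (p ^ k)" and "Y1 = y ^ (p ^ k)" and "t = (x + y) ^ (p ^ k) - X1 - Y1"
    have t: "t \<in> w" using Suc by (simp add: t_def X1_def Y1_def)
    have XY: "X1 \<in> integers A" "Y1 \<in> integers A" "X1 + Y1 \<in> integers A" "t \<in> integers A"
      using x y t wD(1) by (auto simp: X1_def Y1_def intro!: is_subringD[OF O])
    have "((X1 + Y1) + t) ^ p - (X1 + Y1) ^ p - t ^ p \<in> w" "(X1 + Y1) ^ p - X1 ^ p - Y1 ^ p \<in> w"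
      using one XY by blast+
    moreover have "t ^ p \<in> w"
      using wD(6)[OF is_subringD(7)[OF O XY(4)] t, of "p - 1"] prime_gt_0_nat[OF p(1)] by (simp add: power_eq_if mult.commute)
    ultimately have "(((X1 + Y1) + t) ^ p - (X1 + Y1) ^ p - t ^ p) + ((X1 + Y1) ^ p - X1 ^ p - Y1 ^ p) + t ^ p \<in> w"
      using wD(3) by blast
    then have "((X1 + Y1) + t) ^ p - X1 ^ p - Y1 ^ p \<in> w" by (simp add: algebra_simps)
    moreover have "(X1 + Y1) + t = (x + y) ^ (p ^ k)" by (simp add: t_def)
    ultimately show ?case by (simp add: X1_def Y1_def power_mult[symmetric] mult.commute)
  qed
qed

section \<open>Extension of homomorphisms\<close>

lemma poly_Poly_append:
  "poly (Poly (xs @ [a])) x = poly (Poly xs) x + x ^ length xs * (a :: 'a::comm_ring_1)"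
  by (induction xs) (auto simp: algebra_simps)

text \<open>HOL-Algebra lists the coefficients from the leading one down, \<open>Poly\<close> from
  the constant one up; hence \<open>rev\<close>.\<close>

lemma eval_ring_on: "ring.eval (ring_on UNIV) l x = poly (Poly (rev l)) (x :: 'a::comm_ring_1)"
proof -
  interpret R: cring "ring_on (UNIV :: 'a set)" by (rule cring_ring_on[OF is_subring_UNIV])
  have pow: "x [^]\<^bsub>ring_on UNIV\<^esub> n = x ^ n" for n :: nat
    by (induction n) (auto simp: mult.commute)
  show ?thesis
    by (induction l) (auto simp: poly_Poly_append pow mult.commute)
qed

definition over_poly :: "'a::zero set \<Rightarrow> 'a poly \<Rightarrow> bool" where
  "over_poly L f \<longleftrightarrow> (\<forall>i. Polynomial.coeff f i \<in> L)"

context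
  fixes K :: "'a::field_char_0 set"
  assumes ac: "algebraic_closure (ring_on UNIV) K"
begin

lemma algebraic_closure_root:
  assumes "Polynomial.degree f > 0"
  shows "\<exists>x::'a. poly f x = 0"
proof -
  interpret algebraic_closure "ring_on (UNIV :: 'a set)" K by (rule ac)
  define l where "l = rev (coeffs f)"
  have f0: "f \<noteq> 0" using assms by auto
  have len: "length l = Suc (Polynomial.degree f)" using f0 by (simp add: l_def length_coeffs)
  have "l \<noteq> []" using len by auto
  then have "hd l \<noteq> 0" using f0 by (simp add: l_def hd_rev last_coeffs_eq_coeff_degree)
  then have l: "l \<in> carrier (poly_ring (ring_on UNIV))"
    by (simp add: univ_poly_def polynomial_def)
  then have "size (roots l) > 0"
    using roots_over_carrier[OF l] assms len by (simp add: splitted_def)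
  then obtain x where "x \<in># roots l" by (metis multiset_nonemptyE nonempty_has_size)
  then have "is_root l x" using roots_mem_iff_is_root[OF l] by simp
  then have "poly (Poly (rev l)) x = 0" by (simp add: is_root_def eval_ring_on)
  then show ?thesis by (auto simp: l_def)
qed

lemma algebraic_closure_algebraic:
  fixes x :: 'a
  obtains f where "f \<noteq> 0" "over_poly K f" "poly f x = 0"
proof -
  interpret algebraic_closure "ring_on (UNIV :: 'a set)" K by (rule ac)
  have sr: "subring K (ring_on UNIV)" using subfieldE(1) subfield_axioms by blast
  obtain p where p: "p \<in> carrier (univ_poly (ring_on UNIV) K)" "p \<noteq> []" "eval p x = \<zero>\<^bsub>ring_on UNIV\<^esub>"
    using algebraicE[OF sr _ algebraic_extension[of x]] by auto
  then have pK: "set p \<subseteq> K" "hd p \<noteq> 0" by (auto simp: univ_poly_def polynomial_def)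
  have "0 \<in> K" using subringE(2)[OF sr] by simp
  moreover have "rev p ! i \<in> K" if "i < length p" for i using nth_mem[of i "rev p"] pK(1) that by auto
  ultimately have "over_poly K (Poly (rev p))"
    by (auto simp: over_poly_def coeff_Poly nth_default_def)
  moreover have "Poly (rev p) \<noteq> 0"
  proof
    assume "Poly (rev p) = 0"
    then have "nth_default 0 (rev p) (length p - 1) = 0" by (metis coeff_Poly coeff_0)
    then show False using p(2) pK by (simp add: nth_default_def rev_nth hd_conv_nth)
  qed
  ultimately show thesis using that p(3) by (simp add: eval_ring_on)
qed

lemma algebraic_closure_subfield: "is_subring K" "x \<in> K \<Longrightarrow> inverse x \<in> K"
proof -
  interpret algebraic_closure "ring_on (UNIV :: 'a set)" K by (rule ac)
  show "is_subring K" "x \<in> K \<Longrightarrow> inverse x \<in> K" using subfield_ring_on subfield_axioms by blast+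
qed

end

lemma over_poly_simps:
  assumes "is_subring L"
  shows "over_poly L f \<Longrightarrow> over_poly L g \<Longrightarrow> over_poly L (f + g)"
    "over_poly L f \<Longrightarrow> over_poly L g \<Longrightarrow> over_poly L (f - g)"
    "over_poly L f \<Longrightarrow> over_poly L g \<Longrightarrow> over_poly L (f * g)"
    "over_poly L [:a:] \<longleftrightarrow> a \<in> L" "over_poly L 0" "a \<in> L \<Longrightarrow> over_poly L (Polynomial.monom a n)"
    "over_poly L f \<Longrightarrow> over_poly L (pderiv f)"
    "over_poly L (pCons a f) \<longleftrightarrow> a \<in> L \<and> over_poly L f"
proof -
  note L = is_subringD[OF assms]
  show "over_poly L (pCons a f) \<longleftrightarrow> a \<in> L \<and> over_poly L f"
    unfolding over_poly_def by (metis coeff_pCons_0 coeff_pCons_Suc not0_implies_Suc)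
  show "over_poly L [:a:] \<longleftrightarrow> a \<in> L"
    using L(2) by (auto simp: over_poly_def coeff_pCons split: nat.splits)
qed (auto simp: over_poly_def coeff_mult coeff_pderiv is_subringD[OF assms]
    intro!: is_subring_sum[OF assms] is_subringD[OF assms])

lemma over_poly_mono: "L \<subseteq> M \<Longrightarrow> over_poly L f \<Longrightarrow> over_poly M f"
  by (auto simp: over_poly_def)

lemma over_poly_value: "is_subring L \<Longrightarrow> over_poly L f \<Longrightarrow> x \<in> L \<Longrightarrow> poly f x \<in> L"
  unfolding poly_altdef by (intro is_subring_sum is_subringD) (auto simp: over_poly_def)

text \<open>The cancellation of \<open>int_poly_multiple\<close>, now over a ring \<open>L\<close>.
  When \<open>c\<close> is invertible, it expresses the inverse of \<open>x\<close> as a polynomial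
  in \<open>x\<close>.\<close>

lemma over_poly_inverse:
  fixes f :: "'a::Fields.field poly"
  assumes L: "is_subring L"
  shows "over_poly L f \<Longrightarrow> f \<noteq> 0 \<Longrightarrow> poly f x = 0 \<Longrightarrow> x \<noteq> 0 \<Longrightarrow>
    \<exists>c g. c \<in> L \<and> c \<noteq> 0 \<and> over_poly L g \<and> c = x * poly g x"
proof (induction f)
  case (pCons a g)
  then have ag: "a \<in> L" "over_poly L g" by (simp_all add: over_poly_simps[OF L])
  show ?case
  proof (cases "a = 0")
    case False
    then show ?thesis
      using pCons.prems ag is_subringD(3)[OF L]
      by (intro exI[of _ "- a"] exI[of _ g]) (auto simp: add_eq_0_iff)
  next
    case True
    then show ?thesis using pCons ag by auto
  qed
qed auto

lemma ex_minimal_degree: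
  fixes f :: "'a::zero poly"
  assumes "\<exists>f. P f"
  obtains m where "P m" "\<And>f. P f \<Longrightarrow> Polynomial.degree m \<le> Polynomial.degree f"
  using assms ex_least_nat_le[of "\<lambda>n. \<exists>f. P f \<and> Polynomial.degree f = n"]
  by (metis arg_min_nat_lemma)

text \<open>Graphs of homomorphisms into the closure that fix \<open>K\<close> and are defined on intermediate rings.\<close>

definition partial_hom :: "'a::comm_ring_1 set \<Rightarrow> ('a \<times> 'a) set \<Rightarrow> bool" where
  "partial_hom K R \<longleftrightarrow> (\<forall>k\<in>K. (k, k) \<in> R) \<and> (\<forall>y. (0, y) \<in> R \<longrightarrow> y = 0) \<and>
     (\<forall>(x, y)\<in>R. (- x, - y) \<in> R \<and> (\<forall>(x', y')\<in>R. (x + x', y + y') \<in> R \<and> (x * x', y * y') \<in> R))"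

lemma partial_homD:
  assumes "partial_hom K R"
  shows "k \<in> K \<Longrightarrow> (k, k) \<in> R" "(0, y) \<in> R \<Longrightarrow> y = 0" "(x, y) \<in> R \<Longrightarrow> (- x, - y) \<in> R"
    "(x, y) \<in> R \<Longrightarrow> (x', y') \<in> R \<Longrightarrow> (x + x', y + y') \<in> R"
    "(x, y) \<in> R \<Longrightarrow> (x', y') \<in> R \<Longrightarrow> (x * x', y * y') \<in> R"
    "(x, y) \<in> R \<Longrightarrow> (x, z) \<in> R \<Longrightarrow> y = z"
proof -
  show "k \<in> K \<Longrightarrow> (k, k) \<in> R" using assms by (auto simp: partial_hom_def)
  show zero: "(0, y) \<in> R \<Longrightarrow> y = 0" for y using assms by (auto simp: partial_hom_def)
  show minus: "(x, y) \<in> R \<Longrightarrow> (- x, - y) \<in> R" for x y using assms by (auto simp: partial_hom_def)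
  show plus: "(x, y) \<in> R \<Longrightarrow> (x', y') \<in> R \<Longrightarrow> (x + x', y + y') \<in> R" for x y x' y'
    using assms by (auto simp: partial_hom_def)
  show "(x, y) \<in> R \<Longrightarrow> (x', y') \<in> R \<Longrightarrow> (x * x', y * y') \<in> R"
    using assms by (auto simp: partial_hom_def)
  \<comment> \<open>Single-valuedness: the condition at \<open>0\<close> is applied to the
    difference of the two pairs.\<close>
  show "(x, y) \<in> R \<Longrightarrow> (x, z) \<in> R \<Longrightarrow> y = z"
    using zero[of "y - z"] plus[OF _ minus, of x y x z] by simp
qed

definition hom_fun :: "('a \<times> 'a) set \<Rightarrow> 'a \<Rightarrow> 'a" where
  "hom_fun R x = (THE y. (x, y) \<in> R)"

context
  fixes K :: "'a::field_char_0 set" and R :: "('a \<times> 'a) set"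
  assumes ac: "algebraic_closure (ring_on UNIV) K" and R: "partial_hom K R"
begin

private lemmas K = algebraic_closure_subfield[OF ac]
private lemmas RD = partial_homD[OF R]

private abbreviation "L \<equiv> Domain R"
private abbreviation "\<tau> \<equiv> hom_fun R"
private abbreviation "tpoly \<equiv> map_poly (hom_fun R)"

lemma hom_fun_eq: "(x, y) \<in> R \<Longrightarrow> \<tau> x = y"
  unfolding hom_fun_def using RD(6) by blast

lemma hom_fun_in: "x \<in> L \<Longrightarrow> (x, \<tau> x) \<in> R"
  using hom_fun_eq by auto

lemma subring_Domain: "is_subring L"
  using RD(1)[OF is_subringD(1)[OF K(1)]] RD(3-5) unfolding is_subring_def by (meson DomainE DomainI)

lemma hom_fun_simps:
  shows "k \<in> K \<Longrightarrow> \<tau> k = k" "\<tau> 0 = 0" "\<tau> 1 = 1"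
    "x \<in> L \<Longrightarrow> y \<in> L \<Longrightarrow> \<tau> (x + y) = \<tau> x + \<tau> y" "x \<in> L \<Longrightarrow> y \<in> L \<Longrightarrow> \<tau> (x * y) = \<tau> x * \<tau> y"
    "x \<in> L \<Longrightarrow> \<tau> (- x) = - \<tau> x"
  using RD(1) is_subringD(1,2)[OF K(1)] by (auto intro!: hom_fun_eq RD(3-5) hom_fun_in)

private lemma sum_in: "(\<And>i. i \<in> A \<Longrightarrow> f i \<in> L) \<Longrightarrow> sum f A \<in> L \<and> \<tau> (sum f A) = (\<Sum>i\<in>A. \<tau> (f i))"
  by (induction A rule: infinite_finite_induct)
    (auto simp: hom_fun_simps is_subringD[OF subring_Domain] simp del: Domain_iff)

private lemma K_sub: "K \<subseteq> L" using RD(1) by blast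

text \<open>Everything is algebraic over \<open>K\<close>, so an inverse is a polynomial in the
  element with coefficients in \<open>K\<close>. Intermediate rings are therefore fields, and the
  extension argument may divide by leading coefficients.\<close>

lemma Domain_inverse: "x \<in> L \<Longrightarrow> inverse x \<in> L"
proof (cases "x = 0")
  case False
  assume x: "x \<in> L"
  obtain f where "f \<noteq> 0" "over_poly K f" "poly f x = 0" using algebraic_closure_algebraic[OF ac] by blast
  then obtain c g where c: "c \<in> K" "c \<noteq> 0" "over_poly K g" "c = x * poly g x"
    using over_poly_inverse[OF K(1)] False by blast
  have "inverse c \<in> L" using K(2) c K_sub by blast
  moreover have "poly g x \<in> L"
    using over_poly_value[OF subring_Domain _ x] over_poly_mono[OF K_sub] c by blast
  ultimately have "inverse c * poly g x \<in> L" using is_subringD(5)[OF subring_Domain] by blast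
  moreover have "inverse c * poly g x = inverse x" using c False by (simp add: field_simps)
  ultimately show ?thesis by simp
qed (use is_subringD(2)[OF subring_Domain] in simp)

lemma hom_fun_nonzero: "x \<in> L \<Longrightarrow> x \<noteq> 0 \<Longrightarrow> \<tau> x \<noteq> 0"
proof
  assume x: "x \<in> L" "x \<noteq> 0" "\<tau> x = 0"
  then have "\<tau> (x * inverse x) = 0" using hom_fun_simps(5)[OF x(1) Domain_inverse[OF x(1)]] by simp
  moreover have "\<tau> (x * inverse x) = 1" using x hom_fun_simps(3) by simp
  ultimately show False by simp
qed

private lemma coeff_tpoly: "Polynomial.coeff (tpoly f) i = \<tau> (Polynomial.coeff f i)"
  by (simp add: coeff_map_poly hom_fun_simps)

private lemma tpoly_simps:
  shows "over_poly L f \<Longrightarrow> over_poly L g \<Longrightarrow> tpoly (f + g) = tpoly f + tpoly g"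
    "over_poly L f \<Longrightarrow> over_poly L g \<Longrightarrow> tpoly (f * g) = tpoly f * tpoly g"
    "over_poly L f \<Longrightarrow> tpoly (- f) = - tpoly f"
proof -
  show "over_poly L f \<Longrightarrow> over_poly L g \<Longrightarrow> tpoly (f + g) = tpoly f + tpoly g"
    by (rule poly_eqI) (simp add: coeff_tpoly over_poly_def hom_fun_simps)
  show "over_poly L f \<Longrightarrow> tpoly (- f) = - tpoly f"
    by (rule poly_eqI) (simp add: coeff_tpoly over_poly_def hom_fun_simps)
  assume fg: "over_poly L f" "over_poly L g"
  show "tpoly (f * g) = tpoly f * tpoly g"
  proof (rule poly_eqI)
    fix n
    have *: "Polynomial.coeff f i \<in> L" "Polynomial.coeff g i \<in> L" for i using fg by (auto simp: over_poly_def)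
    have "\<tau> (\<Sum>i\<le>n. Polynomial.coeff f i * Polynomial.coeff g (n - i)) = (\<Sum>i\<le>n. \<tau> (Polynomial.coeff f i * Polynomial.coeff g (n - i)))"
      using * is_subringD(5)[OF subring_Domain] by (intro sum_in[THEN conjunct2]) blast
    then show "Polynomial.coeff (tpoly (f * g)) n = Polynomial.coeff (tpoly f * tpoly g) n"
      using * by (simp add: coeff_tpoly coeff_mult hom_fun_simps del: Domain_iff)
  qed
qed

text \<open>The extension sends \<open>poly f x\<close> to the value at \<open>y\<close> of the
  transported polynomial. It is well defined once the transport of every \<open>f\<close> that
  vanishes at \<open>x\<close> vanishes at \<open>y\<close>, and this follows by division by the
  polynomial \<open>m\<close> of minimal degree.\<close>

lemma partial_hom_extend:
  assumes m: "m \<noteq> 0" "over_poly L m" "poly m x = 0"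
    and minimal: "\<And>f. f \<noteq> 0 \<Longrightarrow> over_poly L f \<Longrightarrow> poly f x = 0 \<Longrightarrow> Polynomial.degree m \<le> Polynomial.degree f"
    and y: "poly (tpoly m) y = 0"
  shows "\<exists>R'. R \<subseteq> R' \<and> partial_hom K R' \<and> (x, y) \<in> R'"
proof -
  note L = subring_Domain
  have root: "poly (tpoly f) y = 0" if "over_poly L f" "poly f x = 0" for f
    using that
  proof (induction "Polynomial.degree f" arbitrary: f rule: less_induct)
    case less
    show ?case
    proof (cases "f = 0")
      case False
      \<comment> \<open>One division step: \<open>t\<close> is the multiple of \<open>m\<close> with
        the same degree and leading coefficient as \<open>f\<close>, so \<open>f - t\<close> has
        smaller degree or is \<open>0\<close>.\<close>
      define d where "d = Polynomial.degree f - Polynomial.degree m"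
      define c where "c = Polynomial.lead_coeff f * inverse (Polynomial.lead_coeff m)"
      define t where "t = Polynomial.monom c d * m"
      have le: "Polynomial.degree m \<le> Polynomial.degree f" using minimal False less.prems by blast
      have cL: "c \<in> L"
        unfolding c_def using less.prems m Domain_inverse is_subringD(5)[OF L] by (auto simp: over_poly_def simp del: Domain_iff)
      have tL: "over_poly L t" unfolding t_def using cL m by (intro over_poly_simps[OF L])
      have c0: "c \<noteq> 0" using False m by (simp add: c_def)
      have dt1: "Polynomial.degree t = Polynomial.degree f"
        using le m c0 by (simp add: t_def degree_mult_eq degree_monom_eq d_def monom_eq_0_iff)
      have dt2: "Polynomial.lead_coeff t = Polynomial.lead_coeff f"
        unfolding t_def lead_coeff_mult using c0 m by (simp add: degree_monom_eq c_def)
      note dt = dt1 dt2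
      have ty: "poly (tpoly t) y = 0"
        unfolding t_def using cL m y by (simp add: tpoly_simps over_poly_simps[OF L] del: Domain_iff)
      have fL: "over_poly L (f - t)" using less.prems tL by (intro over_poly_simps[OF L])
      have fx: "poly (f - t) x = 0" using less.prems m by (simp add: t_def)
      have "poly (tpoly (f - t)) y = 0"
      proof (cases "f - t = 0")
        case False
        then have "Polynomial.degree (f - t) < Polynomial.degree f"
        proof -
          have "Polynomial.degree (f - t) \<le> Polynomial.degree f" using dt by (metis degree_diff_le order_refl)
          moreover have "Polynomial.coeff (f - t) (Polynomial.degree f) = 0" using dt by simp
          ultimately show ?thesis using False by (metis leading_coeff_0_iff nat_less_le)
        qed
        then show ?thesis using less.hyps fL fx by blast
      qed simp
      moreover have "tpoly ((f - t) + t) = tpoly (f - t) + tpoly t"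
        by (rule tpoly_simps(1)[OF fL tL])
      ultimately show ?thesis using ty by simp
    qed simp
  qed
  define R' where "R' = {(poly f x, poly (tpoly f) y) | f. over_poly L f}"
  have R'I: "over_poly L f \<Longrightarrow> (poly f x, poly (tpoly f) y) \<in> R'" for f unfolding R'_def by blast
  have const: "(a, \<tau> a) \<in> R'" if "a \<in> L" for a
  proof -
    have "tpoly [:a:] = [:\<tau> a:]"
      by (rule poly_eqI) (simp add: coeff_tpoly coeff_pCons hom_fun_simps(2) split: nat.split)
    then show ?thesis
      using R'I[of "[:a:]"] that by (simp add: over_poly_simps[OF L] del: Domain_iff)
  qed
  have "R \<subseteq> R'" using const hom_fun_eq by (metis DomainI subrelI)
  moreover have "partial_hom K R'"
    unfolding partial_hom_def
  proof (intro conjI ballI allI impI)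
    show "(k, k) \<in> R'" if "k \<in> K" for k using const[of k] hom_fun_simps(1) that K_sub by auto
    show "w = 0" if "(0, w) \<in> R'" for w using that root by (auto simp: R'_def)
    fix p assume "p \<in> R'"
    then obtain f where f: "over_poly L f" "p = (poly f x, poly (tpoly f) y)" by (auto simp: R'_def)
    have "over_poly L (- f)" using f(1) is_subringD(3)[OF L] by (simp add: over_poly_def)
    from R'I[OF this] have "(- poly f x, - poly (tpoly f) y) \<in> R'" by (simp add: tpoly_simps f)
    moreover have "(poly f x + x', poly (tpoly f) y + y') \<in> R' \<and> (poly f x * x', poly (tpoly f) y * y') \<in> R'"
      if "(x', y') \<in> R'" for x' y'
    proof -
      obtain g where g: "over_poly L g" "x' = poly g x" "y' = poly (tpoly g) y"
        using \<open>(x', y') \<in> R'\<close> by (auto simp: R'_def)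
      show ?thesis
        using R'I[OF over_poly_simps(1)[OF L f(1) g(1)]] R'I[OF over_poly_simps(3)[OF L f(1) g(1)]]
        by (simp add: tpoly_simps f g)
    qed
    ultimately show "case p of (x, y) \<Rightarrow> (- x, - y) \<in> R' \<and>
        (\<forall>(x', y')\<in>R'. (x + x', y + y') \<in> R' \<and> (x * x', y * y') \<in> R')"
      by (auto simp: f(2))
  qed
  moreover have "(x, y) \<in> R'"
    using R'I[of "[:0, 1:]"] is_subringD(1,2)[OF L]
    by (simp add: over_poly_simps[OF L] map_poly_pCons hom_fun_simps)
  ultimately show ?thesis by blast
qed


lemma poly_hom_fun_root:
  assumes "poly m x = 0" "m \<noteq> 0" "over_poly L m"
  shows "\<exists>y. poly (tpoly m) y = 0"
proof (rule algebraic_closure_root[OF ac])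
  have "Polynomial.degree m \<noteq> 0"
  proof
    assume "Polynomial.degree m = 0"
    then obtain a where "m = [:a:]" by (rule degree_eq_zeroE)
    then show False using assms by simp
  qed
  moreover have "\<tau> (Polynomial.lead_coeff m) \<noteq> 0"
    using assms by (intro hom_fun_nonzero) (auto simp: over_poly_def simp del: Domain_iff)
  then have "Polynomial.coeff (tpoly m) (Polynomial.degree m) \<noteq> 0" by (simp add: coeff_tpoly)
  then have "Polynomial.degree m \<le> Polynomial.degree (tpoly m)" by (rule le_degree)
  ultimately show "Polynomial.degree (tpoly m) > 0" by simp
qed

end

section \<open>The Galois group and the extension of partial homomorphisms to automorphisms\<close>

lemma gal_simps [simp]:
  "\<sigma> \<otimes>\<^bsub>gal K\<^esub> \<tau> = \<sigma> \<circ> \<tau>" "\<one>\<^bsub>gal K\<^esub> = id"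
  by (simp_all add: gal_def)

lemma carrier_gal_iff:
  "\<sigma> \<in> carrier (gal K) \<longleftrightarrow> bij \<sigma> \<and> (\<forall>x y. \<sigma> (x + y) = \<sigma> x + \<sigma> y) \<and> (\<forall>x y. \<sigma> (x * y) = \<sigma> x * \<sigma> y) \<and>
     \<sigma> 1 = 1 \<and> (\<forall>x\<in>K. \<sigma> x = (x :: 'a::field_char_0))"
  by (auto simp: gal_def ring_iso_def Ring.ring_hom_def)

lemma galD:
  assumes "\<sigma> \<in> carrier (gal K)"
  shows "bij \<sigma>" "inj \<sigma>" "\<sigma> (x + y) = \<sigma> x + \<sigma> y" "\<sigma> (x * y) = \<sigma> x * \<sigma> y" "\<sigma> 1 = 1" "\<sigma> 0 = 0"
    "\<sigma> (- x) = - \<sigma> x" "\<sigma> (x - y) = \<sigma> x - \<sigma> y" "\<sigma> (x ^ n) = \<sigma> x ^ n" "x \<in> K \<Longrightarrow> \<sigma> x = x"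
    "\<sigma> (of_int k) = of_int k" "\<sigma> x = \<sigma> y \<longleftrightarrow> x = y"
proof -
  show "bij \<sigma>" and plus: "\<And>x y. \<sigma> (x + y) = \<sigma> x + \<sigma> y" and times: "\<And>x y. \<sigma> (x * y) = \<sigma> x * \<sigma> y"
    and one: "\<sigma> 1 = 1" and "x \<in> K \<Longrightarrow> \<sigma> x = x"
    using assms by (auto simp: carrier_gal_iff)
  then show inj: "inj \<sigma>" by (simp add: bij_is_inj)
  then show "\<sigma> x = \<sigma> y \<longleftrightarrow> x = y" by (simp add: inj_eq)
  show zero: "\<sigma> 0 = 0" using plus[of 0 0] by simp
  show minus: "\<sigma> (- x) = - \<sigma> x" for x using plus[of x "- x"] zero by (simp add: minus_unique)
  show "\<sigma> (x - y) = \<sigma> x - \<sigma> y" using plus[of x "- y"] minus by simp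
  show "\<sigma> (x ^ n) = \<sigma> x ^ n" by (induction n) (auto simp: one times)
  have nat: "\<sigma> (of_nat n) = of_nat n" for n by (induction n) (auto simp: one zero plus)
  show "\<sigma> (of_int k) = of_int k" by (cases k rule: int_cases2) (auto simp: nat minus)
qed

lemma gal_sum: "\<sigma> \<in> carrier (gal K) \<Longrightarrow> \<sigma> (sum f A) = (\<Sum>i\<in>A. \<sigma> (f i))"
  by (induction A rule: infinite_finite_induct) (auto simp: galD)

lemma gal_poly: "\<sigma> \<in> carrier (gal K) \<Longrightarrow> over_poly K f \<Longrightarrow> \<sigma> (poly f x) = poly f (\<sigma> x)"
  unfolding poly_altdef by (auto simp: gal_sum galD over_poly_def)

lemma gal_group: "Group.group (gal K)"
proof (rule groupI)
  fix \<sigma> assume s: "\<sigma> \<in> carrier (gal K)"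
  then have b: "bij \<sigma>" by (rule galD)
  have inv: "\<sigma> (inv_into UNIV \<sigma> x) = x" "inv_into UNIV \<sigma> (\<sigma> x) = x" for x using b by (simp_all add: bij_is_surj surj_f_inv_f bij_is_inj)
  have "inv_into UNIV \<sigma> \<in> carrier (gal K)"
    unfolding carrier_gal_iff
  proof (intro conjI allI ballI)
    show "bij (inv_into UNIV \<sigma>)" using b by (rule bij_imp_bij_inv)
    show "inv_into UNIV \<sigma> (x + y) = inv_into UNIV \<sigma> x + inv_into UNIV \<sigma> y" for x y using galD(12)[OF s] galD(3)[OF s] inv by metis
    show "inv_into UNIV \<sigma> (x * y) = inv_into UNIV \<sigma> x * inv_into UNIV \<sigma> y" for x y using galD(12)[OF s] galD(4)[OF s] inv by metis
    show "inv_into UNIV \<sigma> 1 = 1" using galD(5)[OF s] inv by metis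
    show "inv_into UNIV \<sigma> x = x" if "x \<in> K" for x using galD(10)[OF s that] inv by metis
  qed
  then show "\<exists>\<tau>\<in>carrier (gal K). \<tau> \<otimes>\<^bsub>gal K\<^esub> \<sigma> = \<one>\<^bsub>gal K\<^esub>"
    by (rule bexI[rotated]) (simp add: fun_eq_iff inv)
qed (auto simp: carrier_gal_iff bij_comp comp_assoc)

lemma gal_m_inv:
  assumes "\<sigma> \<in> carrier (gal K)"
  shows "inv\<^bsub>gal K\<^esub> \<sigma> = inv_into UNIV \<sigma>" "inv_into UNIV \<sigma> \<in> carrier (gal K)" "\<sigma> (inv_into UNIV \<sigma> x) = x" "inv_into UNIV \<sigma> (\<sigma> x) = x"
proof -
  interpret Group.group "gal K" by (rule gal_group)
  have "inv\<^bsub>gal K\<^esub> \<sigma> \<circ> \<sigma> = id" "\<sigma> \<circ> inv\<^bsub>gal K\<^esub> \<sigma> = id"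
    using l_inv[OF assms] r_inv[OF assms] by simp_all
  then show e: "inv\<^bsub>gal K\<^esub> \<sigma> = inv_into UNIV \<sigma>" by (metis inv_unique_comp)
  show "inv_into UNIV \<sigma> \<in> carrier (gal K)" using inv_closed[OF assms] e by simp
  show "\<sigma> (inv_into UNIV \<sigma> x) = x" "inv_into UNIV \<sigma> (\<sigma> x) = x"
    using galD(1)[OF assms] by (simp_all add: bij_is_surj surj_f_inv_f bij_is_inj)
qed

context
  fixes K :: "'a::field_char_0 set"
  assumes ac: "algebraic_closure (ring_on UNIV) K"
begin

private lemmas Kf = algebraic_closure_subfield[OF ac]

text \<open>A field homomorphism is injective, and over \<open>K\<close> it maps the finite root set
  of each polynomial to itself; hence it permutes the roots, and every element is such a
  root.\<close>

lemma injective_hom_gal: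
  assumes plus: "\<And>x y. \<sigma> (x + y) = \<sigma> x + \<sigma> y" and times: "\<And>x y. \<sigma> (x * y) = \<sigma> x * \<sigma> y"
    and fxd: "\<And>x. x \<in> K \<Longrightarrow> \<sigma> x = x"
  shows "\<sigma> \<in> carrier (gal K)"
proof -
  have zero: "\<sigma> 0 = 0" and one: "\<sigma> 1 = 1" using fxd is_subringD(1,2)[OF Kf(1)] by auto
  have minus: "\<sigma> (- x) = - \<sigma> x" for x using plus[of x "- x"] zero by (simp add: minus_unique)
  have nz: "\<sigma> x \<noteq> 0" if "x \<noteq> 0" for x
    using times[of x "inverse x"] that one by auto
  have inj: "inj \<sigma>"
  proof (rule injI)
    fix x y assume "\<sigma> x = \<sigma> y"
    then have "\<sigma> (x - y) = 0" using plus[of x "- y"] minus by simp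
    then have "x - y = 0" using nz by blast
    then show "x = y" by simp
  qed
  have "surj \<sigma>"
    unfolding surj_def
  proof
    fix y
    obtain f where f: "f \<noteq> 0" "over_poly K f" "poly f y = 0" using algebraic_closure_algebraic[OF ac] by blast
    have sum: "\<sigma> (sum g A) = (\<Sum>i\<in>A. \<sigma> (g i))" for g :: "nat \<Rightarrow> 'a" and A
      by (induction A rule: infinite_finite_induct) (auto simp: zero plus)
    have pow: "\<sigma> (x ^ n) = \<sigma> x ^ n" for x n by (induction n) (auto simp: one times)
    have pf: "\<sigma> (poly f x) = poly f (\<sigma> x)" for x
      unfolding poly_altdef using f(2) by (simp add: sum times pow fxd over_poly_def)
    let ?S = "{x. poly f x = 0}"
    have "finite ?S" using f(1) by (rule poly_roots_finite)
    moreover have "\<sigma> ` ?S \<subseteq> ?S" using pf zero by (metis (mono_tags, lifting) image_subsetI mem_Collect_eq)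
    moreover have "inj_on \<sigma> ?S" using inj by (rule inj_on_subset) simp
    ultimately have "\<sigma> ` ?S = ?S" by (rule endo_inj_surj)
    then show "\<exists>x. y = \<sigma> x" using f(3) by (metis (mono_tags, lifting) imageE mem_Collect_eq)
  qed
  then show ?thesis using inj plus times one fxd by (auto simp: carrier_gal_iff bij_def)
qed

lemma partial_hom_Union:
  assumes "C \<noteq> {}" "\<And>R. R \<in> C \<Longrightarrow> partial_hom K R" "\<And>R S. R \<in> C \<Longrightarrow> S \<in> C \<Longrightarrow> R \<subseteq> S \<or> S \<subseteq> R"
  shows "partial_hom K (\<Union>C)"
proof -
  have D: "k \<in> K \<Longrightarrow> (k, k) \<in> R" "(0, y) \<in> R \<Longrightarrow> y = 0" "(x, y) \<in> R \<Longrightarrow> (- x, - y) \<in> R"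
    "(x, y) \<in> R \<Longrightarrow> (x', y') \<in> R \<Longrightarrow> (x + x', y + y') \<in> R"
    "(x, y) \<in> R \<Longrightarrow> (x', y') \<in> R \<Longrightarrow> (x * x', y * y') \<in> R" if "R \<in> C" for R x y x' y' k
    by (fact partial_homD(1-5)[OF assms(2)[OF that]])+
  have both: "\<exists>R\<in>C. p \<in> R \<and> q \<in> R" if "p \<in> \<Union>C" "q \<in> \<Union>C" for p q
    using that assms(3) by (meson UnionE subsetD)
  show ?thesis
    unfolding partial_hom_def
  proof (intro conjI ballI allI impI)
    show "(k, k) \<in> \<Union>C" if "k \<in> K" for k using assms(1) D(1) that by blast
    show "w = 0" if "(0, w) \<in> \<Union>C" for w using that D(2) by blast
    fix p assume p: "p \<in> \<Union>C"
    obtain x y where xy: "p = (x, y)" by fastforce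
    have "(- x, - y) \<in> \<Union>C" using p xy D(3) by blast
    moreover have "(x + x', y + y') \<in> \<Union>C \<and> (x * x', y * y') \<in> \<Union>C" if q: "(x', y') \<in> \<Union>C" for x' y'
      using both[OF p q] xy D(4,5) by blast
    ultimately show "case p of (x, y) \<Rightarrow> (- x, - y) \<in> \<Union>C \<and>
        (\<forall>(x', y')\<in>\<Union>C. (x + x', y + y') \<in> \<Union>C \<and> (x * x', y * y') \<in> \<Union>C)"
      using xy by auto
  qed
qed

lemma minimal_over_poly:
  assumes "is_subring L" "K \<subseteq> L"
  obtains m where "m \<noteq> 0" "over_poly L m" "poly m x = (0::'a)"
    "\<And>f. f \<noteq> 0 \<Longrightarrow> over_poly L f \<Longrightarrow> poly f x = 0 \<Longrightarrow> Polynomial.degree m \<le> Polynomial.degree f"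
proof -
  obtain f where "f \<noteq> 0" "over_poly K f" "poly f x = 0" using algebraic_closure_algebraic[OF ac] by blast
  then have "\<exists>f. f \<noteq> 0 \<and> over_poly L f \<and> poly f x = 0" using over_poly_mono[OF assms(2)] by blast
  from ex_minimal_degree[OF this] that show thesis by metis
qed

text \<open>Zorn's lemma: a maximal extension is defined everywhere, because the closure contains a
  root of each transported minimal polynomial and so one more element can always be
  adjoined.\<close>

lemma partial_hom_extends:
  assumes "partial_hom K R"
  shows "\<exists>\<sigma>\<in>carrier (gal K). \<forall>(x, y)\<in>R. \<sigma> x = y"
proof -
  define \<C> where "\<C> = {S. R \<subseteq> S \<and> partial_hom K S}"
  have "\<C> \<noteq> {}" using assms by (auto simp: \<C>_def)
  moreover have "\<Union>C \<in> \<C>" if C: "C \<noteq> {}" "subset.chain \<C> C" for C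
  proof -
    have "C \<subseteq> \<C>" "\<And>S T. S \<in> C \<Longrightarrow> T \<in> C \<Longrightarrow> S \<subseteq> T \<or> T \<subseteq> S" using C(2) by (auto simp: subset.chain_def)
    then have "partial_hom K (\<Union>C)" using partial_hom_Union[OF C(1)] unfolding \<C>_def by blast
    moreover have "R \<subseteq> \<Union>C" using C(1) \<open>C \<subseteq> \<C>\<close> by (fastforce simp: \<C>_def)
    ultimately show ?thesis by (simp add: \<C>_def)
  qed
  ultimately obtain M where M: "M \<in> \<C>" "\<And>S. S \<in> \<C> \<Longrightarrow> M \<subseteq> S \<Longrightarrow> S = M"
    using subset_Zorn_nonempty[of \<C>] by blast
  then have ph: "partial_hom K M" by (simp add: \<C>_def)
  have dom: "x \<in> Domain M" for x
  proof -
    have L: "is_subring (Domain M)" by (rule subring_Domain[OF ac ph])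
    have "K \<subseteq> Domain M" using partial_homD(1)[OF ph] by blast
    then obtain m where m: "m \<noteq> 0" "over_poly (Domain M) m" "poly m x = 0"
      "\<And>f. f \<noteq> 0 \<Longrightarrow> over_poly (Domain M) f \<Longrightarrow> poly f x = 0 \<Longrightarrow> Polynomial.degree m \<le> Polynomial.degree f"
      using minimal_over_poly[OF L] by blast
    obtain y where "poly (map_poly (hom_fun M) m) y = 0" using poly_hom_fun_root[OF ac ph m(3,1,2)] by blast
    then obtain S where S: "M \<subseteq> S" "partial_hom K S" "(x, y) \<in> S"
      using partial_hom_extend[OF ac ph m] by blast
    then have "S \<in> \<C>" using M(1) by (auto simp: \<C>_def)
    then have "S = M" using M(2) S(1) by blast
    then show ?thesis using S(3) by blast
  qed
  have "hom_fun M \<in> carrier (gal K)"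
    using dom by (intro injective_hom_gal) (auto intro: hom_fun_simps[OF ac ph])
  moreover have "\<forall>(x, y)\<in>R. hom_fun M x = y"
    using M hom_fun_eq[OF ac ph] by (auto simp: \<C>_def)
  ultimately show ?thesis by blast
qed

text \<open>In characteristic \<open>0\<close> the derivative of the minimal polynomial does not
  vanish at \<open>x\<close>, so \<open>x\<close> is a simple root. As \<open>x\<close> is not in
  \<open>K\<close>, the degree exceeds \<open>1\<close> and there is a second root \<open>y\<close>;
  the homomorphism that takes \<open>x\<close> to \<open>y\<close> extends to an
  automorphism.\<close>

lemma fixed_field:
  assumes "x \<notin> K"
  shows "\<exists>\<sigma>\<in>carrier (gal K). \<sigma> x \<noteq> x"
proof -
  define R where "R = {(k, k) | k. k \<in> K}"
  have ph: "partial_hom K R"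
    unfolding partial_hom_def R_def by (auto intro: is_subringD[OF Kf(1)])
  have dR: "Domain R = K" by (auto simp: R_def)
  obtain m where m: "m \<noteq> 0" "over_poly K m" "poly m x = 0"
    and min: "\<And>f. f \<noteq> 0 \<Longrightarrow> over_poly K f \<Longrightarrow> poly f x = 0 \<Longrightarrow> Polynomial.degree m \<le> Polynomial.degree f"
    using minimal_over_poly[OF Kf(1)] by blast
  have deg: "Polynomial.degree m \<noteq> 0"
  proof
    assume "Polynomial.degree m = 0"
    then obtain a where "m = [:a:]" by (rule degree_eq_zeroE)
    then show False using m by simp
  qed
  have d: "poly (pderiv m) x \<noteq> 0"
  proof
    assume "poly (pderiv m) x = 0"
    moreover have "pderiv m \<noteq> 0" using deg by (simp add: pderiv_eq_0_iff)
    moreover have "over_poly K (pderiv m)" using m(2) by (rule over_poly_simps[OF Kf(1)])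
    ultimately have "Polynomial.degree m \<le> Polynomial.degree (pderiv m)" using min by blast
    then show False using deg by (simp add: degree_pderiv)
  qed
  obtain s where s: "m = [:- x, 1:] * s" using m(3) by (metis poly_eq_0_iff_dvd dvdE)
  have sx: "poly s x \<noteq> 0" using d unfolding s pderiv_mult by (simp add: pderiv_pCons)
  have "Polynomial.degree s \<noteq> 0"
  proof
    assume "Polynomial.degree s = 0"
    then obtain a where a: "s = [:a:]" by (rule degree_eq_zeroE)
    then have "m = [:- x * a, a:]" by (simp add: s)
    then have "a \<in> K" "- x * a \<in> K" using m(2) by (simp_all add: over_poly_simps[OF Kf(1)])
    then have "- (- x * a * inverse a) \<in> K" using Kf(2) is_subringD(3,5)[OF Kf(1)] by blast
    moreover have "- (- x * a * inverse a) = x" using sx a by (simp add: mult.assoc)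
    ultimately show False using assms by metis
  qed
  then obtain y where y: "poly s y = 0" using algebraic_closure_root[OF ac] by blast
  then have "y \<noteq> x" using sx by auto
  have "map_poly (hom_fun R) m = m"
  proof (rule poly_eqI)
    fix n
    have "hom_fun R (Polynomial.coeff m n) = Polynomial.coeff m n"
      using m(2) by (intro hom_fun_simps(1)[OF ac ph]) (simp add: over_poly_def)
    then show "Polynomial.coeff (map_poly (hom_fun R) m) n = Polynomial.coeff m n"
      by (simp add: coeff_map_poly hom_fun_simps(2)[OF ac ph])
  qed
  then have "poly (map_poly (hom_fun R) m) y = 0" using y by (simp add: s)
  then obtain S where S: "partial_hom K S" "(x, y) \<in> S"
    using partial_hom_extend[OF ac ph, of m x y] m min unfolding dR by blast
  obtain \<sigma> where s: "\<sigma> \<in> carrier (gal K)" "\<forall>(x, y)\<in>S. \<sigma> x = y"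
    using partial_hom_extends[OF S(1)] by blast
  then have "\<sigma> x = y" using S(2) by auto
  with s(1) show ?thesis using \<open>y \<noteq> x\<close> by blast
qed

end

section \<open>The Krull topology\<close>

lemma openin_fun_discrete:
  "openin (product_topology (\<lambda>_::'a. discrete_topology (UNIV::'b set)) UNIV) U \<longleftrightarrow>
     (\<forall>f\<in>U. \<exists>B. finite B \<and> (\<forall>g. (\<forall>b\<in>B. g b = f b) \<longrightarrow> g \<in> U))"
  unfolding openin_product_topology_alt
proof (intro ball_cong refl iffI)
  fix f
  assume "\<exists>V. finite {i \<in> UNIV. V i \<noteq> topspace (discrete_topology (UNIV::'b set))} \<and>
       (\<forall>i\<in>UNIV. openin (discrete_topology UNIV) (V i)) \<and> f \<in> Pi\<^sub>E UNIV V \<and> Pi\<^sub>E UNIV V \<subseteq> U"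
  then obtain V where V: "finite {i. V i \<noteq> (UNIV::'b set)}" "f \<in> Pi\<^sub>E UNIV V" "Pi\<^sub>E UNIV V \<subseteq> U" by auto
  have "g \<in> U" if "\<forall>b\<in>{i. V i \<noteq> UNIV}. g b = f b" for g
  proof -
    have "g i \<in> V i" for i using that V(2) by (cases "V i = UNIV") (auto simp: PiE_iff)
    then show ?thesis using V(3) by auto
  qed
  then show "\<exists>B. finite B \<and> (\<forall>g. (\<forall>b\<in>B. g b = f b) \<longrightarrow> g \<in> U)" using V(1) by blast
next
  fix f
  assume "\<exists>B. finite B \<and> (\<forall>g. (\<forall>b\<in>B. g b = f b) \<longrightarrow> g \<in> U)"
  then obtain B where B: "finite B" "\<And>g. (\<forall>b\<in>B. g b = f b) \<Longrightarrow> g \<in> U" by blast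
  define V where "V = (\<lambda>i. if i \<in> B then {f i} else UNIV)"
  have "finite {i \<in> UNIV. V i \<noteq> topspace (discrete_topology (UNIV::'b set))}"
    by (rule finite_subset[OF _ B(1)]) (auto simp: V_def)
  moreover have "Pi\<^sub>E UNIV V \<subseteq> U"
  proof
    fix g assume "g \<in> Pi\<^sub>E UNIV V"
    then have "g i \<in> V i" for i by auto
    then have "g b = f b" if "b \<in> B" for b using that by (metis V_def singletonD)
    then show "g \<in> U" using B(2) by blast
  qed
  moreover have "f \<in> Pi\<^sub>E UNIV V" by (auto simp: V_def)
  ultimately show "\<exists>V. finite {i \<in> UNIV. V i \<noteq> topspace (discrete_topology (UNIV::'b set))} \<and>
       (\<forall>i\<in>UNIV. openin (discrete_topology UNIV) (V i)) \<and> f \<in> Pi\<^sub>E UNIV V \<and> Pi\<^sub>E UNIV V \<subseteq> U"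
    by (intro exI[of _ V]) auto
qed

lemma topo_gal:
  "topo (gal K) = subtopology (product_topology (\<lambda>_. discrete_topology UNIV) UNIV) (carrier (gal K))"
  by (simp add: gal_def)

lemma topspace_gal [simp]: "topspace (topo (gal K)) = carrier (gal K)"
  by (simp add: topo_gal)

lemma openin_sub_fun_discrete:
  "openin (subtopology (product_topology (\<lambda>_::'a. discrete_topology (UNIV::'b set)) UNIV) S) U \<longleftrightarrow>
     U \<subseteq> S \<and> (\<forall>\<sigma>\<in>U. \<exists>B. finite B \<and> (\<forall>\<tau>\<in>S. (\<forall>b\<in>B. \<tau> b = \<sigma> b) \<longrightarrow> \<tau> \<in> U))"
    (is "_ \<longleftrightarrow> ?R")
proof
  assume "openin (subtopology (product_topology (\<lambda>_::'a. discrete_topology (UNIV::'b set)) UNIV) S) U"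
  then obtain V where V: "U = V \<inter> S"
    "openin (product_topology (\<lambda>_::'a. discrete_topology (UNIV::'b set)) UNIV) V"
    by (auto simp: openin_subtopology)
  show ?R
  proof (intro conjI ballI)
    fix \<sigma> assume "\<sigma> \<in> U"
    then obtain B where "finite B" "\<And>g. (\<forall>b\<in>B. g b = \<sigma> b) \<Longrightarrow> g \<in> V"
      using V unfolding openin_fun_discrete by blast
    then show "\<exists>B. finite B \<and> (\<forall>\<tau>\<in>S. (\<forall>b\<in>B. \<tau> b = \<sigma> b) \<longrightarrow> \<tau> \<in> U)"
      using V(1) by blast
  qed (use V in auto)
next
  assume R: ?R
  define V where "V = {g. \<exists>\<sigma>\<in>U. \<exists>B. finite B \<and> (\<forall>\<tau>\<in>S. (\<forall>b\<in>B. \<tau> b = \<sigma> b) \<longrightarrow> \<tau> \<in> U) \<and> (\<forall>b\<in>B. g b = \<sigma> b)}"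
  have "openin (product_topology (\<lambda>_::'a. discrete_topology (UNIV::'b set)) UNIV) V"
    unfolding openin_fun_discrete
  proof
    fix f assume "f \<in> V"
    then obtain \<sigma> B where "\<sigma> \<in> U" "finite B" "\<forall>\<tau>\<in>S. (\<forall>b\<in>B. \<tau> b = \<sigma> b) \<longrightarrow> \<tau> \<in> U" "\<forall>b\<in>B. f b = \<sigma> b"
      unfolding V_def by blast
    then have "\<forall>g. (\<forall>b\<in>B. g b = f b) \<longrightarrow> g \<in> V" unfolding V_def by force
    then show "\<exists>B. finite B \<and> (\<forall>g. (\<forall>b\<in>B. g b = f b) \<longrightarrow> g \<in> V)" using \<open>finite B\<close> by blast
  qed
  moreover have "U = V \<inter> S"
  proof
    show "V \<inter> S \<subseteq> U" by (auto simp: V_def)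
    show "U \<subseteq> V \<inter> S"
    proof
      fix \<sigma> assume "\<sigma> \<in> U"
      then show "\<sigma> \<in> V \<inter> S" using R unfolding V_def by blast
    qed
  qed
  ultimately show "openin (subtopology (product_topology (\<lambda>_::'a. discrete_topology (UNIV::'b set)) UNIV) S) U"
    by (auto simp: openin_subtopology)
qed

lemma openin_gal:
  "openin (topo (gal K)) U \<longleftrightarrow> U \<subseteq> carrier (gal K) \<and>
     (\<forall>\<sigma>\<in>U. \<exists>B. finite B \<and> (\<forall>\<tau>\<in>carrier (gal K). (\<forall>b\<in>B. \<tau> b = \<sigma> b) \<longrightarrow> \<tau> \<in> U))"
  unfolding topo_gal by (rule openin_sub_fun_discrete)

lemma openin_gal_subtopology:
  assumes "S \<subseteq> carrier (gal K)"
  shows "openin (subtopology (topo (gal K)) S) U \<longleftrightarrow> U \<subseteq> S \<and>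
     (\<forall>\<sigma>\<in>U. \<exists>B. finite B \<and> (\<forall>\<tau>\<in>S. (\<forall>b\<in>B. \<tau> b = \<sigma> b) \<longrightarrow> \<tau> \<in> U))"
  using assms unfolding topo_gal subtopology_subtopology
  by (simp add: openin_sub_fun_discrete Int_absorb1)

text \<open>Each value \<open>\<sigma> x\<close> is one of finitely many roots, so the group lies in
  a product of finite sets, which is compact, and it is closed there.\<close>

lemma compact_gal:
  fixes K :: "'a::field_char_0 set"
  assumes ac: "algebraic_closure (ring_on UNIV) K"
  shows "compact_space (topo (gal K))"
proof -
  let ?T = "product_topology (\<lambda>_::'a. discrete_topology (UNIV::'a set)) UNIV"
  have "\<forall>x::'a. \<exists>f. f \<noteq> 0 \<and> over_poly K f \<and> poly f x = 0" using algebraic_closure_algebraic[OF ac] by metis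
  then obtain f where f: "\<And>x. f x \<noteq> 0 \<and> over_poly K (f x) \<and> poly (f x) (x::'a) = 0" by metis
  define S where "S x = {y. poly (f x) y = 0}" for x
  have "finite (S x)" for x unfolding S_def using f by (intro poly_roots_finite) blast
  then have "compactin ?T (Pi\<^sub>E UNIV S)"
    unfolding compactin_PiE by (simp add: compactin_discrete_topology)
  moreover have "carrier (gal K) \<subseteq> Pi\<^sub>E UNIV S"
  proof
    fix \<sigma> assume s: "\<sigma> \<in> carrier (gal K)"
    have "poly (f x) (\<sigma> x) = 0" for x
      using gal_poly[OF s, of "f x" x] f[of x] galD(6)[OF s] by simp
    then have "\<sigma> x \<in> S x" for x by (simp add: S_def)
    then show "\<sigma> \<in> Pi\<^sub>E UNIV S" by auto
  qed
  moreover have "closedin ?T (carrier (gal K))"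
    unfolding closedin_def openin_fun_discrete
  proof (intro conjI ballI)
    fix g assume "g \<in> topspace ?T - carrier (gal K)"
    \<comment> \<open>By \<open>injective_hom_gal\<close> a map outside the group violates
      additivity, multiplicativity or the fixing of \<open>K\<close>, and each violation is visible
      on finitely many arguments.\<close>
    then obtain x y k where "g (x + y) \<noteq> g x + g y \<or> g (x * y) \<noteq> g x * g y \<or> (k \<in> K \<and> g k \<noteq> k)"
      using injective_hom_gal[OF ac, of g] by blast
    then have "\<forall>h. (\<forall>b\<in>{x, y, k, x + y, x * y}. h b = g b) \<longrightarrow> h \<in> topspace ?T - carrier (gal K)"
      using galD(3,4,10) by fastforce
    then show "\<exists>B. finite B \<and> (\<forall>h. (\<forall>b\<in>B. h b = g b) \<longrightarrow> h \<in> topspace ?T - carrier (gal K))"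
      by (intro exI[of _ "{x, y, k, x + y, x * y}"]) simp
  qed simp
  ultimately have "compactin ?T (carrier (gal K))" by (rule closed_compactin)
  then show ?thesis by (simp add: topo_gal compact_space_subtopology)
qed

lemma is_subring_over_poly:
  fixes L :: "'a::idom set"
  assumes L: "is_subring L"
  shows "is_subring {f. over_poly L f}"
  unfolding is_subring_def[of "{f. over_poly L f}"]
proof (intro conjI ballI)
  show "1 \<in> {f. over_poly L f}" using over_poly_simps(4)[OF L, of 1] is_subringD(1)[OF L] by (simp add: one_pCons)
  show "- f \<in> {f. over_poly L f}" if "f \<in> {f. over_poly L f}" for f
    using that is_subringD(3)[OF L] by (simp add: over_poly_def)
qed (auto intro: over_poly_simps[OF L])

lemma gal_integers_iff:
  assumes "\<sigma> \<in> carrier (gal K)"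
  shows "\<sigma> x \<in> integers UNIV \<longleftrightarrow> x \<in> integers UNIV"
proof -
  have *: "algebraic_int (\<sigma> x)" if "algebraic_int x" "\<sigma> \<in> carrier (gal K)" for x \<sigma>
  proof -
    obtain p where p: "poly (map_poly of_int p) x = 0" "Polynomial.lead_coeff p = 1"
      using \<open>algebraic_int x\<close> by (auto simp: algebraic_int_altdef_ipoly)
    have "poly (map_poly of_int p) (\<sigma> x) = \<sigma> (poly (map_poly of_int p) x)"
      by (simp add: poly_altdef coeff_map_poly galD[OF that(2)] gal_sum[OF that(2)])
    then show ?thesis using p galD(6)[OF that(2)] by (auto simp: algebraic_int_altdef_ipoly)
  qed
  show ?thesis
    using *[of x \<sigma>] *[of "\<sigma> x" "inv_into UNIV \<sigma>"] gal_m_inv[OF assms] assms by (auto simp: integers_def)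
qed

lemma gal_finite_primes:
  assumes s: "\<sigma> \<in> carrier (gal K)" and v: "v \<in> finite_primes (UNIV :: 'a::field_char_0 set)"
  shows "\<sigma> ` v \<in> finite_primes UNIV"
proof -
  note U = is_subring_UNIV and O = is_subring_integers[OF is_subring_UNIV]
  note vD = finite_primesD[OF U v]
  have v': "maximalideal v (ring_on (integers (UNIV :: 'a set)))" "v \<noteq> {0}"
    using v by (auto simp: finite_primes_def)
  have "maximalideal (\<sigma> ` v) (ring_on (integers (UNIV :: 'a set)))"
    unfolding maximalideal_ring_on[OF O] ideal_ring_on[OF O]
  proof (intro conjI ballI)
    show "\<sigma> ` v \<subseteq> integers UNIV" using vD(1) gal_integers_iff[OF s] by blast
    show "0 \<in> \<sigma> ` v" using vD(2) galD(6)[OF s] by (metis imageI)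
    show "x + y \<in> \<sigma> ` v" if "x \<in> \<sigma> ` v" "y \<in> \<sigma> ` v" for x y
      using that vD(3) by (auto simp: galD(3)[OF s, symmetric])
    show "1 \<notin> \<sigma> ` v" using vD(8) galD(5,12)[OF s] by (metis imageE)
    show "a * x \<in> \<sigma> ` v" if a: "a \<in> integers UNIV" and x: "x \<in> \<sigma> ` v" for a x
    proof -
      obtain b where b: "a = \<sigma> b" using galD(1)[OF s] by (metis bij_pointE)
      then have "b \<in> integers UNIV" using a gal_integers_iff[OF s] by simp
      then show ?thesis using x vD(6) by (auto simp: b galD(4)[OF s, symmetric])
    qed
    fix a assume a: "a \<in> integers UNIV - \<sigma> ` v"
    obtain b where b: "a = \<sigma> b" using galD(1)[OF s] by (metis bij_pointE)
    then have "b \<in> integers UNIV" "b \<notin> v" using a gal_integers_iff[OF s] by auto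
    then obtain c where "c \<in> integers UNIV" "b * c - 1 \<in> v" using vD(9) by blast
    then have "\<sigma> c \<in> integers UNIV" "\<sigma> (b * c - 1) \<in> \<sigma> ` v" using gal_integers_iff[OF s] by auto
    then show "\<exists>b\<in>integers UNIV. a * b - 1 \<in> \<sigma> ` v" by (auto simp: b galD[OF s])
  qed
  moreover have "\<sigma> ` v \<noteq> {0}"
  proof
    assume "\<sigma> ` v = {0}"
    then have "x = 0" if "x \<in> v" for x using that galD(6,12)[OF s] by (metis imageI singletonD)
    then show False using v' vD(2) by blast
  qed
  ultimately show ?thesis by (simp add: finite_primes_def)
qed

section \<open>Frobenius lifts\<close>

definition resq :: "'a::field_char_0 set \<Rightarrow> 'a set \<Rightarrow> nat" where
  "resq K v = card (carrier (ring_on (integers K) Quot below K v))"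

context
  fixes K :: "'a::field_char_0 set" and v :: "'a set"
  assumes nf: "number_field K" and ac: "algebraic_closure (ring_on UNIV) K"
    and v: "v \<in> finite_primes UNIV"
begin

private lemmas Kc = algebraic_closure_subfield[OF ac]
private abbreviation "\<O> \<equiv> integers (UNIV :: 'a set)"
private lemmas U = is_subring_UNIV[where 'a='a]
private lemmas O_closure = is_subring_integers[OF is_subring_UNIV[where 'a='a]]
private lemmas v_primeD = finite_primesD[OF U v]
private abbreviation "q \<equiv> resq K v"

lemma below_properties:
  obtains p k where "prime p" "of_nat p \<in> v" "q = p ^ k" "q > 1"
    "\<And>x. x \<in> integers K \<Longrightarrow> x ^ q - x \<in> v"
proof -
  have b: "below K v \<in> finite_primes K" by (rule below_finite_primes[OF Kc(1) v])
  obtain p :: nat where p: "prime p" "of_nat p \<in> below K v" using finite_primes_ex_prime[OF Kc(1) b] by blast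
  obtain k where "q = p ^ k" using card_residue_field[OF nf b p] by (auto simp: resq_def)
  moreover have "q > 1" using card_residue_field_gt_1[OF nf b p] by (simp add: resq_def)
  moreover have "x ^ q - x \<in> v" if "x \<in> integers K" for x
    using residue_field_fermat[OF nf b p that] by (simp add: resq_def below_def)
  moreover have "of_nat p \<in> v" using p by (simp add: below_def)
  ultimately show thesis using that p(1) by blast
qed

lemma resq_gt_1: "q > 1" using below_properties by metis

lemma resq_fermat: "x \<in> integers K \<Longrightarrow> x ^ q - x \<in> v" using below_properties by metis

lemma frob_power_add:
  assumes "x \<in> \<O>" "y \<in> \<O>"
  shows "(x + y) ^ q - x ^ q - y ^ q \<in> v"
  using below_properties freshmans_dream_mod[OF U v _ _ assms] by metis

lemma frob_power_sum:
  assumes "\<And>i. i \<in> S \<Longrightarrow> f i \<in> \<O>"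
  shows "(\<Sum>i\<in>S. f i) ^ q - (\<Sum>i\<in>S. f i ^ q) \<in> v"
  using assms
proof (induction S rule: infinite_finite_induct)
  case (insert i S)
  have "(f i + sum f S) ^ q - f i ^ q - sum f S ^ q \<in> v"
    using insert.prems by (intro frob_power_add is_subring_sum[OF O_closure]) auto
  moreover have "(\<Sum>i\<in>S. f i) ^ q - (\<Sum>i\<in>S. f i ^ q) \<in> v" using insert by auto
  ultimately have "((f i + sum f S) ^ q - f i ^ q - sum f S ^ q) + ((\<Sum>i\<in>S. f i) ^ q - (\<Sum>i\<in>S. f i ^ q)) \<in> v"
    by (rule v_primeD(3))
  then show ?case using insert.hyps by (simp add: algebra_simps)
qed (use resq_gt_1 v_primeD(2) in \<open>auto simp: power_0_left\<close>)

section \<open>Polynomials over the integers, modulo those with coefficients in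
  \<open>v\<close>\<close>

private abbreviation "OT \<equiv> {f. over_poly \<O> f}"
private abbreviation "vT \<equiv> {f. over_poly v f}"

private lemmas OT = is_subring_over_poly[OF O_closure]

private lemma vT:
  shows "0 \<in> vT" "f \<in> vT \<Longrightarrow> g \<in> vT \<Longrightarrow> f + g \<in> vT" "f \<in> vT \<Longrightarrow> g \<in> vT \<Longrightarrow> f - g \<in> vT"
    "f \<in> OT \<Longrightarrow> g \<in> vT \<Longrightarrow> f * g \<in> vT" "f \<in> vT \<Longrightarrow> - f \<in> vT"
  by (auto simp: over_poly_def coeff_mult intro!: v_primeD(2-6) finite_primes_sum[OF U v])

private lemma vT_sum: "(\<And>i. i \<in> S \<Longrightarrow> f i \<in> vT) \<Longrightarrow> sum f S \<in> vT"
  by (induction S rule: infinite_finite_induct) (use vT in auto)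

text \<open>Gauss's argument: if \<open>i\<close> and \<open>j\<close> are the first indices with
  coefficients outside \<open>v\<close>, then in the coefficient of index \<open>i + j\<close>
  exactly one term lies outside \<open>v\<close>.\<close>

private lemma vT_prime:
  assumes f: "f \<in> OT" "f \<notin> vT" and g: "g \<in> OT" "g \<notin> vT"
  shows "f * g \<notin> vT"
proof -
  have "\<exists>i. Polynomial.coeff f i \<notin> v" "\<exists>j. Polynomial.coeff g j \<notin> v"
    using f(2) g(2) by (auto simp: over_poly_def)
  then obtain i j where "Polynomial.coeff f i \<notin> v \<and> (\<forall>k<i. \<not> Polynomial.coeff f k \<notin> v)"
    "Polynomial.coeff g j \<notin> v \<and> (\<forall>k<j. \<not> Polynomial.coeff g k \<notin> v)"
    using exists_least_iff[of "\<lambda>i. Polynomial.coeff f i \<notin> v"] exists_least_iff[of "\<lambda>i. Polynomial.coeff g i \<notin> v"] by blast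
  then have i: "Polynomial.coeff f i \<notin> v" "\<And>k. k < i \<Longrightarrow> Polynomial.coeff f k \<in> v"
    and j: "Polynomial.coeff g j \<notin> v" "\<And>k. k < j \<Longrightarrow> Polynomial.coeff g k \<in> v"
    by blast+
  have c: "Polynomial.coeff f k \<in> \<O>" "Polynomial.coeff g k \<in> \<O>" for k
    using f(1) g(1) by (auto simp: over_poly_def)
  let ?t = "\<lambda>k. Polynomial.coeff f k * Polynomial.coeff g (i + j - k)"
  have "?t k \<in> v" if "k \<in> {..i + j} - {i}" for k
  proof (cases "k < i")
    case True
    then show ?thesis using i(2) c v_primeD(7) by blast
  next
    case False
    then have "i + j - k < j" using that by auto
    then show ?thesis using j(2) c v_primeD(6) by blast
  qed
  then have "(\<Sum>k\<in>{..i + j} - {i}. ?t k) \<in> v" by (rule finite_primes_sum[OF U v])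
  moreover have "Polynomial.coeff (f * g) (i + j) = ?t i + (\<Sum>k\<in>{..i + j} - {i}. ?t k)"
    unfolding coeff_mult by (rule sum.remove) auto
  moreover have "?t i \<notin> v" using finite_primes_prime[OF U v c(1)[of i] c(2)[of j]] i(1) j(1) by auto
  ultimately have "Polynomial.coeff (f * g) (i + j) \<notin> v"
    using v_primeD(5) by (metis add_diff_cancel_right')
  then show ?thesis by (auto simp: over_poly_def)
qed

private lemma vT_prod:
  "finite S \<Longrightarrow> (\<And>i. i \<in> S \<Longrightarrow> f i \<in> OT) \<Longrightarrow> prod f S \<in> vT \<Longrightarrow> \<exists>i\<in>S. f i \<in> vT"
proof (induction S rule: finite_induct)
  case empty
  then have "Polynomial.coeff (1 :: 'a poly) 0 \<in> v" by (simp only: prod.empty mem_Collect_eq over_poly_def)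
  then show ?case using v_primeD(8) by simp
next
  case (insert i S)
  then have "f i \<in> OT" "prod f S \<in> OT" "f i * prod f S \<in> vT"
    using is_subring_prod[OF OT, of S f] by auto
  then have "f i \<in> vT \<or> prod f S \<in> vT" using vT_prime by blast
  then show ?case using insert by auto
qed

text \<open>The Frobenius acts on the coefficients while the variable stays fixed. Modulo
  \<open>vT\<close> this is a ring homomorphism that fixes the polynomials over the integers of
  \<open>K\<close>.\<close>

private definition fr :: "'a poly \<Rightarrow> 'a poly" where "fr f = map_poly (\<lambda>x. x ^ q) f"

private lemma coeff_fr: "Polynomial.coeff (fr f) i = Polynomial.coeff f i ^ q"
  using resq_gt_1 by (simp add: fr_def coeff_map_poly)

private lemma fr_OT: "f \<in> OT \<Longrightarrow> fr f \<in> OT"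
  by (auto simp: over_poly_def coeff_fr intro: is_subringD(7)[OF O_closure])

private lemma fr_sum: "(\<And>i. i \<in> S \<Longrightarrow> f i \<in> OT) \<Longrightarrow> fr (sum f S) - (\<Sum>i\<in>S. fr (f i)) \<in> vT"
  by (auto simp: over_poly_def coeff_fr coeff_sum intro!: frob_power_sum)

private lemma fr_mult: "f \<in> OT \<Longrightarrow> g \<in> OT \<Longrightarrow> fr (f * g) - fr f * fr g \<in> vT"
proof -
  assume fg: "f \<in> OT" "g \<in> OT"
  have "(\<Sum>i\<le>n. Polynomial.coeff f i * Polynomial.coeff g (n - i)) ^ q -
      (\<Sum>i\<le>n. (Polynomial.coeff f i * Polynomial.coeff g (n - i)) ^ q) \<in> v" for n
    using fg by (intro frob_power_sum is_subringD(5)[OF O_closure]) (auto simp: over_poly_def)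
  then show ?thesis by (simp add: over_poly_def coeff_fr coeff_mult power_mult_distrib)
qed

private lemma fr_power: "f \<in> OT \<Longrightarrow> fr (f ^ n) - fr f ^ n \<in> vT"
proof (induction n)
  case 0
  have "fr 1 = 1" by (rule poly_eqI) (use resq_gt_1 in \<open>auto simp: coeff_fr coeff_1\<close>)
  then show ?case using vT(1) by simp
next
  case (Suc n)
  have "fr (f * f ^ n) - fr f * fr (f ^ n) \<in> vT"
    by (intro fr_mult Suc.prems is_subringD(7)[OF OT])
  moreover have "fr f * (fr (f ^ n) - fr f ^ n) \<in> vT"
    by (intro vT(4) fr_OT Suc)
  ultimately have "(fr (f * f ^ n) - fr f * fr (f ^ n)) + fr f * (fr (f ^ n) - fr f ^ n) \<in> vT" by (rule vT)
  then show ?case by (simp add: algebra_simps)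
qed

text \<open>Modulo \<open>vT\<close>, \<open>fr\<close> commutes with the evaluation of
  \<open>P\<close>, whose coefficients it fixes; so it takes roots of \<open>P\<close> to roots of
  \<open>P\<close> modulo \<open>vT\<close>.\<close>

private lemma fr_poly:
  assumes P: "\<And>j. Polynomial.coeff P j \<in> {f. over_poly (integers K) f}" and f: "f \<in> OT" and zero: "poly P f = 0"
  shows "poly P (fr f) \<in> vT"
proof -
  let ?c = "Polynomial.coeff P" and ?n = "Polynomial.degree P"
  have sub: "integers K \<subseteq> \<O>" by (auto simp: integers_def)
  have cO: "?c j \<in> OT" for j using P[of j] over_poly_mono[OF sub] by blast
  have cv: "fr (?c j) - ?c j \<in> vT" for j
    using P[of j] by (auto simp: over_poly_def coeff_fr resq_fermat)
  have fO: "f ^ j \<in> OT" "fr f ^ j \<in> OT" for j using is_subringD(7)[OF OT] f fr_OT[OF f] by blast+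
  have cf: "fr (?c j * f ^ j) - ?c j * fr f ^ j \<in> vT" for j
  proof -
    have "fr (?c j * f ^ j) - fr (?c j) * fr (f ^ j) \<in> vT" by (rule fr_mult[OF cO fO(1)])
    moreover have "fr (?c j) * (fr (f ^ j) - fr f ^ j) \<in> vT" by (intro vT(4) fr_OT cO fr_power f)
    moreover have "fr f ^ j * (fr (?c j) - ?c j) \<in> vT" by (intro vT(4) fO cv)
    ultimately have "(fr (?c j * f ^ j) - fr (?c j) * fr (f ^ j)) + fr (?c j) * (fr (f ^ j) - fr f ^ j)
        + fr f ^ j * (fr (?c j) - ?c j) \<in> vT" by (intro vT(2))
    then show ?thesis by (simp add: algebra_simps)
  qed
  have "fr (\<Sum>j\<le>?n. ?c j * f ^ j) - (\<Sum>j\<le>?n. fr (?c j * f ^ j)) \<in> vT"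
    using is_subringD(5)[OF OT] cO fO(1) by (intro fr_sum) blast
  moreover have "(\<Sum>j\<le>?n. fr (?c j * f ^ j) - ?c j * fr f ^ j) \<in> vT" by (intro vT_sum cf)
  ultimately have "(fr (\<Sum>j\<le>?n. ?c j * f ^ j) - (\<Sum>j\<le>?n. fr (?c j * f ^ j)))
     + (\<Sum>j\<le>?n. fr (?c j * f ^ j) - ?c j * fr f ^ j) \<in> vT" by (rule vT(2))
  then have "fr (poly P f) - poly P (fr f) \<in> vT" by (simp add: poly_altdef sum_subtractf)
  moreover have "fr 0 = 0" using resq_gt_1 by (simp add: fr_def)
  ultimately show ?thesis using zero vT(5)[of "- poly P (fr f)"] by simp
qed

text \<open>An auxiliary variable turns the elements of \<open>A\<close> into the coefficients of
  one polynomial \<open>\<theta> id\<close>, whose conjugates are the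
  \<open>\<theta> \<sigma>\<close>. \<open>P\<close> has exactly these as roots and has its
  coefficients over \<open>K\<close>, so \<open>fr (\<theta> id)\<close> is a root modulo
  \<open>vT\<close>. As \<open>vT\<close> is prime, it agrees with some
  \<open>\<theta> \<sigma>\<close> modulo \<open>vT\<close>, and this \<open>\<sigma>\<close> serves
  all of \<open>A\<close> at once.\<close>

lemma frob_finite_level:
  assumes A: "finite A" "A \<subseteq> \<O>"
  shows "\<exists>\<sigma>\<in>carrier (gal K). \<forall>a\<in>A. \<sigma> a - a ^ q \<in> v"
proof -
  let ?G = "carrier (gal K)"
  obtain as where as: "set as = A" using finite_list[OF A(1)] by blast
  define \<theta> where "\<theta> \<sigma> = Poly (map \<sigma> as)" for \<sigma> :: "'a \<Rightarrow> 'a"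
  define B where "B = \<theta> ` ?G"
  have coeff_\<theta>: "Polynomial.coeff (\<theta> \<sigma>) i = (if i < length as then \<sigma> (as ! i) else 0)" for \<sigma> i
    by (simp add: \<theta>_def coeff_Poly nth_default_def)
  interpret G: Group.group "gal K" by (rule gal_group)
  have id: "id \<in> ?G" using G.one_closed by simp
  have \<theta>O: "\<theta> \<sigma> \<in> OT" if "\<sigma> \<in> ?G" for \<sigma>
  proof -
    have "as ! i \<in> \<O>" if "i < length as" for i using that as A(2) nth_mem by blast
    then show ?thesis
      using gal_integers_iff[OF that] is_subringD(2)[OF O_closure] by (simp add: over_poly_def coeff_\<theta>)
  qed
  have finB: "finite B"
  proof -
    have "\<forall>x::'a. \<exists>f. f \<noteq> 0 \<and> over_poly K f \<and> poly f x = 0" using algebraic_closure_algebraic[OF ac] by metis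
    then obtain f where f: "\<And>x. f x \<noteq> 0 \<and> over_poly K (f x) \<and> poly (f x) (x::'a) = 0" by metis
    define S where "S = (\<Union>x\<in>A. {y. poly (f x) y = 0})"
    have "finite S" unfolding S_def using f A by (intro finite_UN_I poly_roots_finite) auto
    moreover have "B \<subseteq> Poly ` {xs. set xs \<subseteq> S \<and> length xs = length as}"
      unfolding B_def
    proof
      fix b assume "b \<in> \<theta> ` ?G"
      then obtain \<sigma> where s: "\<sigma> \<in> ?G" "b = Poly (map \<sigma> as)" by (auto simp: \<theta>_def)
      have "poly (f x) (\<sigma> x) = 0" for x
        using gal_poly[OF s(1), of "f x" x] f[of x] galD(6)[OF s(1)] by simp
      then have "set (map \<sigma> as) \<subseteq> S" using as by (auto simp: S_def)
      then show "b \<in> Poly ` {xs. set xs \<subseteq> S \<and> length xs = length as}" using s by auto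
    qed
    moreover have "finite (Poly ` {xs. set xs \<subseteq> S \<and> length xs = length as})"
      using \<open>finite S\<close> by (intro finite_imageI finite_lists_length_eq)
    ultimately show ?thesis using finite_subset by blast
  qed
  define P where "P = (\<Prod>b\<in>B. [:- b, 1:])"
  have PO: "Polynomial.coeff (Polynomial.coeff P j) k \<in> \<O>" for j k
  proof -
    have "P \<in> {F. over_poly OT F}"
      unfolding P_def
    proof (rule is_subring_prod[OF is_subring_over_poly[OF OT]])
      fix b assume "b \<in> B"
      then have "- b \<in> OT" using \<theta>O is_subringD(3)[OF OT] by (auto simp: B_def)
      then show "[:- b, 1:] \<in> {F. over_poly OT F}"
        using is_subringD(1,2)[OF OT] by (auto simp: over_poly_simps[OF OT])
    qed
    then show ?thesis by (simp add: over_poly_def)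
  qed
  \<comment> \<open>Automorphisms permute the factors of \<open>P\<close>; by
    \<open>fixed_field\<close> its inner coefficients then lie in \<open>K\<close>.\<close>
  have fixed: "\<sigma> (Polynomial.coeff (Polynomial.coeff P j) k) = Polynomial.coeff (Polynomial.coeff P j) k"
    if s: "\<sigma> \<in> ?G" for \<sigma> j k
  proof -
    interpret comm_ring_hom \<sigma> by unfold_locales (simp_all add: galD[OF s])
    interpret m1: map_poly_comm_ring_hom \<sigma> ..
    interpret m2: map_poly_comm_ring_hom "map_poly \<sigma>" ..
    have st: "map_poly \<sigma> (\<theta> \<tau>) = \<theta> (\<sigma> \<circ> \<tau>)" for \<tau>
      by (rule poly_eqI) (simp add: coeff_map_poly coeff_\<theta> galD(6)[OF s])
    have inj: "inj_on (map_poly \<sigma>) B"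
    proof (rule inj_onI)
      fix b c assume "map_poly \<sigma> b = map_poly \<sigma> c"
      then have "Polynomial.coeff (map_poly \<sigma> b) i = Polynomial.coeff (map_poly \<sigma> c) i" for i by simp
      then show "b = c" by (intro poly_eqI) (simp add: coeff_map_poly galD(6,12)[OF s])
    qed
    moreover have sub: "map_poly \<sigma> ` B \<subseteq> B"
      using G.m_closed[OF s] by (auto simp: B_def st)
    ultimately have bij: "bij_betw (map_poly \<sigma>) B B"
      using endo_inj_surj[OF finB] by (simp add: bij_betw_def)
    have "map_poly (map_poly \<sigma>) P = (\<Prod>b\<in>B. map_poly (map_poly \<sigma>) [:- b, 1:])"
      unfolding P_def by (rule m2.hom_prod)
    also have "\<dots> = (\<Prod>b\<in>B. [:- map_poly \<sigma> b, 1:])"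
      by (intro prod.cong refl) (simp add: m1.hom_uminus)
    also have "\<dots> = P" unfolding P_def by (rule prod.reindex_bij_betw[OF bij])
    finally have "Polynomial.coeff (Polynomial.coeff (map_poly (map_poly \<sigma>) P) j) k = Polynomial.coeff (Polynomial.coeff P j) k"
      by simp
    then show ?thesis by (simp add: coeff_map_poly galD(6)[OF s])
  qed
  have PK: "Polynomial.coeff P j \<in> {f. over_poly (integers K) f}" for j
  proof -
    have "Polynomial.coeff (Polynomial.coeff P j) k \<in> K" for k using fixed fixed_field[OF ac] by metis
    then show ?thesis using PO by (simp add: over_poly_def integers_def)
  qed
  have Pval: "poly P z = (\<Prod>b\<in>B. z - b)" for z by (simp add: P_def poly_prod)
  have "poly P (\<theta> id) = 0"
    unfolding Pval using finB id by (intro prod_zero) (auto simp: B_def)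
  then have "poly P (fr (\<theta> id)) \<in> vT" by (rule fr_poly[OF PK \<theta>O[OF id]])
  then have "\<exists>b\<in>B. fr (\<theta> id) - b \<in> vT"
    unfolding Pval using \<theta>O
    by (intro vT_prod finB is_subringD(6)[OF OT] fr_OT[OF \<theta>O[OF id]]) (auto simp: B_def)
  then obtain \<sigma> where s: "\<sigma> \<in> ?G" "fr (\<theta> id) - \<theta> \<sigma> \<in> vT" by (auto simp: B_def)
  have "\<sigma> a - a ^ q \<in> v" if "a \<in> A" for a
  proof -
    obtain i where i: "i < length as" "as ! i = a" using \<open>a \<in> A\<close> as by (metis in_set_conv_nth)
    have "Polynomial.coeff (fr (\<theta> id) - \<theta> \<sigma>) i \<in> v" using s(2) by (auto simp: over_poly_def)
    then have "a ^ q - \<sigma> a \<in> v" using i by (simp add: coeff_fr coeff_\<theta>)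
    then show ?thesis using v_primeD(4) by fastforce
  qed
  then show ?thesis using s(1) by blast
qed

text \<open>Being right at one integer is a closed condition on \<open>\<sigma>\<close>. Finitely
  many such conditions are compatible by \<open>frob_finite_level\<close>, and the Galois group is
  compact.\<close>

lemma ex_frob_lift: "\<exists>\<sigma>\<in>carrier (gal K). \<forall>a\<in>\<O>. \<sigma> a - a ^ q \<in> v"
proof -
  let ?G = "carrier (gal K)"
  define C where "C a = {\<sigma>\<in>?G. \<sigma> a - a ^ q \<in> v}" for a
  have "closedin (topo (gal K)) (C a)" for a
    unfolding closedin_def openin_gal
  proof (intro conjI ballI)
    fix \<sigma> assume "\<sigma> \<in> topspace (topo (gal K)) - C a"
    then show "\<exists>B. finite B \<and> (\<forall>\<tau>\<in>?G. (\<forall>b\<in>B. \<tau> b = \<sigma> b) \<longrightarrow> \<tau> \<in> topspace (topo (gal K)) - C a)"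
      by (intro exI[of _ "{a}"]) (auto simp: C_def)
  qed (auto simp: C_def)
  moreover have "\<Inter>\<F> \<noteq> {}" if F: "finite \<F>" "\<F> \<subseteq> C ` \<O>" for \<F>
  proof -
    obtain A where A: "finite A" "A \<subseteq> \<O>" "\<F> = C ` A" using F finite_subset_image by metis
    obtain \<sigma> where "\<sigma> \<in> ?G" "\<forall>a\<in>A. \<sigma> a - a ^ q \<in> v" using frob_finite_level[OF A(1,2)] by blast
    then have "\<sigma> \<in> \<Inter>\<F>" by (auto simp: A(3) C_def)
    then show ?thesis by blast
  qed
  ultimately have "\<Inter>(C ` \<O>) \<noteq> {}"
    using compact_gal[OF ac] unfolding compact_space_fip by (metis (no_types, lifting) imageE)
  then obtain \<sigma> where "\<And>a. a \<in> \<O> \<Longrightarrow> \<sigma> \<in> C a" by auto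
  then show ?thesis using is_subringD(1)[OF O_closure] unfolding C_def by blast
qed

end

section \<open>The local monoids\<close>

text \<open>The elements of the decomposition group that lift the \<open>n\<close>-th power of the Frobenius.\<close>

definition frob_power :: "'a::field_char_0 set \<Rightarrow> 'a set \<Rightarrow> nat \<Rightarrow> ('a \<Rightarrow> 'a) set" where
  "frob_power K v n = {\<sigma> \<in> carrier (gal K). \<forall>x\<in>integers UNIV. \<sigma> x - x ^ (resq K v ^ n) \<in> v}"

lemma frob_power_gal: "\<sigma> \<in> frob_power K v n \<Longrightarrow> \<sigma> \<in> carrier (gal K)"
  by (simp add: frob_power_def)

lemma decomposition_group_simps:
  "carrier (decomposition_group K v) = {\<sigma> \<in> carrier (gal K). \<sigma> ` v = v}"
  "\<sigma> \<otimes>\<^bsub>decomposition_group K v\<^esub> \<tau> = \<sigma> \<circ> \<tau>" "\<one>\<^bsub>decomposition_group K v\<^esub> = id"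
  by (simp_all add: decomposition_group_def)

lemma below_gal:
  assumes "\<sigma> \<in> carrier (gal K)"
  shows "below K (\<sigma> ` v) = below K v"
proof -
  have "x \<in> \<sigma> ` v \<longleftrightarrow> x \<in> v" if "x \<in> K" for x
    using inj_image_mem_iff[OF galD(2)[OF assms], of x v] galD(10)[OF assms that] by simp
  then show ?thesis by (auto simp: below_def integers_def)
qed

lemma resq_gal: "\<sigma> \<in> carrier (gal K) \<Longrightarrow> resq K (\<sigma> ` v) = resq K v"
  by (simp add: resq_def below_gal)

locale local_setting =
  fixes K :: "'a::field_char_0 set"
  assumes nf: "number_field K" and ac: "algebraic_closure (ring_on UNIV) K"
begin

lemmas Kc = algebraic_closure_subfield[OF ac]

sublocale Gal: Group.group "gal K" by (rule gal_group)

end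

locale local_place = local_setting K for K :: "'a::field_char_0 set" +
  fixes v :: "'a set"
  assumes v: "v \<in> finite_primes UNIV"
begin

abbreviation "\<O> \<equiv> integers (UNIV :: 'a set)"
abbreviation "F \<equiv> frob_power K v"
abbreviation "q \<equiv> resq K v"

lemmas O = is_subring_integers[OF is_subring_UNIV[where 'a='a]]
lemmas vD = finite_primesD[OF is_subring_UNIV v]

lemma power_cong:
  assumes "a - b \<in> v" "a \<in> \<O>" "b \<in> \<O>"
  shows "a ^ n - b ^ n \<in> v"
  unfolding power_diff_sumr2
  using assms by (intro vD(7) is_subring_sum[OF O] is_subringD[OF O])

lemma add_resq_power:
  assumes "x \<in> \<O>" "y \<in> \<O>"
  shows "(x + y) ^ (q ^ n) - x ^ (q ^ n) - y ^ (q ^ n) \<in> v"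
proof -
  obtain p k where "prime p" "of_nat p \<in> v" "q = p ^ k" using below_properties[OF nf ac v] by metis
  then show ?thesis
    using freshmans_dream_mod[OF is_subring_UNIV v _ _ assms, of p "k * n"] by (simp add: power_mult)
qed

text \<open>Raising to \<open>q ^ n\<close> is additive modulo \<open>v\<close>, and it is injective
  there because \<open>v\<close> is prime.\<close>

lemma power_cancel:
  assumes "a ^ (q ^ n) - b ^ (q ^ n) \<in> v" "a \<in> \<O>" "b \<in> \<O>"
  shows "a - b \<in> v"
proof -
  have ab: "a - b \<in> \<O>" by (rule is_subringD(6)[OF O assms(2,3)])
  have "((a - b) + b) ^ (q ^ n) - (a - b) ^ (q ^ n) - b ^ (q ^ n) \<in> v"
    by (rule add_resq_power[OF ab assms(3)])
  from vD(5)[OF assms(1) this] have "(a - b) ^ (q ^ n) \<in> v" by simp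
  then show ?thesis by (rule finite_primes_power[OF is_subring_UNIV v ab])
qed

text \<open>An integer and its \<open>q ^ n\<close>-th power lie in \<open>v\<close> together, so
  the congruence alone forces \<open>\<sigma>\<close> into the decomposition group;
  \<open>frob_power\<close> can therefore be defined by the congruence.\<close>

lemma frob_power_stab:
  assumes s: "\<sigma> \<in> F n"
  shows "\<sigma> ` v = v"
proof -
  have G: "\<sigma> \<in> carrier (gal K)" and c: "\<And>x. x \<in> \<O> \<Longrightarrow> \<sigma> x - x ^ (q ^ n) \<in> v"
    using s by (auto simp: frob_power_def)
  have iff: "\<sigma> x \<in> v \<longleftrightarrow> x \<in> v" if x: "x \<in> \<O>" for x
  proof
    assume "x \<in> v"
    have "q ^ n > 0" using resq_gt_1[OF nf ac v] by simp
    then have "x ^ (q ^ n) = x ^ (q ^ n - 1) * x" by (metis power_minus_mult)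
    then have "x ^ (q ^ n) \<in> v" using vD(6)[OF is_subringD(7)[OF O x] \<open>x \<in> v\<close>] by metis
    then show "\<sigma> x \<in> v" using vD(3)[OF c[OF x]] by fastforce
  next
    assume "\<sigma> x \<in> v"
    then have "\<sigma> x - (\<sigma> x - x ^ (q ^ n)) \<in> v" using vD(5) c[OF x] by blast
    then show "x \<in> v" using finite_primes_power[OF is_subring_UNIV v x] by simp
  qed
  show ?thesis
  proof
    show "\<sigma> ` v \<subseteq> v" using iff vD(1) by blast
    show "v \<subseteq> \<sigma> ` v"
    proof
      fix y assume y: "y \<in> v"
      obtain x where x: "y = \<sigma> x" using galD(1)[OF G] by (metis bij_pointE)
      then have "x \<in> \<O>" using y vD(1) gal_integers_iff[OF G] by blast
      then show "y \<in> \<sigma> ` v" using x y iff by blast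
    qed
  qed
qed

lemma inertia_eq: "inertia K v = F 0"
  using frob_power_stab[of _ 0] by (auto simp: inertia_def frob_power_def decomposition_group_simps)

lemma frob_eq: "frob K v = F 1"
  using frob_power_stab[of _ 1] by (auto simp: frob_def frob_power_def decomposition_group_simps resq_def)

lemma ex_frob: "\<exists>\<phi>. \<phi> \<in> F 1"
  using ex_frob_lift[OF nf ac v] by (auto simp: frob_power_def)

lemma frob_power_comp:
  assumes "\<sigma> \<in> F m" "\<tau> \<in> F n"
  shows "\<sigma> \<circ> \<tau> \<in> F (m + n)"
  unfolding frob_power_def
proof (intro CollectI conjI ballI)
  have G: "\<sigma> \<in> carrier (gal K)" "\<tau> \<in> carrier (gal K)" using assms by (auto simp: frob_power_def)
  then show "\<sigma> \<circ> \<tau> \<in> carrier (gal K)" using Gal.m_closed by simp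
  fix x assume x: "x \<in> \<O>"
  then have t: "\<tau> x \<in> \<O>" using gal_integers_iff[OF G(2)] by simp
  have "\<sigma> (\<tau> x) - \<tau> x ^ (q ^ m) \<in> v" using assms(1) t by (simp add: frob_power_def)
  moreover have "\<tau> x ^ (q ^ m) - (x ^ (q ^ n)) ^ (q ^ m) \<in> v"
    using assms(2) x t by (intro power_cong is_subringD[OF O]) (auto simp: frob_power_def)
  ultimately have "(\<sigma> (\<tau> x) - \<tau> x ^ (q ^ m)) + (\<tau> x ^ (q ^ m) - (x ^ (q ^ n)) ^ (q ^ m)) \<in> v"
    by (rule vD(3))
  then show "(\<sigma> \<circ> \<tau>) x - x ^ (q ^ (m + n)) \<in> v" by (simp add: power_mult[symmetric] power_add mult.commute)
qed

text \<open>Inverses of elements of positive degree leave the Weil monoid. Quotients are therefore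
  formed in the Galois group and brought back by cancellation of degrees.\<close>

lemma frob_power_cancel_right:
  assumes st: "\<sigma> \<circ> \<tau> \<in> F (m + n)" and t: "\<tau> \<in> F n" and s: "\<sigma> \<in> carrier (gal K)"
  shows "\<sigma> \<in> F m"
  unfolding frob_power_def
proof (intro CollectI conjI ballI s)
  have G: "\<tau> \<in> carrier (gal K)" using t by (simp add: frob_power_def)
  fix x assume x: "x \<in> \<O>"
  obtain y where y: "x = \<tau> y" using galD(1)[OF G] by (metis bij_pointE)
  then have yO: "y \<in> \<O>" using x gal_integers_iff[OF G] by simp
  have "\<sigma> x - y ^ (q ^ (m + n)) \<in> v" using st yO y by (simp add: frob_power_def)
  moreover have "x ^ (q ^ m) - (y ^ (q ^ n)) ^ (q ^ m) \<in> v"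
    using t x yO y by (intro power_cong is_subringD[OF O]) (auto simp: frob_power_def)
  ultimately have "(\<sigma> x - y ^ (q ^ (m + n))) - (x ^ (q ^ m) - (y ^ (q ^ n)) ^ (q ^ m)) \<in> v"
    by (rule vD(5))
  then show "\<sigma> x - x ^ (q ^ m) \<in> v" by (simp add: power_mult[symmetric] power_add mult.commute)
qed

text \<open>On this side the exponent \<open>q ^ m\<close> has to be removed from the outside, which
  is the injectivity of \<open>power_cancel\<close>.\<close>

lemma frob_power_cancel_left:
  assumes st: "\<sigma> \<circ> \<tau> \<in> F (m + n)" and s: "\<sigma> \<in> F m" and t: "\<tau> \<in> carrier (gal K)"
  shows "\<tau> \<in> F n"
  unfolding frob_power_def
proof (intro CollectI conjI ballI t)
  fix x assume x: "x \<in> \<O>"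
  then have tx: "\<tau> x \<in> \<O>" using gal_integers_iff[OF t] by simp
  have "\<sigma> (\<tau> x) - x ^ (q ^ (m + n)) \<in> v" using st x by (simp add: frob_power_def)
  moreover have "\<sigma> (\<tau> x) - \<tau> x ^ (q ^ m) \<in> v" using s tx by (simp add: frob_power_def)
  ultimately have "(\<sigma> (\<tau> x) - x ^ (q ^ (m + n))) - (\<sigma> (\<tau> x) - \<tau> x ^ (q ^ m)) \<in> v"
    by (rule vD(5))
  then have "\<tau> x ^ (q ^ m) - (x ^ (q ^ n)) ^ (q ^ m) \<in> v"
    by (simp add: power_mult[symmetric] power_add mult.commute)
  then show "\<tau> x - x ^ (q ^ n) \<in> v" by (rule power_cancel) (intro tx is_subringD[OF O] x)+
qed

text \<open>A root of the monic polynomial X^n - X - 1 is an integer with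
  \<open>x ^ n - x = 1\<close>, and \<open>1\<close> is not in \<open>v\<close>.\<close>

lemma residue_infinite:
  assumes "n > 1"
  shows "\<exists>x\<in>\<O>. x ^ n - x \<notin> v"
proof -
  define f :: "int poly" where "f = Polynomial.monom 1 n + [:- 1, - 1:]"
  have df: "Polynomial.degree f = n"
    unfolding f_def using assms by (subst degree_add_eq_left) (auto simp: degree_monom_eq)
  have "Polynomial.coeff f n = 1" using assms by (simp add: f_def coeff_pCons split: nat.split)
  then have lf: "Polynomial.lead_coeff f = 1" using df by simp
  have "Polynomial.degree (map_poly of_int f :: 'a poly) > 0" using assms df by (simp add: degree_map_poly)
  then obtain x :: 'a where x: "poly (map_poly of_int f) x = 0" using algebraic_closure_root[OF ac] by blast
  have "map_poly of_int f = Polynomial.monom 1 n + [:- 1, - 1 :: 'a:]"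
    by (rule poly_eqI) (simp add: f_def coeff_map_poly coeff_pCons split: nat.split)
  then have "poly (Polynomial.monom 1 n + [:- 1, - 1:]) x = 0" using x by simp
  then have "x ^ n - x = 1" by (simp add: poly_monom algebra_simps)
  moreover have "x \<in> \<O>" using x lf by (auto simp: integers_def algebraic_int_altdef_ipoly)
  ultimately show ?thesis using vD(8) by (intro bexI[of _ x]) auto
qed

text \<open>Two different degrees would give, after cancellation, one exponent above
  \<open>1\<close> that acts trivially on all residues. Hence elements of the Weil monoid have a
  well-defined degree.\<close>

lemma frob_power_disjoint:
  assumes "\<sigma> \<in> F m" "\<sigma> \<in> F n"
  shows "m = n"
proof -
  have False if "m < n" "\<sigma> \<in> F m" "\<sigma> \<in> F n" for m n
  proof -
    have "q ^ (n - m) > 1" using one_less_power[OF resq_gt_1[OF nf ac v], of "n - m"] \<open>m < n\<close> by simp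
    then obtain x where x: "x \<in> \<O>" "x ^ (q ^ (n - m)) - x \<notin> v" using residue_infinite by blast
    have "\<sigma> x - x ^ (q ^ m) \<in> v" "\<sigma> x - x ^ (q ^ n) \<in> v"
      using that x by (auto simp: frob_power_def)
    then have "(\<sigma> x - x ^ (q ^ m)) - (\<sigma> x - x ^ (q ^ n)) \<in> v" by (rule vD(5))
    then have "(x ^ (q ^ (n - m))) ^ (q ^ m) - x ^ (q ^ m) \<in> v"
      using \<open>m < n\<close> by (simp add: power_mult[symmetric] power_add[symmetric])
    then have "x ^ (q ^ (n - m)) - x \<in> v" by (rule power_cancel) (intro x is_subringD[OF O])+
    then show False using x by blast
  qed
  then show ?thesis using assms by (metis linorder_neqE_nat)
qed

lemma id_frob_power: "id \<in> F 0"
  using Gal.one_closed vD(2) by (simp add: frob_power_def)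

lemma frob_pow_eq: "frob K v [^]\<^bsub>decomposition_group K v Mod inertia K v\<^esub> (n::nat) = F n"
proof (induction n)
  case 0
  show ?case by (simp add: nat_pow_def FactGroup_def inertia_eq)
next
  case (Suc n)
  have "F n <#>\<^bsub>decomposition_group K v\<^esub> F 1 = F (Suc n)"
  proof
    show "F n <#>\<^bsub>decomposition_group K v\<^esub> F 1 \<subseteq> F (Suc n)"
      using frob_power_comp[of _ n _ 1] by (auto simp: set_mult_def decomposition_group_simps)
    show "F (Suc n) \<subseteq> F n <#>\<^bsub>decomposition_group K v\<^esub> F 1"
    proof
      fix w assume w: "w \<in> F (Suc n)"
      obtain \<phi> where p: "\<phi> \<in> F 1" using ex_frob by blast
      note G = frob_power_gal[OF p] frob_power_gal[OF w]
      let ?s = "w \<circ> inv_into UNIV \<phi>"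
      have e: "?s \<circ> \<phi> = w" using gal_m_inv(4)[OF G(1)] by auto
      have "?s \<in> F n"
      proof (rule frob_power_cancel_right[OF _ p])
        show "?s \<circ> \<phi> \<in> F (n + 1)" using w unfolding e by simp
        show "?s \<in> carrier (gal K)" using Gal.m_closed[OF G(2) gal_m_inv(2)[OF G(1)]] by simp
      qed
      then show "w \<in> F n <#>\<^bsub>decomposition_group K v\<^esub> F 1"
        using p e unfolding set_mult_def decomposition_group_simps by blast
    qed
  qed
  then show ?case using Suc by (simp add: nat_pow_def FactGroup_def frob_eq)
qed

text \<open>Each \<open>F n\<close> is a single coset of inertia, so congruences can replace the
  quotient group in terms of which the Weil monoid was defined.\<close>

lemma weil_monoid_eq: "weil_monoid K v = (\<Union>n. F n)"
proof -
  have coset: "inertia K v #>\<^bsub>decomposition_group K v\<^esub> \<sigma> = F n" if s: "\<sigma> \<in> F n" for \<sigma> n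
  proof
    show "inertia K v #>\<^bsub>decomposition_group K v\<^esub> \<sigma> \<subseteq> F n"
      using frob_power_comp[of _ 0 _ n] s by (auto simp: r_coset_def inertia_eq decomposition_group_simps)
    show "F n \<subseteq> inertia K v #>\<^bsub>decomposition_group K v\<^esub> \<sigma>"
    proof
      fix w assume w: "w \<in> F n"
      note G = frob_power_gal[OF s] frob_power_gal[OF w]
      let ?s = "w \<circ> inv_into UNIV \<sigma>"
      have e: "?s \<circ> \<sigma> = w" using gal_m_inv(4)[OF G(1)] by auto
      have "?s \<in> F 0"
      proof (rule frob_power_cancel_right[OF _ s])
        show "?s \<circ> \<sigma> \<in> F (0 + n)" using w unfolding e by simp
        show "?s \<in> carrier (gal K)" using Gal.m_closed[OF G(2) gal_m_inv(2)[OF G(1)]] by simp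
      qed
      then show "w \<in> inertia K v #>\<^bsub>decomposition_group K v\<^esub> \<sigma>"
        using e unfolding r_coset_def inertia_eq decomposition_group_simps by blast
    qed
  qed
  have self: "\<sigma> \<in> inertia K v #>\<^bsub>decomposition_group K v\<^esub> \<sigma>" for \<sigma>
    unfolding r_coset_def inertia_eq decomposition_group_simps by (intro UN_I[OF id_frob_power]) simp
  show ?thesis
  proof
    show "weil_monoid K v \<subseteq> (\<Union>n. F n)"
      unfolding weil_monoid_def Let_def frob_pow_eq using self by blast
    show "(\<Union>n. F n) \<subseteq> weil_monoid K v"
      unfolding weil_monoid_def Let_def frob_pow_eq decomposition_group_simps
      using coset frob_power_stab frob_power_gal by blast
  qed
qed

text \<open>Translation by an element of \<open>F n\<close> identifies inertia with
  \<open>F n\<close>. The Weil topology is thus the disjoint union of the Krull topologies on the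
  sets \<open>F n\<close>.\<close>

lemma openin_weil_iff:
  "openin (weil_topology K v) V \<longleftrightarrow> V \<subseteq> weil_monoid K v \<and>
     (\<forall>n. \<forall>\<sigma>\<in>V \<inter> F n. \<exists>B. finite B \<and> (\<forall>\<rho>\<in>F n. (\<forall>b\<in>B. \<rho> b = \<sigma> b) \<longrightarrow> \<rho> \<in> V))"
proof -
  have F0: "F 0 \<subseteq> carrier (gal K)" by (auto simp: frob_power_def)
  have op: "openin (subtopology (topo (gal K)) (F 0)) {\<tau> \<in> F 0. \<sigma> \<circ> \<tau> \<in> V} \<longleftrightarrow>
      (\<forall>\<rho>\<in>V \<inter> F n. \<exists>B. finite B \<and> (\<forall>\<rho>'\<in>F n. (\<forall>b\<in>B. \<rho>' b = \<rho> b) \<longrightarrow> \<rho>' \<in> V))"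
    if s: "\<sigma> \<in> F n" for \<sigma> n
  proof -
    note G = frob_power_gal[OF s]
    let ?i = "inv_into UNIV \<sigma>"
    have i: "?i \<circ> \<rho> \<in> F 0" "\<sigma> \<circ> (?i \<circ> \<rho>) = \<rho>" if "\<rho> \<in> F n" for \<rho>
    proof -
      show e: "\<sigma> \<circ> (?i \<circ> \<rho>) = \<rho>" using gal_m_inv(3)[OF G] by auto
      show "?i \<circ> \<rho> \<in> F 0"
      proof (rule frob_power_cancel_left[OF _ s])
        show "\<sigma> \<circ> (?i \<circ> \<rho>) \<in> F (n + 0)" using that unfolding e by simp
        show "?i \<circ> \<rho> \<in> carrier (gal K)"
          using Gal.m_closed[OF gal_m_inv(2)[OF G] frob_power_gal[OF that]] by simp
      qed
    qed
    have c: "\<sigma> \<circ> \<tau> \<in> F n" if "\<tau> \<in> F 0" for \<tau> using frob_power_comp[OF s that] by simp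
    have inj: "\<sigma> x = \<sigma> y \<longleftrightarrow> x = y" for x y using galD(12)[OF G] .
    show ?thesis
      unfolding openin_gal_subtopology[OF F0]
    proof
      assume *: "{\<tau> \<in> F 0. \<sigma> \<circ> \<tau> \<in> V} \<subseteq> F 0 \<and> (\<forall>\<tau>\<in>{\<tau> \<in> F 0. \<sigma> \<circ> \<tau> \<in> V}. \<exists>B. finite B \<and>
        (\<forall>\<tau>'\<in>F 0. (\<forall>b\<in>B. \<tau>' b = \<tau> b) \<longrightarrow> \<tau>' \<in> {\<tau> \<in> F 0. \<sigma> \<circ> \<tau> \<in> V}))"
      show "\<forall>\<rho>\<in>V \<inter> F n. \<exists>B. finite B \<and> (\<forall>\<rho>'\<in>F n. (\<forall>b\<in>B. \<rho>' b = \<rho> b) \<longrightarrow> \<rho>' \<in> V)"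
      proof
        fix \<rho> assume r: "\<rho> \<in> V \<inter> F n"
        then have "?i \<circ> \<rho> \<in> {\<tau> \<in> F 0. \<sigma> \<circ> \<tau> \<in> V}" using i by simp
        from bspec[OF conjunct2[OF *] this] obtain B where B: "finite B"
          "\<forall>\<tau>'\<in>F 0. (\<forall>b\<in>B. \<tau>' b = (?i \<circ> \<rho>) b) \<longrightarrow> \<sigma> \<circ> \<tau>' \<in> V"
          by auto
        have "\<rho>' \<in> V" if "\<rho>' \<in> F n" "\<forall>b\<in>B. \<rho>' b = \<rho> b" for \<rho>'
          using bspec[OF B(2) i(1)[OF that(1)]] i(2)[OF that(1)] that(2) by auto
        then show "\<exists>B. finite B \<and> (\<forall>\<rho>'\<in>F n. (\<forall>b\<in>B. \<rho>' b = \<rho> b) \<longrightarrow> \<rho>' \<in> V)" using B(1) by blast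
      qed
    next
      assume *: "\<forall>\<rho>\<in>V \<inter> F n. \<exists>B. finite B \<and> (\<forall>\<rho>'\<in>F n. (\<forall>b\<in>B. \<rho>' b = \<rho> b) \<longrightarrow> \<rho>' \<in> V)"
      show "{\<tau> \<in> F 0. \<sigma> \<circ> \<tau> \<in> V} \<subseteq> F 0 \<and> (\<forall>\<tau>\<in>{\<tau> \<in> F 0. \<sigma> \<circ> \<tau> \<in> V}. \<exists>B. finite B \<and>
        (\<forall>\<tau>'\<in>F 0. (\<forall>b\<in>B. \<tau>' b = \<tau> b) \<longrightarrow> \<tau>' \<in> {\<tau> \<in> F 0. \<sigma> \<circ> \<tau> \<in> V}))"
      proof (intro conjI ballI)
        fix \<tau> assume t: "\<tau> \<in> {\<tau> \<in> F 0. \<sigma> \<circ> \<tau> \<in> V}"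
        then have "\<sigma> \<circ> \<tau> \<in> V \<inter> F n" using c by simp
        from bspec[OF * this] obtain B where B: "finite B"
          "\<forall>\<rho>'\<in>F n. (\<forall>b\<in>B. \<rho>' b = (\<sigma> \<circ> \<tau>) b) \<longrightarrow> \<rho>' \<in> V"
          by blast
        have "\<sigma> \<circ> \<tau>' \<in> V" if "\<tau>' \<in> F 0" "\<forall>b\<in>B. \<tau>' b = \<tau> b" for \<tau>'
          using bspec[OF B(2) c[OF that(1)]] that(2) by simp
        then show "\<exists>B. finite B \<and> (\<forall>\<tau>'\<in>F 0. (\<forall>b\<in>B. \<tau>' b = \<tau> b) \<longrightarrow> \<tau>' \<in> {\<tau> \<in> F 0. \<sigma> \<circ> \<tau> \<in> V})"
          using B(1) by blast
      qed blast
    qed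
  qed
  have ne: "F n \<noteq> {}" for n
  proof (induction n)
    case 0 show ?case using id_frob_power by blast
  next
    case (Suc n) then show ?case using ex_frob frob_power_comp[of _ n _ 1] by fastforce
  qed
  show ?thesis
    unfolding openin_weil_topology inertia_eq
  proof (intro conj_cong refl iffI allI ballI)
    fix n \<sigma>
    assume a: "\<forall>\<sigma>\<in>weil_monoid K v. openin (subtopology (topo (gal K)) (F 0)) {\<tau> \<in> F 0. \<sigma> \<circ> \<tau> \<in> V}"
      and s: "\<sigma> \<in> V \<inter> F n"
    then have "openin (subtopology (topo (gal K)) (F 0)) {\<tau> \<in> F 0. \<sigma> \<circ> \<tau> \<in> V}" unfolding weil_monoid_eq by blast
    then show "\<exists>B. finite B \<and> (\<forall>\<rho>\<in>F n. (\<forall>b\<in>B. \<rho> b = \<sigma> b) \<longrightarrow> \<rho> \<in> V)"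
      using op[of \<sigma> n] s by blast
  next
    fix \<sigma>
    assume a: "\<forall>n. \<forall>\<sigma>\<in>V \<inter> F n. \<exists>B. finite B \<and> (\<forall>\<rho>\<in>F n. (\<forall>b\<in>B. \<rho> b = \<sigma> b) \<longrightarrow> \<rho> \<in> V)"
      and "\<sigma> \<in> weil_monoid K v"
    then obtain n where "\<sigma> \<in> F n" unfolding weil_monoid_eq by blast
    then show "openin (subtopology (topo (gal K)) (F 0)) {\<tau> \<in> F 0. \<sigma> \<circ> \<tau> \<in> V}"
      using op a by blast
  qed
qed

lemma openin_frob_power: "openin (weil_topology K v) (F n)"
  unfolding openin_weil_iff weil_monoid_eq using frob_power_disjoint by (fastforce intro: exI[of _ "{}"])

lemma topspace_weil: "topspace (weil_topology K v) = weil_monoid K v"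
proof
  show "topspace (weil_topology K v) \<subseteq> weil_monoid K v"
    using openin_topspace[of "weil_topology K v"] unfolding openin_weil_iff by blast
  show "weil_monoid K v \<subseteq> topspace (weil_topology K v)"
    unfolding weil_monoid_eq using openin_subset[OF openin_frob_power] by blast
qed

text \<open>\<open>F n\<close> is closed in the compact Galois group, and on it the Weil topology is
  no finer than the Krull topology.\<close>

lemma compactin_frob_power: "compactin (weil_topology K v) (F n)"
proof -
  have sub: "F n \<subseteq> carrier (gal K)" by (auto simp: frob_power_def)
  have "closedin (topo (gal K)) (F n)"
    unfolding closedin_def openin_gal
  proof (intro conjI ballI)
    fix \<sigma> assume "\<sigma> \<in> topspace (topo (gal K)) - F n"
    then obtain x where "x \<in> \<O>" "\<sigma> x - x ^ (q ^ n) \<notin> v" by (auto simp: frob_power_def)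
    then show "\<exists>B. finite B \<and> (\<forall>\<tau>\<in>carrier (gal K). (\<forall>b\<in>B. \<tau> b = \<sigma> b) \<longrightarrow> \<tau> \<in> topspace (topo (gal K)) - F n)"
      by (intro exI[of _ "{x}"]) (auto simp: frob_power_def intro!: bexI[of _ x])
  qed (use sub in auto)
  then have "compactin (topo (gal K)) (F n)"
    using compact_gal[OF ac] closedin_compact_space by blast
  then have "compactin (subtopology (topo (gal K)) (F n)) (F n)" by (simp add: compactin_subtopology)
  moreover have "continuous_map (subtopology (topo (gal K)) (F n)) (weil_topology K v) id"
    unfolding continuous_map_def
  proof (intro conjI allI impI)
    show "id \<in> topspace (subtopology (topo (gal K)) (F n)) \<rightarrow> topspace (weil_topology K v)"
      unfolding topspace_weil weil_monoid_eq by auto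
    fix V assume V: "openin (weil_topology K v) V"
    have "{x \<in> topspace (subtopology (topo (gal K)) (F n)). id x \<in> V} = V \<inter> F n" using sub by auto
    moreover have "openin (subtopology (topo (gal K)) (F n)) (V \<inter> F n)"
      unfolding openin_gal_subtopology[OF sub]
    proof (intro conjI ballI)
      fix \<sigma> assume "\<sigma> \<in> V \<inter> F n"
      then obtain B where "finite B" "\<forall>\<rho>\<in>F n. (\<forall>b\<in>B. \<rho> b = \<sigma> b) \<longrightarrow> \<rho> \<in> V"
        using V unfolding openin_weil_iff by meson
      then show "\<exists>B. finite B \<and> (\<forall>\<tau>\<in>F n. (\<forall>b\<in>B. \<tau> b = \<sigma> b) \<longrightarrow> \<tau> \<in> V \<inter> F n)"
        by (intro exI[of _ B]) simp
    qed simp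
    ultimately show "openin (subtopology (topo (gal K)) (F n)) {x \<in> topspace (subtopology (topo (gal K)) (F n)). id x \<in> V}"
      by simp
  qed
  ultimately have "compactin (weil_topology K v) (id ` F n)" by (rule image_compactin)
  then show ?thesis by simp
qed

section \<open>The local monoid with its zero, and its topology\<close>

lemma topspace_Q_loc: "topspace (topo (Q_loc K v)) = carrier (Q_loc K v)"
  by (simp add: Q_loc_def topspace_weil)

lemma carrier_Q_loc: "carrier (Q_loc K v) = insert None (Some ` (\<Union>n. F n))"
  by (simp add: Q_loc_def weil_monoid_eq)

lemma Q_loc_simps:
  "Some \<sigma> \<otimes>\<^bsub>Q_loc K v\<^esub> Some \<tau> = Some (\<sigma> \<circ> \<tau>)" "None \<otimes>\<^bsub>Q_loc K v\<^esub> x = None"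
  "x \<otimes>\<^bsub>Q_loc K v\<^esub> None = None" "\<one>\<^bsub>Q_loc K v\<^esub> = Some id"
  by (auto simp: Q_loc_def split: option.split)

lemma compactin_weil_bounded:
  assumes C: "compactin (weil_topology K v) C"
  shows "\<exists>N. C \<subseteq> (\<Union>n<N. F n)"
proof -
  have "C \<subseteq> \<Union>(range F)" using compactin_subset_topspace[OF C] by (simp add: topspace_weil weil_monoid_eq)
  then obtain \<F> where "finite \<F>" "\<F> \<subseteq> range F" "C \<subseteq> \<Union>\<F>"
    using compactinD[OF C, of "range F"] openin_frob_power by blast
  then obtain M where M: "finite M" "C \<subseteq> \<Union>(F ` M)" using finite_subset_image by metis
  obtain N where "M \<subseteq> {..<N}" using finite_nat_iff_bounded M(1) by blast
  then show ?thesis using M(2) by (intro exI[of _ N]) blast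
qed

text \<open>A neighbourhood of the zero omits a compact set, and a compact set meets only finitely
  many of the disjoint open sets \<open>F n\<close>.\<close>

lemma Q_loc_zero_limit:
  assumes "openin (topo (Q_loc K v)) V" "None \<in> V"
  shows "\<exists>N. \<forall>n\<ge>N. Some ` F n \<subseteq> V"
proof -
  obtain C where C: "compactin (weil_topology K v) C" "V = insert None (Some ` (weil_monoid K v - C))"
    using assms by (auto simp: Q_loc_def openin_Alexandroff_compactification topspace_weil)
  obtain N where N: "C \<subseteq> (\<Union>n<N. F n)" using compactin_weil_bounded[OF C(1)] by blast
  have "Some ` F n \<subseteq> V" if "n \<ge> N" for n
  proof
    fix y assume "y \<in> Some ` F n"
    then obtain \<sigma> where s: "\<sigma> \<in> F n" "y = Some \<sigma>" by blast
    have "\<sigma> \<notin> C" using N frob_power_disjoint[OF s(1)] that by fastforce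
    then show "y \<in> V" using s by (auto simp: C(2) weil_monoid_eq)
  qed
  then show ?thesis by blast
qed

lemma continuous_map_Q_loc_discrete:
  assumes S: "h ` carrier (Q_loc K v) \<subseteq> S"
    and loc: "\<And>n \<sigma>. \<sigma> \<in> F n \<Longrightarrow> \<exists>B. finite B \<and> (\<forall>\<rho>\<in>F n. (\<forall>b\<in>B. \<rho> b = \<sigma> b) \<longrightarrow> h (Some \<rho>) = h (Some \<sigma>))"
    and lim: "\<And>n \<sigma>. n > N \<Longrightarrow> \<sigma> \<in> F n \<Longrightarrow> h (Some \<sigma>) = h None"
  shows "continuous_map (topo (Q_loc K v)) (discrete_topology S) h"
  unfolding continuous_map_def
proof (intro conjI allI impI)
  show "h \<in> topspace (topo (Q_loc K v)) \<rightarrow> topspace (discrete_topology S)"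
    using S by (auto simp: topspace_Q_loc)
  fix V
  let ?P = "{x \<in> topspace (topo (Q_loc K v)). h x \<in> V}"
  have op: "openin (weil_topology K v) {w \<in> weil_monoid K v. h (Some w) \<in> V}" for V
    unfolding openin_weil_iff
  proof (intro conjI allI ballI)
    fix n \<sigma> assume s: "\<sigma> \<in> {w \<in> weil_monoid K v. h (Some w) \<in> V} \<inter> F n"
    then obtain B where B: "finite B" "\<forall>\<rho>\<in>F n. (\<forall>b\<in>B. \<rho> b = \<sigma> b) \<longrightarrow> h (Some \<rho>) = h (Some \<sigma>)"
      using loc by blast
    have "\<rho> \<in> {w \<in> weil_monoid K v. h (Some w) \<in> V}" if r: "\<rho> \<in> F n" "\<forall>b\<in>B. \<rho> b = \<sigma> b" for \<rho>
    proof -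
      have "h (Some \<rho>) = h (Some \<sigma>)" using B(2) r by blast
      moreover have "\<rho> \<in> weil_monoid K v" unfolding weil_monoid_eq using r(1) by blast
      ultimately show ?thesis using s by simp
    qed
    then show "\<exists>B. finite B \<and> (\<forall>\<rho>\<in>F n. (\<forall>b\<in>B. \<rho> b = \<sigma> b) \<longrightarrow> \<rho> \<in> {w \<in> weil_monoid K v. h (Some w) \<in> V})"
      using B(1) by blast
  qed blast
  show "openin (topo (Q_loc K v)) ?P"
  proof (cases "h None \<in> V")
    case False
    then have "?P = Some ` {w \<in> weil_monoid K v. h (Some w) \<in> V}"
      by (auto simp: topspace_Q_loc carrier_Q_loc weil_monoid_eq)
    then show ?thesis using op by (simp add: Q_loc_def)
  next
    case True
    \<comment> \<open>The points mapped outside \<open>V\<close>. They form a closed set, which is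
      compact because beyond degree \<open>N\<close> the value is \<open>h None\<close>, a member of
      \<open>V\<close>.\<close>
    define C where "C = {w \<in> weil_monoid K v. h (Some w) \<in> - V}"
    have compl: "topspace (weil_topology K v) - C = {w \<in> weil_monoid K v. h (Some w) \<in> V}"
      by (auto simp: C_def topspace_weil)
    have "closedin (weil_topology K v) C"
      unfolding closedin_def compl using op by (auto simp: C_def topspace_weil)
    moreover have "C \<subseteq> (\<Union>n\<le>N. F n)"
    proof
      fix w assume "w \<in> C"
      then obtain n where "w \<in> F n" "h (Some w) \<notin> V" by (auto simp: C_def weil_monoid_eq)
      then have "n \<le> N" using lim True by (metis not_le)
      then show "w \<in> (\<Union>n\<le>N. F n)" using \<open>w \<in> F n\<close> by blast
    qed
    moreover have "compactin (weil_topology K v) (\<Union>n\<le>N. F n)"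
      using compactin_frob_power by (intro compactin_Union) auto
    ultimately have "compactin (weil_topology K v) C" "closedin (weil_topology K v) C"
      using closed_compactin by blast+
    moreover have "?P = insert None (Some ` (topspace (weil_topology K v) - C))"
      unfolding compl using True by (auto simp: topspace_Q_loc carrier_Q_loc weil_monoid_eq)
    ultimately show ?thesis unfolding Q_loc_def using openin_Alexandroff_compactification by fastforce
  qed
qed

end

section \<open>Profinite monoids and free products\<close>

lemma top_homD:
  assumes "f \<in> top_hom M N"
  shows "x \<in> carrier M \<Longrightarrow> f x \<in> carrier N"
    "x \<in> carrier M \<Longrightarrow> y \<in> carrier M \<Longrightarrow> f (x \<otimes>\<^bsub>M\<^esub> y) = f x \<otimes>\<^bsub>N\<^esub> f y"
    "f \<one>\<^bsub>M\<^esub> = \<one>\<^bsub>N\<^esub>" "continuous_map (topo M) (topo N) f"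
  using assms by (auto simp: top_hom_def hom_def)

lemma top_homI:
  assumes "\<And>x. x \<in> carrier M \<Longrightarrow> f x \<in> carrier N"
    "\<And>x y. x \<in> carrier M \<Longrightarrow> y \<in> carrier M \<Longrightarrow> f (x \<otimes>\<^bsub>M\<^esub> y) = f x \<otimes>\<^bsub>N\<^esub> f y"
    "f \<one>\<^bsub>M\<^esub> = \<one>\<^bsub>N\<^esub>" "continuous_map (topo M) (topo N) f"
  shows "f \<in> top_hom M N"
  using assms by (auto simp: top_hom_def hom_def)

lemma top_hom_comp:
  assumes "f \<in> top_hom M N" "g \<in> top_hom N L"
  shows "(\<lambda>x. g (f x)) \<in> top_hom M L"
  using top_homD[OF assms(1)] top_homD[OF assms(2)] continuous_map_compose[of "topo M" "topo N" f "topo L" g]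
  by (intro top_homI) (auto simp: o_def)

lemma top_hom_one:
  assumes "Group.monoid N" "topspace (topo N) = carrier N"
  shows "(\<lambda>x. \<one>\<^bsub>N\<^esub>) \<in> top_hom M N"
  using assms by (intro top_homI) (auto simp: monoid.one_closed monoid.l_one)

lemma profinite_monoidD:
  assumes "profinite_monoid M"
  shows "Group.monoid M" "topspace (topo M) = carrier M" "compact_space (topo M)"
    "continuous_map (prod_topology (topo M) (topo M)) (topo M) (\<lambda>(x, y). x \<otimes>\<^bsub>M\<^esub> y)"
    "Hausdorff_space (topo M)" "topological_monoid M"
  using assms profinite_Hausdorff[OF assms] by (auto simp: profinite_monoid_def topological_monoid_def)

lemma topological_monoidD:
  assumes "topological_monoid M"
  shows "Group.monoid M" "topspace (topo M) = carrier M"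
    "continuous_map (prod_topology (topo M) (topo M)) (topo M) (\<lambda>(x, y). x \<otimes>\<^bsub>M\<^esub> y)"
  using assms by (auto simp: topological_monoid_def)

lemma continuous_map_mult:
  assumes "topological_monoid M" "continuous_map T (topo M) f" "continuous_map T (topo M) g"
  shows "continuous_map T (topo M) (\<lambda>x. f x \<otimes>\<^bsub>M\<^esub> g x)"
proof -
  have "continuous_map T (prod_topology (topo M) (topo M)) (\<lambda>x. (f x, g x))"
    using assms by (simp add: continuous_map_paired)
  from continuous_map_compose[OF this topological_monoidD(3)[OF assms(1)]] show ?thesis by (simp add: o_def)
qed

lemma closure_of_submonoid:
  assumes M: "topological_monoid M" and A: "submonoid A M"
  shows "submonoid (topo M closure_of A) M"
proof
  note D = topological_monoidD[OF M]
  interpret Group.monoid M by (rule D)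
  have sub: "A \<subseteq> topspace (topo M)" using A D(2) submonoid.subset by blast
  show "topo M closure_of A \<subseteq> carrier M" using closure_of_subset_topspace D(2) by metis
  show "\<one>\<^bsub>M\<^esub> \<in> topo M closure_of A"
    using closure_of_subset[OF sub] submonoid.one_closed[OF A] by blast
  have "(\<lambda>(x, y). x \<otimes>\<^bsub>M\<^esub> y) ` (prod_topology (topo M) (topo M) closure_of (A \<times> A))
      \<subseteq> topo M closure_of ((\<lambda>(x, y). x \<otimes>\<^bsub>M\<^esub> y) ` (A \<times> A))"
    using D(3) by (rule continuous_map_image_closure_subset)
  also have "\<dots> \<subseteq> topo M closure_of A"
    using submonoid.m_closed[OF A] by (intro closure_of_mono) auto
  finally show "x \<otimes>\<^bsub>M\<^esub> y \<in> topo M closure_of A" if "x \<in> topo M closure_of A" "y \<in> topo M closure_of A" for x y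
    using that unfolding closure_of_Times by auto
qed

text \<open>Profiniteness is tested against monoids carried by \<open>nat\<close>; the copy admits
  finite monoids on other types as tests.\<close>

lemma finite_discrete_nat_copy:
  fixes F :: "'b top_monoid"
  assumes F: "finite_discrete_monoid F"
  obtains N :: "nat top_monoid" and h where "finite_discrete_monoid N" "h \<in> top_hom F N" "inj_on h (carrier F)"
proof -
  interpret Group.monoid F using F by (simp add: finite_discrete_monoid_def)
  have fin: "finite (carrier F)" using F by (simp add: finite_discrete_monoid_def)
  obtain h :: "'b \<Rightarrow> nat" where h: "bij_betw h (carrier F) {0..<card (carrier F)}"
    using ex_bij_betw_finite_nat[OF fin] by blast
  then have inj: "inj_on h (carrier F)" by (simp add: bij_betw_def)
  let ?g = "the_inv_into (carrier F) h"
  have g: "?g (h x) = x" if "x \<in> carrier F" for x using inj that by (rule the_inv_into_f_f)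
  define N :: "nat top_monoid" where "N = \<lparr>carrier = h ` carrier F, monoid.mult = (\<lambda>a b. h (?g a \<otimes>\<^bsub>F\<^esub> ?g b)),
      one = h \<one>\<^bsub>F\<^esub>, topo = discrete_topology (h ` carrier F)\<rparr>"
  have "Group.monoid N"
    by (rule monoidI) (auto simp: N_def g m_assoc)
  then have "finite_discrete_monoid N" using fin by (simp add: finite_discrete_monoid_def N_def)
  moreover have "h \<in> top_hom F N"
    using F by (intro top_homI) (auto simp: N_def g finite_discrete_monoid_def)
  ultimately show thesis using that inj by blast
qed

lemma finite_discrete_profinite:
  assumes F: "finite_discrete_monoid F"
  shows "profinite_monoid F"
proof -
  obtain N :: "nat top_monoid" and h where N: "finite_discrete_monoid N" "h \<in> top_hom F N" "inj_on h (carrier F)"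
    using finite_discrete_nat_copy[OF F] by blast
  have "compact_space (topo F)" using F by (simp add: finite_discrete_monoid_def compact_space_discrete_topology)
  then show ?thesis
    unfolding profinite_monoid_def
    using finite_discrete_topological[OF F] N by (metis inj_onD)
qed

text \<open>The quotient by the kernel maps injectively into a finite monoid, so it is profinite.
  This is how a finite monoid gives an upper bound for the minimal profinite congruence, and with it
  a proof that classes differ.\<close>

lemma kernel_profinite_congruence:
  assumes M: "Group.monoid M" and top: "topspace (topo M) = carrier M" and comp: "compact_space (topo M)"
    and F: "finite_discrete_monoid F" and e: "e \<in> top_hom M F"
  shows "profinite_congruence M {(a, b) \<in> carrier M \<times> carrier M. e a = e b}" 
proof -
  define R where "R = {(a, b) \<in> carrier M \<times> carrier M. e a = e b}"
  interpret Group.monoid M by (rule M)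
  note eD = top_homD[OF e]
  have equiv: "equiv (carrier M) R"
    by (auto simp: R_def equiv_def refl_on_def sym_def trans_def)
  have cong: "congruence M R"
    using equiv eD(2) by (auto simp: congruence_def R_def)
  have cls: "R `` {a} = {b \<in> carrier M. e a = e b}" if "a \<in> carrier M" for a using that by (auto simp: R_def)
  obtain N :: "nat top_monoid" and h where N: "finite_discrete_monoid N" "h \<in> top_hom F N" "inj_on h (carrier F)"
    using finite_discrete_nat_copy[OF F] by blast
  \<comment> \<open>The map induced on classes, by way of a chosen representative; it is composed
    with the copy \<open>h\<close> because tests take values in \<open>nat\<close>.\<close>
  define k where "k A = h (e (SOME a. a \<in> A))" for A
  have k: "k (R `` {a}) = h (e a)" if a: "a \<in> carrier M" for a
  proof -
    have "a \<in> R `` {a}" using a cls by simp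
    then have "(SOME b. b \<in> R `` {a}) \<in> R `` {a}" by (rule someI)
    moreover have "\<forall>b\<in>R `` {a}. e b = e a" using cls[OF a] by simp
    ultimately have "e (SOME b. b \<in> R `` {a}) = e a" by (rule bspec[rotated])
    then show ?thesis by (simp add: k_def)
  qed
  let ?Q = "quotient_monoid M R"
  have car: "\<exists>a\<in>carrier M. A = R `` {a}" if "A \<in> carrier ?Q" for A
    using that by (auto simp: quotient_monoid_simps elim!: quotientE)
  have khom: "k \<in> top_hom ?Q N"
  proof (rule top_homI)
    show "k A \<in> carrier N" if "A \<in> carrier ?Q" for A
      using car[OF that] k top_homD(1)[OF N(2)] eD(1) by auto
    show "k (A \<otimes>\<^bsub>?Q\<^esub> B) = k A \<otimes>\<^bsub>N\<^esub> k B" if "A \<in> carrier ?Q" "B \<in> carrier ?Q" for A B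
    proof -
      from car[OF that(1)] car[OF that(2)]
      obtain a b where ab: "a \<in> carrier M" "A = R `` {a}" "b \<in> carrier M" "B = R `` {b}" by blast
      have "k (A \<otimes>\<^bsub>?Q\<^esub> B) = h (e (a \<otimes>\<^bsub>M\<^esub> b))"
        unfolding ab quotient_mult[OF cong ab(1,3)] using ab by (intro k) simp
      also have "\<dots> = k A \<otimes>\<^bsub>N\<^esub> k B"
        unfolding ab k[OF ab(1)] k[OF ab(3)] using ab eD top_homD(2)[OF N(2)] by simp
      finally show ?thesis .
    qed
    show "k \<one>\<^bsub>?Q\<^esub> = \<one>\<^bsub>N\<^esub>"
      unfolding quotient_monoid_simps k[OF one_closed] eD(3) by (rule top_homD(3)[OF N(2)])
    have c: "continuous_map (topo M) (topo N) (\<lambda>x. h (e x))"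
      using top_homD(4)[OF top_hom_comp[OF e N(2)]] .
    show "continuous_map (topo ?Q) (topo N) k"
      unfolding continuous_map_def quotient_monoid_simps topspace_quotient_topology openin_quotient_topology
    proof (intro conjI allI impI)
      show "k \<in> topspace (topo M) // R \<rightarrow> topspace (topo N)"
      proof
        fix A assume "A \<in> topspace (topo M) // R"
        then obtain a where a: "a \<in> carrier M" "A = R `` {a}" using top by (auto elim!: quotientE)
        then have "k A = h (e a)" using k by simp
        then show "k A \<in> topspace (topo N)" using c a(1) top by (auto simp: continuous_map_def)
      qed
      fix U assume "openin (topo N) U"
      then have "openin (topo M) {x \<in> topspace (topo M). h (e x) \<in> U}"
        using c by (simp add: continuous_map_def)
      moreover have "{x \<in> topspace (topo M). R `` {x} \<in> {A \<in> topspace (topo M) // R. k A \<in> U}} =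
          {x \<in> topspace (topo M). h (e x) \<in> U}"
        using k top by (auto intro: quotientI)
      ultimately show "openin (topo M) {x \<in> topspace (topo M). R `` {x} \<in> {A \<in> topspace (topo M) // R. k A \<in> U}}"
        by simp
    qed blast
  qed
  have "profinite_monoid ?Q"
  proof (rule profinite_monoidI[OF monoid_quotient[OF M cong]])
    show "topspace (topo ?Q) = carrier ?Q"
      by (simp add: quotient_monoid_simps topspace_quotient_topology top)
    have "compactin (quotient_topology (topo M) R) ((\<lambda>x. R `` {x}) ` topspace (topo M))"
      by (rule image_compactin[OF _ continuous_quotient]) (use comp in \<open>simp add: compact_space_def\<close>)
    moreover have "(\<lambda>x. R `` {x}) ` topspace (topo M) = topspace (quotient_topology (topo M) R)"
      by (auto simp: topspace_quotient_topology quotient_def)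
    ultimately show "compact_space (topo ?Q)" by (simp add: quotient_monoid_simps compact_space_def)
    fix A B assume AB: "A \<in> carrier ?Q" "B \<in> carrier ?Q" "A \<noteq> B"
    from car[OF AB(1)] car[OF AB(2)]
    obtain a b where ab: "a \<in> carrier M" "A = R `` {a}" "b \<in> carrier M" "B = R `` {b}" by blast
    then have "e a \<noteq> e b" using AB cls by auto
    then have "h (e a) \<noteq> h (e b)" using N(3) eD(1) ab by (meson inj_onD)
    then have "k A \<noteq> k B" using k ab by simp
    then show "\<exists>(F :: nat top_monoid) e. finite_discrete_monoid F \<and> e \<in> top_hom ?Q F \<and> e A \<noteq> e B"
      using N(1) khom by blast
  qed
  with cong show ?thesis by (simp add: profinite_congruence_def R_def)
qed

lemma min_profinite_congruence_separates:
  assumes M: "Group.monoid M" "topspace (topo M) = carrier M" "compact_space (topo M)"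
    and F: "finite_discrete_monoid F" and e: "e \<in> top_hom M F"
    and r: "\<And>a b. (a, b) \<in> r \<Longrightarrow> a \<in> carrier M \<and> b \<in> carrier M \<and> e a = e b"
    and ab: "(a, b) \<in> min_profinite_congruence M r"
  shows "e a = e b"
proof -
  have "(a, b) \<in> {(a, b) \<in> carrier M \<times> carrier M. e a = e b}"
    using ab kernel_profinite_congruence[OF M F e] r unfolding min_profinite_congruence_def by blast
  then show ?thesis by simp
qed

lemma min_profinite_congruence_incl: "r \<subseteq> min_profinite_congruence M r"
  by (auto simp: min_profinite_congruence_def)

section \<open>Generation of free products by the images of their factors\<close>

context
  fixes I :: "'i set" and D :: "'i \<Rightarrow> 'd top_monoid"
begin

private abbreviation "P \<equiv> prod_monoid (tests I D) fst"
private abbreviation "FP \<equiv> free_product I D"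

private lemma carrier_FP: "carrier FP =
    \<Inter>{C. submonoid C P \<and> closedin (topo P) C \<and> (\<Union>i\<in>I. free_incl I D i ` carrier (D i)) \<subseteq> C}"
  by (simp add: free_product_def Let_def)

private lemma FP_simps: "x \<otimes>\<^bsub>FP\<^esub> y = x \<otimes>\<^bsub>P\<^esub> y" "\<one>\<^bsub>FP\<^esub> = \<one>\<^bsub>P\<^esub>" "topo FP = subtopology (topo P) (carrier FP)"
  by (simp_all add: free_product_def Let_def)

lemma free_incl_closed: "i \<in> I \<Longrightarrow> x \<in> carrier (D i) \<Longrightarrow> free_incl I D i x \<in> carrier (free_product I D)"
  unfolding carrier_FP by blast

text \<open>The free product is compact, hence closed in the ambient product of all tests. A closed
  submonoid of it is then closed in that product too and competes in the intersection that defines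
  the free product.\<close>

lemma free_product_induct:
  assumes C: "submonoid C (free_product I D)" "closedin (topo (free_product I D)) C"
    and gen: "\<And>i x. i \<in> I \<Longrightarrow> x \<in> carrier (D i) \<Longrightarrow> free_incl I D i x \<in> C"
  shows "C = carrier (free_product I D)"
proof
  have P: "profinite_monoid P" by (rule prod_finite_discrete_profinite) (auto simp: tests_def)
  note FPD = profinite_monoidD[OF free_product_profinite[of I D]]
  show "C \<subseteq> carrier FP" using C(1) submonoid.subset by blast
  have top: "topspace (subtopology (topo P) (carrier FP)) = carrier FP" using FPD(2) FP_simps(3) by metis
  then have sub: "carrier FP \<subseteq> carrier P"
    unfolding topspace_subtopology profinite_monoidD(2)[OF P] by blast
  have "compactin (topo P) (carrier FP)"
    using FPD(3) unfolding compact_space_def FP_simps(3) top by (simp only: compactin_subtopology)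
  then have cl: "closedin (topo P) (carrier FP)"
    using profinite_monoidD(5)[OF P] by (rule compactin_imp_closedin[rotated])
  have "closedin (topo P) C" using C(2) cl unfolding FP_simps(3) by (rule closedin_trans_full)
  moreover have "submonoid C P"
  proof
    show "C \<subseteq> carrier P" using C(1) submonoid.subset sub by blast
    show "x \<otimes>\<^bsub>P\<^esub> y \<in> C" if "x \<in> C" "y \<in> C" for x y
      using submonoid.m_closed[OF C(1) that] by (simp only: FP_simps)
    show "\<one>\<^bsub>P\<^esub> \<in> C" using submonoid.one_closed[OF C(1)] by (simp only: FP_simps)
  qed
  ultimately show "carrier FP \<subseteq> C" unfolding carrier_FP using gen by blast
qed

text \<open>The version for \<open>Q_loc\<close>, whose carrier and topology have been matched,
  while continuity of its multiplication has not been established.\<close>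

lemma free_incl_top_hom_weak:
  assumes i: "i \<in> I" and D: "topspace (topo (D i)) = carrier (D i)"
  shows "free_incl I D i \<in> top_hom (D i) (free_product I D)"
proof (rule top_homI)
  show c: "free_incl I D i x \<in> carrier FP" if "x \<in> carrier (D i)" for x
    using free_incl_closed i that .
  show "continuous_map (topo (D i)) (topo FP) (free_incl I D i)"
    unfolding FP_simps(3)
    using c i
    by (auto simp: continuous_map_in_subtopology D continuous_map_componentwise free_incl_def
        tests_def top_hom_def split_def)
  show "free_incl I D i (x \<otimes>\<^bsub>D i\<^esub> y) = free_incl I D i x \<otimes>\<^bsub>FP\<^esub> free_incl I D i y"
    if "x \<in> carrier (D i)" "y \<in> carrier (D i)" for x y
    using i that by (auto simp: FP_simps free_incl_def fun_eq_iff tests_def top_hom_def hom_mult)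
  show "free_incl I D i \<one>\<^bsub>D i\<^esub> = \<one>\<^bsub>FP\<^esub>"
    using i by (auto simp: FP_simps free_incl_def fun_eq_iff tests_def top_hom_def)
qed

lemma free_product_hom_eq:
  assumes E: "profinite_monoid E" and f: "f \<in> top_hom (free_product I D) E" and g: "g \<in> top_hom (free_product I D) E"
    and gen: "\<And>i x. i \<in> I \<Longrightarrow> x \<in> carrier (D i) \<Longrightarrow> f (free_incl I D i x) = g (free_incl I D i x)"
    and z: "z \<in> carrier (free_product I D)"
  shows "f z = g z"
proof -
  note FPD = profinite_monoidD[OF free_product_profinite[of I D]]
  interpret FP: Group.monoid FP by (rule FPD)
  let ?C = "{d \<in> topspace (topo FP). f d = g d}"
  have "?C = carrier FP"
  proof (rule free_product_induct)
    show "submonoid ?C FP"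
      by (rule submonoid.intro) (auto simp: FPD(2) top_homD[OF f] top_homD[OF g])
    show "closedin (topo FP) ?C"
      by (rule closedin_continuous_maps_eq[OF profinite_monoidD(5)[OF E] top_homD(4)[OF f] top_homD(4)[OF g]])
    show "free_incl I D i x \<in> ?C" if "i \<in> I" "x \<in> carrier (D i)" for i x
      using gen free_incl_closed that by (simp add: FPD(2))
  qed
  then show ?thesis using z by blast
qed

end

section \<open>The free deformation\<close>

context local_setting
begin

lemma place: "v \<in> finite_primes UNIV \<Longrightarrow> local_place K v"
  using nf ac by (simp add: local_place_def local_place_axioms_def local_setting_def)

section \<open>Conjugation of the local monoids by Galois elements\<close>

lemma conj_frob_power:
  assumes s: "s \<in> carrier (gal K)" and r: "\<rho> \<in> frob_power K v n"
  shows "s \<circ> \<rho> \<circ> inv_into UNIV s \<in> frob_power K (s ` v) n"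
  unfolding frob_power_def
proof (intro CollectI conjI ballI)
  note si = gal_m_inv[OF s]
  show "s \<circ> \<rho> \<circ> inv_into UNIV s \<in> carrier (gal K)"
    using Gal.m_closed[OF Gal.m_closed[OF s frob_power_gal[OF r]] si(2)] by simp
  fix x assume x: "x \<in> integers (UNIV :: 'a set)"
  let ?y = "inv_into UNIV s x"
  have "?y \<in> integers UNIV" using x gal_integers_iff[OF s, of ?y] si(3) by simp
  then have "\<rho> ?y - ?y ^ (resq K v ^ n) \<in> v" using r by (simp add: frob_power_def)
  then have "s (\<rho> ?y - ?y ^ (resq K v ^ n)) \<in> s ` v" by (rule imageI)
  then show "(s \<circ> \<rho> \<circ> inv_into UNIV s) x - x ^ (resq K (s ` v) ^ n) \<in> s ` v"
    by (simp add: galD[OF s] si(3) resq_gal[OF s])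
qed

lemma conj_loc_simps:
  assumes "s \<in> carrier (gal K)"
  shows "conj_loc K s None = None" "conj_loc K s (Some \<rho>) = Some (s \<circ> \<rho> \<circ> inv_into UNIV s)"
  using gal_m_inv(1)[OF assms] by (simp_all add: conj_loc_def)

lemma conj_loc_comp:
  assumes s: "s \<in> carrier (gal K)" and t: "t \<in> carrier (gal K)"
  shows "conj_loc K (s \<circ> t) x = conj_loc K s (conj_loc K t x)"
proof -
  have st: "s \<circ> t \<in> carrier (gal K)" using Gal.m_closed[OF s t] by simp
  have "inv_into UNIV (s \<circ> t) = inv_into UNIV t \<circ> inv_into UNIV s"
    using galD(1)[OF s] galD(1)[OF t] by (rule o_inv_distrib)
  then show ?thesis
    using conj_loc_simps[OF s] conj_loc_simps[OF t] conj_loc_simps[OF st] by (cases x) (simp_all add: comp_assoc)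
qed

lemma conj_loc_id: "conj_loc K id x = x"
  using conj_loc_simps[OF Gal.one_closed] by (cases x) (simp_all add: inv_id)

lemma conj_loc_inv:
  assumes s: "s \<in> carrier (gal K)"
  shows "conj_loc K (inv_into UNIV s) (conj_loc K s x) = x" "conj_loc K s (conj_loc K (inv_into UNIV s) x) = x"
proof -
  note si = gal_m_inv[OF s]
  have "inv_into UNIV s \<circ> s = id" "s \<circ> inv_into UNIV s = id" using si by auto
  then show "conj_loc K (inv_into UNIV s) (conj_loc K s x) = x" "conj_loc K s (conj_loc K (inv_into UNIV s) x) = x"
    using conj_loc_comp[OF s si(2), of x] conj_loc_comp[OF si(2) s, of x] by (simp_all add: conj_loc_id)
qed

lemma continuous_map_conj_weil:
  assumes s: "s \<in> carrier (gal K)" and v: "v \<in> finite_primes UNIV"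
  shows "continuous_map (weil_topology K v) (weil_topology K (s ` v)) (\<lambda>\<rho>. s \<circ> \<rho> \<circ> inv_into UNIV s)"
proof -
  interpret v: local_place K v by (rule place[OF v])
  interpret sv: local_place K "s ` v" by (rule place[OF gal_finite_primes[OF s v]])
  let ?c = "\<lambda>\<rho>. s \<circ> \<rho> \<circ> inv_into UNIV s"
  show ?thesis
    unfolding continuous_map_def
  proof (intro conjI allI impI)
    show "?c \<in> topspace (weil_topology K v) \<rightarrow> topspace (weil_topology K (s ` v))"
      unfolding v.topspace_weil sv.topspace_weil v.weil_monoid_eq sv.weil_monoid_eq
      using conj_frob_power[OF s] by blast
    fix U assume U: "openin (weil_topology K (s ` v)) U"
    show "openin (weil_topology K v) {x \<in> topspace (weil_topology K v). ?c x \<in> U}"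
      unfolding v.openin_weil_iff
    proof (intro conjI allI ballI)
      show "{x \<in> topspace (weil_topology K v). ?c x \<in> U} \<subseteq> weil_monoid K v" by (auto simp: v.topspace_weil)
      fix n \<sigma> assume a: "\<sigma> \<in> {x \<in> topspace (weil_topology K v). ?c x \<in> U} \<inter> frob_power K v n"
      then have "?c \<sigma> \<in> U \<inter> frob_power K (s ` v) n" using conj_frob_power[OF s] by blast
      then obtain B where B: "finite B" "\<forall>\<rho>\<in>frob_power K (s ` v) n. (\<forall>b\<in>B. \<rho> b = ?c \<sigma> b) \<longrightarrow> \<rho> \<in> U"
        using U unfolding sv.openin_weil_iff by meson
      have "\<rho> \<in> {x \<in> topspace (weil_topology K v). ?c x \<in> U}"
        if r: "\<rho> \<in> frob_power K v n" "\<forall>b\<in>inv_into UNIV s ` B. \<rho> b = \<sigma> b" for \<rho>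
      proof -
        have "?c \<rho> \<in> U" using bspec[OF B(2) conj_frob_power[OF s r(1)]] r(2) by simp
        moreover have "\<rho> \<in> topspace (weil_topology K v)"
          unfolding v.topspace_weil v.weil_monoid_eq using r(1) by blast
        ultimately show ?thesis by blast
      qed
      then show "\<exists>B. finite B \<and> (\<forall>\<rho>\<in>frob_power K v n. (\<forall>b\<in>B. \<rho> b = \<sigma> b) \<longrightarrow> \<rho> \<in> {x \<in> topspace (weil_topology K v). ?c x \<in> U})"
        using B(1) by (intro exI[of _ "inv_into UNIV s ` B"]) blast
    qed
  qed
qed

lemma conj_loc_top_hom:
  assumes s: "s \<in> carrier (gal K)" and v: "v \<in> finite_primes UNIV"
  shows "conj_loc K s \<in> top_hom (Q_loc K v) (Q_loc K (s ` v))"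
proof -
  note si = gal_m_inv[OF s]
  note sv = gal_finite_primes[OF s v]
  interpret v: local_place K v by (rule place[OF v])
  interpret sv: local_place K "s ` v" by (rule place[OF sv])
  let ?i = "inv_into UNIV s"
  let ?c = "\<lambda>\<rho>. s \<circ> \<rho> \<circ> ?i" and ?d = "\<lambda>\<rho>. ?i \<circ> \<rho> \<circ> inv_into UNIV ?i"
  have isv: "?i ` (s ` v) = v" using si(4) by (simp add: image_image)
  note cs = conj_loc_simps[OF s] and ci = conj_loc_simps[OF si(2)]
  have dc: "?d (?c \<rho>) = \<rho>" "?c (?d \<rho>) = \<rho>" for \<rho>
    using conj_loc_inv[OF s, of "Some \<rho>"] unfolding cs ci by simp_all
  have cc: "continuous_map (weil_topology K v) (weil_topology K (s ` v)) ?c"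
    by (rule continuous_map_conj_weil[OF s v])
  have cd: "continuous_map (weil_topology K (s ` v)) (weil_topology K v) ?d"
    using continuous_map_conj_weil[OF si(2) sv] unfolding isv .
  have car: "conj_loc K s x \<in> carrier (Q_loc K (s ` v))" if "x \<in> carrier (Q_loc K v)" for x
    using that conj_frob_power[OF s] by (fastforce simp: v.carrier_Q_loc sv.carrier_Q_loc cs)
  show ?thesis
  proof (rule top_homI)
    show "conj_loc K s x \<in> carrier (Q_loc K (s ` v))" if "x \<in> carrier (Q_loc K v)" for x
      using car[OF that] .
    show "conj_loc K s (x \<otimes>\<^bsub>Q_loc K v\<^esub> y) = conj_loc K s x \<otimes>\<^bsub>Q_loc K (s ` v)\<^esub> conj_loc K s y" for x y
      by (cases x; cases y) (simp_all add: v.Q_loc_simps sv.Q_loc_simps cs fun_eq_iff si)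
    show "conj_loc K s \<one>\<^bsub>Q_loc K v\<^esub> = \<one>\<^bsub>Q_loc K (s ` v)\<^esub>"
      by (simp add: v.Q_loc_simps sv.Q_loc_simps cs fun_eq_iff si)
    show "continuous_map (topo (Q_loc K v)) (topo (Q_loc K (s ` v))) (conj_loc K s)"
      unfolding continuous_map_def
    proof (intro conjI allI impI)
      show "conj_loc K s \<in> topspace (topo (Q_loc K v)) \<rightarrow> topspace (topo (Q_loc K (s ` v)))"
        using car by (auto simp: v.topspace_Q_loc sv.topspace_Q_loc)
      fix V assume "openin (topo (Q_loc K (s ` v))) V"
      then consider (fin) U where "openin (weil_topology K (s ` v)) U" "V = Some ` U"
        | (inf) C where "compactin (weil_topology K (s ` v)) C" "closedin (weil_topology K (s ` v)) C"
            "V = insert None (Some ` (topspace (weil_topology K (s ` v)) - C))"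
        by (auto simp: Q_loc_def openin_Alexandroff_compactification)
      then show "openin (topo (Q_loc K v)) {x \<in> topspace (topo (Q_loc K v)). conj_loc K s x \<in> V}"
      proof cases
        case fin
        have "{x \<in> topspace (topo (Q_loc K v)). conj_loc K s x \<in> V} = Some ` {w \<in> topspace (weil_topology K v). ?c w \<in> U}"
          unfolding v.topspace_Q_loc v.topspace_weil by (auto simp: v.carrier_Q_loc v.weil_monoid_eq cs fin(2))
        moreover have "openin (weil_topology K v) {w \<in> topspace (weil_topology K v). ?c w \<in> U}"
          using cc fin(1) by (simp add: continuous_map_def)
        ultimately show ?thesis by (simp add: Q_loc_def)
      next
        case inf
        have tv: "\<And>w. w \<in> topspace (weil_topology K v) \<Longrightarrow> ?c w \<in> topspace (weil_topology K (s ` v))"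
          using cc by (auto simp: continuous_map_def)
        \<comment> \<open>The preimage of \<open>C\<close> under conjugation is its image under the
          inverse conjugation: closed by the first description, compact by the second. This gives
          continuity at the zero.\<close>
        have e: "{w \<in> topspace (weil_topology K v). ?c w \<in> C} = ?d ` C"
        proof
          show "{w \<in> topspace (weil_topology K v). ?c w \<in> C} \<subseteq> ?d ` C" using dc(1) by (metis (no_types, lifting) image_eqI mem_Collect_eq subsetI)
          show "?d ` C \<subseteq> {w \<in> topspace (weil_topology K v). ?c w \<in> C}"
            using cd compactin_subset_topspace[OF inf(1)] dc(2) by (auto simp: continuous_map_def)
        qed
        have "compactin (weil_topology K v) (?d ` C)" using inf(1) cd by (rule image_compactin)
        moreover have "closedin (weil_topology K v) (?d ` C)"
          using closedin_continuous_map_preimage[OF cc inf(2)] unfolding e .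
        moreover have "{x \<in> topspace (topo (Q_loc K v)). conj_loc K s x \<in> V} =
            insert None (Some ` (topspace (weil_topology K v) - ?d ` C))"
        proof -
          have "{x \<in> insert None (Some ` W). conj_loc K s x \<in> V} = insert None (Some ` {w \<in> W. ?c w \<in> topspace (weil_topology K (s ` v)) - C})" for W
            by (auto simp: cs inf(3))
          moreover have "{w \<in> topspace (weil_topology K v). ?c w \<in> topspace (weil_topology K (s ` v)) - C} = topspace (weil_topology K v) - ?d ` C"
            unfolding e[symmetric] using tv by auto
          ultimately show ?thesis by (simp add: Q_loc_def)
        qed
        ultimately show ?thesis unfolding Q_loc_def using openin_Alexandroff_compactification by fastforce
      qed
    qed
  qed
qed

section \<open>Free products over finitely many primes, their projections and the Galois
  action\<close>

lemma Q_fin_profinite: "profinite_monoid (Q_fin K S)"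
  unfolding Q_fin_def by (rule free_product_profinite)

lemmas Q_finD = profinite_monoidD[OF Q_fin_profinite]

lemma Q_incl_top_hom:
  assumes v: "v \<in> finite_primes UNIV"
  shows "Q_incl K S v \<in> top_hom (Q_loc K v) (Q_fin K S)"
proof -
  interpret v: local_place K v by (rule place[OF v])
  show ?thesis
  proof (cases "v \<in> primes_over K S")
    case True
    have "Q_incl K S v = free_incl (primes_over K S) (Q_loc K) v" using True by (auto simp: Q_incl_def)
    then show ?thesis
      unfolding Q_fin_def using free_incl_top_hom_weak[where D = "Q_loc K" and i = v, OF True v.topspace_Q_loc] by simp
  next
    case False
    have "Q_incl K S v = (\<lambda>x. \<one>\<^bsub>Q_fin K S\<^esub>)" using False by (auto simp: Q_incl_def)
    then show ?thesis using top_hom_one[OF Q_finD(1,2)] by simp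
  qed
qed

lemma primes_over_place: "v \<in> primes_over K S \<Longrightarrow> v \<in> finite_primes UNIV"
  by (simp add: primes_over_def)

lemma primes_over_gal:
  assumes "s \<in> carrier (gal K)" "v \<in> finite_primes UNIV"
  shows "s ` v \<in> primes_over K S \<longleftrightarrow> v \<in> primes_over K S"
  using assms gal_finite_primes by (auto simp: primes_over_def below_gal)

lemma Q_fin_hom_eq:
  assumes E: "profinite_monoid E" and f: "f \<in> top_hom (Q_fin K S) E" and g: "g \<in> top_hom (Q_fin K S) E"
    and gen: "\<And>v x. v \<in> primes_over K S \<Longrightarrow> x \<in> carrier (Q_loc K v) \<Longrightarrow> f (Q_incl K S v x) = g (Q_incl K S v x)"
    and z: "z \<in> carrier (Q_fin K S)"
  shows "f z = g z"
proof (rule free_product_hom_eq[OF E f[unfolded Q_fin_def] g[unfolded Q_fin_def] _ z[unfolded Q_fin_def]])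
  fix v x assume "v \<in> primes_over K S" "x \<in> carrier (Q_loc K v)"
  then show "f (free_incl (primes_over K S) (Q_loc K) v x) = g (free_incl (primes_over K S) (Q_loc K) v x)"
    using gen[of v x] by (simp add: Q_incl_def)
qed

lemma Q_fin_lift:
  assumes E: "profinite_monoid E" and h: "\<And>v. v \<in> primes_over K S \<Longrightarrow> h v \<in> top_hom (Q_loc K v) E"
  shows "free_lift (primes_over K S) (Q_loc K) E h \<in> top_hom (Q_fin K S) E"
    "v \<in> primes_over K S \<Longrightarrow> x \<in> carrier (Q_loc K v) \<Longrightarrow>
       free_lift (primes_over K S) (Q_loc K) E h (Q_incl K S v x) = h v x"
  using free_lift[OF E h, of "primes_over K S"] by (auto simp: Q_fin_def Q_incl_def)

lemma Q_proj_top_hom: "Q_proj K S S' \<in> top_hom (Q_fin K S') (Q_fin K S)"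
  unfolding Q_proj_def by (intro Q_fin_lift Q_fin_profinite Q_incl_top_hom primes_over_place)

lemma Q_proj_incl:
  assumes "S \<subseteq> S'" "v \<in> finite_primes UNIV" "x \<in> carrier (Q_loc K v)"
  shows "Q_proj K S S' (Q_incl K S' v x) = Q_incl K S v x"
proof (cases "v \<in> primes_over K S'")
  case True
  then show ?thesis
    unfolding Q_proj_def by (intro Q_fin_lift Q_fin_profinite Q_incl_top_hom primes_over_place assms)
next
  case False
  then have "v \<notin> primes_over K S" using assms(1) by (auto simp: primes_over_def)
  then show ?thesis using False top_homD(3)[OF Q_proj_top_hom] by (simp add: Q_incl_def)
qed

lemma Q_fin_act_hom:
  assumes s: "s \<in> carrier (gal K)"
  shows "Q_fin_act K S s \<in> top_hom (Q_fin K S) (Q_fin K S)"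
    "v \<in> finite_primes UNIV \<Longrightarrow> x \<in> carrier (Q_loc K v) \<Longrightarrow>
      Q_fin_act K S s (Q_incl K S v x) = Q_incl K S (s ` v) (conj_loc K s x)"
proof -
  have h: "(\<lambda>x. Q_incl K S (s ` v) (conj_loc K s x)) \<in> top_hom (Q_loc K v) (Q_fin K S)"
    if "v \<in> finite_primes UNIV" for v
    by (rule top_hom_comp[OF conj_loc_top_hom[OF s that] Q_incl_top_hom[OF gal_finite_primes[OF s that]]])
  show hom: "Q_fin_act K S s \<in> top_hom (Q_fin K S) (Q_fin K S)"
    unfolding Q_fin_act_def by (intro Q_fin_lift Q_fin_profinite h primes_over_place)
  assume v: "v \<in> finite_primes UNIV" and x: "x \<in> carrier (Q_loc K v)"
  show "Q_fin_act K S s (Q_incl K S v x) = Q_incl K S (s ` v) (conj_loc K s x)"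
  proof (cases "v \<in> primes_over K S")
    case True
    then show ?thesis
      unfolding Q_fin_act_def by (intro Q_fin_lift Q_fin_profinite h primes_over_place x)
  next
    case False
    then show ?thesis using primes_over_gal[OF s v] top_homD(3)[OF hom] by (simp add: Q_incl_def)
  qed
qed

lemma Q_fin_act_comp:
  assumes s: "s \<in> carrier (gal K)" and t: "t \<in> carrier (gal K)" and z: "z \<in> carrier (Q_fin K S)"
  shows "Q_fin_act K S (s \<circ> t) z = Q_fin_act K S s (Q_fin_act K S t z)"
proof (rule Q_fin_hom_eq[OF Q_fin_profinite Q_fin_act_hom(1) _ _ z])
  show st: "s \<circ> t \<in> carrier (gal K)" using Gal.m_closed[OF s t] by simp
  show "(\<lambda>z. Q_fin_act K S s (Q_fin_act K S t z)) \<in> top_hom (Q_fin K S) (Q_fin K S)"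
    by (rule top_hom_comp[OF Q_fin_act_hom(1)[OF t] Q_fin_act_hom(1)[OF s]])
  fix v x assume "v \<in> primes_over K S" and x: "x \<in> carrier (Q_loc K v)"
  then have v: "v \<in> finite_primes UNIV" by (simp add: primes_over_def)
  show "Q_fin_act K S (s \<circ> t) (Q_incl K S v x) = Q_fin_act K S s (Q_fin_act K S t (Q_incl K S v x))"
    using top_homD(1)[OF conj_loc_top_hom[OF t v] x] gal_finite_primes[OF t v]
    by (simp add: Q_fin_act_hom(2)[OF st v x] Q_fin_act_hom(2)[OF t v x] Q_fin_act_hom(2)[OF s] conj_loc_comp[OF s t] image_image)
qed

lemma Q_fin_act_id:
  assumes z: "z \<in> carrier (Q_fin K S)"
  shows "Q_fin_act K S id z = z"
proof (rule Q_fin_hom_eq[OF Q_fin_profinite Q_fin_act_hom(1) _ _ z])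
  show i: "id \<in> carrier (gal K)" using Gal.one_closed by simp
  show "(\<lambda>z. z) \<in> top_hom (Q_fin K S) (Q_fin K S)" by (rule top_homI) auto
  fix v x assume "v \<in> primes_over K S" and x: "x \<in> carrier (Q_loc K v)"
  then have v: "v \<in> finite_primes UNIV" by (simp add: primes_over_def)
  show "Q_fin_act K S id (Q_incl K S v x) = Q_incl K S v x"
    using Q_fin_act_hom(2)[OF i v x] by (simp add: conj_loc_id)
qed

lemma Q_fin_act_proj:
  assumes s: "s \<in> carrier (gal K)" and S: "S \<subseteq> S'" and z: "z \<in> carrier (Q_fin K S')"
  shows "Q_proj K S S' (Q_fin_act K S' s z) = Q_fin_act K S s (Q_proj K S S' z)"
proof (rule Q_fin_hom_eq[OF Q_fin_profinite top_hom_comp[OF Q_fin_act_hom(1)[OF s] Q_proj_top_hom]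
      top_hom_comp[OF Q_proj_top_hom Q_fin_act_hom(1)[OF s]] _ z])
  fix v x assume "v \<in> primes_over K S'" and x: "x \<in> carrier (Q_loc K v)"
  then have v: "v \<in> finite_primes UNIV" by (simp add: primes_over_def)
  show "Q_proj K S S' (Q_fin_act K S' s (Q_incl K S' v x)) = Q_fin_act K S s (Q_proj K S S' (Q_incl K S' v x))"
    using Q_fin_act_hom(2)[OF s v x] Q_proj_incl[OF S v x]
      Q_proj_incl[OF S gal_finite_primes[OF s v] top_homD(1)[OF conj_loc_top_hom[OF s v] x]] by simp
qed

section \<open>The inverse limit of these free products\<close>

lemma Q_hat_simps:
  "carrier (Q_hat K) = {x \<in> (\<Pi>\<^sub>E S\<in>finite_sets K. carrier (Q_fin K S)). \<forall>S\<in>finite_sets K. \<forall>S'\<in>finite_sets K.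
     S \<subseteq> S' \<longrightarrow> Q_proj K S S' (x S') = x S}"
  "x \<otimes>\<^bsub>Q_hat K\<^esub> y = (\<lambda>S\<in>finite_sets K. x S \<otimes>\<^bsub>Q_fin K S\<^esub> y S)"
  "\<one>\<^bsub>Q_hat K\<^esub> = (\<lambda>S\<in>finite_sets K. \<one>\<^bsub>Q_fin K S\<^esub>)"
  "topo (Q_hat K) = subtopology (product_topology (\<lambda>S. topo (Q_fin K S)) (finite_sets K)) (carrier (Q_hat K))"
  by (simp_all add: Q_hat_def inv_limit_def)

lemma Q_hatD:
  assumes "x \<in> carrier (Q_hat K)"
  shows "S \<in> finite_sets K \<Longrightarrow> x S \<in> carrier (Q_fin K S)"
    "S \<in> finite_sets K \<Longrightarrow> S' \<in> finite_sets K \<Longrightarrow> S \<subseteq> S' \<Longrightarrow> Q_proj K S S' (x S') = x S"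
    "x \<in> extensional (finite_sets K)"
  using assms by (auto simp: Q_hat_simps PiE_iff)

lemma Q_hatI:
  assumes "\<And>S. S \<in> finite_sets K \<Longrightarrow> f S \<in> carrier (Q_fin K S)"
    "\<And>S S'. S \<in> finite_sets K \<Longrightarrow> S' \<in> finite_sets K \<Longrightarrow> S \<subseteq> S' \<Longrightarrow> Q_proj K S S' (f S') = f S"
  shows "(\<lambda>S\<in>finite_sets K. f S) \<in> carrier (Q_hat K)"
  using assms by (auto simp: Q_hat_simps)

lemma Q_hat_eqI:
  assumes "x \<in> carrier (Q_hat K)" "y \<in> carrier (Q_hat K)" "\<And>S. S \<in> finite_sets K \<Longrightarrow> x S = y S"
  shows "x = y"
  using assms by (intro extensionalityI[OF Q_hatD(3) Q_hatD(3)]) auto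

lemma Q_hat_mult_closed: "x \<in> carrier (Q_hat K) \<Longrightarrow> y \<in> carrier (Q_hat K) \<Longrightarrow> x \<otimes>\<^bsub>Q_hat K\<^esub> y \<in> carrier (Q_hat K)"
  unfolding Q_hat_simps(2)
  by (intro Q_hatI) (auto simp: top_homD(2)[OF Q_proj_top_hom] Q_hatD intro!: monoid.m_closed[OF Q_finD(1)])

lemma Q_hat_one_closed: "\<one>\<^bsub>Q_hat K\<^esub> \<in> carrier (Q_hat K)"
  unfolding Q_hat_simps(3)
  by (intro Q_hatI) (auto simp: top_homD(3)[OF Q_proj_top_hom] intro!: monoid.one_closed[OF Q_finD(1)])

lemma Q_hat_monoid: "Group.monoid (Q_hat K)"
proof (rule monoidI)
  fix x y z assume xyz: "x \<in> carrier (Q_hat K)" "y \<in> carrier (Q_hat K)" "z \<in> carrier (Q_hat K)"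
  show "x \<otimes>\<^bsub>Q_hat K\<^esub> y \<otimes>\<^bsub>Q_hat K\<^esub> z = x \<otimes>\<^bsub>Q_hat K\<^esub> (y \<otimes>\<^bsub>Q_hat K\<^esub> z)"
    by (rule Q_hat_eqI[OF Q_hat_mult_closed[OF Q_hat_mult_closed[OF xyz(1,2)] xyz(3)]
          Q_hat_mult_closed[OF xyz(1) Q_hat_mult_closed[OF xyz(2,3)]]])
      (simp add: Q_hat_simps(2) Q_hatD(1) xyz monoid.m_assoc[OF Q_finD(1)])
next
  fix x assume x: "x \<in> carrier (Q_hat K)"
  show "\<one>\<^bsub>Q_hat K\<^esub> \<otimes>\<^bsub>Q_hat K\<^esub> x = x"
    by (rule Q_hat_eqI[OF Q_hat_mult_closed[OF Q_hat_one_closed x] x])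
      (simp add: Q_hat_simps(2,3) Q_hatD(1) x monoid.l_one[OF Q_finD(1)])
  show "x \<otimes>\<^bsub>Q_hat K\<^esub> \<one>\<^bsub>Q_hat K\<^esub> = x"
    by (rule Q_hat_eqI[OF Q_hat_mult_closed[OF x Q_hat_one_closed] x])
      (simp add: Q_hat_simps(2,3) Q_hatD(1) x monoid.r_one[OF Q_finD(1)])
qed (auto intro: Q_hat_mult_closed Q_hat_one_closed)

lemma topspace_Q_hat: "topspace (topo (Q_hat K)) = carrier (Q_hat K)"
  by (subst Q_hat_simps(4)) (auto simp: Q_finD(2) Q_hat_simps(1))

lemma Q_hat_proj_continuous: "S \<in> finite_sets K \<Longrightarrow> continuous_map (topo (Q_hat K)) (topo (Q_fin K S)) (\<lambda>x. x S)"
  unfolding Q_hat_simps(4)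
  by (intro continuous_map_from_subtopology continuous_map_product_projection)

lemma compact_Q_hat: "compact_space (topo (Q_hat K))"
proof -
  let ?T = "product_topology (\<lambda>S. topo (Q_fin K S)) (finite_sets K)"
  have top: "topspace ?T = (\<Pi>\<^sub>E S\<in>finite_sets K. carrier (Q_fin K S))" by (simp add: Q_finD(2))
  define \<A> where "\<A> = insert (topspace ?T) {{x \<in> topspace ?T. Q_proj K S S' (x S') = x S} | S S'. S \<in> finite_sets K \<and> S' \<in> finite_sets K \<and> S \<subseteq> S'}"
  have "closedin ?T A" if A: "A \<in> \<A>" for A
  proof (cases "A = topspace ?T")
    case False
    then obtain S S' where S: "S \<in> finite_sets K" "S' \<in> finite_sets K" "S \<subseteq> S'"
      "A = {x \<in> topspace ?T. Q_proj K S S' (x S') = x S}" using A by (auto simp: \<A>_def)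
    have "continuous_map ?T (topo (Q_fin K S)) (\<lambda>x. Q_proj K S S' (x S'))"
      using continuous_map_compose[OF continuous_map_product_projection[OF S(2)] top_homD(4)[OF Q_proj_top_hom]]
      by (simp add: o_def)
    then show ?thesis
      unfolding S(4) using Q_finD(5) continuous_map_product_projection[OF S(1)]
      by (intro closedin_continuous_maps_eq)
  next
    case True
    show ?thesis unfolding True by (rule closedin_topspace)
  qed
  then have "closedin ?T (\<Inter>\<A>)" by (intro closedin_Inter) (auto simp: \<A>_def)
  moreover have "\<Inter>\<A> = carrier (Q_hat K)"
    unfolding Q_hat_simps(1) top[symmetric] \<A>_def by auto
  moreover have "compact_space ?T" using Q_finD(3) by (simp add: compact_space_product_topology)
  ultimately show ?thesis
    unfolding Q_hat_simps(4) using closedin_compact_space compact_space_subtopology by metis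
qed

lemma Q_hat_incl_top_hom:
  assumes v: "v \<in> finite_primes UNIV"
  shows "Q_hat_incl K v \<in> top_hom (Q_loc K v) (Q_hat K)"
proof -
  note I = Q_incl_top_hom[OF v]
  interpret v: local_place K v by (rule place[OF v])
  have c: "Q_hat_incl K v x \<in> carrier (Q_hat K)" if "x \<in> carrier (Q_loc K v)" for x
    unfolding Q_hat_incl_def using that by (intro Q_hatI top_homD(1)[OF I] Q_proj_incl v)
  show ?thesis
  proof (rule top_homI)
    show "Q_hat_incl K v x \<in> carrier (Q_hat K)" if "x \<in> carrier (Q_loc K v)" for x using c that .
    show "Q_hat_incl K v (x \<otimes>\<^bsub>Q_loc K v\<^esub> y) = Q_hat_incl K v x \<otimes>\<^bsub>Q_hat K\<^esub> Q_hat_incl K v y"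
      if "x \<in> carrier (Q_loc K v)" "y \<in> carrier (Q_loc K v)" for x y
      using that by (auto simp: Q_hat_incl_def Q_hat_simps(2) top_homD(2)[OF I] fun_eq_iff)
    show "Q_hat_incl K v \<one>\<^bsub>Q_loc K v\<^esub> = \<one>\<^bsub>Q_hat K\<^esub>"
      by (auto simp: Q_hat_incl_def Q_hat_simps(3) top_homD(3)[OF I] fun_eq_iff)
    show "continuous_map (topo (Q_loc K v)) (topo (Q_hat K)) (Q_hat_incl K v)"
      unfolding Q_hat_simps(4) continuous_map_in_subtopology continuous_map_componentwise
      using c top_homD(4)[OF I] by (auto simp: v.topspace_Q_loc Q_hat_incl_def cong: restrict_cong)
  qed
qed

lemma Q_hat_act_closed:
  assumes s: "s \<in> carrier (gal K)" and x: "x \<in> carrier (Q_hat K)"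
  shows "Q_hat_act K s x \<in> carrier (Q_hat K)"
  unfolding Q_hat_act_def
  using Q_hatD[OF x] by (intro Q_hatI) (auto simp: Q_fin_act_proj[OF s] intro: top_homD(1)[OF Q_fin_act_hom(1)[OF s]])

lemma Q_hat_act_mult:
  assumes s: "s \<in> carrier (gal K)" and "x \<in> carrier (Q_hat K)" "y \<in> carrier (Q_hat K)"
  shows "Q_hat_act K s (x \<otimes>\<^bsub>Q_hat K\<^esub> y) = Q_hat_act K s x \<otimes>\<^bsub>Q_hat K\<^esub> Q_hat_act K s y"
  using Q_hatD(1)[OF assms(2)] Q_hatD(1)[OF assms(3)]
  by (auto simp: Q_hat_act_def Q_hat_simps(2) fun_eq_iff top_homD(2)[OF Q_fin_act_hom(1)[OF s]])

lemma Q_hat_act_one: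
  assumes s: "s \<in> carrier (gal K)"
  shows "Q_hat_act K s \<one>\<^bsub>Q_hat K\<^esub> = \<one>\<^bsub>Q_hat K\<^esub>"
  by (auto simp: Q_hat_act_def Q_hat_simps(3) fun_eq_iff top_homD(3)[OF Q_fin_act_hom(1)[OF s]])

lemma Q_hat_act_comp:
  assumes "s \<in> carrier (gal K)" "t \<in> carrier (gal K)" "x \<in> carrier (Q_hat K)"
  shows "Q_hat_act K (s \<circ> t) x = Q_hat_act K s (Q_hat_act K t x)"
  using Q_hatD(1)[OF assms(3)] by (auto simp: Q_hat_act_def fun_eq_iff Q_fin_act_comp[OF assms(1,2)])

lemma Q_hat_act_id: "x \<in> carrier (Q_hat K) \<Longrightarrow> Q_hat_act K id x = x"
  using Q_hatD(1,3) by (intro extensionalityI[of _ "finite_sets K"]) (auto simp: Q_hat_act_def Q_fin_act_id)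

section \<open>The semidirect product and its quotient, the free deformation\<close>

abbreviation "M \<equiv> Q_hat_semidirect K"

lemma M_simps:
  "carrier M = carrier (Q_hat K) \<times> carrier (gal K)"
  "(\<rho>, \<sigma>) \<otimes>\<^bsub>M\<^esub> (\<rho>', \<sigma>') = (\<rho> \<otimes>\<^bsub>Q_hat K\<^esub> Q_hat_act K \<sigma> \<rho>', \<sigma> \<circ> \<sigma>')"
  "\<one>\<^bsub>M\<^esub> = (\<one>\<^bsub>Q_hat K\<^esub>, id)" "topo M = prod_topology (topo (Q_hat K)) (topo (gal K))"
  by (simp_all add: Q_hat_semidirect_def semidirect_def)

lemma M_monoid: "Group.monoid M"
proof (rule monoidI)
  note Q = monoid.m_assoc[OF Q_hat_monoid] monoid.l_one[OF Q_hat_monoid] monoid.r_one[OF Q_hat_monoid]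
  have comp: "\<sigma> \<circ> \<tau> \<in> carrier (gal K)" if "\<sigma> \<in> carrier (gal K)" "\<tau> \<in> carrier (gal K)" for \<sigma> \<tau>
    using Gal.m_closed[OF that] by simp
  have id: "id \<in> carrier (gal K)" using Gal.one_closed by simp
  fix x y z assume "x \<in> carrier M" "y \<in> carrier M" "z \<in> carrier M"
  then show "x \<otimes>\<^bsub>M\<^esub> y \<otimes>\<^bsub>M\<^esub> z = x \<otimes>\<^bsub>M\<^esub> (y \<otimes>\<^bsub>M\<^esub> z)"
    by (auto simp: M_simps Q_hat_act_mult Q_hat_act_closed Q_hat_act_comp Q comp_assoc)
qed (use Gal.m_closed Gal.one_closed in \<open>auto simp: M_simps Q_hat_mult_closed Q_hat_one_closed Q_hat_act_closed
  Q_hat_act_one Q_hat_act_id monoid.l_one[OF Q_hat_monoid] monoid.r_one[OF Q_hat_monoid]\<close>)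

lemma topspace_M: "topspace (topo M) = carrier M"
  by (simp add: M_simps topspace_Q_hat)

lemma compact_M: "compact_space (topo M)"
  using compact_Q_hat compact_gal[OF ac] by (simp add: M_simps compact_space_prod_topology)

lemma inertia_rel_carrier: "inertia_rel K \<subseteq> carrier M \<times> carrier M"
proof -
  have "Q_hat_incl K v (Some u) \<in> carrier (Q_hat K)" "u \<in> carrier (gal K)"
    if v: "v \<in> finite_primes UNIV" and u: "u \<in> inertia K v" for v u
  proof -
    interpret v: local_place K v by (rule place[OF v])
    have "Some u \<in> carrier (Q_loc K v)" using u unfolding v.carrier_Q_loc v.inertia_eq by blast
    then show "Q_hat_incl K v (Some u) \<in> carrier (Q_hat K)" by (rule top_homD(1)[OF Q_hat_incl_top_hom[OF v]])
    show "u \<in> carrier (gal K)" using u unfolding v.inertia_eq by (rule frob_power_gal)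
  qed
  then show ?thesis
    using Gal.m_closed Gal.inv_closed by (auto simp: inertia_rel_def M_simps Q_hat_mult_closed)
qed

lemma DG_profinite: "profinite_monoid (DG K)"
  using profinite_min_congruence[OF M_monoid topspace_M compact_M inertia_rel_carrier]
  by (simp add: DG_def profinite_congruence_def)

definition DG_class where
  "DG_class a = min_profinite_congruence M (inertia_rel K) `` {a}"

lemma DG_class_top_hom: "DG_class \<in> top_hom M (DG K)"
proof -
  let ?R = "min_profinite_congruence M (inertia_rel K)"
  have cong: "congruence M ?R"
    using profinite_min_congruence[OF M_monoid topspace_M compact_M inertia_rel_carrier]
    by (simp add: profinite_congruence_def)
  show ?thesis
  proof (rule top_homI)
    show "DG_class x \<in> carrier (DG K)" if "x \<in> carrier M" for x
      using that by (simp add: DG_def DG_class_def quotient_monoid_simps quotientI)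
    show "DG_class (x \<otimes>\<^bsub>M\<^esub> y) = DG_class x \<otimes>\<^bsub>DG K\<^esub> DG_class y" if "x \<in> carrier M" "y \<in> carrier M" for x y
      using quotient_mult[OF cong that] by (simp add: DG_def DG_class_def)
    show "DG_class \<one>\<^bsub>M\<^esub> = \<one>\<^bsub>DG K\<^esub>" by (simp add: DG_def DG_class_def quotient_monoid_simps)
    show "continuous_map (topo M) (topo (DG K)) DG_class"
      using continuous_quotient[of "topo M" ?R] by (simp add: DG_def DG_class_def[abs_def] quotient_monoid_simps)
  qed
qed

lemma DG_class_surj: "carrier (DG K) = DG_class ` carrier M"
  by (auto simp: DG_def DG_class_def quotient_monoid_simps quotient_def)

lemma DG_class_eq_iff:
  assumes "a \<in> carrier M" "b \<in> carrier M"
  shows "DG_class a = DG_class b \<longleftrightarrow> (a, b) \<in> min_profinite_congruence M (inertia_rel K)"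
proof -
  have "equiv (carrier M) (min_profinite_congruence M (inertia_rel K))"
    using profinite_min_congruence[OF M_monoid topspace_M compact_M inertia_rel_carrier]
    by (simp add: profinite_congruence_def congruence_def)
  then show ?thesis unfolding DG_class_def using assms by (rule eq_equiv_class_iff)
qed

end

section \<open>Density\<close>

context local_setting
begin

text \<open>A basic neighbourhood restricts finitely many components. All of them are projections of
  the component at the union of their index sets, so a single component controls it.\<close>

lemma Q_hat_nbhd:
  assumes U: "openin (topo (Q_hat K)) U" and \<rho>: "\<rho> \<in> U"
  shows "\<exists>S\<in>finite_sets K. \<forall>x\<in>carrier (Q_hat K). x S = \<rho> S \<longrightarrow> x \<in> U"
proof -
  let ?T = "product_topology (\<lambda>S. topo (Q_fin K S)) (finite_sets K)"
  obtain V where V: "openin ?T V" "U = V \<inter> carrier (Q_hat K)"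
    using U unfolding Q_hat_simps(4) openin_subtopology by blast
  have "\<rho> \<in> V" using V(2) \<rho> by simp
  from bspec[OF V(1)[unfolded openin_product_topology_alt] this]
  obtain W where W: "finite {S \<in> finite_sets K. W S \<noteq> topspace (topo (Q_fin K S))}"
    "\<rho> \<in> Pi\<^sub>E (finite_sets K) W" "Pi\<^sub>E (finite_sets K) W \<subseteq> V"
    by (elim exE conjE)
  define \<S> where "\<S> = {S \<in> finite_sets K. W S \<noteq> topspace (topo (Q_fin K S))}"
  have \<rho>Q: "\<rho> \<in> carrier (Q_hat K)" using V \<rho> by blast
  have S: "\<Union>\<S> \<in> finite_sets K" using W(1) by (auto simp: finite_sets_def \<S>_def)
  have "x \<in> U" if x: "x \<in> carrier (Q_hat K)" "x (\<Union>\<S>) = \<rho> (\<Union>\<S>)" for x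
  proof -
    have "x S \<in> W S" if "S \<in> finite_sets K" for S
    proof (cases "S \<in> \<S>")
      case True
      then have sub: "S \<subseteq> \<Union>\<S>" by blast
      have "x S = \<rho> S"
        using Q_hatD(2)[OF x(1) that S sub] Q_hatD(2)[OF \<rho>Q that S sub] x(2) by simp
      then show ?thesis using W(2) that by auto
    next
      case False
      then show ?thesis using Q_hatD(1)[OF x(1) that] that by (auto simp: Q_finD(2) \<S>_def)
    qed
    then have "x \<in> Pi\<^sub>E (finite_sets K) W" using Q_hatD(3)[OF x(1)] by (simp add: PiE_iff)
    then show ?thesis using V(2) W(3) x(1) by blast
  qed
  then show ?thesis using S by blast
qed

text \<open>The image of \<open>T\<close> in each \<open>Q_fin\<close> is compact, so it is a closed
  submonoid with all generators and hence everything. A closed set with full image in every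
  component is the whole limit, because each neighbourhood is controlled by one component.\<close>

lemma Q_hat_generated:
  assumes cl: "closedin (topo (Q_hat K)) T" and sub: "submonoid T (Q_hat K)"
    and gen: "\<And>v x. v \<in> finite_primes UNIV \<Longrightarrow> x \<in> carrier (Q_loc K v) \<Longrightarrow> Q_hat_incl K v x \<in> T"
  shows "T = carrier (Q_hat K)"
proof
  show TQ: "T \<subseteq> carrier (Q_hat K)" using sub submonoid.subset by blast
  have onto: "\<exists>y\<in>T. y S = x S" if x: "x \<in> carrier (Q_hat K)" and S: "S \<in> finite_sets K" for x S
  proof -
    let ?N = "(\<lambda>y. y S) ` T"
    have "compactin (topo (Q_hat K)) T" using compact_Q_hat cl closedin_compact_space by blast
    then have "compactin (topo (Q_fin K S)) ?N" using Q_hat_proj_continuous[OF S] by (rule image_compactin)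
    then have "closedin (topo (Q_fin K S)) ?N" using Q_finD(5) compactin_imp_closedin by blast
    moreover have "submonoid ?N (Q_fin K S)"
    proof
      show "?N \<subseteq> carrier (Q_fin K S)" using TQ Q_hatD(1) S by blast
      have "\<one>\<^bsub>Q_hat K\<^esub> S \<in> ?N" using submonoid.one_closed[OF sub] by (rule imageI)
      then show "\<one>\<^bsub>Q_fin K S\<^esub> \<in> ?N" using S by (simp add: Q_hat_simps(3))
      show "a \<otimes>\<^bsub>Q_fin K S\<^esub> b \<in> ?N" if ab: "a \<in> ?N" "b \<in> ?N" for a b
      proof -
        obtain y z where yz: "y \<in> T" "a = y S" "z \<in> T" "b = z S" using ab by blast
        have "(y \<otimes>\<^bsub>Q_hat K\<^esub> z) S \<in> ?N" using submonoid.m_closed[OF sub yz(1,3)] by (rule imageI)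
        then show ?thesis using S yz by (simp add: Q_hat_simps(2))
      qed
    qed
    moreover have "free_incl (primes_over K S) (Q_loc K) v y \<in> ?N"
      if v: "v \<in> primes_over K S" and y: "y \<in> carrier (Q_loc K v)" for v y
    proof -
      have "Q_hat_incl K v y S \<in> ?N" using gen[OF primes_over_place[OF v] y] by (rule imageI)
      then show ?thesis using S v by (simp add: Q_hat_incl_def Q_incl_def)
    qed
    ultimately have "?N = carrier (Q_fin K S)" unfolding Q_fin_def by (intro free_product_induct)
    then have "x S \<in> ?N" using Q_hatD(1)[OF x S] by simp
    then show ?thesis by force
  qed
  show "carrier (Q_hat K) \<subseteq> T"
  proof (rule subsetI, rule ccontr)
    fix x assume x: "x \<in> carrier (Q_hat K)" "x \<notin> T"
    have "openin (topo (Q_hat K)) (carrier (Q_hat K) - T)"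
      using cl unfolding closedin_def topspace_Q_hat by blast
    then obtain S where S: "S \<in> finite_sets K" "\<And>y. y \<in> carrier (Q_hat K) \<Longrightarrow> y S = x S \<Longrightarrow> y \<in> carrier (Q_hat K) - T"
      using Q_hat_nbhd[of "carrier (Q_hat K) - T" x] x by blast
    obtain y where "y \<in> T" "y S = x S" using onto[OF x(1) S(1)] by blast
    then show False using S(2) TQ by blast
  qed
qed

section \<open>Labels that approximate every automorphism\<close>

lemma countable_closure: "countable (UNIV :: 'a set)"
proof -
  have cK: "countable K" by (rule countable_number_field[OF nf])
  have "{f. over_poly K f} \<subseteq> Poly ` lists K"
  proof
    fix f assume "f \<in> {f. over_poly K f}"
    then have "set (coeffs f) \<subseteq> K" by (auto simp: over_poly_def coeffs_def)
    then have "coeffs f \<in> lists K" by blast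
    then have "Poly (coeffs f) \<in> Poly ` lists K" by (rule imageI)
    then show "f \<in> Poly ` lists K" by simp
  qed
  then have "countable {f. over_poly K f}"
    using countable_lists[OF cK] by (meson countable_image countable_subset)
  then have "countable (\<Union>f\<in>{f. over_poly K f} - {0}. {x. poly f x = 0})"
    by (intro countable_UN) (auto intro: countable_subset countable_finite poly_roots_finite)
  moreover have "(\<Union>f\<in>{f. over_poly K f} - {0}. {x. poly f x = 0}) = UNIV"
  proof -
    have "x \<in> (\<Union>f\<in>{f. over_poly K f} - {0}. {x. poly f x = 0})" for x
      using algebraic_closure_algebraic[OF ac, of x] by blast
    then show ?thesis by blast
  qed
  ultimately show ?thesis by simp
qed

text \<open>
  Countability of the closure takes the place of Chebotarev's theorem: the label \<open>s v\<close> need not be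
  related to \<open>v\<close>, so it suffices to enumerate the finite pieces of automorphisms along the primes of \<open>K\<close>.
\<close>

lemma ex_dense_labelling:
  "\<exists>s. (\<forall>v. s v \<in> carrier (gal K)) \<and> (\<forall>T \<sigma> B. finite T \<longrightarrow> \<sigma> \<in> carrier (gal K) \<longrightarrow> finite B \<longrightarrow>
     (\<exists>v\<in>finite_primes UNIV. below K v \<notin> T \<and> (\<forall>b\<in>B. s v b = \<sigma> b)))"
proof -
  have "countable (lists (UNIV \<times> UNIV :: ('a \<times> 'a) set))"
    using countable_closure by (intro countable_lists countable_SIGMA)
  then have c: "countable (UNIV :: ('a \<times> 'a) list set)" by simp
  define en where "en = from_nat_into (UNIV :: ('a \<times> 'a) list set)"
  have en: "\<exists>k. en k = ps" for ps
    using range_from_nat_into[OF _ c] unfolding en_def by (metis UNIV_I UNIV_not_empty rangeE)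
  define P where "P = enumerate {p::nat. prime p}"
  have P: "prime (P i)" for i
    using enumerate_in_set[OF primes_infinite, of i] by (simp add: P_def)
  have injP: "inj P" unfolding P_def using strict_mono_enumerate[OF primes_infinite] by (rule strict_mono_imp_inj_on)
  define pr where "pr v = (THE p::nat. prime p \<and> of_nat p \<in> v)" for v :: "'a set"
  define fits where "fits ps \<sigma> \<longleftrightarrow> \<sigma> \<in> carrier (gal K) \<and> (\<forall>(x, y)\<in>set ps. \<sigma> x = y)" for ps \<sigma>
  define sf where "sf ps = (if \<exists>\<sigma>. fits ps \<sigma> then SOME \<sigma>. fits ps \<sigma> else id)" for ps
  \<comment> \<open>If \<open>pr v\<close> is the \<open>i\<close>-th prime and \<open>i\<close>
    encodes the pair \<open>(k, j)\<close>, then \<open>s v\<close> realises the \<open>k\<close>-th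
    finite list of prescribed values, provided that some automorphism does. Varying \<open>j\<close>
    repeats each list over infinitely many primes.\<close>
  define s where "s v = sf (en (fst (prod_decode (inv_into UNIV P (pr v)))))" for v
  have sf: "fits ps (sf ps)" if "fits ps \<sigma>" for ps \<sigma>
    using that someI[of "fits ps" \<sigma>] unfolding sf_def by auto
  have "sf ps \<in> carrier (gal K)" for ps
    using sf[of ps] Gal.one_closed by (cases "\<exists>\<sigma>. fits ps \<sigma>") (auto simp: fits_def sf_def)
  then have sG: "s v \<in> carrier (gal K)" for v by (simp add: s_def)
  have "\<exists>v\<in>finite_primes UNIV. below K v \<notin> T \<and> (\<forall>b\<in>B. s v b = \<sigma> b)"
    if T: "finite T" and \<sigma>: "\<sigma> \<in> carrier (gal K)" and B: "finite B" for T \<sigma> B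
  proof -
    obtain bs where bs: "set bs = B" using finite_list[OF B] by blast
    obtain k where k: "en k = map (\<lambda>b. (b, \<sigma> b)) bs" using en by blast
    have "\<forall>j. \<exists>v. v \<in> finite_primes UNIV \<and> of_nat (P (prod_encode (k, j))) \<in> v"
      using ex_finite_prime_above[OF is_subring_UNIV P] by blast
    from choice[OF this] obtain w where
      "\<forall>j. w j \<in> finite_primes (UNIV :: 'a set) \<and> of_nat (P (prod_encode (k, j))) \<in> w j" ..
    then have w: "\<And>j. w j \<in> finite_primes (UNIV :: 'a set)" "\<And>j. of_nat (P (prod_encode (k, j))) \<in> w j"
      by simp_all
    have uniq: "p = P (prod_encode (k, j))" if "prime p" "of_nat p \<in> w j" for p j
      using finite_primes_prime_unique[OF is_subring_UNIV w(1)] that P w(2) by blast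
    have prw: "pr (w j) = P (prod_encode (k, j))" for j
      unfolding pr_def using P w(2) uniq by (intro the_equality) auto
    \<comment> \<open>Places over distinct rational primes restrict to distinct primes of
      \<open>K\<close>; so for a fixed list \<open>k\<close> some of them avoid the finite set
      \<open>T\<close>.\<close>
    have "inj (\<lambda>j. below K (w j))"
    proof (rule injI)
      fix i j assume e: "below K (w i) = below K (w j)"
      have "of_nat (P (prod_encode (k, i))) \<in> below K (w i)"
        using w(2) is_subringD(8)[OF is_subring_integers[OF Kc(1)]] by (simp add: below_def)
      then have "of_nat (P (prod_encode (k, i))) \<in> w j" unfolding e by (simp add: below_def)
      then have "P (prod_encode (k, i)) = P (prod_encode (k, j))" using uniq P by blast
      then have "(k, i) = (k, j)" using injP by (metis injD inj_prod_encode)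
      then show "i = j" by simp
    qed
    then have "infinite (range (\<lambda>j. below K (w j)))" using finite_imageD infinite_UNIV_nat by blast
    then have "\<not> range (\<lambda>j. below K (w j)) \<subseteq> T" using finite_subset[OF _ T] by blast
    then obtain j where j: "below K (w j) \<notin> T" by blast
    have "s (w j) = sf (map (\<lambda>b. (b, \<sigma> b)) bs)"
      unfolding s_def prw inv_into_f_f[OF injP UNIV_I] by (simp add: k)
    moreover have "fits (map (\<lambda>b. (b, \<sigma> b)) bs) (sf (map (\<lambda>b. (b, \<sigma> b)) bs))"
      by (rule sf[of _ \<sigma>]) (auto simp: fits_def \<sigma>)
    ultimately have "\<forall>b\<in>B. s (w j) b = \<sigma> b" using bs by (auto simp: fits_def)
    then show ?thesis using w(1) j by blast
  qed
  then show ?thesis using sG by blast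
qed

end

section \<open>The homomorphism on words and the density of its image\<close>

locale labelled_setting = local_setting K for K :: "'a::field_char_0 set" +
  fixes \<phi> s :: "'a set \<Rightarrow> 'a \<Rightarrow> 'a"
  assumes \<phi>: "\<And>v. v \<in> finite_primes UNIV \<Longrightarrow> \<phi> v \<in> frob_power K v 1"
    and s: "\<And>v. s v \<in> carrier (gal K)"
    and dense: "\<And>T \<sigma> B. finite T \<Longrightarrow> \<sigma> \<in> carrier (gal K) \<Longrightarrow> finite B \<Longrightarrow>
      \<exists>v\<in>finite_primes UNIV. below K v \<notin> T \<and> (\<forall>b\<in>B. s v b = \<sigma> b)"
begin

definition letter where "letter v = (Q_hat_incl K v (Some (\<phi> v)), s v)"

definition word_val where "word_val ws = foldr (\<lambda>v z. letter v \<otimes>\<^bsub>M\<^esub> z) ws \<one>\<^bsub>M\<^esub>"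

definition \<psi> where "\<psi> ws = DG_class (word_val ws)"

lemma Some_in_Q_loc: "v \<in> finite_primes UNIV \<Longrightarrow> w \<in> frob_power K v n \<Longrightarrow> Some w \<in> carrier (Q_loc K v)"
  using local_place.carrier_Q_loc[OF place] by blast

lemma letter_closed: "v \<in> finite_primes UNIV \<Longrightarrow> letter v \<in> carrier M"
  using top_homD(1)[OF Q_hat_incl_top_hom Some_in_Q_loc[OF _ \<phi>]] s by (simp add: letter_def M_simps)

lemma word_val_closed: "ws \<in> lists (finite_primes UNIV) \<Longrightarrow> word_val ws \<in> carrier M"
  using monoid.one_closed[OF M_monoid] monoid.m_closed[OF M_monoid letter_closed]
  by (induction ws) (auto simp: word_val_def)

lemma word_val_append:
  "xs \<in> lists (finite_primes UNIV) \<Longrightarrow> ys \<in> lists (finite_primes UNIV) \<Longrightarrow>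
    word_val (xs @ ys) = word_val xs \<otimes>\<^bsub>M\<^esub> word_val ys"
proof (induction xs)
  case Nil
  then show ?case using monoid.l_one[OF M_monoid word_val_closed] by (simp add: word_val_def)
next
  case (Cons v xs)
  then have "word_val (xs @ ys) = word_val xs \<otimes>\<^bsub>M\<^esub> word_val ys" "v \<in> finite_primes UNIV" "xs \<in> lists (finite_primes UNIV)" by auto
  then show ?case
    using monoid.m_assoc[OF M_monoid letter_closed word_val_closed word_val_closed[OF Cons.prems(2)]]
    by (simp add: word_val_def)
qed

lemma \<psi>_top_hom: "\<psi> \<in> top_hom (words (finite_primes UNIV)) (DG K)"
proof (rule top_homI)
  note D = top_homD[OF DG_class_top_hom]
  show c: "\<psi> x \<in> carrier (DG K)" if "x \<in> carrier (words (finite_primes UNIV))" for x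
    using that D(1) word_val_closed by (simp add: words_def \<psi>_def)
  show "\<psi> (x \<otimes>\<^bsub>words (finite_primes UNIV)\<^esub> y) = \<psi> x \<otimes>\<^bsub>DG K\<^esub> \<psi> y"
    if "x \<in> carrier (words (finite_primes UNIV))" "y \<in> carrier (words (finite_primes UNIV))" for x y
    using that D(2) word_val_closed by (simp add: words_def \<psi>_def word_val_append)
  show "\<psi> \<one>\<^bsub>words (finite_primes UNIV)\<^esub> = \<one>\<^bsub>DG K\<^esub>" using D(3) by (simp add: words_def \<psi>_def word_val_def)
  show "continuous_map (topo (words (finite_primes UNIV))) (topo (DG K)) \<psi>"
    using c profinite_monoidD(2)[OF DG_profinite] by (simp add: words_def)
qed

lemma \<psi>_dense: "topo (DG K) closure_of (\<psi> ` carrier (words (finite_primes UNIV))) = carrier (DG K)"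
proof
  note DG = profinite_monoidD[OF DG_profinite]
  note D = top_homD[OF DG_class_top_hom]
  note \<psi>D = top_homD[OF \<psi>_top_hom]
  let ?W = "carrier (words (finite_primes (UNIV :: 'a set)))"
  define C where "C = topo (DG K) closure_of (\<psi> ` ?W)"
  show "topo (DG K) closure_of (\<psi> ` ?W) \<subseteq> carrier (DG K)"
    using closure_of_subset_topspace DG(2) by metis
  have subW: "submonoid (\<psi> ` ?W) (DG K)"
  proof
    show "\<psi> ` ?W \<subseteq> carrier (DG K)" using \<psi>D(1) by blast
    show "\<one>\<^bsub>DG K\<^esub> \<in> \<psi> ` ?W" using \<psi>D(3) by (metis image_eqI list.set(1) lists.Nil partial_object.select_convs(1) words_def monoid.select_convs(2))
    show "x \<otimes>\<^bsub>DG K\<^esub> y \<in> \<psi> ` ?W" if xy: "x \<in> \<psi> ` ?W" "y \<in> \<psi> ` ?W" for x y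
    proof -
      obtain a b where ab: "a \<in> ?W" "x = \<psi> a" "b \<in> ?W" "y = \<psi> b" using xy by blast
      have "\<psi> (a \<otimes>\<^bsub>words (finite_primes UNIV)\<^esub> b) = x \<otimes>\<^bsub>DG K\<^esub> y" using \<psi>D(2) ab by simp
      moreover have "a \<otimes>\<^bsub>words (finite_primes UNIV)\<^esub> b \<in> ?W" using ab by (simp add: words_def)
      ultimately show ?thesis by (metis imageI)
    qed
  qed
  have C: "submonoid C (DG K)" unfolding C_def by (rule closure_of_submonoid[OF DG(6) subW])
  \<comment> \<open>Membership is tested in the free deformation: \<open>P\<close> is closed because
    \<open>DG_class\<close> is continuous, and it is closed under products because \<open>C\<close>
    is a submonoid and \<open>DG_class\<close> is multiplicative.\<close>
  define P where "P = {a \<in> carrier M. DG_class a \<in> C}"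
  have P_mult: "a \<otimes>\<^bsub>M\<^esub> b \<in> P" if "a \<in> P" "b \<in> P" for a b
    using that submonoid.m_closed[OF C] D(2) monoid.m_closed[OF M_monoid] by (auto simp: P_def)
  have P_one: "\<one>\<^bsub>M\<^esub> \<in> P"
    using submonoid.one_closed[OF C] D(3) monoid.one_closed[OF M_monoid] by (simp add: P_def)
  have "closedin (topo (DG K)) C" by (simp add: C_def)
  then have P_closed: "closedin (topo M) P"
    using closedin_continuous_map_preimage[OF D(4)] unfolding P_def topspace_M by blast
  have id: "id \<in> carrier (gal K)" using Gal.one_closed by simp
  note Qone = Q_hat_one_closed and Ql = monoid.l_one[OF Q_hat_monoid] and Qr = monoid.r_one[OF Q_hat_monoid]
  have letter_P: "letter v \<in> P" if v: "v \<in> finite_primes UNIV" for v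
  proof -
    have w: "[v] \<in> ?W" using v by (simp add: words_def)
    have "word_val [v] = letter v" using monoid.r_one[OF M_monoid letter_closed[OF v]] by (simp add: word_val_def)
    then have "DG_class (letter v) \<in> \<psi> ` ?W" using imageI[OF w, of \<psi>] by (simp add: \<psi>_def)
    moreover have "\<psi> ` ?W \<subseteq> C"
      unfolding C_def using \<psi>D(1) DG(2) by (intro closure_of_subset) auto
    ultimately show ?thesis using letter_closed[OF v] by (auto simp: P_def)
  qed
  have gal_P: "(\<one>\<^bsub>Q_hat K\<^esub>, \<sigma>) \<in> P" if \<sigma>: "\<sigma> \<in> carrier (gal K)" for \<sigma>
  proof (rule ccontr)
    assume n: "(\<one>\<^bsub>Q_hat K\<^esub>, \<sigma>) \<notin> P"
    have op: "openin (prod_topology (topo (Q_hat K)) (topo (gal K))) (carrier M - P)"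
      using P_closed[unfolded closedin_def topspace_M, THEN conjunct2] by (simp only: M_simps(4))
    have mem: "(\<one>\<^bsub>Q_hat K\<^esub>, \<sigma>) \<in> carrier M - P" using n \<sigma> Qone by (simp add: M_simps)
    from op[unfolded openin_prod_topology_alt, rule_format, OF mem]
    obtain U V where UV: "openin (topo (Q_hat K)) U" "openin (topo (gal K)) V"
      "\<one>\<^bsub>Q_hat K\<^esub> \<in> U" "\<sigma> \<in> V" "U \<times> V \<subseteq> carrier M - P"
      by (elim exE conjE)
    obtain S where S: "S \<in> finite_sets K" "\<And>x. x \<in> carrier (Q_hat K) \<Longrightarrow> x S = \<one>\<^bsub>Q_hat K\<^esub> S \<Longrightarrow> x \<in> U"
      using Q_hat_nbhd[OF UV(1,3)] by blast
    obtain B where B: "finite B" "\<And>\<tau>. \<tau> \<in> carrier (gal K) \<Longrightarrow> (\<forall>b\<in>B. \<tau> b = \<sigma> b) \<Longrightarrow> \<tau> \<in> V"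
      using bspec[OF conjunct2[OF UV(2)[unfolded openin_gal]] UV(4)] by blast
    have "finite S" using S(1) by (simp add: finite_sets_def)
    then obtain v where v: "v \<in> finite_primes UNIV" "below K v \<notin> S" "\<forall>b\<in>B. s v b = \<sigma> b"
      using dense[OF _ \<sigma> B(1)] by blast
    \<comment> \<open>The prime under \<open>v\<close> is not in \<open>S\<close>, so
      \<open>Q_v\<close> is trivial in the only component that \<open>U\<close> has to
      control.\<close>
    have "Q_hat_incl K v (Some (\<phi> v)) S = \<one>\<^bsub>Q_hat K\<^esub> S"
      using v(2) S(1) by (simp add: Q_hat_incl_def Q_incl_def Q_hat_simps(3) primes_over_def)
    then have "letter v \<in> U \<times> V"
      using S(2) B(2)[OF s v(3)] letter_closed[OF v(1)] by (simp add: letter_def M_simps)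
    with UV(5) have "letter v \<in> carrier M - P" by (rule subsetD)
    then show False using letter_P[OF v(1)] by simp
  qed
  let ?E = "\<lambda>\<rho>. (\<rho>, id :: 'a \<Rightarrow> 'a)"
  have E_mult: "?E \<rho> \<otimes>\<^bsub>M\<^esub> ?E \<rho>' = ?E (\<rho> \<otimes>\<^bsub>Q_hat K\<^esub> \<rho>')" if "\<rho>' \<in> carrier (Q_hat K)" for \<rho> \<rho>'
    using that by (simp add: M_simps Q_hat_act_id)
  have loc_P: "?E (Q_hat_incl K v x) \<in> P" if v: "v \<in> finite_primes UNIV" and x: "x \<in> carrier (Q_loc K v)" for v x
  proof -
    interpret v: local_place K v by (rule place[OF v])
    note I = top_homD[OF Q_hat_incl_top_hom[OF v]]
    have phi: "?E (Q_hat_incl K v (Some (\<phi> v))) \<in> P"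
    proof -
      note si = gal_m_inv[OF s[of v]]
      have "letter v \<otimes>\<^bsub>M\<^esub> (\<one>\<^bsub>Q_hat K\<^esub>, inv_into UNIV (s v)) \<in> P"
        by (rule P_mult[OF letter_P[OF v] gal_P[OF si(2)]])
      moreover have "letter v \<otimes>\<^bsub>M\<^esub> (\<one>\<^bsub>Q_hat K\<^esub>, inv_into UNIV (s v)) = ?E (Q_hat_incl K v (Some (\<phi> v)))"
        using Qr[OF I(1)[OF Some_in_Q_loc[OF v \<phi>[OF v]]]] si(3)
        by (auto simp: letter_def M_simps Q_hat_act_one[OF s])
      ultimately show ?thesis by simp
    qed
    \<comment> \<open>The inertia relation at trivial first component and
      \<open>\<sigma> = u\<close> identifies \<open>(1, u)\<close>, already known to lie in
      \<open>P\<close>, with \<open>(u, 1)\<close>.\<close>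
    have inert: "?E (Q_hat_incl K v (Some u)) \<in> P" if u: "u \<in> v.F 0" for u
    proof -
      note uG = frob_power_gal[OF u]
      have c: "Q_hat_incl K v (Some u) \<in> carrier (Q_hat K)" by (rule I(1)[OF Some_in_Q_loc[OF v u]])
      have "((\<one>\<^bsub>Q_hat K\<^esub>, u), (\<one>\<^bsub>Q_hat K\<^esub> \<otimes>\<^bsub>Q_hat K\<^esub> Q_hat_incl K v (Some u), inv\<^bsub>gal K\<^esub> u \<otimes>\<^bsub>gal K\<^esub> u)) \<in> inertia_rel K"
        unfolding inertia_rel_def using Qone uG v u v.inertia_eq by blast
      then have "((\<one>\<^bsub>Q_hat K\<^esub>, u), ?E (Q_hat_incl K v (Some u))) \<in> inertia_rel K"
        using Ql[OF c] Gal.l_inv[OF uG] by simp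
      then have "((\<one>\<^bsub>Q_hat K\<^esub>, u), ?E (Q_hat_incl K v (Some u))) \<in> min_profinite_congruence M (inertia_rel K)"
        using min_profinite_congruence_incl by blast
      then have "DG_class (\<one>\<^bsub>Q_hat K\<^esub>, u) = DG_class (?E (Q_hat_incl K v (Some u)))"
        using DG_class_eq_iff c id Qone uG by (simp add: M_simps)
      then show ?thesis using gal_P[OF uG] c id by (simp add: P_def M_simps)
    qed
    have some: "?E (Q_hat_incl K v (Some w)) \<in> P" if "w \<in> v.F n" for w n
      using that
    proof (induction n arbitrary: w)
      case 0
      then show ?case by (rule inert)
    next
      case (Suc n)
      note G = frob_power_gal[OF \<phi>[OF v]]
      let ?t = "inv_into UNIV (\<phi> v) \<circ> w"
      have e: "\<phi> v \<circ> ?t = w" using gal_m_inv(3)[OF G] by auto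
      have t: "?t \<in> v.F n"
      proof (rule v.frob_power_cancel_left[OF _ \<phi>[OF v]])
        show "\<phi> v \<circ> ?t \<in> v.F (1 + n)" using Suc.prems unfolding e by simp
        show "?t \<in> carrier (gal K)" using Gal.m_closed[OF gal_m_inv(2)[OF G] frob_power_gal[OF Suc.prems]] by simp
      qed
      have "Q_hat_incl K v (Some w) = Q_hat_incl K v (Some (\<phi> v)) \<otimes>\<^bsub>Q_hat K\<^esub> Q_hat_incl K v (Some ?t)"
        using I(2)[OF Some_in_Q_loc[OF v \<phi>[OF v]] Some_in_Q_loc[OF v t]] by (simp only: v.Q_loc_simps e)
      then have "?E (Q_hat_incl K v (Some w)) = ?E (Q_hat_incl K v (Some (\<phi> v))) \<otimes>\<^bsub>M\<^esub> ?E (Q_hat_incl K v (Some ?t))"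
        using E_mult[OF I(1)[OF Some_in_Q_loc[OF v t]]] by simp
      then show ?case using P_mult[OF phi Suc.IH[OF t]] by (simp only:)
    qed
    have none: "?E (Q_hat_incl K v None) \<in> P"
    proof (rule ccontr)
      assume n: "?E (Q_hat_incl K v None) \<notin> P"
      have "continuous_map (topo (Q_loc K v)) (topo M) (\<lambda>x. ?E (Q_hat_incl K v x))"
        unfolding M_simps continuous_map_paired using I(4) id by simp
      then have cl: "closedin (topo (Q_loc K v)) {x \<in> topspace (topo (Q_loc K v)). ?E (Q_hat_incl K v x) \<in> P}"
        using P_closed by (rule closedin_continuous_map_preimage)
      define Z where "Z = topspace (topo (Q_loc K v)) - {x \<in> topspace (topo (Q_loc K v)). ?E (Q_hat_incl K v x) \<in> P}"
      have "openin (topo (Q_loc K v)) Z" unfolding Z_def using cl by (rule openin_diff[OF openin_topspace])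
      moreover have "None \<in> Z" using n by (simp add: Z_def v.topspace_Q_loc v.carrier_Q_loc)
      ultimately have "\<exists>N. \<forall>n\<ge>N. Some ` v.F n \<subseteq> Z" by (rule v.Q_loc_zero_limit)
      then obtain N where N: "Some ` v.F N \<subseteq> Z" by auto
      have "\<exists>w. w \<in> v.F N"
      proof (induction N)
        case 0 show ?case using v.id_frob_power by blast
      next
        case (Suc N) then show ?case using v.frob_power_comp[OF _ \<phi>[OF v], of _ N] by fastforce
      qed
      then obtain w where w: "w \<in> v.F N" by blast
      then have "Some w \<in> Z" using N by blast
      then show False using some[OF w] by (simp add: Z_def)
    qed
    show ?thesis using x some none unfolding v.carrier_Q_loc by blast
  qed
  define T where "T = {\<rho> \<in> carrier (Q_hat K). ?E \<rho> \<in> P}"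
  have "T = carrier (Q_hat K)"
  proof (rule Q_hat_generated)
    have "continuous_map (topo (Q_hat K)) (topo M) ?E"
      unfolding M_simps continuous_map_paired using id by simp
    from closedin_continuous_map_preimage[OF this P_closed] show "closedin (topo (Q_hat K)) T"
      unfolding T_def topspace_Q_hat .
    show "submonoid T (Q_hat K)"
    proof
      show "T \<subseteq> carrier (Q_hat K)" by (auto simp: T_def)
      show "\<one>\<^bsub>Q_hat K\<^esub> \<in> T" using gal_P[OF id] Qone by (simp add: T_def)
      show "x \<otimes>\<^bsub>Q_hat K\<^esub> y \<in> T" if "x \<in> T" "y \<in> T" for x y
        using that P_mult[of "?E x" "?E y"] by (simp add: T_def E_mult Q_hat_mult_closed)
    qed
    show "Q_hat_incl K v x \<in> T" if "v \<in> finite_primes UNIV" "x \<in> carrier (Q_loc K v)" for v x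
      using loc_P[OF that] by (simp add: T_def P_def M_simps)
  qed
  then have E_P: "?E \<rho> \<in> P" if "\<rho> \<in> carrier (Q_hat K)" for \<rho> using that by (auto simp: T_def)
  have "(\<rho>, \<sigma>) \<in> P" if "\<rho> \<in> carrier (Q_hat K)" "\<sigma> \<in> carrier (gal K)" for \<rho> \<sigma>
    using P_mult[OF E_P[OF that(1)] gal_P[OF that(2)]] that by (simp add: M_simps Q_hat_act_one[OF id] Qr)
  then have "carrier M \<subseteq> P" by (auto simp: M_simps)
  then show "carrier (DG K) \<subseteq> topo (DG K) closure_of (\<psi> ` ?W)"
    unfolding DG_class_surj C_def[symmetric] by (auto simp: P_def)
qed

end

section \<open>Injectivity\<close>

context local_setting
begin

text \<open>\<open>B\<close> collects all roots of one monic integer polynomial for each element of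
  \<open>A\<close>. Automorphisms permute these roots, which are integers again.\<close>

lemma ex_stable_superset:
  assumes A: "finite A" "A \<subseteq> integers UNIV"
  shows "\<exists>B. finite B \<and> A \<subseteq> B \<and> B \<subseteq> integers UNIV \<and> (\<forall>\<sigma>\<in>carrier (gal K). \<sigma> ` B = B)"
proof -
  have "\<exists>f. Polynomial.lead_coeff f = 1 \<and> poly (map_poly of_int f) x = 0" if "x \<in> A" for x
    using that A by (auto simp: integers_def algebraic_int_altdef_ipoly)
  then obtain f where f: "\<And>x. x \<in> A \<Longrightarrow> Polynomial.lead_coeff (f x) = 1 \<and> poly (map_poly of_int (f x)) x = 0"
    by metis
  define R where "R x = {y::'a. poly (map_poly of_int (f x)) y = 0}" for x
  define B where "B = (\<Union>x\<in>A. R x)"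
  have finR: "finite (R x)" if "x \<in> A" for x
  proof -
    have "f x \<noteq> 0" using f[OF that] by auto
    then have "(map_poly of_int (f x) :: 'a poly) \<noteq> 0" by simp
    then show ?thesis unfolding R_def by (rule poly_roots_finite)
  qed
  have finB: "finite B" unfolding B_def using A(1) finR by blast
  have "\<sigma> ` B = B" if s: "\<sigma> \<in> carrier (gal K)" for \<sigma>
  proof (rule endo_inj_surj[OF finB])
    have "poly (map_poly of_int p) (\<sigma> x) = \<sigma> (poly (map_poly of_int p) x)" for p x
      by (simp add: poly_altdef coeff_map_poly galD[OF s] gal_sum[OF s])
    then show "\<sigma> ` B \<subseteq> B" using galD(6)[OF s] by (auto simp: B_def R_def)
    show "inj_on \<sigma> B" using galD(2)[OF s] by (rule inj_on_subset) simp
  qed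
  moreover have "A \<subseteq> B" using f by (auto simp: B_def R_def)
  moreover have "B \<subseteq> integers UNIV"
    using f by (auto simp: B_def R_def integers_def algebraic_int_altdef_ipoly)
  ultimately show ?thesis using finB by blast
qed

text \<open>If inertia moves \<open>b\<close>, then the place divides a difference of conjugates of \<open>b\<close>.\<close>

lemma finite_ramified:
  assumes B: "finite B" "B \<subseteq> integers UNIV" "\<And>\<sigma>. \<sigma> \<in> carrier (gal K) \<Longrightarrow> \<sigma> ` B = B"
  shows "finite {below K v | v. v \<in> finite_primes UNIV \<and> (\<exists>u\<in>frob_power K v 0. \<exists>b\<in>B. u b \<noteq> b)}"
proof -
  note O = is_subring_integers[OF is_subring_UNIV]
  define I where "I = {(a, b) \<in> B \<times> B. a \<noteq> b}"
  have finI: "finite I" unfolding I_def by (rule finite_subset[OF _ finite_cartesian_product[OF B(1) B(1)]]) blast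
  \<comment> \<open>All differences at once. Every place in question contains one factor, hence
    \<open>d\<close>, hence the rational integer \<open>k\<close>, which has finitely many prime
    divisors; over each of them lie finitely many primes of \<open>K\<close>.\<close>
  define d where "d = (\<Prod>p\<in>I. fst p - snd p)"
  have dO: "d \<in> integers UNIV"
    unfolding d_def using B(2) by (intro is_subring_prod[OF O]) (auto simp: I_def intro!: is_subringD[OF O])
  have "d \<noteq> 0" unfolding d_def using finI by (auto simp: I_def)
  then obtain k y where k: "k \<noteq> 0" "y \<in> integers UNIV" "of_int k = d * y" using integer_multiple[OF is_subring_UNIV dO] by blast
  have fin: "finite {p::nat. prime p \<and> int p dvd k}"
  proof (rule finite_subset)
    show "{p::nat. prime p \<and> int p dvd k} \<subseteq> {p. p dvd nat \<bar>k\<bar>}" by auto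
    show "finite {p. p dvd nat \<bar>k\<bar>}" using k(1) by (intro finite_divisors_nat) simp
  qed
  have "\<exists>p\<in>{p::nat. prime p \<and> int p dvd k}. below K v \<in> {w \<in> finite_primes K. of_nat p \<in> w}"
    if v: "v \<in> finite_primes UNIV" and u: "u \<in> frob_power K v 0" and b: "b \<in> B" "u b \<noteq> b" for v u b
  proof -
    note vD = finite_primesD[OF is_subring_UNIV v]
    have uv: "u b - b \<in> v" using u b(1) B(2) by (auto simp: frob_power_def)
    have mem: "(u b, b) \<in> I" using B(3)[OF frob_power_gal[OF u]] b by (auto simp: I_def)
    have "d = (u b - b) * (\<Prod>p\<in>I - {(u b, b)}. fst p - snd p)"
      unfolding d_def using prod.remove[OF finI mem, of "\<lambda>p. fst p - snd p"] by simp
    moreover have "(\<Prod>p\<in>I - {(u b, b)}. fst p - snd p) \<in> integers UNIV"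
      using B(2) by (intro is_subring_prod[OF O]) (auto simp: I_def intro!: is_subringD[OF O])
    ultimately have "d \<in> v" using vD(7)[OF _ uv] by simp
    then have kv: "of_int k \<in> v" unfolding k(3) by (rule vD(7)[OF k(2)])
    obtain p :: nat where p: "prime p" "of_nat p \<in> v" using finite_primes_ex_prime[OF is_subring_UNIV v] by blast
    have "int p dvd k" using finite_primes_int_iff[OF is_subring_UNIV v p] kv by simp
    moreover have "of_nat p \<in> below K v"
      using p(2) is_subringD(8)[OF is_subring_integers[OF Kc(1)]] by (simp add: below_def)
    ultimately show ?thesis using p(1) below_finite_primes[OF Kc(1) v] by blast
  qed
  then have "{below K v | v. v \<in> finite_primes UNIV \<and> (\<exists>u\<in>frob_power K v 0. \<exists>b\<in>B. u b \<noteq> b)}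
      \<subseteq> (\<Union>p\<in>{p::nat. prime p \<and> int p dvd k}. {w \<in> finite_primes K. of_nat p \<in> w})" by blast
  moreover have "finite (\<Union>p\<in>{p::nat. prime p \<and> int p dvd k}. {w \<in> finite_primes K. of_nat p \<in> w})"
    using fin finite_primes_over_prime[OF nf] by blast
  ultimately show ?thesis by (rule finite_subset)
qed

end

text \<open>
  The finite quotients that detect words: the free monoid over the traces \<open>v \<inter> B\<close>, truncated at
  length \<open>L\<close> and extended by the restrictions of the Galois group to \<open>B\<close>; \<^const>\<open>None\<close> is a zero.
\<close>

locale word_quotient = local_setting K for K :: "'a::field_char_0 set" +
  fixes B :: "'a set" and L :: nat and S :: "'a set set"
  assumes finB: "finite B"
    and stable: "\<And>\<sigma>. \<sigma> \<in> carrier (gal K) \<Longrightarrow> \<sigma> ` B = B"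
    and S: "S \<in> finite_sets K"
    and unramified: "\<And>v u b. v \<in> finite_primes UNIV \<Longrightarrow> below K v \<notin> S \<Longrightarrow> u \<in> frob_power K v 0 \<Longrightarrow> b \<in> B \<Longrightarrow> u b = b"
begin

definition elt :: "'a set list \<Rightarrow> ('a \<Rightarrow> 'a) \<Rightarrow> ('a set list \<times> ('a \<Rightarrow> 'a)) option" where
  "elt m \<sigma> = Some (m, restrict \<sigma> B)"

text \<open>The letters are all subsets of \<open>B\<close> and not only traces of places: this
  alphabet is visibly finite and stable under the Galois group. Products that exceed length
  \<open>L\<close> become the zero, and the functions are restricted to \<open>B\<close> so that
  equality means equal action on \<open>B\<close>.\<close>

definition W :: "('a set list \<times> ('a \<Rightarrow> 'a)) option top_monoid" where
  "W = \<lparr>carrier = insert None {elt m \<sigma> | m \<sigma>. m \<in> lists (Pow B) \<and> length m \<le> L \<and> \<sigma> \<in> carrier (gal K)},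
     monoid.mult = (\<lambda>x y. case (x, y) of
       (Some (m, g), Some (m', g')) \<Rightarrow>
         if length m + length m' \<le> L then Some (m @ map ((`) g) m', \<lambda>b\<in>B. g (g' b)) else None
       | _ \<Rightarrow> None),
     one = elt [] id,
     topo = discrete_topology (insert None {elt m \<sigma> | m \<sigma>. m \<in> lists (Pow B) \<and> length m \<le> L \<and> \<sigma> \<in> carrier (gal K)})\<rparr>"

lemma W_simps:
  "\<one>\<^bsub>W\<^esub> = elt [] id" "topo W = discrete_topology (carrier W)"
  "None \<otimes>\<^bsub>W\<^esub> x = None" "x \<otimes>\<^bsub>W\<^esub> None = None"
  by (auto simp: W_def split: option.split)

lemma carrier_W: "carrier W = insert None {elt m \<sigma> | m \<sigma>. m \<in> lists (Pow B) \<and> length m \<le> L \<and> \<sigma> \<in> carrier (gal K)}"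
  by (simp add: W_def)

lemma None_in_W: "None \<in> carrier W"
  by (simp add: carrier_W)

lemma elt_in_W: "m \<in> lists (Pow B) \<Longrightarrow> length m \<le> L \<Longrightarrow> \<sigma> \<in> carrier (gal K) \<Longrightarrow> elt m \<sigma> \<in> carrier W"
  unfolding carrier_W by blast

lemma W_cases:
  assumes "x \<in> carrier W"
  obtains "x = None" | m \<sigma> where "x = elt m \<sigma>" "m \<in> lists (Pow B)" "length m \<le> L" "\<sigma> \<in> carrier (gal K)"
  using assms unfolding carrier_W insert_iff mem_Collect_eq by (elim disjE exE conjE)

lemma elt_eq_iff: "elt m \<sigma> = elt m' \<sigma>' \<longleftrightarrow> m = m' \<and> (\<forall>b\<in>B. \<sigma> b = \<sigma>' b)"
  by (auto simp: elt_def fun_eq_iff restrict_def)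

lemma elt_mult:
  assumes "m' \<in> lists (Pow B)" "\<tau> \<in> carrier (gal K)"
  shows "elt m \<sigma> \<otimes>\<^bsub>W\<^esub> elt m' \<tau> =
    (if length m + length m' \<le> L then elt (m @ map ((`) \<sigma>) m') (\<sigma> \<circ> \<tau>) else None)"
proof -
  have "map ((`) (restrict \<sigma> B)) m' = map ((`) \<sigma>) m'"
    using assms(1) by (intro map_cong refl) (auto simp: in_lists_conv_set)
  moreover have "(\<lambda>b\<in>B. restrict \<sigma> B (restrict \<tau> B b)) = restrict (\<sigma> \<circ> \<tau>) B"
    using stable[OF assms(2)] by (auto simp: restrict_def fun_eq_iff)
  ultimately show ?thesis by (simp add: elt_def W_def)
qed

lemma map_image_lists: "\<sigma> \<in> carrier (gal K) \<Longrightarrow> m \<in> lists (Pow B) \<Longrightarrow> map ((`) \<sigma>) m \<in> lists (Pow B)"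
  using stable[of \<sigma>] by (fastforce simp: in_lists_conv_set)

lemma comp_gal: "\<sigma> \<in> carrier (gal K) \<Longrightarrow> \<tau> \<in> carrier (gal K) \<Longrightarrow> \<sigma> \<circ> \<tau> \<in> carrier (gal K)"
  using Gal.m_closed by simp

lemma id_gal: "id \<in> carrier (gal K)" using Gal.one_closed by simp

lemma W_finite_discrete: "finite_discrete_monoid W"
  unfolding finite_discrete_monoid_def
proof (intro conjI)
  show "Group.monoid W"
  proof (rule monoidI)
    show "x \<otimes>\<^bsub>W\<^esub> y \<in> carrier W" if x: "x \<in> carrier W" and y: "y \<in> carrier W" for x y
      by (rule W_cases[OF x]; rule W_cases[OF y])
        (simp_all add: W_simps elt_mult map_image_lists comp_gal None_in_W elt_in_W del: in_lists_conv_set)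
    show "\<one>\<^bsub>W\<^esub> \<in> carrier W" unfolding W_simps by (rule elt_in_W) (auto simp: id_gal)
    show "x \<otimes>\<^bsub>W\<^esub> y \<otimes>\<^bsub>W\<^esub> z = x \<otimes>\<^bsub>W\<^esub> (y \<otimes>\<^bsub>W\<^esub> z)"
      if x: "x \<in> carrier W" and y: "y \<in> carrier W" and z: "z \<in> carrier W" for x y z
      by (rule W_cases[OF x]; rule W_cases[OF y]; rule W_cases[OF z])
        (auto simp: W_simps elt_mult map_image_lists comp_gal image_comp comp_assoc fun_eq_iff elt_eq_iff
          simp del: in_lists_conv_set)
    show "\<one>\<^bsub>W\<^esub> \<otimes>\<^bsub>W\<^esub> x = x" if x: "x \<in> carrier W" for x
      by (rule W_cases[OF x]) (simp_all add: W_simps elt_mult)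
    show "x \<otimes>\<^bsub>W\<^esub> \<one>\<^bsub>W\<^esub> = x" if x: "x \<in> carrier W" for x
      by (rule W_cases[OF x]) (simp_all add: W_simps elt_mult id_gal)
  qed
  have "carrier W \<subseteq> insert None (Some ` ({m. set m \<subseteq> Pow B \<and> length m \<le> L} \<times> (B \<rightarrow>\<^sub>E B)))"
  proof
    fix x assume "x \<in> carrier W"
    then show "x \<in> insert None (Some ` ({m. set m \<subseteq> Pow B \<and> length m \<le> L} \<times> (B \<rightarrow>\<^sub>E B)))"
    proof (cases rule: W_cases)
      case (2 m \<sigma>)
      have "restrict \<sigma> B \<in> B \<rightarrow>\<^sub>E B" using stable[OF 2(4)] by auto
      then show ?thesis using 2 unfolding 2(1) elt_def by (intro insertI2 imageI SigmaI) (auto simp: in_lists_conv_set)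
    qed simp
  qed
  moreover have "finite (insert None (Some ` ({m. set m \<subseteq> Pow B \<and> length m \<le> L} \<times> (B \<rightarrow>\<^sub>E B))))"
    using finB by (intro finite.insertI finite_imageI finite_cartesian_product finite_lists_length_le finite_PiE finite_Pow_iff[THEN iffD2])
  ultimately show "finite (carrier W)" by (rule finite_subset)
qed (rule W_simps)

lemmas W_profinite = finite_discrete_profinite[OF W_finite_discrete]
lemmas W_monoid = profinite_monoidD(1)[OF W_profinite]

section \<open>Evaluation of the free deformation in the finite quotient\<close>

definition \<alpha> where "\<alpha> \<sigma> = elt [] \<sigma>"

lemma \<alpha>_in_W: "\<sigma> \<in> carrier (gal K) \<Longrightarrow> \<alpha> \<sigma> \<in> carrier W"
  unfolding \<alpha>_def by (rule elt_in_W) auto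

lemma \<alpha>_mult: "\<tau> \<in> carrier (gal K) \<Longrightarrow> \<alpha> \<sigma> \<otimes>\<^bsub>W\<^esub> \<alpha> \<tau> = \<alpha> (\<sigma> \<circ> \<tau>)"
  by (simp add: \<alpha>_def elt_mult)

lemma \<alpha>_continuous: "continuous_map (topo (gal K)) (topo W) \<alpha>"
  unfolding continuous_map_def W_simps
proof (intro conjI allI impI)
  show "\<alpha> \<in> topspace (topo (gal K)) \<rightarrow> topspace (discrete_topology (carrier W))" using \<alpha>_in_W by auto
  fix U
  show "openin (topo (gal K)) {\<sigma> \<in> topspace (topo (gal K)). \<alpha> \<sigma> \<in> U}"
    unfolding openin_gal
  proof (intro conjI ballI)
    fix \<sigma> assume s: "\<sigma> \<in> {\<sigma> \<in> topspace (topo (gal K)). \<alpha> \<sigma> \<in> U}"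
    have "\<tau> \<in> {\<sigma> \<in> topspace (topo (gal K)). \<alpha> \<sigma> \<in> U}" if "\<tau> \<in> carrier (gal K)" "\<forall>b\<in>B. \<tau> b = \<sigma> b" for \<tau>
    proof -
      have "\<alpha> \<tau> = \<alpha> \<sigma>" using that(2) by (simp add: \<alpha>_def elt_eq_iff)
      then show ?thesis using that(1) s by simp
    qed
    then show "\<exists>B. finite B \<and> (\<forall>\<tau>\<in>carrier (gal K). (\<forall>b\<in>B. \<tau> b = \<sigma> b) \<longrightarrow> \<tau> \<in> {\<sigma> \<in> topspace (topo (gal K)). \<alpha> \<sigma> \<in> U})"
      using finB by blast
  qed auto
qed

definition deg where "deg v w = (THE n. w \<in> frob_power K v n)"

text \<open>Degrees above \<open>L\<close> share the value of the zero \<open>0_v\<close>; this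
  makes \<open>\<beta> v\<close> continuous at the zero.\<close>

definition \<beta> where
  "\<beta> v x = (case x of None \<Rightarrow> None
     | Some w \<Rightarrow> if deg v w \<le> L then elt (replicate (deg v w) (v \<inter> B)) w else None)"

lemma deg_eq: "v \<in> finite_primes UNIV \<Longrightarrow> w \<in> frob_power K v n \<Longrightarrow> deg v w = n"
  unfolding deg_def using local_place.frob_power_disjoint[OF place] by blast

lemma \<beta>_Some:
  assumes "v \<in> finite_primes UNIV" "w \<in> frob_power K v n"
  shows "\<beta> v (Some w) = (if n \<le> L then elt (replicate n (v \<inter> B)) w else None)"
  using deg_eq[OF assms] by (simp add: \<beta>_def)

lemma \<beta>_None: "\<beta> v None = None" by (simp add: \<beta>_def)

lemma image_trace:
  assumes "\<sigma> \<in> carrier (gal K)"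
  shows "\<sigma> ` (v \<inter> B) = \<sigma> ` v \<inter> B"
  using stable[OF assms] image_Int[OF galD(2)[OF assms], of v B] by simp

lemma \<beta>_top_hom:
  assumes v: "v \<in> finite_primes UNIV"
  shows "\<beta> v \<in> top_hom (Q_loc K v) W"
proof -
  interpret v: local_place K v by (rule place[OF v])
  have c: "\<beta> v x \<in> carrier W" if "x \<in> carrier (Q_loc K v)" for x
  proof (cases x)
    case None
    then show ?thesis by (simp add: \<beta>_None carrier_W)
  next
    case (Some w)
    then obtain n where w: "w \<in> v.F n" using \<open>x \<in> carrier (Q_loc K v)\<close> unfolding v.carrier_Q_loc by blast
    show ?thesis
    proof (cases "n \<le> L")
      case True
      then show ?thesis
        unfolding Some \<beta>_Some[OF v w] using elt_in_W[OF _ _ frob_power_gal[OF w]] by (simp add: in_lists_conv_set)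
    qed (simp add: Some \<beta>_Some[OF v w] carrier_W)
  qed
  show ?thesis
  proof (rule top_homI)
    show "\<beta> v x \<in> carrier W" if "x \<in> carrier (Q_loc K v)" for x using c that .
    show "\<beta> v \<one>\<^bsub>Q_loc K v\<^esub> = \<one>\<^bsub>W\<^esub>"
      using \<beta>_Some[OF v v.id_frob_power] by (simp add: v.Q_loc_simps W_simps)
    show "\<beta> v (x \<otimes>\<^bsub>Q_loc K v\<^esub> y) = \<beta> v x \<otimes>\<^bsub>W\<^esub> \<beta> v y"
      if x: "x \<in> carrier (Q_loc K v)" and y: "y \<in> carrier (Q_loc K v)" for x y
    proof (cases "x = None \<or> y = None")
      case True
      then show ?thesis by (auto simp: v.Q_loc_simps \<beta>_None W_simps)
    next
      case False
      then obtain w z m n where wz: "x = Some w" "w \<in> v.F m" "y = Some z" "z \<in> v.F n"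
        using x y unfolding v.carrier_Q_loc by blast
      \<comment> \<open>\<open>w\<close> stabilises both \<open>v\<close> and \<open>B\<close>,
        hence the trace. The twist in the product of \<open>W\<close> is therefore invisible on
        powers of one trace, and degrees simply add.\<close>
      have tr: "w ` (v \<inter> B) = v \<inter> B"
        using image_trace[OF frob_power_gal[OF wz(2)]] v.frob_power_stab[OF wz(2)] by simp
      show ?thesis
        unfolding wz v.Q_loc_simps \<beta>_Some[OF v wz(2)] \<beta>_Some[OF v wz(4)] \<beta>_Some[OF v v.frob_power_comp[OF wz(2,4)]]
        by (auto simp: W_simps elt_mult frob_power_gal[OF wz(4)] in_lists_conv_set tr replicate_add)
    qed
    show "continuous_map (topo (Q_loc K v)) (topo W) (\<beta> v)"
      unfolding W_simps
    proof (rule v.continuous_map_Q_loc_discrete[where N = L])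
      show "\<beta> v ` carrier (Q_loc K v) \<subseteq> carrier W" using c by blast
      show "\<exists>B. finite B \<and> (\<forall>\<rho>\<in>v.F n. (\<forall>b\<in>B. \<rho> b = \<sigma> b) \<longrightarrow> \<beta> v (Some \<rho>) = \<beta> v (Some \<sigma>))"
        if s: "\<sigma> \<in> v.F n" for n \<sigma>
        using finB by (intro exI[of _ B]) (auto simp: \<beta>_Some[OF v s] \<beta>_Some[OF v] elt_eq_iff)
      show "\<beta> v (Some \<sigma>) = \<beta> v None" if "n > L" "\<sigma> \<in> v.F n" for n \<sigma>
        using that by (simp add: \<beta>_Some[OF v that(2)] \<beta>_None)
    qed
  qed
qed

definition eval_Q where "eval_Q = free_lift (primes_over K S) (Q_loc K) W \<beta>"

lemma eval_Q_top_hom: "eval_Q \<in> top_hom (Q_fin K S) W"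
  unfolding eval_Q_def by (intro Q_fin_lift W_profinite \<beta>_top_hom primes_over_place)

lemma eval_Q_incl: "v \<in> primes_over K S \<Longrightarrow> x \<in> carrier (Q_loc K v) \<Longrightarrow> eval_Q (Q_incl K S v x) = \<beta> v x"
  unfolding eval_Q_def by (intro Q_fin_lift W_profinite \<beta>_top_hom primes_over_place)

text \<open>The covariance that allows \<open>\<beta>\<close> and \<open>\<alpha>\<close> to be
  combined on the semidirect product. It holds because conjugation preserves degrees and takes the
  trace of a place to the trace of its image.\<close>

lemma \<alpha>_\<beta>:
  assumes s: "\<sigma> \<in> carrier (gal K)" and v: "v \<in> finite_primes UNIV" and x: "x \<in> carrier (Q_loc K v)"
  shows "\<alpha> \<sigma> \<otimes>\<^bsub>W\<^esub> \<beta> v x = \<beta> (\<sigma> ` v) (conj_loc K \<sigma> x) \<otimes>\<^bsub>W\<^esub> \<alpha> \<sigma>"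
proof (cases x)
  case None
  then show ?thesis by (simp add: conj_loc_simps[OF s] \<beta>_None W_simps)
next
  case (Some w)
  interpret v: local_place K v by (rule place[OF v])
  obtain n where w: "w \<in> v.F n" using x Some unfolding v.carrier_Q_loc by blast
  let ?c = "\<sigma> \<circ> w \<circ> inv_into UNIV \<sigma>"
  have "?c \<circ> \<sigma> = \<sigma> \<circ> w" using gal_m_inv(4)[OF s] by auto
  then show ?thesis
    unfolding Some conj_loc_simps[OF s] \<beta>_Some[OF v w] \<beta>_Some[OF gal_finite_primes[OF s v] conj_frob_power[OF s w]]
    by (auto simp: \<alpha>_def W_simps elt_mult frob_power_gal[OF w] s in_lists_conv_set image_trace[OF s])
qed

text \<open>Covariance spreads from the generators: the elements for which it holds form a closed
  submonoid of the free product.\<close>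

lemma \<alpha>_eval_Q:
  assumes s: "\<sigma> \<in> carrier (gal K)" and z: "z \<in> carrier (Q_fin K S)"
  shows "\<alpha> \<sigma> \<otimes>\<^bsub>W\<^esub> eval_Q z = eval_Q (Q_fin_act K S \<sigma> z) \<otimes>\<^bsub>W\<^esub> \<alpha> \<sigma>"
proof -
  note a = Q_fin_act_hom[OF s] and fD = top_homD[OF eval_Q_top_hom] and assoc = monoid.m_assoc[OF W_monoid]
  note aD = top_homD[OF a(1)]
  let ?C = "{z \<in> topspace (topo (Q_fin K S)). \<alpha> \<sigma> \<otimes>\<^bsub>W\<^esub> eval_Q z = eval_Q (Q_fin_act K S \<sigma> z) \<otimes>\<^bsub>W\<^esub> \<alpha> \<sigma>}"
  have const: "continuous_map (topo (Q_fin K S)) (topo W) (\<lambda>z. \<alpha> \<sigma>)"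
    using \<alpha>_in_W[OF s] profinite_monoidD(2)[OF W_profinite] by simp
  have cl: "closedin (topo (Q_fin K S)) ?C"
    using continuous_map_mult[OF profinite_monoidD(6)[OF W_profinite] const fD(4)]
      continuous_map_mult[OF profinite_monoidD(6)[OF W_profinite] top_homD(4)[OF top_hom_comp[OF a(1) eval_Q_top_hom]] const]
      profinite_monoidD(5)[OF W_profinite]
    by (intro closedin_continuous_maps_eq[where Y = "topo W"]) (simp_all add: o_def)
  have sub: "submonoid ?C (Q_fin K S)"
  proof
    show "?C \<subseteq> carrier (Q_fin K S)" by (auto simp: Q_finD(2))
    show "\<one>\<^bsub>Q_fin K S\<^esub> \<in> ?C"
      using monoid.one_closed[OF Q_finD(1)] aD(3) fD(3) monoid.l_one[OF W_monoid \<alpha>_in_W[OF s]] monoid.r_one[OF W_monoid \<alpha>_in_W[OF s]]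
      by (simp add: Q_finD(2))
    show "x \<otimes>\<^bsub>Q_fin K S\<^esub> y \<in> ?C" if xy: "x \<in> ?C" "y \<in> ?C" for x y
    proof -
      have c: "x \<in> carrier (Q_fin K S)" "y \<in> carrier (Q_fin K S)"
        and e: "\<alpha> \<sigma> \<otimes>\<^bsub>W\<^esub> eval_Q x = eval_Q (Q_fin_act K S \<sigma> x) \<otimes>\<^bsub>W\<^esub> \<alpha> \<sigma>" "\<alpha> \<sigma> \<otimes>\<^bsub>W\<^esub> eval_Q y = eval_Q (Q_fin_act K S \<sigma> y) \<otimes>\<^bsub>W\<^esub> \<alpha> \<sigma>"
        using xy by (auto simp: Q_finD(2))
      note cl = fD(1)[OF c(1)] fD(1)[OF c(2)] fD(1)[OF aD(1)[OF c(1)]] fD(1)[OF aD(1)[OF c(2)]] \<alpha>_in_W[OF s]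
      have "\<alpha> \<sigma> \<otimes>\<^bsub>W\<^esub> eval_Q (x \<otimes>\<^bsub>Q_fin K S\<^esub> y) = (\<alpha> \<sigma> \<otimes>\<^bsub>W\<^esub> eval_Q x) \<otimes>\<^bsub>W\<^esub> eval_Q y"
        using assoc cl by (simp add: fD(2)[OF c])
      also have "\<dots> = eval_Q (Q_fin_act K S \<sigma> x) \<otimes>\<^bsub>W\<^esub> (\<alpha> \<sigma> \<otimes>\<^bsub>W\<^esub> eval_Q y)"
        unfolding e(1) using assoc cl by simp
      also have "\<dots> = (eval_Q (Q_fin_act K S \<sigma> x) \<otimes>\<^bsub>W\<^esub> eval_Q (Q_fin_act K S \<sigma> y)) \<otimes>\<^bsub>W\<^esub> \<alpha> \<sigma>"
        unfolding e(2) using assoc cl by simp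
      also have "eval_Q (Q_fin_act K S \<sigma> x) \<otimes>\<^bsub>W\<^esub> eval_Q (Q_fin_act K S \<sigma> y) = eval_Q (Q_fin_act K S \<sigma> (x \<otimes>\<^bsub>Q_fin K S\<^esub> y))"
        using aD(1)[OF c(1)] aD(1)[OF c(2)] by (simp add: aD(2)[OF c] fD(2))
      finally show ?thesis using c monoid.m_closed[OF Q_finD(1)] by (simp add: Q_finD(2))
    qed
  qed
  have "?C = carrier (Q_fin K S)"
    unfolding Q_fin_def
  proof (rule free_product_induct)
    show "submonoid {z \<in> topspace (topo (free_product (primes_over K S) (Q_loc K))).
        \<alpha> \<sigma> \<otimes>\<^bsub>W\<^esub> eval_Q z = eval_Q (Q_fin_act K S \<sigma> z) \<otimes>\<^bsub>W\<^esub> \<alpha> \<sigma>} (free_product (primes_over K S) (Q_loc K))"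
      using sub unfolding Q_fin_def .
    show "closedin (topo (free_product (primes_over K S) (Q_loc K))) {z \<in> topspace (topo (free_product (primes_over K S) (Q_loc K))).
        \<alpha> \<sigma> \<otimes>\<^bsub>W\<^esub> eval_Q z = eval_Q (Q_fin_act K S \<sigma> z) \<otimes>\<^bsub>W\<^esub> \<alpha> \<sigma>}"
      using cl unfolding Q_fin_def .
    fix v x assume v: "v \<in> primes_over K S" and x: "x \<in> carrier (Q_loc K v)"
    note vp = primes_over_place[OF v]
    have "\<alpha> \<sigma> \<otimes>\<^bsub>W\<^esub> eval_Q (Q_incl K S v x) = eval_Q (Q_fin_act K S \<sigma> (Q_incl K S v x)) \<otimes>\<^bsub>W\<^esub> \<alpha> \<sigma>"
      using \<alpha>_\<beta>[OF s vp x] eval_Q_incl[OF v x] a(2)[OF vp x] primes_over_gal[OF s vp, of S] v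
        eval_Q_incl[OF _ top_homD(1)[OF conj_loc_top_hom[OF s vp] x]] by simp
    moreover have "Q_incl K S v x \<in> topspace (topo (Q_fin K S))"
      using top_homD(1)[OF Q_incl_top_hom[OF vp] x] by (simp add: Q_finD(2))
    moreover have "Q_incl K S v x = free_incl (primes_over K S) (Q_loc K) v x" using v by (simp add: Q_incl_def)
    ultimately show "free_incl (primes_over K S) (Q_loc K) v x \<in> {z \<in> topspace (topo (free_product (primes_over K S) (Q_loc K))).
        \<alpha> \<sigma> \<otimes>\<^bsub>W\<^esub> eval_Q z = eval_Q (Q_fin_act K S \<sigma> z) \<otimes>\<^bsub>W\<^esub> \<alpha> \<sigma>}"
      unfolding Q_fin_def by simp
  qed
  then show ?thesis using z by blast
qed

text \<open>Only the component at \<open>S\<close> is read; elements of \<open>Q_v\<close> with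
  \<open>v\<close> outside \<open>S\<close> become trivial.\<close>

definition eval_M where "eval_M p = eval_Q (fst p S) \<otimes>\<^bsub>W\<^esub> \<alpha> (snd p)"

lemma eval_M_top_hom: "eval_M \<in> top_hom M W"
proof (rule top_homI)
  note fD = top_homD[OF eval_Q_top_hom] and assoc = monoid.m_assoc[OF W_monoid]
  have fS: "eval_Q (\<rho> S) \<in> carrier W" if "\<rho> \<in> carrier (Q_hat K)" for \<rho>
    using fD(1) Q_hatD(1)[OF that S] by blast
  show "eval_M x \<in> carrier W" if "x \<in> carrier M" for x
    using that fS \<alpha>_in_W monoid.m_closed[OF W_monoid] by (auto simp: eval_M_def M_simps)
  show "eval_M \<one>\<^bsub>M\<^esub> = \<one>\<^bsub>W\<^esub>"
    using fD(3) S monoid.l_one[OF W_monoid \<alpha>_in_W[OF id_gal]] by (simp add: eval_M_def M_simps Q_hat_simps(3) \<alpha>_def W_simps)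
  show "eval_M (x \<otimes>\<^bsub>M\<^esub> y) = eval_M x \<otimes>\<^bsub>W\<^esub> eval_M y" if xy: "x \<in> carrier M" "y \<in> carrier M" for x y
  proof -
    obtain \<rho> \<sigma> \<rho>' \<sigma>' where e: "x = (\<rho>, \<sigma>)" "y = (\<rho>', \<sigma>')" by fastforce
    then have c: "\<rho> \<in> carrier (Q_hat K)" "\<sigma> \<in> carrier (gal K)" "\<rho>' \<in> carrier (Q_hat K)" "\<sigma>' \<in> carrier (gal K)"
      using xy by (auto simp: M_simps)
    note z = Q_hatD(1)[OF c(1) S] Q_hatD(1)[OF c(3) S]
    note az = top_homD(1)[OF Q_fin_act_hom(1)[OF c(2)] z(2)]
    note cl = fD(1)[OF z(1)] fD(1)[OF z(2)] fD(1)[OF az] \<alpha>_in_W[OF c(2)] \<alpha>_in_W[OF c(4)]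
    note mc = monoid.m_closed[OF W_monoid]
    have "eval_M (x \<otimes>\<^bsub>M\<^esub> y) = eval_Q (\<rho> S \<otimes>\<^bsub>Q_fin K S\<^esub> Q_fin_act K S \<sigma> (\<rho>' S)) \<otimes>\<^bsub>W\<^esub> \<alpha> (\<sigma> \<circ> \<sigma>')"
      using S by (simp add: e eval_M_def M_simps Q_hat_simps(2) Q_hat_act_def)
    also have "\<dots> = (eval_Q (\<rho> S) \<otimes>\<^bsub>W\<^esub> eval_Q (Q_fin_act K S \<sigma> (\<rho>' S))) \<otimes>\<^bsub>W\<^esub> (\<alpha> \<sigma> \<otimes>\<^bsub>W\<^esub> \<alpha> \<sigma>')"
      by (simp add: fD(2)[OF z(1) az] \<alpha>_mult c(4))
    also have "\<dots> = eval_Q (\<rho> S) \<otimes>\<^bsub>W\<^esub> (eval_Q (Q_fin_act K S \<sigma> (\<rho>' S)) \<otimes>\<^bsub>W\<^esub> \<alpha> \<sigma>) \<otimes>\<^bsub>W\<^esub> \<alpha> \<sigma>'"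
      using assoc cl mc by simp
    also have "\<dots> = eval_Q (\<rho> S) \<otimes>\<^bsub>W\<^esub> (\<alpha> \<sigma> \<otimes>\<^bsub>W\<^esub> eval_Q (\<rho>' S)) \<otimes>\<^bsub>W\<^esub> \<alpha> \<sigma>'"
      by (simp add: \<alpha>_eval_Q[OF c(2) z(2)])
    also have "\<dots> = eval_M x \<otimes>\<^bsub>W\<^esub> eval_M y"
      unfolding e eval_M_def fst_conv snd_conv using assoc cl mc by simp
    finally show ?thesis .
  qed
  have "continuous_map (topo M) (topo W) (\<lambda>p. eval_Q (fst p S))"
    using continuous_map_compose[OF continuous_map_compose[OF continuous_map_fst Q_hat_proj_continuous[OF S]] fD(4)]
    by (simp add: M_simps o_def)
  moreover have "continuous_map (topo M) (topo W) (\<lambda>p. \<alpha> (snd p))"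
    using continuous_map_compose[OF continuous_map_snd \<alpha>_continuous] by (simp add: M_simps o_def)
  ultimately show "continuous_map (topo M) (topo W) eval_M"
    unfolding eval_M_def[abs_def] by (rule continuous_map_mult[OF profinite_monoidD(6)[OF W_profinite]])
qed

text \<open>If \<open>v\<close> lies over \<open>S\<close>, then \<open>u\<close>, having degree
  \<open>0\<close>, is evaluated to its restriction to \<open>B\<close>, and it cancels against the
  inverse in the second factor. Otherwise it is evaluated to \<open>1\<close>, and the inverse acts
  trivially on \<open>B\<close> by \<open>unramified\<close>.\<close>

lemma eval_M_inertia_rel:
  assumes "(a, b) \<in> inertia_rel K"
  shows "a \<in> carrier M \<and> b \<in> carrier M \<and> eval_M a = eval_M b"
proof (intro conjI)
  show c: "a \<in> carrier M" "b \<in> carrier M" using inertia_rel_carrier assms by auto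
  obtain \<rho> \<sigma> v u where ab: "a = (\<rho>, \<sigma>)"
    "b = (\<rho> \<otimes>\<^bsub>Q_hat K\<^esub> Q_hat_incl K v (Some u), inv\<^bsub>gal K\<^esub> u \<otimes>\<^bsub>gal K\<^esub> \<sigma>)"
    and r: "\<rho> \<in> carrier (Q_hat K)" "\<sigma> \<in> carrier (gal K)" and v: "v \<in> finite_primes UNIV" and u: "u \<in> inertia K v"
    using assms unfolding inertia_rel_def by blast
  interpret v: local_place K v by (rule place[OF v])
  have u0: "u \<in> v.F 0" using u by (simp add: v.inertia_eq)
  note uG = frob_power_gal[OF u0]
  note ui = gal_m_inv[OF uG]
  have uQ: "Some u \<in> carrier (Q_loc K v)" using u0 unfolding v.carrier_Q_loc by blast
  note fD = top_homD[OF eval_Q_top_hom]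
  note z = Q_hatD(1)[OF r(1) S]
  have iG: "inv_into UNIV u \<circ> \<sigma> \<in> carrier (gal K)" by (rule comp_gal[OF ui(2) r(2)])
  have key: "eval_Q (Q_incl K S v (Some u)) \<otimes>\<^bsub>W\<^esub> \<alpha> (inv_into UNIV u \<circ> \<sigma>) = \<alpha> \<sigma>"
  proof (cases "v \<in> primes_over K S")
    case True
    have "eval_Q (Q_incl K S v (Some u)) = \<alpha> u"
      unfolding eval_Q_incl[OF True uQ] \<beta>_Some[OF v u0] by (simp add: \<alpha>_def)
    moreover have "u \<circ> (inv_into UNIV u \<circ> \<sigma>) = \<sigma>" using ui(3) by auto
    ultimately show ?thesis by (simp add: \<alpha>_mult[OF iG])
  next
    case False
    then have nS: "below K v \<notin> S" using v by (simp add: primes_over_def)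
    have "eval_Q (Q_incl K S v (Some u)) = \<one>\<^bsub>W\<^esub>" using False fD(3) by (simp add: Q_incl_def)
    moreover have "\<alpha> (inv_into UNIV u \<circ> \<sigma>) = \<alpha> \<sigma>"
      unfolding \<alpha>_def elt_eq_iff
    proof (intro conjI refl ballI)
      fix b assume "b \<in> B"
      then have "\<sigma> b \<in> B" using stable[OF r(2)] by blast
      then have "u (\<sigma> b) = \<sigma> b" by (rule unramified[OF v nS u0])
      then show "(inv_into UNIV u \<circ> \<sigma>) b = \<sigma> b" using ui(4)[of "\<sigma> b"] by simp
    qed
    ultimately show ?thesis using monoid.l_one[OF W_monoid \<alpha>_in_W[OF r(2)]] by simp
  qed
  have iQ: "Q_incl K S v (Some u) \<in> carrier (Q_fin K S)" by (rule top_homD(1)[OF Q_incl_top_hom[OF v] uQ])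
  have "eval_M b = (eval_Q (\<rho> S) \<otimes>\<^bsub>W\<^esub> eval_Q (Q_incl K S v (Some u))) \<otimes>\<^bsub>W\<^esub> \<alpha> (inv_into UNIV u \<circ> \<sigma>)"
    using S fD(2)[OF z iQ] by (simp add: ab eval_M_def Q_hat_simps(2) Q_hat_incl_def ui(1))
  also have "\<dots> = eval_Q (\<rho> S) \<otimes>\<^bsub>W\<^esub> \<alpha> \<sigma>"
    using monoid.m_assoc[OF W_monoid fD(1)[OF z] fD(1)[OF iQ] \<alpha>_in_W[OF iG]] key by simp
  finally show "eval_M a = eval_M b" by (simp add: ab eval_M_def)
qed

lemma eval_M_DG_class:
  assumes "a \<in> carrier M" "b \<in> carrier M" "DG_class a = DG_class b"
  shows "eval_M a = eval_M b"
  using min_profinite_congruence_separates[OF M_monoid topspace_M compact_M W_finite_discrete eval_M_top_hom eval_M_inertia_rel]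
    assms DG_class_eq_iff by blast

end

section \<open>Recovery of a word from its image in a finite quotient\<close>

context labelled_setting
begin

fun traces :: "'a set \<Rightarrow> 'a set list \<Rightarrow> 'a set list" where
  "traces B [] = []"
| "traces B (v # vs) = (v \<inter> B) # map ((`) (\<phi> v \<circ> s v)) (traces B vs)"

fun product_gal :: "'a set list \<Rightarrow> 'a \<Rightarrow> 'a" where
  "product_gal [] = id"
| "product_gal (v # vs) = (\<phi> v \<circ> s v) \<circ> product_gal vs"

lemma length_traces: "length (traces B vs) = length vs"
  by (induction vs) auto

lemma letter_gal: "v \<in> finite_primes UNIV \<Longrightarrow> \<phi> v \<circ> s v \<in> carrier (gal K)"
  using Gal.m_closed[OF frob_power_gal[OF \<phi>] s] by simp

lemma product_gal_closed: "ws \<in> lists (finite_primes UNIV) \<Longrightarrow> product_gal ws \<in> carrier (gal K)"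
  using Gal.m_closed[OF letter_gal] Gal.one_closed by (induction ws) auto

lemma eval_word:
  assumes "word_quotient K B S"
    and "ws \<in> lists (primes_over K S)" "length ws \<le> L"
  shows "word_quotient.eval_M K B L S (word_val ws) = word_quotient.elt B (traces B ws) (product_gal ws) \<and>
    traces B ws \<in> lists (Pow B)"
proof -
  interpret W: word_quotient K B L S by fact
  note eD = top_homD[OF W.eval_M_top_hom]
  show ?thesis
    using assms(2,3)
  proof (induction ws)
    case Nil
    then show ?case using eD(3) by (simp add: word_val_def W.W_simps W.elt_eq_iff)
  next
    case (Cons v ws)
    then have v: "v \<in> primes_over K S" and ws: "ws \<in> lists (primes_over K S)" by auto
    note vp = primes_over_place[OF v]
    have wl: "ws \<in> lists (finite_primes UNIV)" using ws primes_over_place by auto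
    have L1: "1 \<le> L" using Cons.prems by simp
    have "W.eval_M (letter v) = W.\<beta> v (Some (\<phi> v)) \<otimes>\<^bsub>W.W\<^esub> W.\<alpha> (s v)"
      using W.S W.eval_Q_incl[OF v Some_in_Q_loc[OF vp \<phi>[OF vp]]] by (simp add: W.eval_M_def letter_def Q_hat_incl_def)
    also have "\<dots> = W.elt [v \<inter> B] (\<phi> v \<circ> s v)"
      unfolding W.\<beta>_Some[OF vp \<phi>[OF vp]] using L1 by (simp add: W.\<alpha>_def W.elt_mult s)
    finally have l: "W.eval_M (letter v) = W.elt [v \<inter> B] (\<phi> v \<circ> s v)" .
    have IH: "W.eval_M (word_val ws) = W.elt (traces B ws) (product_gal ws)" "traces B ws \<in> lists (Pow B)"
      using Cons ws by auto
    have "W.eval_M (word_val (v # ws)) = W.eval_M (letter v) \<otimes>\<^bsub>W.W\<^esub> W.eval_M (word_val ws)"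
      using eD(2)[OF letter_closed[OF vp] word_val_closed[OF wl]] by (simp add: word_val_def)
    also have "\<dots> = W.elt (traces B (v # ws)) (product_gal (v # ws))"
      unfolding l IH(1) W.elt_mult[OF IH(2) product_gal_closed[OF wl]]
      using Cons.prems by (simp add: length_traces)
    finally show ?case using IH(2) W.map_image_lists[OF letter_gal[OF vp] IH(2)] by (simp add: W.elt_eq_iff)
  qed
qed

text \<open>The head of the list determines the first letter, because traces separate
  \<open>V\<close>. This letter determines the automorphism applied to the tail, which is undone by
  injectivity.\<close>

lemma traces_inj:
  assumes "\<And>v v'. v \<in> V \<Longrightarrow> v' \<in> V \<Longrightarrow> v \<inter> B = v' \<inter> B \<Longrightarrow> v = v'"
    and "V \<subseteq> finite_primes UNIV"
  shows "ws \<in> lists V \<Longrightarrow> ws' \<in> lists V \<Longrightarrow> traces B ws = traces B ws' \<Longrightarrow> ws = ws'"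
proof (induction ws arbitrary: ws')
  case Nil
  then show ?case using length_traces[of B ws'] by simp
next
  case (Cons v ws)
  then obtain v' vs where ws': "ws' = v' # vs" by (metis length_traces length_Suc_conv)
  have v: "v = v'" using assms(1)[of v v'] Cons.prems unfolding ws' by simp
  have "inj (\<phi> v \<circ> s v)"
    using galD(2)[OF letter_gal] Cons.prems(1) assms(2) by auto
  then have "inj ((`) (\<phi> v \<circ> s v))" by (intro injI) (simp only: inj_image_eq_iff)
  then have "traces B ws = traces B vs" using Cons.prems(3) unfolding ws' v[symmetric] by (simp add: inj_map_eq_map)
  then show ?case using Cons unfolding ws' v by simp
qed

text \<open>If \<open>v\<close> were properly contained in \<open>v'\<close>, an inverse modulo
  \<open>v\<close> of an element of \<open>v'\<close> outside \<open>v\<close> would put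
  \<open>1\<close> into \<open>v'\<close>.\<close>

lemma finite_primes_incomparable:
  assumes "v \<in> finite_primes (UNIV :: 'a set)" "v' \<in> finite_primes UNIV" "v \<noteq> v'"
  shows "\<exists>x\<in>v. x \<notin> v'"
proof (rule ccontr)
  assume "\<not> (\<exists>x\<in>v. x \<notin> v')"
  then have sub: "v \<subseteq> v'" by blast
  then obtain x where x: "x \<in> v'" "x \<notin> v" using assms(3) by blast
  note vD = finite_primesD[OF is_subring_UNIV assms(1)] and v'D = finite_primesD[OF is_subring_UNIV assms(2)]
  obtain b where b: "b \<in> integers UNIV" "x * b - 1 \<in> v" using vD(9)[of x] x v'D(1) by blast
  then have "x * b - (x * b - 1) \<in> v'" using v'D(5)[OF v'D(7)[OF b(1) x(1)]] b(2) sub by blast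
  then have "1 \<in> v'" by simp
  then show False using v'D(8) by simp
qed

lemma \<psi>_inj: "inj_on \<psi> (lists (finite_primes UNIV))"
proof (rule inj_onI)
  fix w w' :: "'a set list"
  assume w: "w \<in> lists (finite_primes UNIV)" and w': "w' \<in> lists (finite_primes UNIV)" and eq: "\<psi> w = \<psi> w'"
  define V where "V = set w \<union> set w'"
  have V: "finite V" "V \<subseteq> finite_primes UNIV" using w w' by (auto simp: V_def)
  have "\<forall>v\<in>V. \<forall>v'\<in>V. \<exists>x. v \<noteq> v' \<longrightarrow> x \<in> v \<and> x \<notin> v'" using finite_primes_incomparable V(2) by blast
  then obtain t where t: "\<And>v v'. v \<in> V \<Longrightarrow> v' \<in> V \<Longrightarrow> v \<noteq> v' \<Longrightarrow> t v v' \<in> v \<and> t v v' \<notin> v'" by metis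
  \<comment> \<open>Integers that tell the letters of both words apart. Once \<open>B\<close>
    contains them, a letter is determined by its trace on \<open>B\<close>.\<close>
  define A where "A = {t v v' | v v'. v \<in> V \<and> v' \<in> V \<and> v \<noteq> v'}"
  have "finite A"
    by (rule finite_subset[of _ "(\<lambda>(v, v'). t v v') ` (V \<times> V)"]) (use V(1) in \<open>auto simp: A_def\<close>)
  moreover have "A \<subseteq> integers UNIV"
    using t V(2) finite_primesD(1)[OF is_subring_UNIV] by (fastforce simp: A_def)
  ultimately have "\<exists>B. finite B \<and> A \<subseteq> B \<and> B \<subseteq> integers UNIV \<and> (\<forall>\<sigma>\<in>carrier (gal K). \<sigma> ` B = B)"
    by (rule ex_stable_superset)
  then obtain B where B: "finite B" "A \<subseteq> B" "B \<subseteq> integers UNIV" "\<And>\<sigma>. \<sigma> \<in> carrier (gal K) \<Longrightarrow> \<sigma> ` B = B"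
    by (elim exE conjE) simp
  have sep: "v = v'" if "v \<in> V" "v' \<in> V" "v \<inter> B = v' \<inter> B" for v v'
  proof (rule ccontr)
    assume "v \<noteq> v'"
    then have "t v v' \<in> B" "t v v' \<in> v" "t v v' \<notin> v'" using t[OF that(1,2)] B(2) that by (auto simp: A_def)
    then show False using that(3) by blast
  qed
  define R where "R = {below K v | v. v \<in> finite_primes UNIV \<and> (\<exists>u\<in>frob_power K v 0. \<exists>b\<in>B. u b \<noteq> b)}"
  \<comment> \<open>\<open>R\<close> secures \<open>unramified\<close> at all primes outside
    \<open>S\<close>; the other part keeps every letter of the two words visible.\<close>
  define S where "S = R \<union> below K ` V"
  have "finite R" unfolding R_def by (rule finite_ramified[OF B(1,3,4)])
  then have S: "S \<in> finite_sets K"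
    using V below_finite_primes[OF Kc(1)] by (auto simp: finite_sets_def S_def R_def)
  \<comment> \<open>Long enough that neither word is truncated to the zero.\<close>
  define L where "L = max (length w) (length w')"
  have WQ: "word_quotient K B S"
  proof
    show "finite B" "\<And>\<sigma>. \<sigma> \<in> carrier (gal K) \<Longrightarrow> \<sigma> ` B = B" "S \<in> finite_sets K" by (fact B S)+
    show "u b = b" if "v \<in> finite_primes UNIV" "below K v \<notin> S" "u \<in> frob_power K v 0" "b \<in> B" for v u b
      using that unfolding S_def R_def by blast
  qed
  interpret W: word_quotient K B L S by (rule WQ)
  have VS: "V \<subseteq> primes_over K S" using V(2) by (auto simp: primes_over_def S_def)
  have ws: "w \<in> lists (primes_over K S)" "w' \<in> lists (primes_over K S)" using VS by (auto simp: V_def)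
  have "W.eval_M (word_val w) = W.eval_M (word_val w')"
    using eq by (intro W.eval_M_DG_class word_val_closed w w') (simp add: \<psi>_def)
  then have "W.elt (traces B w) (product_gal w) = W.elt (traces B w') (product_gal w')"
    using eval_word[OF WQ ws(1)] eval_word[OF WQ ws(2)] by (simp add: L_def)
  then have "traces B w = traces B w'" by (simp add: W.elt_eq_iff)
  then show "w = w'" by (rule traces_inj[OF sep V(2), rotated -1]) (auto simp: V_def)
qed

end

theorem lemma3p12:
  fixes K :: "'a::field_char_0 set"
  assumes "number_field K"
    and "algebraic_closure (ring_on (UNIV :: 'a set)) K"
  shows "\<exists>\<psi>. \<psi> \<in> top_hom (words (\<V> :: 'a set set)) (DG K) \<and>
             inj_on \<psi> (carrier (words \<V>)) \<and>
             topo (DG K) closure_of (\<psi> ` carrier (words \<V>)) = carrier (DG K)"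
proof -
  interpret local_setting K using assms by (rule local_setting.intro)
  have "\<forall>v. \<exists>\<phi>. v \<in> \<V> \<longrightarrow> \<phi> \<in> frob_power K v 1" using local_place.ex_frob[OF place] by blast
  then obtain \<phi> where \<phi>: "\<And>v. v \<in> \<V> \<Longrightarrow> \<phi> v \<in> frob_power K v 1" by metis
  obtain s where s: "\<And>v. s v \<in> carrier (gal K)" "\<And>T \<sigma> B. finite T \<Longrightarrow> \<sigma> \<in> carrier (gal K) \<Longrightarrow> finite B \<Longrightarrow>
     (\<exists>v\<in>\<V>. below K v \<notin> T \<and> (\<forall>b\<in>B. s v b = \<sigma> b))"
    using ex_dense_labelling by blast
  interpret labelled_setting K \<phi> s by unfold_locales (use \<phi> s in blast)+
  show ?thesis
    using \<psi>_top_hom \<psi>_dense \<psi>_inj by (intro exI[of _ \<psi>]) (simp add: words_def)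
qed

end
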